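(* Let $K\subset\overline{\mathbb R}$ be a non-empty compact set, $\mathcal V=(\nu_n)_{n\in\mathbb N}$ a directed family of continuous weights on $\mathbb C$, and let $\mathcal{OV}(\overline{\mathbb C})$ satisfy $(\Omega)$. Let $(qV_\infty)$, $(qL^1)$, $(CT.1)$ and $(CT.2)$ be fulfilled for $K$ and, in addition, $(H3CT)$ if $K\cap\{\pm\infty\}\neq\varnothing$. If (i) $K\subset\mathbb R$, or $K\cap\{\pm\infty\}$ has no isolated points in $K$ and $(CT.3)$–$(CT.5)$ is fulfilled for $K$, or (ii) $(qV_\infty)$, $(qL^1)$ and $(CT)$ are fulfilled for $\overline{\mathbb R}$ with $g_K=g_{\overline{\mathbb R}}$, and $\mathcal{OV}^{-1}_{\mathrm{ind}}(\overline{\mathbb R})$ is dense in $\mathcal{OV}^{-1}_{\mathrm{ind}}(K)$, then $\mathcal{OV}(\overline{\mathbb C}\setminus K)$ satisfies $(\Omega)$.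
   Context: **Sets.** $\mathbb N=\{1,2,\dots\}$; $\overline{\mathbb R}=\mathbb R\cup\{\pm\infty\}$ is the two-point compactification of $\mathbb R$. $d(M_0,M_1)$ is the Euclidean distance of subsets of $\mathbb C$, with value $\infty$ if one of them is empty. $\mathbb B_r(z)$ is the open disc. For compact $K\subset\overline{\mathbb R}$ (possibly empty) and real $t\ge1$, $U_t(K)$ is the union of $\{z\in\mathbb C: d(\{z\},K\cap\mathbb C)<1/t\}$, of $(t,\infty)+i(-1/t,1/t)$ if $\infty\in K$, and of $(-\infty,-t)+i(-1/t,1/t)$ if $-\infty\in K$. $S_t(K):=(\mathbb C\setminus\overline{U_t(K)})\cap\{z:|\mathrm{Im}\,z|<t\}$ for $t>1$ and $S_1(K):=S_{3/2}(K)$ (closures and complements in $\mathbb C$). $\mathbb C\setminus K$ means $\mathbb C\setminus(K\cap\mathbb C)$. That $K\cap\{\pm\infty\}$ has no isolated points in $K$ means that no point of $K\cap\{\pm\infty\}$ is an isolated point of $K$. **Weights.** A directed family of continuous weights on $\mathbb C$ is a sequence of continuous $\nu_n\colon\mathbb C\to(0,\infty)$ with $\nu_n\le\nu_{n+1}$ for all $n\in\mathbb N$. **Spaces.** $\mathcal{OV}(\overline{\mathbb C}\setminus K)$ is the Fréchet space of holomorphic $F\colon\mathbb C\setminus K\to\mathbb C$ with $|F|_{K,n}:=\sup_{z\in S_n(K)}|F(z)|\nu_n(z)<\infty$ for all $n\in\mathbb N$, with the topology given by these seminorms; $\mathcal{OV}(\overline{\mathbb C})$ is the case $K=\varnothing$.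 $\mathcal O\nu_n^{-1}(\overline{U_n(K)})$ is the space of continuous $f\colon\overline{U_n(K)}\to\mathbb C$, holomorphic on $U_n(K)$, with $\|f\|_{K,n}:=\sup_{z\in\overline{U_n(K)}}|f(z)|\nu_n(z)^{-1}<\infty$; $\mathcal{OV}^{-1}_{\mathrm{ind}}(K):=\varinjlim_n\mathcal O\nu_n^{-1}(\overline{U_n(K)})$ is the locally convex inductive limit with restrictions as linking maps. Density in (ii) refers to the embedding $\mathcal{OV}^{-1}_{\mathrm{ind}}(\overline{\mathbb R})\to\mathcal{OV}^{-1}_{\mathrm{ind}}(K)$ given by restriction. **Property $(\Omega)$.** A Fréchet space $F$ with increasing fundamental system of seminorms $(|||\cdot|||_k)_{k\in\mathbb N}$ satisfies $(\Omega)$ if $\forall p\in\mathbb N\ \exists q\in\mathbb N\ \forall k\in\mathbb N\ \exists n\in\mathbb N, C>0\ \forall r>0:\ U_q\subset Cr^nU_k+\frac1rU_p$, where $U_k:=\{x\in F: |||x|||_k\le1\}$. **Conditions for a non-empty compact $K\subset\overline{\mathbb R}$.** $(qV_\infty)$: for every $n\in\mathbb N$ there is $\mathcal I_1(n)>n$ such that for every $\varepsilon>0$ there is a compact $Q\subset\overline{U_{\mathcal I_1(n)}(K)}$ with $\nu_n\le\varepsilon\nu_{\mathcal I_1(n)}$ on $\overline{U_{\mathcal I_1(n)}(K)}\setminus Q$. $(qL^1)$: for every $n$, $\nu_n(z)=\nu_n(|\mathrm{Re}\,z|)$ for all $z\in\mathbb C$ and, if $K\cap\{\pm\infty\}\ne\varnothing$,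 there is $\mathcal I_2(n)>n$ with $\nu_n/\nu_{\mathcal I_2(n)}\in L^1([0,\infty))$. $(CT)$: there is an entire function $g_K$ with $g_K(0)=1$ such that, with $G_K(z):=g_K(z-\cdot)$, (CT.1)–(CT.5) hold: (CT.1) for all $z_0\in\mathbb C\setminus K$ there is $n\in\mathbb N$ such that $G_K(\mathbb B_{1/n}(z_0))\subset\mathcal O\nu_n^{-1}(\overline{U_n(K)})$ and $\lim_{h\to0}(G_K(z_0+h)-G_K(z_0))/h$ (with $h\in\mathbb C$, $h\neq0$) exists in $\mathcal O\nu_n^{-1}(\overline{U_n(K)})$; (CT.2) for all $n$ there is $\mathcal J_2(n)>n$ with $\sup_{z\in S_n(K)}\|G_K(z)\|_{K,\mathcal J_2(n)}\nu_n(z)<\infty$; (CT.3) for all $n$ there is $\mathcal J_3(n)>n$ with $\sup_{z\in S_n(\{x_0\})}\|G_K(z)\|_{\{x_0\},\mathcal J_3(n)}\nu_n(z)<\infty$ for all $x_0\in K\cap\mathbb R$; (CT.4) for all $n$ there are $p,m\in\mathbb N$ with $2\le p<m$ and $C>0$ such that $\int_{-\infty}^\infty\frac{|g_K(z-(t\pm ip))|}{\nu_m(t\pm ip)}\nu_n(z)\,dt\le C$ (both signs) for all $z\in\mathbb C$ with $|\mathrm{Im}\,z|\le1/n$; (CT.5) for all $n$ and $z\in\mathbb C\setminus K$: $\sup_{\zeta\in S_n(K)}|G_K(z)(\zeta)|\nu_n(\zeta)^{-1}<\infty$. When only some of (CT.1)–(CT.5) are required for $K$, they are required for one common entire function $g_K$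 with $g_K(0)=1$. $(H3CT)$ (for $K\cap\{\pm\infty\}\ne\varnothing$): there is a strictly decreasing real sequence $(c_n)_{n\in\mathbb N}$ with $c_n\le1$ for all $n$ and $\lim_nc_n=0$ such that for all $p,q,k\in\mathbb N$ with $p<q<k$ there is $C>0$ such that for all $\zeta\in\mathbb R$ with $|\zeta|\ge1+c_k^{-1}$ $$\Bigl(\sup_{|z-\zeta|\le c_k}\nu_k(z)\Bigr)^\theta\Bigl(\sup_{|z-\zeta|\le c_p}\nu_p(z)\Bigr)^{1-\theta}\le C\inf_{|z-\zeta|\le c_q}\nu_q(z),\qquad\theta:=\frac{\ln(c_p/c_q)}{\ln(c_p/c_k)},$$ with $z$ ranging over $\mathbb C$. *)

theory Defs
  imports "HOL-Complex_Analysis.Complex_Analysis"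
begin

text \<open>The compactification of the reals is \<^typ>\<open>ereal\<close>. The natural numbers start at 1, so all
  indices below carry a guard \<open>n \<ge> 1\<close>; the value \<open>\<nu> 0\<close> is never used. Weighted suprema are taken
  in \<^typ>\<open>ennreal\<close>, so that finiteness is literally \<open>< \<infinity>\<close>.\<close>

definition cpart :: "ereal set \<Rightarrow> complex set" where
  "cpart K = {complex_of_real x |x. ereal x \<in> K}"

text \<open>Unlike the library's \<^const>\<open>setdist\<close>, this is \<open>\<infinity>\<close> if one of the sets is empty.\<close>

definition edist_set :: "complex set \<Rightarrow> complex set \<Rightarrow> ereal" where
  "edist_set M N = (INF z\<in>M. INF w\<in>N. ereal (dist z w))"

definition U_nbhd :: "real \<Rightarrow> ereal set \<Rightarrow> complex set" where
  "U_nbhd t K = {z. edist_set {z} (cpart K) < ereal (1 / t)}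
    \<union> (if \<infinity> \<in> K then {z. t < Re z \<and> \<bar>Im z\<bar> < 1 / t} else {})
    \<union> (if -\<infinity> \<in> K then {z. Re z < - t \<and> \<bar>Im z\<bar> < 1 / t} else {})"

definition S_set :: "real \<Rightarrow> ereal set \<Rightarrow> complex set" where
  "S_set t K = (let s = (if t = 1 then 3 / 2 else t) in (- closure (U_nbhd s K)) \<inter> {z. \<bar>Im z\<bar> < s})"

definition directed_weights :: "(nat \<Rightarrow> complex \<Rightarrow> real) \<Rightarrow> bool" where
  "directed_weights \<nu> \<longleftrightarrow> (\<forall>n\<ge>1. continuous_on UNIV (\<nu> n) \<and> (\<forall>z. 0 < \<nu> n z \<and> \<nu> n z \<le> \<nu> (Suc n) z))"

definition OV_norm :: "(nat \<Rightarrow> complex \<Rightarrow> real) \<Rightarrow> ereal set \<Rightarrow> nat \<Rightarrow> (complex \<Rightarrow> complex) \<Rightarrow> ennreal" where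
  "OV_norm \<nu> K n F = (SUP z\<in>S_set (real n) K. ennreal (cmod (F z) * \<nu> n z))"

text \<open>Functions on the complement of \<open>K\<close> are represented by total functions that vanish on
  the finite part of \<open>K\<close>.\<close>

definition OV :: "(nat \<Rightarrow> complex \<Rightarrow> real) \<Rightarrow> ereal set \<Rightarrow> (complex \<Rightarrow> complex) set" where
  "OV \<nu> K = {F. F holomorphic_on (- cpart K) \<and> (\<forall>z\<in>cpart K. F z = 0) \<and>
     (\<forall>n\<ge>1. OV_norm \<nu> K n F < \<infinity>)}"

definition O_norm :: "(nat \<Rightarrow> complex \<Rightarrow> real) \<Rightarrow> ereal set \<Rightarrow> nat \<Rightarrow> (complex \<Rightarrow> complex) \<Rightarrow> ennreal" where
  "O_norm \<nu> K n f = (SUP z\<in>closure (U_nbhd (real n) K). ennreal (cmod (f z) * inverse (\<nu> n z)))"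

text \<open>Elements of the following space are total functions whose values outside
  \<open>closure (U_nbhd n K)\<close> are irrelevant.\<close>

definition O_space :: "(nat \<Rightarrow> complex \<Rightarrow> real) \<Rightarrow> ereal set \<Rightarrow> nat \<Rightarrow> (complex \<Rightarrow> complex) set" where
  "O_space \<nu> K n = {f. continuous_on (closure (U_nbhd (real n) K)) f \<and> f holomorphic_on (U_nbhd (real n) K) \<and>
     O_norm \<nu> K n f < \<infinity>}"

text \<open>Elements of the algebraic inductive limit are classes of functions that eventually
  agree on some \<open>closure (U_nbhd n K)\<close>.\<close>

definition germ :: "ereal set \<Rightarrow> (complex \<Rightarrow> complex) \<Rightarrow> (complex \<Rightarrow> complex) set" where
  "germ K f = {g. \<exists>n::nat. n \<ge> 1 \<and> (\<forall>z\<in>closure (U_nbhd (real n) K). g z = f z)}"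

definition OV_ind :: "(nat \<Rightarrow> complex \<Rightarrow> real) \<Rightarrow> ereal set \<Rightarrow> (complex \<Rightarrow> complex) set set" where
  "OV_ind \<nu> K = {germ K f |f n. n \<ge> 1 \<and> f \<in> O_space \<nu> K n}"

definition germ_abs_convex ::
    "(nat \<Rightarrow> complex \<Rightarrow> real) \<Rightarrow> ereal set \<Rightarrow> (complex \<Rightarrow> complex) set set \<Rightarrow> bool" where
  "germ_abs_convex \<nu> K W \<longleftrightarrow> W \<subseteq> OV_ind \<nu> K \<and>
     (\<forall>f g a b. germ K f \<in> W \<longrightarrow> germ K g \<in> W \<longrightarrow> cmod a + cmod b \<le> 1 \<longrightarrow>
        germ K (\<lambda>z. a * f z + b * g z) \<in> W)"

text \<open>The preimage of \<open>W\<close> under every canonical map \<open>f \<mapsto> germ K f\<close> from a step into the limit is a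
  neighbourhood of zero.\<close>

definition germ_zero_nhd ::
    "(nat \<Rightarrow> complex \<Rightarrow> real) \<Rightarrow> ereal set \<Rightarrow> (complex \<Rightarrow> complex) set set \<Rightarrow> bool" where
  "germ_zero_nhd \<nu> K W \<longleftrightarrow>
     (\<forall>n\<ge>1. \<exists>\<epsilon>>0. \<forall>f\<in>O_space \<nu> K n. O_norm \<nu> K n f < ennreal \<epsilon> \<longrightarrow> germ K f \<in> W)"

text \<open>The finest locally convex topology making the canonical maps from the steps continuous: the
  absolutely convex sets whose preimages in all steps are zero neighbourhoods form a base of
  zero neighbourhoods.\<close>

definition OV_ind_open ::
    "(nat \<Rightarrow> complex \<Rightarrow> real) \<Rightarrow> ereal set \<Rightarrow> (complex \<Rightarrow> complex) set set \<Rightarrow> bool" where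
  "OV_ind_open \<nu> K V \<longleftrightarrow> V \<subseteq> OV_ind \<nu> K \<and>
     (\<forall>f. germ K f \<in> V \<longrightarrow> (\<exists>W. germ_abs_convex \<nu> K W \<and> germ_zero_nhd \<nu> K W \<and>
        (\<forall>g. germ K g \<in> W \<longrightarrow> germ K (\<lambda>z. f z + g z) \<in> V)))"

definition OV_ind_topology ::
    "(nat \<Rightarrow> complex \<Rightarrow> real) \<Rightarrow> ereal set \<Rightarrow> (complex \<Rightarrow> complex) set topology" where
  "OV_ind_topology \<nu> K = topology (OV_ind_open \<nu> K)"

text \<open>Restriction of germs: \<open>germ UNIV f\<close> is mapped to \<open>germ K f\<close>.\<close>

definition germ_restrict :: "ereal set \<Rightarrow> (complex \<Rightarrow> complex) set \<Rightarrow> (complex \<Rightarrow> complex) set" where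
  "germ_restrict K A = (\<Union>f\<in>A. germ K f)"

definition OV_ind_dense :: "(nat \<Rightarrow> complex \<Rightarrow> real) \<Rightarrow> ereal set \<Rightarrow> bool" where
  "OV_ind_dense \<nu> K \<longleftrightarrow>
     OV_ind_topology \<nu> K closure_of (germ_restrict K ` OV_ind \<nu> UNIV) = OV_ind \<nu> K"

definition unit_ball :: "('a \<Rightarrow> complex) set \<Rightarrow> (nat \<Rightarrow> ('a \<Rightarrow> complex) \<Rightarrow> ennreal) \<Rightarrow> nat \<Rightarrow> ('a \<Rightarrow> complex) set" where
  "unit_ball X p k = {f \<in> X. p k f \<le> 1}"

text \<open>Here \<open>X\<close> is a linear space of functions and \<open>p 1 \<le> p 2 \<le> \<dots>\<close> is a fundamental system of
  seminorms of \<open>X\<close>; the index \<open>p\<close> of the usual formulation is called \<open>j\<close>.\<close>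

definition Omega :: "('a \<Rightarrow> complex) set \<Rightarrow> (nat \<Rightarrow> ('a \<Rightarrow> complex) \<Rightarrow> ennreal) \<Rightarrow> bool" where
  "Omega X p \<longleftrightarrow>
     (\<forall>j\<ge>1. \<exists>q\<ge>1. \<forall>k\<ge>1. \<exists>n::nat. n \<ge> 1 \<and> (\<exists>C::real. C > 0 \<and> (\<forall>r::real. r > 0 \<longrightarrow>
        unit_ball X p q \<subseteq>
          {(\<lambda>z. complex_of_real (C * r ^ n) * f z + complex_of_real (1 / r) * g z) |f g.
             f \<in> unit_ball X p k \<and> g \<in> unit_ball X p j})))"

definition qV_inf :: "(nat \<Rightarrow> complex \<Rightarrow> real) \<Rightarrow> ereal set \<Rightarrow> bool" where
  "qV_inf \<nu> K \<longleftrightarrow>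
     (\<forall>n\<ge>1. \<exists>m>n. \<forall>\<epsilon>>0. \<exists>Q. compact Q \<and> Q \<subseteq> closure (U_nbhd (real m) K) \<and>
        (\<forall>z\<in>closure (U_nbhd (real m) K) - Q. \<nu> n z \<le> \<epsilon> * \<nu> m z))"

definition qL1 :: "(nat \<Rightarrow> complex \<Rightarrow> real) \<Rightarrow> ereal set \<Rightarrow> bool" where
  "qL1 \<nu> K \<longleftrightarrow>
     (\<forall>n\<ge>1. (\<forall>z. \<nu> n z = \<nu> n (complex_of_real \<bar>Re z\<bar>)) \<and>
        (K \<inter> {\<infinity>, -\<infinity>} \<noteq> {} \<longrightarrow>
           (\<exists>m>n. set_integrable lebesgue {0..}
              (\<lambda>x::real. \<nu> n (complex_of_real x) / \<nu> m (complex_of_real x)))))"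

definition CT1 :: "(nat \<Rightarrow> complex \<Rightarrow> real) \<Rightarrow> ereal set \<Rightarrow> (complex \<Rightarrow> complex) \<Rightarrow> bool" where
  "CT1 \<nu> K g \<longleftrightarrow>
     (\<forall>z0\<in>- cpart K. \<exists>n::nat. n \<ge> 1 \<and>
        (\<forall>z\<in>ball z0 (1 / real n). (\<lambda>\<zeta>. g (z - \<zeta>)) \<in> O_space \<nu> K n) \<and>
        (\<exists>f\<in>O_space \<nu> K n.
           ((\<lambda>h. O_norm \<nu> K n (\<lambda>\<zeta>. (g (z0 + h - \<zeta>) - g (z0 - \<zeta>)) / h - f \<zeta>)) \<longlongrightarrow> 0) (at 0)))"

definition CT2 :: "(nat \<Rightarrow> complex \<Rightarrow> real) \<Rightarrow> ereal set \<Rightarrow> (complex \<Rightarrow> complex) \<Rightarrow> bool" where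
  "CT2 \<nu> K g \<longleftrightarrow>
     (\<forall>n\<ge>1. \<exists>m>n.
        (SUP z\<in>S_set (real n) K. O_norm \<nu> K m (\<lambda>\<zeta>. g (z - \<zeta>)) * ennreal (\<nu> n z)) < \<infinity>)"

definition CT3 :: "(nat \<Rightarrow> complex \<Rightarrow> real) \<Rightarrow> ereal set \<Rightarrow> (complex \<Rightarrow> complex) \<Rightarrow> bool" where
  "CT3 \<nu> K g \<longleftrightarrow>
     (\<forall>n\<ge>1. \<exists>m>n. \<forall>x::real. ereal x \<in> K \<longrightarrow>
        (SUP z\<in>S_set (real n) {ereal x}. O_norm \<nu> {ereal x} m (\<lambda>\<zeta>. g (z - \<zeta>)) * ennreal (\<nu> n z)) < \<infinity>)"

text \<open>The sign in \<open>t \<plusminus> i p\<close> is the variable \<open>s\<close>.\<close>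

definition CT4 :: "(nat \<Rightarrow> complex \<Rightarrow> real) \<Rightarrow> (complex \<Rightarrow> complex) \<Rightarrow> bool" where
  "CT4 \<nu> g \<longleftrightarrow>
     (\<forall>n\<ge>1. \<exists>p m :: nat. 2 \<le> p \<and> p < m \<and> (\<exists>C::real. C > 0 \<and>
        (\<forall>s\<in>{1, -1}. \<forall>z. \<bar>Im z\<bar> \<le> 1 / real n \<longrightarrow>
           (\<integral>\<^sup>+t. ennreal (cmod (g (z - Complex t (s * real p))) / \<nu> m (Complex t (s * real p)) * \<nu> n z)
              \<partial>lebesgue) \<le> ennreal C)))"

definition CT5 :: "(nat \<Rightarrow> complex \<Rightarrow> real) \<Rightarrow> ereal set \<Rightarrow> (complex \<Rightarrow> complex) \<Rightarrow> bool" where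
  "CT5 \<nu> K g \<longleftrightarrow>
     (\<forall>n\<ge>1. \<forall>z\<in>- cpart K.
        (SUP \<zeta>\<in>S_set (real n) K. ennreal (cmod (g (z - \<zeta>)) * inverse (\<nu> n \<zeta>))) < \<infinity>)"

definition H3CT :: "(nat \<Rightarrow> complex \<Rightarrow> real) \<Rightarrow> bool" where
  "H3CT \<nu> \<longleftrightarrow>
     (\<exists>c :: nat \<Rightarrow> real.
        (\<forall>m\<ge>1. \<forall>n>m. c n < c m) \<and> (\<forall>n\<ge>1. c n \<le> 1) \<and> c \<longlonglongrightarrow> 0 \<and>
        (\<forall>p q k :: nat. 1 \<le> p \<longrightarrow> p < q \<longrightarrow> q < k \<longrightarrow>
           (\<exists>C::real. C > 0 \<and> (\<forall>\<zeta>::real. \<bar>\<zeta>\<bar> \<ge> 1 + inverse (c k) \<longrightarrow>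
              (let \<theta> = ln (c p / c q) / ln (c p / c k) in
                 (SUP z\<in>cball (complex_of_real \<zeta>) (c k). \<nu> k z) powr \<theta> *
                 (SUP z\<in>cball (complex_of_real \<zeta>) (c p). \<nu> p z) powr (1 - \<theta>)
                 \<le> C * (INF z\<in>cball (complex_of_real \<zeta>) (c q). \<nu> q z))))))"

lemma istopology_OV_ind: "istopology (OV_ind_open \<nu> K)"
  unfolding istopology_def
proof (intro conjI allI impI)
  fix V V' assume V: "OV_ind_open \<nu> K V" and V': "OV_ind_open \<nu> K V'"
  show "OV_ind_open \<nu> K (V \<inter> V')"
    unfolding OV_ind_open_def
  proof (intro conjI allI impI)
    show "V \<inter> V' \<subseteq> OV_ind \<nu> K" using V by (auto simp: OV_ind_open_def)
    fix f assume f: "germ K f \<in> V \<inter> V'"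
    obtain W where W: "germ_abs_convex \<nu> K W" "germ_zero_nhd \<nu> K W"
      "\<forall>g. germ K g \<in> W \<longrightarrow> germ K (\<lambda>z. f z + g z) \<in> V"
      using V f unfolding OV_ind_open_def by blast
    obtain W' where W': "germ_abs_convex \<nu> K W'" "germ_zero_nhd \<nu> K W'"
      "\<forall>g. germ K g \<in> W' \<longrightarrow> germ K (\<lambda>z. f z + g z) \<in> V'"
      using V' f unfolding OV_ind_open_def by blast
    have "germ_abs_convex \<nu> K (W \<inter> W')"
      using W(1) W'(1) unfolding germ_abs_convex_def by blast
    moreover have "germ_zero_nhd \<nu> K (W \<inter> W')"
      unfolding germ_zero_nhd_def
    proof (intro allI impI)
      fix n :: nat assume n: "n \<ge> 1"
      obtain e e' where e: "e > 0" "\<forall>f\<in>O_space \<nu> K n. O_norm \<nu> K n f < ennreal e \<longrightarrow> germ K f \<in> W"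
        and e': "e' > 0" "\<forall>f\<in>O_space \<nu> K n. O_norm \<nu> K n f < ennreal e' \<longrightarrow> germ K f \<in> W'"
        using W(2) W'(2) n unfolding germ_zero_nhd_def by blast
      have "ennreal (min e e') \<le> ennreal e" "ennreal (min e e') \<le> ennreal e'"
        by (auto intro: ennreal_leI)
      then show "\<exists>e>0. \<forall>f\<in>O_space \<nu> K n. O_norm \<nu> K n f < ennreal e \<longrightarrow> germ K f \<in> W \<inter> W'"
        using e e' by (intro exI[of _ "min e e'"]) (meson IntI less_le_trans min_less_iff_conj)
    qed
    ultimately show "\<exists>W. germ_abs_convex \<nu> K W \<and> germ_zero_nhd \<nu> K W \<and>
        (\<forall>g. germ K g \<in> W \<longrightarrow> germ K (\<lambda>z. f z + g z) \<in> V \<inter> V')"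
      using W(3) W'(3) by blast
  qed
next
  fix \<K> assume \<K>: "\<forall>V\<in>\<K>. OV_ind_open \<nu> K V"
  then have sub: "V \<subseteq> OV_ind \<nu> K"
    and ex: "\<And>f. germ K f \<in> V \<Longrightarrow> \<exists>W. germ_abs_convex \<nu> K W \<and> germ_zero_nhd \<nu> K W \<and>
        (\<forall>g. germ K g \<in> W \<longrightarrow> germ K (\<lambda>z. f z + g z) \<in> V)" if "V \<in> \<K>" for V
    using that by (auto simp: OV_ind_open_def)
  show "OV_ind_open \<nu> K (\<Union>\<K>)"
    unfolding OV_ind_open_def
  proof (intro conjI allI impI)
    show "\<Union>\<K> \<subseteq> OV_ind \<nu> K" using sub by blast
    fix f assume "germ K f \<in> \<Union>\<K>"
    then obtain V where V: "V \<in> \<K>" "germ K f \<in> V" by blast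
    obtain W where "germ_abs_convex \<nu> K W" "germ_zero_nhd \<nu> K W"
      "\<forall>g. germ K g \<in> W \<longrightarrow> germ K (\<lambda>z. f z + g z) \<in> V"
      using ex[OF V] by blast
    then show "\<exists>W. germ_abs_convex \<nu> K W \<and> germ_zero_nhd \<nu> K W \<and>
        (\<forall>g. germ K g \<in> W \<longrightarrow> germ K (\<lambda>z. f z + g z) \<in> \<Union>\<K>)"
      using V(1) by (intro exI[of _ W]) blast
  qed
qed

lemma openin_OV_ind: "openin (OV_ind_topology \<nu> K) = OV_ind_open \<nu> K"
  unfolding OV_ind_topology_def by (rule topology_inverse') (rule istopology_OV_ind)

lemma U_mono:
  assumes "1 \<le> t" "t \<le> s" shows "U_nbhd s K \<subseteq> U_nbhd t K"
proof -
  have le: "1 / s \<le> 1 / t" using assms by (simp add: frac_le)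
  then have le': "ereal (1 / s) \<le> ereal (1 / t)" by simp
  show ?thesis
    unfolding U_nbhd_def using le less_le_trans[OF _ le'] assms by (auto split: if_splits)
qed

lemma germ_eqI:
  assumes "n \<ge> 1" "\<And>z. z \<in> closure (U_nbhd (real n) K) \<Longrightarrow> f z = f' z"
  shows "germ K f = germ K f'"
proof -
  have sub: "germ K f \<subseteq> germ K f'"
    if "\<And>z. z \<in> closure (U_nbhd (real n) K) \<Longrightarrow> f z = f' z" for f f'
  proof
    fix g assume "g \<in> germ K f"
    then obtain m :: nat where m: "m \<ge> 1" "\<forall>z\<in>closure (U_nbhd (real m) K). g z = f z"
      unfolding germ_def by blast
    have "closure (U_nbhd (real (max m n)) K) \<subseteq> closure (U_nbhd (real m) K)"
         "closure (U_nbhd (real (max m n)) K) \<subseteq> closure (U_nbhd (real n) K)"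
      using assms(1) m(1) by (intro closure_mono U_mono; simp)+
    then have "\<forall>z\<in>closure (U_nbhd (real (max m n)) K). g z = f' z"
      using m(2) that by (metis subsetD)
    then show "g \<in> germ K f'"
      unfolding germ_def using m(1) by (intro CollectI exI[of _ "max m n"]) simp
  qed
  show ?thesis using sub[of f f'] sub[of f' f] assms(2) by auto
qed

lemma germ_refl: "f \<in> germ K f"
  unfolding germ_def by (auto intro: exI[of _ 1])

lemma O_space_mono:
  assumes "directed_weights \<nu>" "1 \<le> n" "n \<le> m" shows "O_space \<nu> K n \<subseteq> O_space \<nu> K m"
proof
  fix f assume f: "f \<in> O_space \<nu> K n"
  have U: "U_nbhd (real m) K \<subseteq> U_nbhd (real n) K" using assms by (intro U_mono) auto
  have cU: "closure (U_nbhd (real m) K) \<subseteq> closure (U_nbhd (real n) K)" using U by (rule closure_mono)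
  have nu: "\<nu> n z \<le> \<nu> m z" for z
    using assms(3)
  proof (induction m rule: dec_induct)
    case (step k)
    have "\<nu> k z \<le> \<nu> (Suc k) z"
      using assms(1,2) step(1) unfolding directed_weights_def by auto
    with step show ?case by simp
  qed simp
  have pos: "0 < \<nu> n z" for z using assms unfolding directed_weights_def by auto
  have "O_norm \<nu> K m f \<le> O_norm \<nu> K n f"
    unfolding O_norm_def
    by (rule SUP_subset_mono[OF cU])
      (use nu pos in \<open>auto intro!: ennreal_leI mult_left_mono le_imp_inverse_le\<close>)
  with f show "f \<in> O_space \<nu> K m"
    unfolding O_space_def using U cU
    by (auto intro: continuous_on_subset holomorphic_on_subset)
qed

lemma O_space_lincomb:
  assumes "directed_weights \<nu>" "1 \<le> n" "f \<in> O_space \<nu> K n" "g \<in> O_space \<nu> K n"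
  shows "(\<lambda>z. a * f z + b * g z) \<in> O_space \<nu> K n"
proof -
  have pos: "0 < \<nu> n z" for z using assms unfolding directed_weights_def by auto
  have "O_norm \<nu> K n (\<lambda>z. a * f z + b * g z) \<le> ennreal (cmod a) * O_norm \<nu> K n f + ennreal (cmod b) * O_norm \<nu> K n g"
    unfolding O_norm_def
  proof (rule SUP_least)
    fix z assume z: "z \<in> closure (U_nbhd (real n) K)"
    have "cmod (a * f z + b * g z) * inverse (\<nu> n z)
      \<le> (cmod a * cmod (f z) + cmod b * cmod (g z)) * inverse (\<nu> n z)"
      using pos[of z] by (intro mult_right_mono) (auto simp: norm_mult[symmetric] norm_triangle_ineq)
    also have "\<dots> = cmod a * (cmod (f z) * inverse (\<nu> n z)) + cmod b * (cmod (g z) * inverse (\<nu> n z))"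
      by (simp add: algebra_simps)
    finally have "ennreal (cmod (a * f z + b * g z) * inverse (\<nu> n z)) \<le>
      ennreal (cmod a) * ennreal (cmod (f z) * inverse (\<nu> n z)) +
      ennreal (cmod b) * ennreal (cmod (g z) * inverse (\<nu> n z))"
      using pos[of z] by (simp add: ennreal_mult[symmetric] ennreal_plus[symmetric] ennreal_leI del: ennreal_plus)
    also have "\<dots> \<le> ennreal (cmod a) * (SUP z\<in>closure (U_nbhd (real n) K). ennreal (cmod (f z) * inverse (\<nu> n z))) +
      ennreal (cmod b) * (SUP z\<in>closure (U_nbhd (real n) K). ennreal (cmod (g z) * inverse (\<nu> n z)))"
      using z by (intro add_mono mult_left_mono SUP_upper) auto
    finally show "ennreal (cmod (a * f z + b * g z) * inverse (\<nu> n z)) \<le> \<dots>" .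
  qed
  also have "\<dots> < \<infinity>"
    using assms(3,4) by (auto simp: O_space_def ennreal_mult_less_top ennreal_add_eq_top less_top[symmetric] ennreal_mult_eq_top_iff)
  finally show ?thesis
    using assms(3,4) unfolding O_space_def by (auto intro!: continuous_intros holomorphic_intros)
qed

lemma OV_ind_lincomb:
  assumes "directed_weights \<nu>" "germ K f \<in> OV_ind \<nu> K" "germ K g \<in> OV_ind \<nu> K"
  shows "germ K (\<lambda>z. a * f z + b * g z) \<in> OV_ind \<nu> K"
proof -
  obtain f' n where f': "germ K f = germ K f'" "n \<ge> 1" "f' \<in> O_space \<nu> K n"
    using assms(2) unfolding OV_ind_def by auto
  obtain g' m where g': "germ K g = germ K g'" "m \<ge> 1" "g' \<in> O_space \<nu> K m"
    using assms(3) unfolding OV_ind_def by auto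
  obtain i :: nat where i: "i \<ge> 1" "\<forall>z\<in>closure (U_nbhd (real i) K). f z = f' z"
    using germ_refl[of f K] unfolding f'(1) unfolding germ_def by blast
  obtain j :: nat where j: "j \<ge> 1" "\<forall>z\<in>closure (U_nbhd (real j) K). g z = g' z"
    using germ_refl[of g K] unfolding g'(1) unfolding germ_def by blast
  have "closure (U_nbhd (real (max i j)) K) \<subseteq> closure (U_nbhd (real i) K)"
       "closure (U_nbhd (real (max i j)) K) \<subseteq> closure (U_nbhd (real j) K)"
    using i(1) j(1) by (intro closure_mono U_mono; simp)+
  then have "germ K (\<lambda>z. a * f z + b * g z) = germ K (\<lambda>z. a * f' z + b * g' z)"
    using i j by (intro germ_eqI[of "max i j"]) (simp_all add: subset_iff)
  moreover have "(\<lambda>z. a * f' z + b * g' z) \<in> O_space \<nu> K (max n m)"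
    using O_space_mono[OF assms(1), of n "max n m" K] O_space_mono[OF assms(1), of m "max n m" K] f' g'
    by (intro O_space_lincomb[OF assms(1)]) auto
  moreover have "max n m \<ge> 1" using f'(2) by simp
  ultimately show ?thesis
    unfolding OV_ind_def by blast
qed

lemma topspace_OV_ind:
  assumes "directed_weights \<nu>" shows "topspace (OV_ind_topology \<nu> K) = OV_ind \<nu> K"
proof
  show "topspace (OV_ind_topology \<nu> K) \<subseteq> OV_ind \<nu> K"
    unfolding topspace_def openin_OV_ind OV_ind_open_def by blast
  have "germ_abs_convex \<nu> K (OV_ind \<nu> K)"
    unfolding germ_abs_convex_def using OV_ind_lincomb[OF assms] by blast
  moreover have "germ_zero_nhd \<nu> K (OV_ind \<nu> K)"
    unfolding germ_zero_nhd_def OV_ind_def by (blast intro: zero_less_one)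
  moreover have "germ K (\<lambda>z. f z + g z) \<in> OV_ind \<nu> K"
    if "germ K f \<in> OV_ind \<nu> K" "germ K g \<in> OV_ind \<nu> K" for f g
    using OV_ind_lincomb[OF assms that, of 1 1] by simp
  ultimately have "OV_ind_open \<nu> K (OV_ind \<nu> K)"
    unfolding OV_ind_open_def by blast
  then show "OV_ind \<nu> K \<subseteq> topspace (OV_ind_topology \<nu> K)"
    unfolding openin_OV_ind[symmetric] by (rule openin_subset)
qed

lemma germ_restrict_germ: "germ_restrict K (germ UNIV f) = germ K f"
proof -
  have c: "closure (U_nbhd (real n) K) \<subseteq> closure (U_nbhd (real n) UNIV)" if "n \<ge> 1" for n
  proof (intro closure_mono)
    have "edist_set {z} (cpart UNIV) \<le> edist_set {z} (cpart K)" for z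
      unfolding edist_set_def cpart_def by (auto intro!: INF_superset_mono)
    then show "U_nbhd (real n) K \<subseteq> U_nbhd (real n) UNIV"
      unfolding U_nbhd_def by (auto intro: le_less_trans split: if_splits)
  qed
  have "germ K g = germ K f" if g: "g \<in> germ UNIV f" for g
  proof -
    obtain n :: nat where "n \<ge> 1" "\<forall>z\<in>closure (U_nbhd (real n) UNIV). g z = f z"
      using g unfolding germ_def by auto
    then show ?thesis using c[of n] by (intro germ_eqI[of n]) auto
  qed
  then show ?thesis
    unfolding germ_restrict_def using germ_refl[of f UNIV] by blast
qed

end

theory Submission imports Defs begin

text \<open>
  Let \<open>k(w) = g(w)/w\<close>. Integrating \<open>F(\<zeta>) k(z - \<zeta>)\<close> over a large box with a neighbourhood of \<open>K\<close>
  removed splits \<open>F\<close> into an entire function \<open>E\<close>, given by the integral over the outer boundary and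
  estimated near an unbounded \<open>K\<close> through \<open>CT4\<close>, and a sum of integrals over the boundaries of small tiles
  covering \<open>K\<close>. The part \<open>E\<close> is decomposed by the assumption \<open>(\<Omega>)\<close> for \<open>OV \<nu> {}\<close>.

  A tile integral is a series \<open>\<Sum>t. b\<^sub>t k\<^bsup>(t)\<^esup>(z - x)\<close> with center \<open>x\<close> on the real line. Its partial
  sum of degree about \<open>ln r\<close> approximates it to order \<open>1/r\<close> and is bounded by a power of \<open>r\<close>. If
  \<open>x\<close> is not in \<open>K\<close>, the pole of the partial sum is pushed in finitely many short steps into \<open>K\<close>,
  truncating the re-expansion each time, or towards an infinite end of \<open>K\<close> and from there to
  infinity. For the tiles near infinity the truncation degree depends on the tile, and \<open>H3CT\<close>
  interpolates between the weights like the three circles theorem. Tiles beyond a distance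
  depending on \<open>r\<close> are negligible because the quotients of the weights are integrable.
\<close>

text \<open>The order of quantifiers in (\<Omega>) shapes the construction: q is chosen before k.
  Hence the tile width 1/d may depend on j only, although for large k the edges of the tiles run
  inside \<open>S_set k K\<close>, so that a tile integral is no element of \<open>OV\<close>. It is
  used on \<open>S_set j K\<close> alone, through its Taylor coefficients. With the tile in a disc
  of radius \<rho> = 3/d and the kernel controlled on radius R = 4/d, the remainder of degree N is
  of order (3/4)^N, so N of order ln r suffices. The index k enters only through the growth of a
  partial sum, which is at most exponential in N; every such exponential is a power of r, and the
  exponent n in (\<Omega>) may depend on k. For the same reason a chain of pushing steps, whose
  number depends on k but not on r, does no harm. Near infinity the quotients of the weights are not
  bounded in general, and then no single degree serves all tiles.\<close>

section \<open>Taylor coefficients of the kernel and sums of its derivatives\<close>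

lemma higher_deriv_bound_ball:
  assumes "f holomorphic_on ball w R" "0 < R" "\<And>u. u \<in> ball w R \<Longrightarrow> cmod (f u) \<le> M"
  shows "cmod ((deriv ^^ t) f w) \<le> fact t * M / R ^ t"
proof -
  \<comment> \<open>The Cauchy inequality needs a closed disc inside the domain, so it is applied
    with s < R; letting s tend to R afterwards loses nothing in the constant.\<close>
  have *: "cmod ((deriv ^^ t) f w) * s ^ t \<le> fact t * M" if s: "0 < s" "s < R" for s
  proof -
    have "cball w s \<subseteq> ball w R" using s by auto
    then have "continuous_on (cball w s) f" "f holomorphic_on ball w s"
      using assms(1) holomorphic_on_imp_continuous_on continuous_on_subset holomorphic_on_subset
      by (blast, meson ball_subset_cball holomorphic_on_subset order_trans)
    then have "cmod ((deriv ^^ t) f w) \<le> fact t * M / s ^ t"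
      using s assms(3) by (intro Cauchy_inequality) (auto simp: dist_norm)
    then show ?thesis using s by (simp add: field_simps)
  qed
  have "((\<lambda>s. cmod ((deriv ^^ t) f w) * s ^ t) \<longlongrightarrow> cmod ((deriv ^^ t) f w) * R ^ t) (at_left R)"
    by (intro tendsto_intros)
  moreover have "eventually (\<lambda>s. cmod ((deriv ^^ t) f w) * s ^ t \<le> fact t * M) (at_left R)"
    using eventually_at_left_real[OF assms(2)] by eventually_elim (use * in auto)
  ultimately have "cmod ((deriv ^^ t) f w) * R ^ t \<le> fact t * M"
    by (rule tendsto_upperbound) simp
  then show ?thesis using assms(2) by (simp add: field_simps)
qed

lemma higher_deriv_add: "(deriv ^^ s) ((deriv ^^ l) f) = (deriv ^^ (s + l)) f"
  by (simp add: funpow_add)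

lemma higher_deriv_sums:
  assumes "f holomorphic_on ball w R" "cmod h < R"
  shows "(\<lambda>s. (deriv ^^ (s + l)) f w * h ^ s / fact s) sums (deriv ^^ l) f (w + h)"
proof -
  have "(deriv ^^ l) f holomorphic_on ball w R"
    using assms(1) by (intro holomorphic_intros) auto
  then have "(\<lambda>n. (deriv ^^ n) ((deriv ^^ l) f) w / fact n * (w + h - w) ^ n) sums (deriv ^^ l) f (w + h)"
    by (rule holomorphic_power_series) (use assms(2) in \<open>auto simp: dist_norm\<close>)
  then show ?thesis by (simp add: higher_deriv_add)
qed

text \<open>Moments of a measure of mass A on a disc of radius \<rho>, divided by t!, satisfy this
  bound. Against the Cauchy estimate t! M / R^t for the derivatives of the kernel it leaves a
  geometric series of ratio \<rho>/R.\<close>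

definition pole_bound :: "(nat \<Rightarrow> complex) \<Rightarrow> real \<Rightarrow> real \<Rightarrow> bool" where
  "pole_bound b \<rho> A \<longleftrightarrow> (\<forall>t. cmod (b t) * fact t \<le> A * \<rho> ^ t)"

definition pole_series :: "(complex \<Rightarrow> complex) \<Rightarrow> (nat \<Rightarrow> complex) \<Rightarrow> complex \<Rightarrow> complex \<Rightarrow> complex" where
  "pole_series k b x z = (\<Sum>t. b t * (deriv ^^ t) k (z - x))"

text \<open>Unlike the full series, whose convergence requires z - x to keep some distance from 0,
  the finite sum is holomorphic off x alone. This is why series are truncated before functions of
  \<open>OV\<close> are formed.\<close>

definition pole_sum :: "(complex \<Rightarrow> complex) \<Rightarrow> (nat \<Rightarrow> complex) \<Rightarrow> nat \<Rightarrow> complex \<Rightarrow> complex \<Rightarrow> complex" where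
  "pole_sum k b N x z = (\<Sum>t<N. b t * (deriv ^^ t) k (z - x))"

lemma pole_bound_nonneg: "pole_bound b \<rho> A \<Longrightarrow> 0 \<le> A"
  unfolding pole_bound_def by (drule spec[of _ 0]) (auto intro: order_trans[OF norm_ge_zero])

lemma pole_term_bound:
  assumes "pole_bound b \<rho> A" "k holomorphic_on ball w R" "0 < R"
    "\<And>u. u \<in> ball w R \<Longrightarrow> cmod (k u) \<le> M"
  shows "cmod (b t * (deriv ^^ t) k w) \<le> A * M * (\<rho> / R) ^ t"
proof -
  have M: "0 \<le> M" using assms(4)[of w] assms(3) by (auto intro: order_trans[OF norm_ge_zero])
  have "cmod (b t * (deriv ^^ t) k w) \<le> cmod (b t) * (fact t * M / R ^ t)"
    unfolding norm_mult by (intro mult_left_mono higher_deriv_bound_ball assms) auto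
  also have "\<dots> = (cmod (b t) * fact t) * (M / R ^ t)" by simp
  also have "\<dots> \<le> (A * \<rho> ^ t) * (M / R ^ t)"
    using assms M unfolding pole_bound_def by (intro mult_right_mono) auto
  finally show ?thesis by (simp add: power_divide mult_ac)
qed

lemma pole_series_summable:
  assumes "pole_bound b \<rho> A" "k holomorphic_on ball w R" "0 \<le> \<rho>" "\<rho> < R"
    "\<And>u. u \<in> ball w R \<Longrightarrow> cmod (k u) \<le> M"
  shows "summable (\<lambda>t. cmod (b t * (deriv ^^ t) k w))"
proof (rule summable_comparison_test')
  show "summable (\<lambda>t. A * M * (\<rho> / R) ^ t)"
    using assms by (intro summable_mult summable_geometric) auto
  show "norm (cmod (b t * (deriv ^^ t) k w)) \<le> A * M * (\<rho> / R) ^ t" for t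
    using pole_term_bound[OF assms(1,2) _ assms(5)] assms by simp
qed

text \<open>The tail of the dominating geometric series. Once (R/\<rho>)^N exceeds r, it is of order
  1/r.\<close>

lemma pole_series_minus_sum:
  assumes "pole_bound b \<rho> A" "k holomorphic_on ball (z - x) R" "0 \<le> \<rho>" "\<rho> < R"
    "\<And>u. u \<in> ball (z - x) R \<Longrightarrow> cmod (k u) \<le> M"
  shows "cmod (pole_series k b x z - pole_sum k b N x z) \<le> A * M * (\<rho> / R) ^ N / (1 - \<rho> / R)"
proof -
  let ?f = "\<lambda>t. b t * (deriv ^^ t) k (z - x)"
  have s: "summable (\<lambda>t. norm (?f t))" using pole_series_summable[OF assms] by simp
  have eq: "pole_series k b x z - pole_sum k b N x z = (\<Sum>t. ?f (t + N))"
    unfolding pole_series_def pole_sum_def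
    using suminf_split_initial_segment[OF summable_norm_cancel[OF s], of N] by simp
  have sg: "summable (\<lambda>t. (\<rho> / R) ^ t)" using assms by (intro summable_geometric) auto
  have "cmod (\<Sum>t. ?f (t + N)) \<le> (\<Sum>t. A * M * (\<rho> / R) ^ N * (\<rho> / R) ^ t)"
  proof (rule order_trans[OF summable_norm])
    show s': "summable (\<lambda>t. norm (?f (t + N)))" using s by (rule summable_ignore_initial_segment)
    show "(\<Sum>t. norm (?f (t + N))) \<le> (\<Sum>t. A * M * (\<rho> / R) ^ N * (\<rho> / R) ^ t)"
    proof (rule suminf_le[OF _ s' summable_mult[OF sg]])
      show "norm (?f (t + N)) \<le> A * M * (\<rho> / R) ^ N * (\<rho> / R) ^ t" for t
        using pole_term_bound[OF assms(1,2) _ assms(5), of "t + N"] assms by (simp add: power_add mult_ac)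
    qed
  qed
  also have "\<dots> = A * M * (\<rho> / R) ^ N / (1 - \<rho> / R)"
    using assms by (subst suminf_mult[OF sg], subst suminf_geometric) auto
  finally show ?thesis unfolding eq .
qed

lemma pole_sum_bound:
  assumes "pole_bound b \<rho> A" "k holomorphic_on ball (z - x) R" "0 < R"
    "\<And>u. u \<in> ball (z - x) R \<Longrightarrow> cmod (k u) \<le> M"
  shows "cmod (pole_sum k b N x z) \<le> A * M * (\<Sum>t<N. (\<rho> / R) ^ t)"
  unfolding pole_sum_def sum_distrib_left
  by (rule order_trans[OF norm_sum]) (intro sum_mono pole_term_bound assms; assumption)

text \<open>Re-expansion of a finite sum of poles at \<open>x\<close> about a nearby point \<open>y\<close>.\<close>

definition pole_shift :: "(nat \<Rightarrow> complex) \<Rightarrow> nat \<Rightarrow> complex \<Rightarrow> nat \<Rightarrow> complex" where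
  "pole_shift b N h t = (\<Sum>l\<in>{l. l < N \<and> l \<le> t}. b l * h ^ (t - l) / fact (t - l))"

text \<open>The binomial theorem: multiplied by t!, the convolution turns into the expansion of
  (\<rho> + |h|)^t. Only the radius grows; the constant A is kept and does not depend on N.\<close>

lemma pole_bound_shift:
  assumes "pole_bound b \<rho> A" "0 \<le> \<rho>"
  shows "pole_bound (pole_shift b N h) (\<rho> + cmod h) A"
  unfolding pole_bound_def
proof
  fix t
  have A: "0 \<le> A" using assms pole_bound_nonneg by blast
  have sub: "{l. l < N \<and> l \<le> t} \<subseteq> {..t}" by auto
  have "cmod (pole_shift b N h t) * fact t
     \<le> (\<Sum>l\<in>{l. l < N \<and> l \<le> t}. cmod (b l * h ^ (t - l) / fact (t - l)) * fact t)"
    unfolding pole_shift_def sum_distrib_right[symmetric] by (intro mult_right_mono norm_sum) auto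
  also have "\<dots> = (\<Sum>l\<in>{l. l < N \<and> l \<le> t}. (cmod (b l) * fact l) * (of_nat (t choose l) * cmod h ^ (t - l)))"
    by (intro sum.cong refl) (auto simp: norm_mult norm_divide norm_power binomial_fact field_simps)
  also have "\<dots> \<le> (\<Sum>l\<in>{l. l < N \<and> l \<le> t}. (A * \<rho> ^ l) * (of_nat (t choose l) * cmod h ^ (t - l)))"
    using assms(1) unfolding pole_bound_def by (intro sum_mono mult_right_mono) auto
  also have "\<dots> \<le> (\<Sum>l\<le>t. (A * \<rho> ^ l) * (of_nat (t choose l) * cmod h ^ (t - l)))"
    using A assms(2) by (intro sum_mono2 sub) auto
  also have "\<dots> = A * (\<rho> + cmod h) ^ t"
    unfolding binomial_ring sum_distrib_left by (simp add: mult_ac)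
  finally show "cmod (pole_shift b N h t) * fact t \<le> A * (\<rho> + cmod h) ^ t" .
qed

text \<open>Each derivative of k at z - x is expanded about z - y, and terms of equal total order
  are collected. Only finitely many series are added, so no question of rearrangement
  arises.\<close>

lemma pole_sum_shift:
  assumes "k holomorphic_on ball (z - y) R" "cmod (y - x) < R"
  shows "pole_sum k b N x z = pole_series k (pole_shift b N (y - x)) y z"
proof -
  let ?h = "y - x"
  let ?c = "\<lambda>l t. if l \<le> t then b l * ?h ^ (t - l) / fact (t - l) * (deriv ^^ t) k (z - y) else 0"
  have *: "?c l sums (b l * (deriv ^^ l) k (z - x))" for l
  proof -
    have "(\<lambda>s. b l * ((deriv ^^ (s + l)) k (z - y) * ?h ^ s / fact s)) sums (b l * (deriv ^^ l) k (z - y + ?h))"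
      by (intro sums_mult higher_deriv_sums[OF assms])
    then have "(\<lambda>s. ?c l (s + l)) sums (b l * (deriv ^^ l) k (z - x))" by (simp add: mult_ac)
    moreover have "(\<Sum>t<l. ?c l t) = 0" by (intro sum.neutral) auto
    ultimately show ?thesis using sums_iff_shift[of "?c l" l "b l * (deriv ^^ l) k (z - x)"] by simp
  qed
  have "(\<lambda>t. \<Sum>l<N. ?c l t) sums (\<Sum>l<N. b l * (deriv ^^ l) k (z - x))"
    by (intro sums_sum *)
  moreover have "(\<Sum>l<N. ?c l t) = pole_shift b N ?h t * (deriv ^^ t) k (z - y)" for t
  proof -
    have "(\<Sum>l<N. ?c l t) = (\<Sum>l\<in>{l\<in>{..<N}. l \<le> t}. b l * ?h ^ (t - l) / fact (t - l) * (deriv ^^ t) k (z - y))"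
      by (intro sum.inter_filter[symmetric]) auto
    also have "{l\<in>{..<N}. l \<le> t} = {l. l < N \<and> l \<le> t}" by auto
    finally show ?thesis by (simp add: pole_shift_def sum_distrib_right)
  qed
  ultimately show ?thesis unfolding pole_series_def pole_sum_def using sums_unique by force
qed

text \<open>Counterpart of the shift: a finite sum may be assigned a smaller radius at the price of
  a factor exponential in N. Shrinking before every shift keeps the radius from growing along a
  chain of shifts.\<close>

lemma pole_bound_truncate:
  assumes "pole_bound b \<rho> A" "0 < \<rho>'" "\<rho>' \<le> \<rho>"
  shows "pole_bound (\<lambda>t. if t < N then b t else 0) \<rho>' (A * (\<rho> / \<rho>') ^ N)"
  unfolding pole_bound_def
proof
  fix t
  have A: "0 \<le> A" using assms pole_bound_nonneg by blast
  show "cmod (if t < N then b t else 0) * fact t \<le> A * (\<rho> / \<rho>') ^ N * \<rho>' ^ t"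
  proof (cases "t < N")
    case True
    have "cmod (b t) * fact t \<le> A * \<rho> ^ t" using assms unfolding pole_bound_def by auto
    also have "\<dots> = A * ((\<rho> / \<rho>') ^ t * \<rho>' ^ t)" using assms by (simp add: power_divide)
    also have "\<dots> \<le> A * ((\<rho> / \<rho>') ^ N * \<rho>' ^ t)"
      using True A assms by (intro mult_left_mono mult_right_mono power_increasing) auto
    finally show ?thesis using True by (simp add: mult_ac)
  qed (use A assms in auto)
qed

lemma pole_sum_truncate: "pole_sum k (\<lambda>t. if t < N then b t else 0) N x z = pole_sum k b N x z"
  unfolding pole_sum_def by (intro sum.cong) auto

lemma pole_sum_holomorphic:
  assumes "k holomorphic_on - {0}"
  shows "pole_sum k b N x holomorphic_on - {x}"
proof -
  have "(\<lambda>z. (deriv ^^ t) k (z - x)) holomorphic_on - {x}" for t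
  proof -
    have "(deriv ^^ t) k \<circ> (\<lambda>z. z - x) holomorphic_on - {x}"
      using assms by (intro holomorphic_on_compose_gen[of _ _ _ "- {0}"] holomorphic_intros) auto
    then show ?thesis by (simp add: o_def)
  qed
  then show ?thesis unfolding pole_sum_def by (intro holomorphic_intros)
qed

subsection \<open>Integrals of the kernel along segments\<close>

definition seg :: "(complex \<Rightarrow> complex) \<Rightarrow> (complex \<Rightarrow> complex) \<Rightarrow> complex \<Rightarrow> complex \<Rightarrow> complex \<Rightarrow> complex" where
  "seg k F a b z = contour_integral (linepath a b) (\<lambda>\<zeta>. F \<zeta> * k (z - \<zeta>))"

lemma seg_continuous:
  assumes "k holomorphic_on - {0}" "continuous_on (closed_segment a b) F" "z \<notin> closed_segment a b"
  shows "continuous_on (closed_segment a b) (\<lambda>\<zeta>. F \<zeta> * k (z - \<zeta>))"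
  using assms(3)
  by (intro continuous_intros assms continuous_on_compose2[OF holomorphic_on_imp_continuous_on[OF assms(1)]]) auto

lemma seg_bound:
  assumes "k holomorphic_on - {0}" "continuous_on (closed_segment a b) F" "z \<notin> closed_segment a b"
    "\<And>\<zeta>. \<zeta> \<in> closed_segment a b \<Longrightarrow> cmod (F \<zeta> * k (z - \<zeta>)) \<le> M"
  shows "cmod (seg k F a b z) \<le> M * cmod (b - a)"
  unfolding seg_def
proof (rule contour_integral_bound_linepath)
  show "0 \<le> M" using assms(4)[of a] by (auto intro: order_trans[OF norm_ge_zero])
qed (use seg_continuous[OF assms(1-3)] assms(4) contour_integrable_continuous_linepath in auto)

lemma seg_split:
  assumes "k holomorphic_on - {0}" "continuous_on (closed_segment a b) F" "z \<notin> closed_segment a b"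
    "c \<in> closed_segment a b"
  shows "seg k F a b z = seg k F a c z + seg k F c b z"
  unfolding seg_def by (intro contour_integral_split_linepath seg_continuous assms)

lemma linepath_Complex_horizontal: "linepath (Complex a y) (Complex b y) s = Complex (a + (b - a) * s) y"
  by (simp add: linepath_def complex_eq_iff algebra_simps)

lemma closed_segment_horizontal:
  assumes "a \<le> b"
  shows "closed_segment (Complex a y) (Complex b y) = {\<zeta>. Im \<zeta> = y \<and> a \<le> Re \<zeta> \<and> Re \<zeta> \<le> b}"
  using assms closed_segment_same_Im[of "Complex a y" "Complex b y"]
  by (auto simp: closed_segment_eq_real_ivl)

lemma closed_segment_vertical:
  assumes "a \<le> b"
  shows "closed_segment (Complex x a) (Complex x b) = {\<zeta>. Re \<zeta> = x \<and> a \<le> Im \<zeta> \<and> Im \<zeta> \<le> b}"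
  using assms closed_segment_same_Re[of "Complex x a" "Complex x b"]
  by (auto simp: closed_segment_eq_real_ivl)

text \<open>The usual bound, length times maximum, is too coarse where infinitely many tiles have to
  be summed. Here the bound is an integral over the real projection of the segment, and such
  integrals add up over adjacent tiles.\<close>

lemma contour_integral_horizontal_bound:
  assumes ab: "a \<le> b" and f: "continuous_on {\<zeta>. Im \<zeta> = y \<and> a \<le> Re \<zeta> \<and> Re \<zeta> \<le> b} f"
    and u: "u integrable_on {a..b}" "\<And>t. a \<le> t \<Longrightarrow> t \<le> b \<Longrightarrow> cmod (f (Complex t y)) \<le> u t"
  shows "cmod (contour_integral (linepath (Complex a y) (Complex b y)) f) \<le> integral {a..b} u"
proof (cases "a = b")
  case False
  then have ab: "a < b" using ab by simp
  let ?l = "linepath (Complex a y) (Complex b y)"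
  have c: "continuous_on {0..1} (\<lambda>s. f (?l s) * (Complex b y - Complex a y))"
  proof (intro continuous_intros continuous_on_compose2[OF f])
    show "?l ` {0..1} \<subseteq> {\<zeta>. Im \<zeta> = y \<and> a \<le> Re \<zeta> \<and> Re \<zeta> \<le> b}"
      using ab closed_segment_horizontal[of a b y] by (simp add: linepath_image_01)
  qed
  have aff: "((\<lambda>s. u (a + (b - a) * s)) has_integral (integral {a..b} u / (b - a))) {0..1}"
  proof -
    have "((\<lambda>s. u ((b - a) *\<^sub>R s + a)) has_integral (1 / \<bar>b - a\<bar> ^ DIM(real)) *\<^sub>R integral {a..b} u)
        ((\<lambda>x. (1 / (b - a)) *\<^sub>R x + - ((1 / (b - a)) *\<^sub>R a)) ` cbox a b)"
      using ab integrable_integral[OF u(1)] by (intro has_integral_affinity) auto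
    moreover have "(\<lambda>x. (1 / (b - a)) *\<^sub>R x + - ((1 / (b - a)) *\<^sub>R a)) ` cbox a b = {0..1}"
    proof -
      have "b / (b - a) - a / (b - a) = 1" using ab by (simp add: diff_divide_distrib[symmetric])
      then show ?thesis using ab by (subst image_affinity_cbox) auto
    qed
    ultimately show ?thesis using ab by (simp add: add.commute)
  qed
  have "contour_integral ?l f = integral {0..1} (\<lambda>s. f (?l s) * (Complex b y - Complex a y))"
    by (simp add: contour_integral_integral vector_derivative_linepath_at mult.commute cong: integral_cong)
  also have "cmod \<dots> \<le> integral {0..1} (\<lambda>s. (b - a) * u (a + (b - a) * s))"
  proof (rule integral_norm_bound_integral)
    show "(\<lambda>s. f (?l s) * (Complex b y - Complex a y)) integrable_on {0..1}"
      using c by (rule integrable_continuous_real)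
    show "(\<lambda>s. (b - a) * u (a + (b - a) * s)) integrable_on {0..1}"
      using aff by (intro integrable_on_mult_right) blast
    fix s :: real assume s: "s \<in> {0..1}"
    have "Complex b y - Complex a y = of_real (b - a)" by (simp add: complex_eq_iff)
    then have e: "cmod (Complex b y - Complex a y) = b - a" using ab by (simp del: of_real_diff)
    have "0 \<le> (b - a) * s" "(b - a) * s \<le> (b - a) * 1"
      using s ab by (auto simp del: mult_1_right intro!: mult_left_mono)
    then have "cmod (f (?l s)) \<le> u (a + (b - a) * s)"
      unfolding linepath_Complex_horizontal by (intro u) auto
    then have "cmod (f (?l s)) * cmod (Complex b y - Complex a y) \<le> u (a + (b - a) * s) * (b - a)"
      unfolding e using ab by (intro mult_right_mono) auto
    then show "cmod (f (?l s) * (Complex b y - Complex a y)) \<le> (b - a) * u (a + (b - a) * s)"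
      by (simp add: norm_mult mult.commute)
  qed
  also have "\<dots> = integral {a..b} u"
    using integral_unique[OF has_integral_mult_right[OF aff, of "b - a"]] ab by simp
  finally show ?thesis .
qed (simp add: contour_integral_trivial)

text \<open>These moments are the coefficients that arise when the Taylor expansion of k(z -
  \<zeta>) about z - x, in powers of x - \<zeta>, is inserted into \<open>seg\<close>.\<close>

definition seg_coeff :: "(complex \<Rightarrow> complex) \<Rightarrow> complex \<Rightarrow> complex \<Rightarrow> complex \<Rightarrow> nat \<Rightarrow> complex" where
  "seg_coeff F a b x t = contour_integral (linepath a b) (\<lambda>\<zeta>. F \<zeta> * (x - \<zeta>) ^ t / fact t)"

text \<open>On the segment |x - \<zeta>| <= \<rho> < R, so the Taylor series of the kernel converges
  uniformly in \<zeta> and may be integrated term by term.\<close>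

lemma seg_expansion:
  assumes k: "k holomorphic_on ball (z - x) R" and F: "continuous_on (closed_segment a b) F"
    and \<rho>: "closed_segment a b \<subseteq> cball x \<rho>" "\<rho> < R"
    and M: "\<And>u. u \<in> ball (z - x) R \<Longrightarrow> cmod (k u) \<le> M"
  shows "(\<lambda>t. seg_coeff F a b x t * (deriv ^^ t) k (z - x)) sums seg k F a b z"
proof -
  have "a \<in> cball x \<rho>" using \<rho> by auto
  then have \<rho>0: "0 \<le> \<rho>" by (auto intro: order_trans[OF zero_le_dist])
  then have R: "0 < R" using \<rho> by simp
  obtain B where B: "\<And>\<zeta>. \<zeta> \<in> closed_segment a b \<Longrightarrow> cmod (F \<zeta>) \<le> B"
    using compact_imp_bounded[OF compact_continuous_image[OF F compact_segment(1)]]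
    unfolding bounded_iff by (metis image_eqI)
  have B0: "0 \<le> B" using B[of a] by (auto intro: order_trans[OF norm_ge_zero])
  have M0: "0 \<le> M" using M[of "z - x"] R by (auto intro: order_trans[OF norm_ge_zero])
  let ?f = "\<lambda>t \<zeta>. F \<zeta> * (x - \<zeta>) ^ t / fact t * (deriv ^^ t) k (z - x)"
  have u: "uniform_limit (closed_segment a b) (\<lambda>n \<zeta>. \<Sum>t<n. ?f t \<zeta>) (\<lambda>\<zeta>. \<Sum>t. ?f t \<zeta>) sequentially"
  proof (rule Weierstrass_m_test)
    show "summable (\<lambda>t. B * M * (\<rho> / R) ^ t)"
      using \<rho>0 \<rho> by (intro summable_mult summable_geometric) auto
    fix t \<zeta> assume \<zeta>: "\<zeta> \<in> closed_segment a b"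
    then have d: "cmod (x - \<zeta>) \<le> \<rho>" using \<rho> by (auto simp: dist_norm)
    have "norm (?f t \<zeta>) \<le> B * \<rho> ^ t / fact t * (fact t * M / R ^ t)"
      unfolding norm_mult norm_divide norm_power norm_fact
      using B[OF \<zeta>] B0 \<rho>0 d by (intro mult_mono divide_right_mono power_mono higher_deriv_bound_ball k M R) auto
    then show "norm (?f t \<zeta>) \<le> B * M * (\<rho> / R) ^ t" by (simp add: power_divide mult_ac)
  qed
  have lim: "(\<Sum>t. ?f t \<zeta>) = F \<zeta> * k (z - \<zeta>)" if "\<zeta> \<in> closed_segment a b" for \<zeta>
  proof -
    have d: "cmod (x - \<zeta>) < R" using that \<rho> by (force simp: dist_norm)
    have "(\<lambda>s. F \<zeta> * ((deriv ^^ (s + 0)) k (z - x) * (x - \<zeta>) ^ s / fact s)) sums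
        (F \<zeta> * (deriv ^^ 0) k (z - x + (x - \<zeta>)))"
      by (intro sums_mult higher_deriv_sums[OF k d])
    then show ?thesis using sums_unique by (force simp: mult_ac)
  qed
  have int: "(\<lambda>\<zeta>. ?f t \<zeta>) contour_integrable_on linepath a b" for t
    by (intro contour_integrable_continuous_linepath continuous_intros F) auto
  have int': "(\<lambda>\<zeta>. F \<zeta> * (x - \<zeta>) ^ t / fact t) contour_integrable_on linepath a b" for t
    by (intro contour_integrable_continuous_linepath continuous_intros F) auto
  have "(\<lambda>n. contour_integral (linepath a b) (\<lambda>\<zeta>. \<Sum>t<n. ?f t \<zeta>)) \<longlonglongrightarrow>
      contour_integral (linepath a b) (\<lambda>\<zeta>. \<Sum>t. ?f t \<zeta>)"
  proof (rule contour_integral_uniform_limit(2))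
    show "\<forall>\<^sub>F n in sequentially. (\<lambda>\<zeta>. \<Sum>t<n. ?f t \<zeta>) contour_integrable_on linepath a b"
      using int by (intro always_eventually allI contour_integrable_sum) simp_all
    show "norm (vector_derivative (linepath a b) (at t)) \<le> cmod (b - a)" for t
      by (simp add: vector_derivative_linepath_at)
  qed (use u in auto)
  moreover have "contour_integral (linepath a b) (\<lambda>\<zeta>. \<Sum>t<n. ?f t \<zeta>) =
      (\<Sum>t<n. seg_coeff F a b x t * (deriv ^^ t) k (z - x))" for n
    unfolding seg_coeff_def contour_integral_rmul[OF int', symmetric]
    by (intro contour_integral_sum int) simp
  moreover have "contour_integral (linepath a b) (\<lambda>\<zeta>. \<Sum>t. ?f t \<zeta>) = seg k F a b z"
    unfolding seg_def by (intro contour_integral_cong) (use lim in auto)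
  ultimately show ?thesis unfolding sums_def by simp
qed

lemma seg_coeff_bound:
  assumes F: "continuous_on (closed_segment a b) F" and \<rho>: "closed_segment a b \<subseteq> cball x \<rho>"
    and M: "\<And>\<zeta>. \<zeta> \<in> closed_segment a b \<Longrightarrow> cmod (F \<zeta>) \<le> M"
  shows "pole_bound (seg_coeff F a b x) \<rho> (M * cmod (b - a))"
  unfolding pole_bound_def
proof
  fix t
  have M0: "0 \<le> M" using M[of a] by (auto intro: order_trans[OF norm_ge_zero])
  have "a \<in> cball x \<rho>" using \<rho> by auto
  then have \<rho>0: "0 \<le> \<rho>" by (auto intro: order_trans[OF zero_le_dist])
  have "cmod (seg_coeff F a b x t) \<le> M * \<rho> ^ t / fact t * cmod (b - a)"
    unfolding seg_coeff_def
  proof (rule contour_integral_bound_linepath)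
    fix \<zeta> assume \<zeta>: "\<zeta> \<in> closed_segment a b"
    then have "cmod (x - \<zeta>) \<le> \<rho>" using \<rho> by (auto simp: dist_norm)
    then show "cmod (F \<zeta> * (x - \<zeta>) ^ t / fact t) \<le> M * \<rho> ^ t / fact t"
      unfolding norm_mult norm_divide norm_power norm_fact
      using M[OF \<zeta>] M0 by (intro divide_right_mono mult_mono power_mono) auto
  qed (use M0 \<rho>0 F in \<open>auto intro!: contour_integrable_continuous_linepath continuous_intros\<close>)
  then show "cmod (seg_coeff F a b x t) * fact t \<le> M * cmod (b - a) * \<rho> ^ t"
    by (simp add: field_simps)
qed

lemma seg_coeff_bound_horizontal:
  assumes ab: "a \<le> b" and F: "continuous_on {\<zeta>. Im \<zeta> = y \<and> a \<le> Re \<zeta> \<and> Re \<zeta> \<le> b} F"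
    and \<rho>: "closed_segment (Complex a y) (Complex b y) \<subseteq> cball x \<rho>"
    and u: "u integrable_on {a..b}" "\<And>t. a \<le> t \<Longrightarrow> t \<le> b \<Longrightarrow> cmod (F (Complex t y)) \<le> u t"
  shows "pole_bound (seg_coeff F (Complex a y) (Complex b y) x) \<rho> (integral {a..b} u)"
  unfolding pole_bound_def
proof
  fix t
  have "cmod (seg_coeff F (Complex a y) (Complex b y) x t) \<le> integral {a..b} (\<lambda>s. u s * (\<rho> ^ t / fact t))"
    unfolding seg_coeff_def
  proof (rule contour_integral_horizontal_bound[OF ab])
    fix s assume s: "a \<le> s" "s \<le> b"
    then have "Complex s y \<in> closed_segment (Complex a y) (Complex b y)"
      by (simp add: closed_segment_horizontal[OF ab])
    then have "Complex s y \<in> cball x \<rho>" using \<rho> by blast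
    then have "cmod (x - Complex s y) \<le> \<rho>" by (simp add: dist_norm)
    then have "cmod (F (Complex s y)) * (cmod (x - Complex s y) ^ t / fact t) \<le> u s * (\<rho> ^ t / fact t)"
      using u(2)[OF s] by (intro mult_mono divide_right_mono power_mono)
        (auto intro: order_trans[OF norm_ge_zero])
    then show "cmod (F (Complex s y) * (x - Complex s y) ^ t / fact t) \<le> u s * (\<rho> ^ t / fact t)"
      by (simp add: norm_mult norm_divide norm_power)
  qed (use u F in \<open>auto intro!: continuous_intros integrable_on_mult_left\<close>)
  also have "\<dots> = integral {a..b} u * (\<rho> ^ t / fact t)" by simp
  finally show "cmod (seg_coeff F (Complex a y) (Complex b y) x t) * fact t \<le> integral {a..b} u * \<rho> ^ t"
    by (simp add: field_simps)
qed

text \<open>F is merely continuous along the segment. The dependence on z sits in the kernel alone,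
  which permits differentiation under the integral sign.\<close>

lemma seg_holomorphic:
  assumes k: "k holomorphic_on - {0}" and F: "continuous_on (closed_segment a b) F"
  shows "seg k F a b holomorphic_on - closed_segment a b"
proof -
  let ?l = "linepath a b"
  have op: "open (- closed_segment a b)" by (simp add: open_Compl)
  have dk: "continuous_on (- {0}) (deriv k)"
    using k by (intro holomorphic_on_imp_continuous_on holomorphic_deriv) auto
  have ck: "continuous_on (- {0}) k"
    using k by (intro holomorphic_on_imp_continuous_on)
  have l: "?l t \<in> closed_segment a b" if "t \<in> {0..1}" for t
    using that linepath_in_path by auto
  have eq: "seg k F a b = (\<lambda>z. integral (cbox 0 1) (\<lambda>t. F (?l t) * k (z - ?l t) * (b - a)))"
    by (rule ext) (simp add: seg_def contour_integral_integral)
  show ?thesis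
  proof (subst analytic_on_open[symmetric, OF op], unfold analytic_on_def, intro ballI)
    fix z0 assume "z0 \<in> - closed_segment a b"
    then obtain e where e: "e > 0" "ball z0 e \<subseteq> - closed_segment a b"
      using op open_contains_ball by blast
    have ne: "z \<noteq> ?l t" if "z \<in> ball z0 e" "t \<in> {0..1}" for z t
      using e l[OF that(2)] that(1) by auto
    have cF: "continuous_on {0..1} (\<lambda>t. F (?l t))"
      by (rule continuous_on_compose2[OF F]) (use l in \<open>auto intro!: continuous_intros\<close>)
    have "seg k F a b holomorphic_on ball z0 e"
      unfolding eq
    proof (rule leibniz_rule_holomorphic)
      fix z t assume z: "z \<in> ball z0 e" "t \<in> cbox 0 (1::real)"
      have "(k has_field_derivative deriv k (z - ?l t)) (at (z - ?l t))"
        using k ne[of z t] z by (intro holomorphic_derivI[of k "- {0}"]) auto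
      then have "((\<lambda>z. k (z - ?l t)) has_field_derivative deriv k (z - ?l t) * 1) (at z within ball z0 e)"
        by (rule DERIV_chain2) (auto intro!: derivative_eq_intros)
      then show "((\<lambda>z. F (?l t) * k (z - ?l t) * (b - a)) has_field_derivative
          F (?l t) * deriv k (z - ?l t) * (b - a)) (at z within ball z0 e)"
        by (auto intro!: derivative_eq_intros)
    next
      fix z assume z: "z \<in> ball z0 e"
      have "continuous_on {0..1} (\<lambda>t. F (?l t) * k (z - ?l t) * (b - a))"
        by (intro continuous_intros cF continuous_on_compose2[OF ck]) (use ne[OF z] in \<open>auto simp: image_subset_iff simp del: atLeastAtMost_iff\<close>)
      then show "(\<lambda>t. F (?l t) * k (z - ?l t) * (b - a)) integrable_on cbox 0 1"
        by (simp add: integrable_continuous_real)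
    next
      have im: "(\<lambda>p. fst p - ?l (snd p)) ` (ball z0 e \<times> cbox 0 1) \<subseteq> - {0}"
      proof (intro image_subsetI)
        fix p assume "p \<in> ball z0 e \<times> cbox 0 (1::real)"
        then have "fst p \<noteq> ?l (snd p)" by (intro ne) auto
        then show "fst p - ?l (snd p) \<in> - {0}" by simp
      qed
      have cl: "continuous_on X (\<lambda>p. ?l (snd p))" for X :: "(complex \<times> real) set"
        by (rule continuous_on_compose2[OF continuous_on_linepath[of UNIV]]) (auto intro: continuous_intros)
      have "continuous_on (ball z0 e \<times> cbox 0 1) (\<lambda>p. F (?l (snd p)) * deriv k (fst p - ?l (snd p)) * (b - a))"
        by (intro continuous_intros continuous_on_compose2[OF dk _ im] continuous_on_compose2[OF cF] cl) auto
      then show "continuous_on (ball z0 e \<times> cbox 0 1) (\<lambda>(z, t). F (?l t) * deriv k (z - ?l t) * (b - a))"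
        by (simp add: case_prod_unfold)
    qed auto
    then show "\<exists>e>0. seg k F a b holomorphic_on ball z0 e" using e by blast
  qed
qed

lemma seg_reverse: "seg k F b a z = - seg k F a b z"
proof -
  have "contour_integral (reversepath (linepath a b)) (\<lambda>\<zeta>. F \<zeta> * k (z - \<zeta>)) =
      - contour_integral (linepath a b) (\<lambda>\<zeta>. F \<zeta> * k (z - \<zeta>))"
    by (rule contour_integral_reversepath) simp
  then show ?thesis unfolding seg_def by simp
qed

text \<open>Since k(z - \<zeta>) = - g(z - \<zeta>) / (\<zeta> - z), the Cauchy formula for
  F(\<zeta>) g(z - \<zeta>) produces - 2 pi i F(z), using g 0 = 1. The signs on the left are those
  of the positively oriented boundary, all segments being directed to the right or upwards.\<close>

lemma seg_rectangle:
  assumes g: "g holomorphic_on UNIV" "g 0 = 1" and k: "\<And>w. k w = g w / w"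
    and S: "convex S" "open S" "F holomorphic_on S"
    and xy: "x1 \<le> x2" "y1 \<le> y2" "cbox (Complex x1 y1) (Complex x2 y2) \<subseteq> S"
    and z: "z \<notin> cbox (Complex x1 y1) (Complex x2 y2) - box (Complex x1 y1) (Complex x2 y2)"
  shows "seg k F (Complex x1 y1) (Complex x2 y1) z + seg k F (Complex x2 y1) (Complex x2 y2) z
    - seg k F (Complex x1 y2) (Complex x2 y2) z - seg k F (Complex x1 y1) (Complex x1 y2) z
    = - (2 * pi * \<i>) * (if z \<in> box (Complex x1 y1) (Complex x2 y2) then F z else 0)"
proof -
  let ?a = "Complex x1 y1" and ?b = "Complex x2 y1" and ?c = "Complex x2 y2" and ?d = "Complex x1 y2"
  let ?R = "rectpath ?a ?c" and ?\<phi> = "\<lambda>\<zeta>. F \<zeta> * k (z - \<zeta>)"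
  have pi: "path_image ?R = cbox ?a ?c - box ?a ?c"
    using xy by (intro path_image_rectpath_cbox_minus_box) auto
  have g': "(\<lambda>w. g (z - w)) holomorphic_on X" for X
    by (rule holomorphic_on_compose_gen[of "\<lambda>w. z - w" X g UNIV, unfolded o_def])
      (use g in \<open>auto intro: holomorphic_intros\<close>)
  have pS: "path_image ?R \<subseteq> S - {z}" using pi xy z by auto
  \<comment> \<open>The Cauchy formula on a convex set needs z in S. For z outside S the integrand
    is holomorphic on all of S, and the Cauchy theorem gives 0.\<close>
  have main: "(?\<phi> has_contour_integral - (2 * pi * \<i>) * (if z \<in> box ?a ?c then F z else 0)) ?R"
  proof (cases "z \<in> S")
    case True
    have w: "winding_number ?R z = (if z \<in> box ?a ?c then 1 else 0)"
      using winding_number_rectpath[of z ?a ?c] winding_number_rectpath_outside[of ?a ?c z] xy z by auto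
    have "((\<lambda>w. (- F w * g (z - w)) / (w - z)) has_contour_integral
        (2 * pi * \<i> * winding_number ?R z * (- F z * g (z - z)))) ?R"
      using S True pS g' by (intro Cauchy_integral_formula_convex_simple holomorphic_intros)
        (auto simp: interior_open)
    moreover have "(- F w * g (z - w)) / (w - z) = ?\<phi> w" for w
      unfolding k using minus_divide_right[of "F w * g (z - w)" "w - z"] by simp
    ultimately show ?thesis using w g by (simp split: if_splits)
  next
    case False
    have "?\<phi> holomorphic_on S"
      unfolding k using False S g' by (intro holomorphic_intros) auto
    then have "(?\<phi> has_contour_integral 0) ?R"
      using S pS by (intro Cauchy_theorem_convex_simple[of _ S]) auto
    moreover have "z \<notin> box ?a ?c" using False xy box_subset_cbox by blast
    ultimately show ?thesis by simp
  qed
  have seg: "path_image ?R = closed_segment ?a ?b \<union> closed_segment ?b ?c \<union> closed_segment ?c ?d \<union> closed_segment ?d ?a"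
    unfolding rectpath_def Let_def by (auto simp: path_image_join)
  have kh: "k holomorphic_on - {0}"
    unfolding k by (intro holomorphic_intros holomorphic_on_subset[OF g(1)]) auto
  have int: "?\<phi> contour_integrable_on linepath p q" if "closed_segment p q \<subseteq> path_image ?R" for p q
  proof -
    have "z \<notin> closed_segment p q" "closed_segment p q \<subseteq> S" using that pS by auto
    then show ?thesis
      using S(3) by (intro contour_integrable_continuous_linepath seg_continuous kh)
        (auto intro: continuous_on_subset holomorphic_on_imp_continuous_on)
  qed
  have ints: "?\<phi> contour_integrable_on linepath ?a ?b" "?\<phi> contour_integrable_on linepath ?b ?c"
    "?\<phi> contour_integrable_on linepath ?c ?d" "?\<phi> contour_integrable_on linepath ?d ?a"
    using seg by (auto intro!: int)
  have "contour_integral ?R ?\<phi> = seg k F ?a ?b z + (seg k F ?b ?c z + (seg k F ?c ?d z + seg k F ?d ?a z))"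
    unfolding rectpath_def Let_def seg_def using ints by simp
  then show ?thesis
    using contour_integral_unique[OF main] seg_reverse[of k F ?c ?d z] seg_reverse[of k F ?d ?a z] by simp
qed

subsection \<open>A dense set avoiding all grid lines\<close>

text \<open>Grid lines with rational coordinates never pass through these points, so that contour
  identities hold there without exceptions; elsewhere they follow by continuity.\<close>

definition irr_pts :: "complex set" where
  "irr_pts = {z. Re z \<notin> \<rat> \<and> Im z \<notin> \<rat>}"

lemma ex_irrational_between:
  assumes "a < (b::real)" shows "\<exists>x. a < x \<and> x < b \<and> x \<notin> \<rat>"
proof (rule ccontr)
  assume "\<not> ?thesis"
  then have "{a<..<b} \<subseteq> \<rat>" by auto
  then have "countable {a<..<b}" using countable_rat countable_subset by blast
  then show False using assms uncountable_open_interval[of a b] by simp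
qed

lemma irr_pts_dense:
  assumes "open S" "z \<in> S" shows "\<exists>w. w \<in> S \<and> w \<in> irr_pts"
proof -
  obtain e where e: "e > 0" "ball z e \<subseteq> S" using assms open_contains_ball by blast
  obtain x where x: "Re z < x" "x < Re z + e / 2" "x \<notin> \<rat>"
    using ex_irrational_between[of "Re z" "Re z + e / 2"] e by auto
  obtain y where y: "Im z < y" "y < Im z + e / 2" "y \<notin> \<rat>"
    using ex_irrational_between[of "Im z" "Im z + e / 2"] e by auto
  have "cmod (Complex x y - z) \<le> \<bar>x - Re z\<bar> + \<bar>y - Im z\<bar>"
    using cmod_le[of "Complex x y - z"] by simp
  then have "Complex x y \<in> ball z e" using x y by (simp add: dist_norm norm_minus_commute)
  then show ?thesis using e x y by (intro exI[of _ "Complex x y"]) (auto simp: irr_pts_def)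
qed

lemma irr_pts_le:
  fixes u :: "complex \<Rightarrow> real"
  assumes "open S" "continuous_on S u" "\<And>z. z \<in> S \<Longrightarrow> z \<in> irr_pts \<Longrightarrow> u z \<le> c" "z \<in> S"
  shows "u z \<le> c"
proof (rule ccontr)
  assume "\<not> u z \<le> c"
  then have "z \<in> u -` {c<..} \<inter> S" using assms by auto
  moreover have "open (u -` {c<..} \<inter> S)"
    using assms(1,2) continuous_on_open_vimage open_greaterThan by blast
  ultimately obtain w where "w \<in> u -` {c<..} \<inter> S" "w \<in> irr_pts"
    using irr_pts_dense by blast
  then show False using assms(3)[of w] by auto
qed

lemma irr_pts_eq:
  fixes f h :: "complex \<Rightarrow> complex"
  assumes "open S" "continuous_on S f" "continuous_on S h"
    "\<And>z. z \<in> S \<Longrightarrow> z \<in> irr_pts \<Longrightarrow> f z = h z" "z \<in> S"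
  shows "f z = h z"
proof -
  have "cmod (f z - h z) \<le> 0"
    by (rule irr_pts_le[of S "\<lambda>z. cmod (f z - h z)"]) (use assms in \<open>auto intro!: continuous_intros\<close>)
  then show ?thesis by simp
qed

text \<open>Pointwise convergence is known on the dense set only. The family is locally bounded,
  hence normal, so some subsequence converges on all of S; on the dense set its limit can only be e,
  and the bound \<beta> survives the limit.\<close>

lemma holomorphic_limit_on_dense:
  fixes f :: "nat \<Rightarrow> complex \<Rightarrow> complex"
  assumes S: "open S" and f: "\<And>n. f n holomorphic_on S"
    and \<beta>: "continuous_on S \<beta>" "\<And>n z. z \<in> S \<Longrightarrow> cmod (f n z) \<le> \<beta> z"
    and e: "\<And>z. z \<in> S \<Longrightarrow> z \<in> irr_pts \<Longrightarrow> (\<lambda>n. f n z) \<longlonglongrightarrow> e z"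
  obtains h where "h holomorphic_on S" "\<And>z. z \<in> S \<Longrightarrow> z \<in> irr_pts \<Longrightarrow> h z = e z"
    "\<And>z. z \<in> S \<Longrightarrow> cmod (h z) \<le> \<beta> z"
proof -
  have bd: "\<exists>B. \<forall>h\<in>range f. \<forall>z\<in>X. cmod (h z) \<le> B" if "compact X" "X \<subseteq> S" for X
  proof -
    have "bounded (\<beta> ` X)"
      using that \<beta>(1) by (meson compact_continuous_image compact_imp_bounded continuous_on_subset)
    then obtain B where B: "\<And>z. z \<in> X \<Longrightarrow> \<bar>\<beta> z\<bar> \<le> B" unfolding bounded_iff by auto
    have "cmod (f n z) \<le> B" if "z \<in> X" for n z
      using \<beta>(2)[of z n] B[OF that] that \<open>X \<subseteq> S\<close> by fastforce
    then show ?thesis by blast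
  qed
  obtain h r where h: "h holomorphic_on S" "strict_mono (r :: nat \<Rightarrow> nat)"
      "\<And>x. x \<in> S \<Longrightarrow> (\<lambda>n. f (r n) x) \<longlonglongrightarrow> h x"
    by (rule Montel[OF S, of "range f" f]) (use f bd in auto)
  show thesis
  proof (rule that[OF h(1)])
    fix z assume z: "z \<in> S" "z \<in> irr_pts"
    have "(\<lambda>n. f (r n) z) \<longlonglongrightarrow> e z"
      using LIMSEQ_subseq_LIMSEQ[OF e[OF z] h(2)] by (simp add: o_def)
    then show "h z = e z" using h(3)[OF z(1)] LIMSEQ_unique by blast
  next
    fix z assume z: "z \<in> S"
    show "cmod (h z) \<le> \<beta> z"
      by (rule tendsto_upperbound[OF tendsto_norm[OF h(3)[OF z]]]) (use \<beta>(2)[OF z] in auto)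
  qed
qed

text \<open>The local functions need not be compared beforehand: on an overlap two of them are
  continuous and agree with e on a dense set, hence agree.\<close>

lemma holomorphic_patching:
  fixes e :: "complex \<Rightarrow> complex"
  assumes "\<And>z. \<exists>S h. open S \<and> z \<in> S \<and> h holomorphic_on S \<and> (\<forall>w\<in>S \<inter> irr_pts. h w = e w)"
  obtains E where "E holomorphic_on UNIV" "\<And>z. z \<in> irr_pts \<Longrightarrow> E z = e z"
proof -
  obtain S h where Sh: "\<And>z. open (S z)" "\<And>z. z \<in> S z" "\<And>z. h z holomorphic_on S z"
      "\<And>z w. w \<in> S z \<inter> irr_pts \<Longrightarrow> h z w = e w"
    using assms by metis
  define E where "E z = h z z" for z
  have loc: "E w = h z w" if "w \<in> S z" for z w
    unfolding E_def
    by (rule irr_pts_eq[of "S w \<inter> S z" "h w" "h z"])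
      (use Sh that in \<open>auto intro: continuous_on_subset[OF holomorphic_on_imp_continuous_on[OF Sh(3)]]\<close>)
  have "E field_differentiable at z" for z
  proof -
    have "h z field_differentiable at z"
      using Sh holomorphic_on_imp_differentiable_at by blast
    moreover have "eventually (\<lambda>w. h z w = E w) (nhds z)"
      using eventually_nhds_in_open[OF Sh(1,2)] by (rule eventually_mono) (use loc in auto)
    ultimately show ?thesis
      unfolding field_differentiable_def using DERIV_cong_ev by blast
  qed
  then have "E holomorphic_on UNIV" by (simp add: holomorphic_on_def field_differentiable_at_within)
  moreover have "E z = e z" if "z \<in> irr_pts" for z
    unfolding E_def using Sh(2,4) that by auto
  ultimately show thesis using that by blast
qed

subsection \<open>The sets \<open>U\<close> and \<open>S\<close>\<close>

lemma edist_set_less: "edist_set {z} M < ereal c \<longleftrightarrow> (\<exists>w\<in>M. dist z w < c)"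
  unfolding edist_set_def by (simp add: INF_less_iff)

lemma mem_U_nbhd:
  "z \<in> U_nbhd t K \<longleftrightarrow> (\<exists>x. ereal x \<in> K \<and> dist z (complex_of_real x) < 1 / t) \<or>
    (\<infinity> \<in> K \<and> t < Re z \<and> \<bar>Im z\<bar> < 1 / t) \<or> (-\<infinity> \<in> K \<and> Re z < - t \<and> \<bar>Im z\<bar> < 1 / t)"
  unfolding U_nbhd_def Un_iff mem_Collect_eq edist_set_less by (auto simp: cpart_def)

lemma abs_Im_le_dist: "\<bar>Im z\<bar> \<le> dist z (complex_of_real x)"
  using abs_Im_le_cmod[of "z - of_real x"] by (simp add: dist_norm)

lemma abs_Re_le_dist: "\<bar>Re z - x\<bar> \<le> dist z (complex_of_real x)"
  using abs_Re_le_cmod[of "z - of_real x"] by (simp add: dist_norm)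

lemma dist_Re_le: "\<bar>Re z - Re w\<bar> \<le> dist z w"
  using abs_Re_le_cmod[of "z - w"] by (simp add: dist_norm)

lemma dist_Im_le: "\<bar>Im z - Im w\<bar> \<le> dist z w"
  using abs_Im_le_cmod[of "z - w"] by (simp add: dist_norm)

lemma U_nbhd_Im: "z \<in> U_nbhd t K \<Longrightarrow> \<bar>Im z\<bar> < 1 / t"
  unfolding mem_U_nbhd using abs_Im_le_dist by (meson le_less_trans)

lemma not_in_closure_U:
  assumes "\<epsilon> > 0" "\<And>w. dist w z < \<epsilon> \<Longrightarrow> w \<notin> U_nbhd t K"
  shows "z \<notin> closure (U_nbhd t K)"
  using assms unfolding closure_approachable by blast

lemma not_in_closure_U_Im:
  assumes "\<bar>Im z\<bar> > 1 / t" shows "z \<notin> closure (U_nbhd t K)"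
proof (rule not_in_closure_U[of "\<bar>Im z\<bar> - 1 / t"])
  fix w assume "dist w z < \<bar>Im z\<bar> - 1 / t"
  then have "\<bar>Im w\<bar> > 1 / t" using dist_Im_le[of w z] by auto
  then show "w \<notin> U_nbhd t K" using U_nbhd_Im[of w t K] by auto
qed (use assms in auto)

lemma not_in_closure_U_I:
  assumes "\<epsilon> > 0" "\<And>x. ereal x \<in> K \<Longrightarrow> dist z (complex_of_real x) \<ge> 1 / t + \<epsilon>"
    "\<infinity> \<in> K \<Longrightarrow> Re z \<le> t - \<epsilon>" "-\<infinity> \<in> K \<Longrightarrow> Re z \<ge> - t + \<epsilon>"
  shows "z \<notin> closure (U_nbhd t K)"
proof (rule not_in_closure_U[OF assms(1)])
  fix w assume w: "dist w z < \<epsilon>"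
  have "dist w (complex_of_real x) \<ge> 1 / t" if "ereal x \<in> K" for x
    using assms(2)[OF that] w dist_triangle[of z "of_real x" w] by (simp add: dist_commute)
  moreover have "\<bar>Re w - Re z\<bar> < \<epsilon>" using dist_Re_le[of w z] w by simp
  ultimately show "w \<notin> U_nbhd t K"
    unfolding mem_U_nbhd using assms(3,4) by (auto simp: not_less[symmetric])
qed

lemma S_set_eq: "n \<ge> 2 \<Longrightarrow> S_set (real n) K = - closure (U_nbhd (real n) K) \<inter> {z. \<bar>Im z\<bar> < real n}"
  unfolding S_set_def by (simp add: Let_def)

lemma S_set_1: "S_set (real 1) K = - closure (U_nbhd (3/2) K) \<inter> {z. \<bar>Im z\<bar> < 3/2}"
  unfolding S_set_def by (simp add: Let_def)

lemma open_S_set: "open (S_set t K)"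
proof -
  have "open {z. \<bar>Im z\<bar> < s}" for s
    by (intro open_Collect_less continuous_intros)
  then show ?thesis unfolding S_set_def Let_def by (intro open_Int open_Compl closed_closure)
qed

text \<open>The case n = 1 is separate because \<open>S_set 1 K\<close> is cut out by
  \<open>U_nbhd (3/2) K\<close>; the value 3/2 lies below every m >= 2.\<close>

lemma S_set_mono:
  assumes "1 \<le> n" "n \<le> m" shows "S_set (real n) K \<subseteq> S_set (real m) K"
proof (cases "n = 1")
  case True
  show ?thesis
  proof (cases "m = 1")
    case False
    then have "closure (U_nbhd (real m) K) \<subseteq> closure (U_nbhd (3/2) K)"
      using assms by (intro closure_mono U_mono) auto
    then show ?thesis using False assms True S_set_1[of K] S_set_eq[of m K] by auto
  qed (use True in simp)
next
  case False
  then have "closure (U_nbhd (real m) K) \<subseteq> closure (U_nbhd (real n) K)"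
    using assms by (intro closure_mono U_mono) auto
  then show ?thesis using False assms S_set_eq[of n K] S_set_eq[of m K] by auto
qed

lemma S_set_empty: "n \<ge> 2 \<Longrightarrow> S_set (real n) {} = {z. \<bar>Im z\<bar> < real n}"
  by (auto simp: S_set_eq U_nbhd_def edist_set_less cpart_def)

lemma S_set_subset_empty: "n \<ge> 1 \<Longrightarrow> S_set (real n) K \<subseteq> S_set (real n) {}"
  by (auto simp: S_set_def U_nbhd_def edist_set_less cpart_def Let_def)

lemma S_set_disjoint_cpart: "n \<ge> 1 \<Longrightarrow> S_set (real n) K \<inter> cpart K = {}"
proof -
  assume "n \<ge> 1"
  then have "cpart K \<subseteq> U_nbhd s K" if "s = 3 / 2 \<or> s = real n" for s
    using that by (auto simp: cpart_def mem_U_nbhd intro!: exI)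
  then have "cpart K \<subseteq> closure (U_nbhd (3 / 2) K)" "cpart K \<subseteq> closure (U_nbhd (real n) K)"
    using closure_subset by blast+
  then show ?thesis unfolding S_set_def Let_def by auto
qed

text \<open>Read backwards, this bounds the distance between \<open>S_set n K\<close> and
  \<open>U_nbhd m K\<close> from below, and so keeps the pole of the kernel away. At an infinite end
  the real part moves by less than 1/n, which is covered by m >= n + 1.\<close>

lemma ball_subset_U:
  assumes "\<zeta> \<in> U_nbhd (real m) K" "2 \<le> n" "n < m"
  shows "ball \<zeta> (1 / real n - 1 / real m) \<subseteq> U_nbhd (real n) K"
proof
  fix w assume "w \<in> ball \<zeta> (1 / real n - 1 / real m)"
  then have w: "dist \<zeta> w < 1 / real n - 1 / real m" by simp
  have le: "1 / real n \<le> 1 / 2" "0 \<le> 1 / real m" "real n + 1 \<le> real m" using assms by (auto simp: field_simps)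
  have d: "\<bar>Re \<zeta> - Re w\<bar> < 1 / real n - 1 / real m" "\<bar>Im \<zeta> - Im w\<bar> < 1 / real n - 1 / real m"
    using w dist_Re_le[of \<zeta> w] dist_Im_le[of \<zeta> w] by auto
  from assms(1) consider x where "ereal x \<in> K" "dist \<zeta> (complex_of_real x) < 1 / real m"
    | "\<infinity> \<in> K" "real m < Re \<zeta>" "\<bar>Im \<zeta>\<bar> < 1 / real m"
    | "-\<infinity> \<in> K" "Re \<zeta> < - real m" "\<bar>Im \<zeta>\<bar> < 1 / real m"
    unfolding mem_U_nbhd by blast
  then show "w \<in> U_nbhd (real n) K"
  proof cases
    case 1
    then have "dist w (complex_of_real x) < 1 / real n"
      using w dist_triangle[of w "of_real x" \<zeta>] by (simp add: dist_commute)
    then show ?thesis using 1 unfolding mem_U_nbhd by blast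
  next
    case 2
    then have "real n < Re w" "\<bar>Im w\<bar> < 1 / real n" using d le by linarith+
    then show ?thesis using 2 unfolding mem_U_nbhd by blast
  next
    case 3
    then have "Re w < - real n" "\<bar>Im w\<bar> < 1 / real n" using d le by linarith+
    then show ?thesis using 3 unfolding mem_U_nbhd by blast
  qed
qed

lemma closed_cpart:
  assumes "closed K" shows "closed (cpart K)"
proof -
  have "cpart K = {z. Im z = 0} \<inter> (\<lambda>z. ereal (Re z)) -` K"
  proof (intro equalityI subsetI)
    fix z assume "z \<in> {z. Im z = 0} \<inter> (\<lambda>z. ereal (Re z)) -` K"
    then have "z = of_real (Re z)" "ereal (Re z) \<in> K" by (auto simp: complex_eq_iff)
    then show "z \<in> cpart K" unfolding cpart_def by blast
  qed (auto simp: cpart_def)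
  moreover have "closed {z. Im z = 0}" by (intro closed_Collect_eq continuous_intros)
  moreover have "closed ((\<lambda>z. ereal (Re z)) -` K)"
    by (intro closed_vimage assms continuous_intros)
  ultimately show ?thesis by auto
qed

lemma S_set_exhaust:
  assumes "closed K" "z \<notin> cpart K"
  obtains n where "n \<ge> 2" "z \<in> S_set (real n) K"
proof -
  obtain e where e: "e > 0" "ball z e \<subseteq> - cpart K"
    using closed_cpart[OF assms(1)] assms(2) open_contains_ball[of "- cpart K"] by (auto simp: open_Compl)
  have d: "dist z (of_real x) \<ge> e" if "ereal x \<in> K" for x
    using e(2) that by (auto simp: subset_iff cpart_def not_less[symmetric])
  \<comment> \<open>One bound for all requirements: 1/n < e/2, real part of z within
    [-n + e/2, n - e/2], and |Im z| < n.\<close>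
  obtain n :: nat where n: "real n > 2 / e + \<bar>Re z\<bar> + \<bar>Im z\<bar> + 2 + e"
    using reals_Archimedean2 by blast
  have "2 / e < real n" using n e abs_ge_zero[of "Re z"] abs_ge_zero[of "Im z"] by linarith
  then have "2 < real n * e" using e by (simp add: field_simps)
  moreover have n0: "0 < real n" using \<open>2 / e < real n\<close> e by (meson divide_pos_pos less_trans zero_less_numeral)
  ultimately have 1: "1 / real n < e / 2" by (simp add: field_simps)
  have 2: "2 / e > 0" using e by simp
  have "z \<notin> closure (U_nbhd (real n) K)"
  proof (rule not_in_closure_U_I[of "e / 2"])
    show "1 / real n + e / 2 \<le> dist z (complex_of_real x)" if "ereal x \<in> K" for x
      using d[OF that] 1 by simp
  qed (use e n 2 abs_ge_self[of "Re z"] abs_ge_minus_self[of "Re z"] abs_ge_zero[of "Im z"] in linarith)+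
  moreover have "real n > 2" "\<bar>Im z\<bar> < real n"
    using n e 2 abs_ge_zero[of "Re z"] abs_ge_zero[of "Im z"] by linarith+
  ultimately show thesis using that[of n] S_set_eq[of n K] by auto
qed

lemma PInf_bound:
  assumes "closed K" "\<infinity> \<notin> K" obtains X where "\<And>x. ereal x \<in> K \<Longrightarrow> x \<le> X"
proof -
  have "open (- K)" "\<infinity> \<in> - K" using assms by auto
  then obtain X where "{ereal X<..} \<subseteq> - K" using open_PInfty by blast
  then have "x \<le> X" if "ereal x \<in> K" for x
    using that subsetD[of "{ereal X<..}" "- K" "ereal x"] by (auto simp: not_less[symmetric])
  then show thesis using that by blast
qed

lemma MInf_bound:
  assumes "closed K" "-\<infinity> \<notin> K" obtains X where "\<And>x. ereal x \<in> K \<Longrightarrow> X \<le> x"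
proof -
  have "open (- K)" "-\<infinity> \<in> - K" using assms by auto
  then obtain X where "{..<ereal X} \<subseteq> - K" using open_MInfty by blast
  then have "X \<le> x" if "ereal x \<in> K" for x
    using that subsetD[of "{..<ereal X}" "- K" "ereal x"] by (auto simp: not_less[symmetric])
  then show thesis using that by blast
qed

subsection \<open>Weights and the spaces \<open>OV\<close>\<close>

lemma weights_pos: "directed_weights \<nu> \<Longrightarrow> n \<ge> 1 \<Longrightarrow> 0 < \<nu> n z"
  unfolding directed_weights_def by auto

lemma weights_continuous: "directed_weights \<nu> \<Longrightarrow> n \<ge> 1 \<Longrightarrow> continuous_on A (\<nu> n)"
  unfolding directed_weights_def using continuous_on_subset by blast

lemma weights_mono:
  assumes "directed_weights \<nu>" "1 \<le> n" "n \<le> m" shows "\<nu> n z \<le> \<nu> m z"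
  using assms(3)
proof (induction m rule: dec_induct)
  case (step k)
  then have "\<nu> k z \<le> \<nu> (Suc k) z" using assms(1,2) unfolding directed_weights_def by auto
  with step show ?case by simp
qed simp

lemma OV_norm_le_iff:
  assumes "0 \<le> c"
  shows "OV_norm \<nu> K n F \<le> ennreal c \<longleftrightarrow> (\<forall>z\<in>S_set (real n) K. cmod (F z) * \<nu> n z \<le> c)"
  unfolding OV_norm_def using assms by (auto simp: SUP_le_iff ennreal_le_iff)

lemma OV_norm_le_1_iff:
  "OV_norm \<nu> K n F \<le> 1 \<longleftrightarrow> (\<forall>z\<in>S_set (real n) K. cmod (F z) * \<nu> n z \<le> 1)"
  using OV_norm_le_iff[of 1] by simp

lemma OV_bound:
  assumes "F \<in> OV \<nu> K" "n \<ge> 1"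
  obtains c where "c > 0" "\<And>z. z \<in> S_set (real n) K \<Longrightarrow> cmod (F z) * \<nu> n z \<le> c"
proof -
  have "OV_norm \<nu> K n F < \<infinity>" using assms unfolding OV_def by auto
  then obtain c where c: "c \<ge> 0" "OV_norm \<nu> K n F = ennreal c"
    by (cases "OV_norm \<nu> K n F") auto
  then have "\<forall>z\<in>S_set (real n) K. cmod (F z) * \<nu> n z \<le> c"
    using OV_norm_le_iff[of c] by (metis order_refl)
  then show thesis using that[of "c + 1"] c by force
qed

lemma OV_I:
  assumes "F holomorphic_on - cpart K" "\<And>z. z \<in> cpart K \<Longrightarrow> F z = 0"
    "\<And>n. n \<ge> 1 \<Longrightarrow> \<exists>c. \<forall>z\<in>S_set (real n) K. cmod (F z) * \<nu> n z \<le> c"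
  shows "F \<in> OV \<nu> K"
proof -
  have "OV_norm \<nu> K n F < \<infinity>" if n: "n \<ge> 1" for n
  proof -
    obtain c where "\<forall>z\<in>S_set (real n) K. cmod (F z) * \<nu> n z \<le> c" using assms(3)[OF n] by blast
    then have "OV_norm \<nu> K n F \<le> ennreal (max c 0)" by (subst OV_norm_le_iff) auto
    then show ?thesis by (rule le_less_trans) simp
  qed
  then show ?thesis using assms unfolding OV_def by auto
qed

text \<open>The seminorm of index 1 is dominated by that of index 2, so the exceptional set
  \<open>S_set 1 K\<close> can be ignored in membership proofs.\<close>

lemma OV_I':
  assumes "directed_weights \<nu>" "F holomorphic_on - cpart K" "\<And>z. z \<in> cpart K \<Longrightarrow> F z = 0"
    "\<And>n. n \<ge> 2 \<Longrightarrow> \<exists>c. \<forall>z\<in>S_set (real n) K. cmod (F z) * \<nu> n z \<le> c"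
  shows "F \<in> OV \<nu> K"
proof (rule OV_I[OF assms(2,3)])
  fix n :: nat assume n: "n \<ge> 1"
  obtain c where c: "\<forall>z\<in>S_set (real (Suc n)) K. cmod (F z) * \<nu> (Suc n) z \<le> c"
    using assms(4)[of "Suc n"] n by auto
  have "cmod (F z) * \<nu> n z \<le> c" if "z \<in> S_set (real n) K" for z
  proof -
    have "z \<in> S_set (real (Suc n)) K" using S_set_mono[of n "Suc n" K] n that by auto
    moreover have "cmod (F z) * \<nu> n z \<le> cmod (F z) * \<nu> (Suc n) z"
      using weights_mono[OF assms(1), of n "Suc n" z] n by (intro mult_left_mono) auto
    ultimately show ?thesis using c by fastforce
  qed
  then show "\<exists>c. \<forall>z\<in>S_set (real n) K. cmod (F z) * \<nu> n z \<le> c" by blast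
qed auto

lemma weighted_triangle:
  assumes "cmod (f z) * w \<le> c" "cmod (h z) * w \<le> c'" "0 \<le> (w::real)"
  shows "cmod (a * f z + b * h z) * w \<le> cmod a * c + cmod b * c'"
proof -
  have "cmod (a * f z + b * h z) * w \<le> (cmod a * cmod (f z) + cmod b * cmod (h z)) * w"
    using assms(3) norm_triangle_ineq[of "a * f z" "b * h z"] by (intro mult_right_mono) (auto simp: norm_mult)
  also have "\<dots> = cmod a * (cmod (f z) * w) + cmod b * (cmod (h z) * w)" by (simp add: algebra_simps)
  also have "\<dots> \<le> cmod a * c + cmod b * c'" using assms by (intro add_mono mult_left_mono) auto
  finally show ?thesis .
qed

lemma OV_lincomb:
  assumes "directed_weights \<nu>" "f \<in> OV \<nu> K" "h \<in> OV \<nu> K"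
  shows "(\<lambda>z. a * f z + b * h z) \<in> OV \<nu> K"
proof (rule OV_I)
  show "(\<lambda>z. a * f z + b * h z) holomorphic_on - cpart K"
    using assms unfolding OV_def by (auto intro!: holomorphic_intros)
  show "a * f z + b * h z = 0" if "z \<in> cpart K" for z using assms that unfolding OV_def by auto
  fix n :: nat assume n: "n \<ge> 1"
  obtain c where c: "\<And>z. z \<in> S_set (real n) K \<Longrightarrow> cmod (f z) * \<nu> n z \<le> c"
    using OV_bound[OF assms(2) n] by blast
  obtain c' where c': "\<And>z. z \<in> S_set (real n) K \<Longrightarrow> cmod (h z) * \<nu> n z \<le> c'"
    using OV_bound[OF assms(3) n] by blast
  show "\<exists>c. \<forall>z\<in>S_set (real n) K. cmod (a * f z + b * h z) * \<nu> n z \<le> c"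
    using weighted_triangle[of f _ _ c h c', OF c c'] weights_pos[OF assms(1) n] by (meson less_imp_le)
qed

lemma OV_zero: "(\<lambda>z. 0) \<in> OV \<nu> K"
  by (rule OV_I) auto

lemma OV_scale: "directed_weights \<nu> \<Longrightarrow> f \<in> OV \<nu> K \<Longrightarrow> (\<lambda>z. a * f z) \<in> OV \<nu> K"
  using OV_lincomb[of \<nu> f K f a 0] by simp

lemma OV_add: "directed_weights \<nu> \<Longrightarrow> f \<in> OV \<nu> K \<Longrightarrow> h \<in> OV \<nu> K \<Longrightarrow> (\<lambda>z. f z + h z) \<in> OV \<nu> K"
  using OV_lincomb[of \<nu> f K h 1 1] by simp

lemma OV_restrict:
  assumes "f \<in> OV \<nu> {}"
  shows "(\<lambda>z. if z \<in> cpart K then 0 else f z) \<in> OV \<nu> K"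
proof (rule OV_I)
  have "f holomorphic_on UNIV" using assms by (simp add: OV_def cpart_def)
  then have "f holomorphic_on - cpart K" by (rule holomorphic_on_subset) simp
  then show "(\<lambda>z. if z \<in> cpart K then 0 else f z) holomorphic_on - cpart K"
    by (rule holomorphic_transform) auto
  fix n :: nat assume n: "n \<ge> 1"
  obtain c where c: "c > 0" "\<And>z. z \<in> S_set (real n) {} \<Longrightarrow> cmod (f z) * \<nu> n z \<le> c"
    using OV_bound[OF assms n] by blast
  have "cmod (if z \<in> cpart K then 0 else f z) * \<nu> n z \<le> c" if "z \<in> S_set (real n) K" for z
    using c that S_set_subset_empty[OF n] by auto
  then show "\<exists>c. \<forall>z\<in>S_set (real n) K. cmod (if z \<in> cpart K then 0 else f z) * \<nu> n z \<le> c" by blast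
qed auto

subsection \<open>The kernel\<close>

locale weighted_kernel =
  fixes K :: "ereal set" and \<nu> :: "nat \<Rightarrow> complex \<Rightarrow> real" and g :: "complex \<Rightarrow> complex"
  assumes closed_K: "closed K" and weights: "directed_weights \<nu>"
    and g_entire: "g holomorphic_on UNIV" and g_0: "g 0 = 1" and CT2_K: "CT2 \<nu> K g"
begin

text \<open>A Cauchy kernel: g 0 = 1 makes the residue at 0 equal to 1, while the numerator supplies
  the growth control relative to the weights that 1/w lacks.\<close>

definition kern :: "complex \<Rightarrow> complex" where "kern w = g w / w"

lemma kern_holomorphic: "kern holomorphic_on - {0}"
  unfolding kern_def[abs_def] by (intro holomorphic_intros holomorphic_on_subset[OF g_entire]) auto

lemma \<nu>_pos: "n \<ge> 1 \<Longrightarrow> 0 < \<nu> n z"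
  using weights_pos[OF weights] .

lemma \<nu>_mono: "1 \<le> n \<Longrightarrow> n \<le> m \<Longrightarrow> \<nu> n z \<le> \<nu> m z"
  using weights_mono[OF weights] .

lemma g_bound:
  assumes "n \<ge> 1"
  obtains m B where "m > n" "B > 0"
    "\<And>z \<zeta>. z \<in> S_set (real n) K \<Longrightarrow> \<zeta> \<in> closure (U_nbhd (real m) K) \<Longrightarrow> cmod (g (z - \<zeta>)) * \<nu> n z \<le> B * \<nu> m \<zeta>"
proof -
  obtain m where m: "m > n" and fin:
    "(SUP z\<in>S_set (real n) K. O_norm \<nu> K m (\<lambda>\<zeta>. g (z - \<zeta>)) * ennreal (\<nu> n z)) < \<infinity>" (is "?s < _")
    using CT2_K assms unfolding CT2_def by blast
  obtain B where B: "B \<ge> 0" "?s = ennreal B" using fin by (cases ?s) auto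
  show thesis
  proof (rule that[of m "B + 1"])
    fix z \<zeta> assume z: "z \<in> S_set (real n) K" and \<zeta>: "\<zeta> \<in> closure (U_nbhd (real m) K)"
    have pos: "0 < \<nu> m \<zeta>" "0 < \<nu> n z" using m assms \<nu>_pos by auto
    have "ennreal (cmod (g (z - \<zeta>)) * inverse (\<nu> m \<zeta>)) \<le> O_norm \<nu> K m (\<lambda>\<zeta>. g (z - \<zeta>))"
      unfolding O_norm_def using \<zeta> by (intro SUP_upper)
    then have "ennreal (cmod (g (z - \<zeta>)) * inverse (\<nu> m \<zeta>)) * ennreal (\<nu> n z) \<le> ?s"
      by (intro SUP_upper2[OF z] mult_right_mono) auto
    then have "ennreal (cmod (g (z - \<zeta>)) * inverse (\<nu> m \<zeta>) * \<nu> n z) \<le> ennreal B"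
      using pos B by (simp add: ennreal_mult)
    then have "cmod (g (z - \<zeta>)) * inverse (\<nu> m \<zeta>) * \<nu> n z \<le> B"
      using B by (simp add: ennreal_le_iff)
    then have "cmod (g (z - \<zeta>)) * \<nu> n z \<le> B * \<nu> m \<zeta>" using pos by (simp add: field_simps)
    also have "\<dots> \<le> (B + 1) * \<nu> m \<zeta>" using pos by simp
    finally show "cmod (g (z - \<zeta>)) * \<nu> n z \<le> (B + 1) * \<nu> m \<zeta>" .
  qed (use m B in auto)
qed

text \<open>Points of \<open>S_set n K\<close> and \<open>U_nbhd m K\<close> are at least 1/n - 1/m
  apart, so dividing by z - \<zeta> costs only a constant. The index starts at 2, since
  \<open>S_set 1 K\<close> is not the complement of the closure of
  \<open>U_nbhd 1 K\<close>.\<close>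

lemma kern_bound:
  assumes "n \<ge> 2"
  obtains m B where "m > n" "B > 0" "S_set (real n) K \<inter> U_nbhd (real m) K = {}"
    "\<And>z \<zeta>. z \<in> S_set (real n) K \<Longrightarrow> \<zeta> \<in> U_nbhd (real m) K \<Longrightarrow> cmod (kern (z - \<zeta>)) * \<nu> n z \<le> B * \<nu> m \<zeta>"
proof -
  obtain m B where m: "m > n" "B > 0" and B:
    "\<And>z \<zeta>. z \<in> S_set (real n) K \<Longrightarrow> \<zeta> \<in> closure (U_nbhd (real m) K) \<Longrightarrow> cmod (g (z - \<zeta>)) * \<nu> n z \<le> B * \<nu> m \<zeta>"
    using g_bound[of n] assms by auto
  define \<epsilon> where "\<epsilon> = 1 / real n - 1 / real m"
  have \<epsilon>: "\<epsilon> > 0" using m assms by (simp add: \<epsilon>_def field_simps)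
  have d: "\<epsilon> \<le> dist z \<zeta>" if z: "z \<in> S_set (real n) K" "\<zeta> \<in> U_nbhd (real m) K" for z \<zeta>
  proof -
    have "z \<notin> U_nbhd (real n) K"
      using z(1) S_set_eq[OF assms] closure_subset by blast
    then have "z \<notin> ball \<zeta> \<epsilon>" using ball_subset_U[OF z(2) assms m(1)] unfolding \<epsilon>_def by blast
    then show ?thesis by (simp add: dist_commute)
  qed
  show thesis
  proof (rule that[of m "B / \<epsilon>"])
    show "S_set (real n) K \<inter> U_nbhd (real m) K = {}" using d \<epsilon> by fastforce
    fix z \<zeta> assume z: "z \<in> S_set (real n) K" "\<zeta> \<in> U_nbhd (real m) K"
    have "cmod (g (z - \<zeta>)) * \<nu> n z \<le> B * \<nu> m \<zeta>" using B z closure_subset by blast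
    moreover have "cmod (kern (z - \<zeta>)) \<le> cmod (g (z - \<zeta>)) / \<epsilon>"
      unfolding kern_def norm_divide using d[OF z] \<epsilon> by (intro divide_left_mono) (auto simp: dist_norm intro!: mult_pos_pos)
    ultimately show "cmod (kern (z - \<zeta>)) * \<nu> n z \<le> B / \<epsilon> * \<nu> m \<zeta>"
      using \<nu>_pos[of n z] assms \<epsilon>
        mult_right_mono[of "cmod (kern (z - \<zeta>))" "cmod (g (z - \<zeta>)) / \<epsilon>" "\<nu> n z"]
        divide_right_mono[of "cmod (g (z - \<zeta>)) * \<nu> n z" "B * \<nu> m \<zeta>" \<epsilon>] by auto
  qed (use m \<epsilon> in auto)
qed

subsection \<open>Tiles\<close>

text \<open>Cauchy's formula is applied on a neighbourhood of \<open>K\<close> composed of the tiles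
  \<open>[i/d, (i+1)/d] + i[-1/d, 1/d]\<close>. A vertical edge common to two tiles would contribute with
  opposite signs, and it may meet \<open>K\<close>; it is therefore left out.\<close>

definition tiles :: "nat \<Rightarrow> int set" where
  "tiles d = {i. (\<exists>x. ereal x \<in> K \<and> (of_int i - 1) / d \<le> x \<and> x \<le> (of_int i + 2) / d) \<or>
     (\<infinity> \<in> K \<and> real d \<le> of_int i / d) \<or> (-\<infinity> \<in> K \<and> (of_int i + 1) / d \<le> - real d)}"

text \<open>An edge with a non-tile on at least one side is kept. Hence every index outside
  \<open>tiles d\<close> carries the full boundary of its rectangle, to which the Cauchy formula
  applies, and in a sum over consecutive indices the vertical parts telescope whatever was left
  out.\<close>

definition vert :: "nat \<Rightarrow> (complex \<Rightarrow> complex) \<Rightarrow> int \<Rightarrow> complex \<Rightarrow> complex" where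
  "vert d F i z = (if i - 1 \<in> tiles d \<and> i \<in> tiles d then 0
     else seg kern F (Complex (of_int i / d) (- 1 / d)) (Complex (of_int i / d) (1 / d)) z)"

definition horiz :: "nat \<Rightarrow> (complex \<Rightarrow> complex) \<Rightarrow> int \<Rightarrow> real \<Rightarrow> complex \<Rightarrow> complex" where
  "horiz d F i y = seg kern F (Complex (of_int i / d) y) (Complex ((of_int i + 1) / d) y)"

definition tile_int :: "nat \<Rightarrow> (complex \<Rightarrow> complex) \<Rightarrow> int \<Rightarrow> complex \<Rightarrow> complex" where
  "tile_int d F i z = horiz d F i (- 1 / d) z + vert d F (i + 1) z - horiz d F i (1 / d) z - vert d F i z"

definition tile :: "nat \<Rightarrow> int \<Rightarrow> complex set" where
  "tile d i = {\<zeta>. of_int i / d \<le> Re \<zeta> \<and> Re \<zeta> \<le> (of_int i + 1) / d \<and> \<bar>Im \<zeta>\<bar> \<le> 1 / d}"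

text \<open>The path of integration of \<open>tile_int\<close>; the omitted vertical edges, which
  may meet K, do not belong to it.\<close>

definition edges :: "nat \<Rightarrow> int \<Rightarrow> complex set" where
  "edges d i = {\<zeta>\<in>tile d i. \<bar>Im \<zeta>\<bar> = 1 / d \<or> (Re \<zeta> = of_int i / d \<and> \<not> (i - 1 \<in> tiles d \<and> i \<in> tiles d)) \<or>
     (Re \<zeta> = (of_int i + 1) / d \<and> \<not> (i \<in> tiles d \<and> i + 1 \<in> tiles d))}"

lemma step_le: "d \<ge> 1 \<Longrightarrow> of_int i / real d \<le> (of_int i + 1) / real d"
  by (simp add: divide_right_mono)

lemma horiz_edges:
  assumes "d \<ge> 1" "s = 1 / real d \<or> s = - 1 / real d"
  shows "closed_segment (Complex (of_int i / d) s) (Complex ((of_int i + 1) / d) s) \<subseteq> edges d i"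
  using assms by (auto simp: closed_segment_horizontal step_le edges_def tile_def)

lemma vert_edges:
  assumes "d \<ge> 1" "\<not> (i - 1 \<in> tiles d \<and> i \<in> tiles d)"
  shows "closed_segment (Complex (of_int i / d) (- 1 / d)) (Complex (of_int i / d) (1 / d)) \<subseteq> edges d i"
    "closed_segment (Complex (of_int i / d) (- 1 / d)) (Complex (of_int i / d) (1 / d)) \<subseteq> edges d (i - 1)"
proof -
  have s: "closed_segment (Complex (of_int i / d) (- 1 / d)) (Complex (of_int i / d) (1 / d)) =
      {\<zeta>. Re \<zeta> = of_int i / d \<and> - 1 / d \<le> Im \<zeta> \<and> Im \<zeta> \<le> 1 / d}"
    by (rule closed_segment_vertical) (simp add: field_simps)
  show "closed_segment (Complex (of_int i / d) (- 1 / d)) (Complex (of_int i / d) (1 / d)) \<subseteq> edges d i"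
    "closed_segment (Complex (of_int i / d) (- 1 / d)) (Complex (of_int i / d) (1 / d)) \<subseteq> edges d (i - 1)"
    unfolding s using assms step_le[of d i] step_le[of d "i - 1"] by (auto simp: edges_def tile_def)
qed

lemma vert_edges_right:
  assumes "d \<ge> 1" "\<not> (i \<in> tiles d \<and> i + 1 \<in> tiles d)"
  shows "closed_segment (Complex ((of_int i + 1) / d) (- 1 / d)) (Complex ((of_int i + 1) / d) (1 / d)) \<subseteq> edges d i"
  using vert_edges(2)[of d "i + 1"] assms by simp

text \<open>An index is in \<open>tiles d\<close> as soon as its interval, widened by 1/d on both
  sides, meets K. If the vertical edge at j/d is kept, then j - 1 or j is no tile, so K has no point
  in [(j-1)/d, (j+1)/d]. If \<infinity> belongs to K, kept edges have real part at most d + 1/d, and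
  similarly at the other end; this is where d + 2 comes from.\<close>

lemma edges_not_closure_U:
  assumes "d \<ge> 1" "q \<ge> d + 2" "\<zeta> \<in> edges d i"
  shows "\<zeta> \<notin> closure (U_nbhd (real q) K)"
proof -
  have dq: "1 / real q < 1 / real d" "real d + 2 \<le> real q" "1 / real d \<le> 1" "0 \<le> 1 / real q"
    using assms by (auto simp: field_simps)
  have vertical: "\<zeta> \<notin> closure (U_nbhd (real q) K)" if re: "Re \<zeta> = of_int j / d" and j: "\<not> (j - 1 \<in> tiles d \<and> j \<in> tiles d)" for j
  proof (rule not_in_closure_U_I[of "1 / real d - 1 / real q"])
    show "1 / real q + (1 / real d - 1 / real q) \<le> dist \<zeta> (complex_of_real x)" if x: "ereal x \<in> K" for x
    proof -
      have "\<not> ((of_int j - 1) / d \<le> x \<and> x \<le> (of_int j + 1) / d)"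
      proof
        assume "(of_int j - 1) / d \<le> x \<and> x \<le> (of_int j + 1) / d"
        then have "(of_int j - 1) / d \<le> x" "x \<le> (of_int j + 2) / d"
          "(of_int (j - 1) - 1) / d \<le> x" "x \<le> (of_int (j - 1) + 2) / d"
          using assms(1) by (auto simp: field_simps)
        then show False using x j unfolding tiles_def by blast
      qed
      then have "1 / d \<le> \<bar>Re \<zeta> - x\<bar>" unfolding re by (auto simp: diff_divide_distrib add_divide_distrib)
      then show ?thesis using abs_Re_le_dist[of \<zeta> x] by simp
    qed
    show "Re \<zeta> \<le> real q - (1 / real d - 1 / real q)" if "\<infinity> \<in> K"
    proof -
      have "\<not> (real d \<le> of_int j / d \<and> real d \<le> of_int (j - 1) / d)"
        using that j unfolding tiles_def by blast
      moreover have "of_int (j - 1) / real d = of_int j / d - 1 / d" by (simp add: diff_divide_distrib)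
      ultimately have "Re \<zeta> \<le> real d + 1 / d" unfolding re using dq by linarith
      then show ?thesis using dq by linarith
    qed
    show "- real q + (1 / real d - 1 / real q) \<le> Re \<zeta>" if "-\<infinity> \<in> K"
    proof -
      have "\<not> ((of_int j + 1) / d \<le> - real d \<and> (of_int (j - 1) + 1) / d \<le> - real d)"
        using that j unfolding tiles_def by blast
      then have "\<not> ((of_int j + 1) / d \<le> - real d \<and> of_int j / d \<le> - real d)" by simp
      moreover have "(of_int j + 1) / real d = of_int j / d + 1 / d" by (rule add_divide_distrib)
      ultimately have "Re \<zeta> \<ge> - real d - 1 / d" unfolding re using dq by linarith
      then show ?thesis using dq by linarith
    qed
  qed (use dq in simp)
  show ?thesis
  proof (cases "\<bar>Im \<zeta>\<bar> = 1 / d")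
    case True
    then show ?thesis using dq by (intro not_in_closure_U_Im) simp
  next
    case False
    then show ?thesis using vertical[of i] vertical[of "i + 1"] assms(3) unfolding edges_def by auto
  qed
qed

lemma edges_subset_S:
  assumes "d \<ge> 1" "q \<ge> d + 2" shows "edges d i \<subseteq> S_set (real q) K"
proof
  fix \<zeta> assume \<zeta>: "\<zeta> \<in> edges d i"
  have "1 / real d \<le> 1" "real q > 1" using assms by auto
  moreover have "\<bar>Im \<zeta>\<bar> \<le> 1 / real d" using \<zeta> unfolding edges_def tile_def by auto
  ultimately have "\<bar>Im \<zeta>\<bar> < real q" by linarith
  then show "\<zeta> \<in> S_set (real q) K" using edges_not_closure_U[OF assms \<zeta>] assms S_set_eq[of q K] by auto
qed

lemma edges_cpart: "d \<ge> 1 \<Longrightarrow> edges d i \<subseteq> - cpart K"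
  using edges_subset_S[of d "d + 2" i] S_set_disjoint_cpart[of "d + 2" K] by auto

lemma tile_dist:
  assumes "d \<ge> 1" "\<zeta> \<in> tile d i" "(of_int i - 1) / d \<le> x" "x \<le> (of_int i + 2) / d"
  shows "dist (complex_of_real x) \<zeta> \<le> 3 / d"
proof -
  have e: "2 / real d = 2 * (1 / d)" "3 / real d = 3 * (1 / d)" by auto
  have "\<bar>Re \<zeta> - x\<bar> \<le> 2 / d" "\<bar>Im \<zeta>\<bar> \<le> 1 / d"
    using assms unfolding tile_def e abs_le_iff mem_Collect_eq
    by (simp_all only: add_divide_distrib diff_divide_distrib e) linarith+
  moreover have "dist (complex_of_real x) \<zeta> \<le> \<bar>Re (\<zeta> - x)\<bar> + \<bar>Im (\<zeta> - x)\<bar>"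
    unfolding dist_norm using cmod_le[of "\<zeta> - x"] by (simp add: norm_minus_commute)
  ultimately show ?thesis by simp
qed

lemma tile_dist':
  assumes "d \<ge> 1" "\<zeta> \<in> tile d i"
  shows "dist (complex_of_real (of_int i / d)) \<zeta> \<le> 2 / d"
proof -
  have "\<bar>Re \<zeta> - of_int i / d\<bar> \<le> 1 / d" "\<bar>Im \<zeta>\<bar> \<le> 1 / d"
    using assms unfolding tile_def by (auto simp: abs_le_iff add_divide_distrib)
  moreover have "dist (complex_of_real (of_int i / d)) \<zeta> \<le> \<bar>Re (\<zeta> - complex_of_real (of_int i / d))\<bar> + \<bar>Im (\<zeta> - complex_of_real (of_int i / d))\<bar>"
    unfolding dist_norm using cmod_le[of "\<zeta> - complex_of_real (of_int i / d)"] by (simp add: norm_minus_commute)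
  moreover have "Re (complex_of_real (of_int i / d)) = of_int i / d" "Im (complex_of_real (of_int i / d)) = 0"
    by (rule Re_complex_of_real, rule Im_complex_of_real)
  ultimately show ?thesis by (simp del: of_real_divide)
qed

text \<open>The widened interval offers a point of K at horizontal distance at most 2/d, and the
  half height is 1/d; the sum is the radius 3/d. A tile that belongs to an infinite end takes i/d as
  its center.\<close>

lemma tile_center:
  assumes "d \<ge> 1" "i \<in> tiles d"
  obtains x where "tile d i \<subseteq> cball (complex_of_real x) (3 / d)"
    "ereal x \<in> K \<or> (\<infinity> \<in> K \<and> real d \<le> x) \<or> (-\<infinity> \<in> K \<and> x \<le> - real d)"
proof -
  from assms(2) consider x where "ereal x \<in> K" "(of_int i - 1) / d \<le> x" "x \<le> (of_int i + 2) / d"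
    | "\<infinity> \<in> K" "real d \<le> of_int i / d" | "-\<infinity> \<in> K" "(of_int i + 1) / d \<le> - real d"
    unfolding tiles_def by blast
  moreover have self: "tile d i \<subseteq> cball (complex_of_real (of_int i / d)) (3 / d)"
    using assms(1) by (auto intro!: tile_dist simp: divide_right_mono simp del: of_real_divide)
  ultimately show thesis
  proof cases
    case 1
    then have "tile d i \<subseteq> cball (complex_of_real x) (3 / d)" using tile_dist[OF assms(1) _ 1(2,3)] by auto
    then show thesis using that[of x] 1(1) by blast
  next
    case 2
    then show thesis using that[OF self] by simp
  next
    case 3
    then have "of_int i / d \<le> - real d" using step_le[OF assms(1), of i] by linarith
    then show thesis using 3 that[OF self] by simp
  qed
qed

text \<open>The room 4/d around the center against the radius 3/d of the tile gives the ratio 3/4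
  from which the later powers of 4/3 stem.\<close>

lemma center_ball_subset_U:
  assumes "m \<ge> 2" "d \<ge> 4 * m" "ereal x \<in> K \<or> (\<infinity> \<in> K \<and> real d \<le> x) \<or> (-\<infinity> \<in> K \<and> x \<le> - real d)"
  shows "ball (complex_of_real x) (4 / d) \<subseteq> U_nbhd (real m) K"
proof
  fix w assume "w \<in> ball (complex_of_real x) (4 / d)"
  then have w: "dist w (complex_of_real x) < 4 / d" by (simp add: dist_commute)
  have "real d \<ge> 4 * real m" "real m \<ge> 2" using assms by linarith+
  then have dm: "4 / d \<le> 1 / m" "1 / m \<le> 1 / 2" "real d \<ge> real m + 1" by (auto simp: field_simps)
  have re: "\<bar>Re w - x\<bar> < 1 / m" "\<bar>Im w\<bar> < 1 / m" "dist w (complex_of_real x) < 1 / m"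
    using w abs_Re_le_dist[of w x] abs_Im_le_dist[of w x] dm by linarith+
  from assms(3) show "w \<in> U_nbhd (real m) K"
  proof (elim disjE conjE)
    assume "\<infinity> \<in> K" "real d \<le> x"
    then have "real m < Re w" using re dm by linarith
    then show ?thesis using re \<open>\<infinity> \<in> K\<close> unfolding mem_U_nbhd by blast
  next
    assume "-\<infinity> \<in> K" "x \<le> - real d"
    then have "Re w < - real m" using re dm by linarith
    then show ?thesis using re \<open>-\<infinity> \<in> K\<close> unfolding mem_U_nbhd by blast
  qed (use re in \<open>auto simp: mem_U_nbhd\<close>)
qed

lemma tile_subset_U:
  assumes "m \<ge> 2" "d \<ge> 4 * m" "i \<in> tiles d"
  shows "tile d i \<subseteq> U_nbhd (real m) K"
proof -
  have d: "d \<ge> 1" using assms by simp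
  obtain x where x: "tile d i \<subseteq> cball (complex_of_real x) (3 / d)"
    "ereal x \<in> K \<or> (\<infinity> \<in> K \<and> real d \<le> x) \<or> (-\<infinity> \<in> K \<and> x \<le> - real d)"
    using tile_center[OF d assms(3)] by blast
  have "3 / real d < 4 / real d" using d by (simp add: divide_strict_right_mono)
  then have "cball (complex_of_real x) (3 / d) \<subseteq> ball (complex_of_real x) (4 / d)" by auto
  then show ?thesis using x(1) center_ball_subset_U[OF assms(1,2) x(2)] by blast
qed

lemma OV_continuous_edges:
  assumes "F \<in> OV \<nu> K" "d \<ge> 1" shows "continuous_on (edges d i) F"
  using assms edges_cpart[of d i] unfolding OV_def
  by (auto intro: continuous_on_subset holomorphic_on_imp_continuous_on)

lemma tile_int_holomorphic:
  assumes F: "continuous_on (edges d i) F" and d: "d \<ge> 1"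
  shows "tile_int d F i holomorphic_on - edges d i"
proof -
  have seg: "seg kern F a b holomorphic_on - edges d i" if "closed_segment a b \<subseteq> edges d i" for a b
    by (rule holomorphic_on_subset[OF seg_holomorphic[OF kern_holomorphic continuous_on_subset[OF F that]]]) (use that in auto)
  have "horiz d F i s holomorphic_on - edges d i" if "s = 1 / real d \<or> s = - 1 / real d" for s
    unfolding horiz_def by (intro seg horiz_edges d that)
  moreover have "vert d F i holomorphic_on - edges d i"
    using seg[OF vert_edges(1)[OF d, of i]] by (cases "i - 1 \<in> tiles d \<and> i \<in> tiles d") (auto simp: vert_def[abs_def])
  moreover have "vert d F (i + 1) holomorphic_on - edges d i"
    using seg[OF vert_edges_right[OF d, of i]]
    by (cases "i \<in> tiles d \<and> i + 1 \<in> tiles d") (auto simp: vert_def[abs_def])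
  ultimately show ?thesis unfolding tile_int_def[abs_def] by (intro holomorphic_intros) auto
qed

definition tile_coeff :: "nat \<Rightarrow> (complex \<Rightarrow> complex) \<Rightarrow> int \<Rightarrow> complex \<Rightarrow> nat \<Rightarrow> complex" where
  "tile_coeff d F i x t =
     seg_coeff F (Complex (of_int i / d) (- 1 / d)) (Complex ((of_int i + 1) / d) (- 1 / d)) x t
     + (if i \<in> tiles d \<and> i + 1 \<in> tiles d then 0 else
         seg_coeff F (Complex ((of_int i + 1) / d) (- 1 / d)) (Complex ((of_int i + 1) / d) (1 / d)) x t)
     - seg_coeff F (Complex (of_int i / d) (1 / d)) (Complex ((of_int i + 1) / d) (1 / d)) x t
     - (if i - 1 \<in> tiles d \<and> i \<in> tiles d then 0 else
         seg_coeff F (Complex (of_int i / d) (- 1 / d)) (Complex (of_int i / d) (1 / d)) x t)"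

lemma tile_expansion:
  assumes F: "continuous_on (edges d i) F" and d: "d \<ge> 1"
    and k: "kern holomorphic_on ball (z - x) R" "\<And>u. u \<in> ball (z - x) R \<Longrightarrow> cmod (kern u) \<le> M"
    and \<rho>: "edges d i \<subseteq> cball x \<rho>" "\<rho> < R"
  shows "tile_int d F i z = pole_series kern (tile_coeff d F i x) x z"
proof -
  have s: "(\<lambda>t. seg_coeff F a b x t * (deriv ^^ t) kern (z - x)) sums seg kern F a b z"
    if "closed_segment a b \<subseteq> edges d i" for a b
    by (rule seg_expansion[OF k(1) continuous_on_subset[OF F that] _ \<rho>(2) k(2)]) (use that \<rho> in auto)
  have "(\<lambda>t. (if i - 1 \<in> tiles d \<and> i \<in> tiles d then 0 else
        seg_coeff F (Complex (of_int i / d) (- 1 / d)) (Complex (of_int i / d) (1 / d)) x t) * (deriv ^^ t) kern (z - x)) sums vert d F i z"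
    using s[OF vert_edges(1)[OF d, of i]] by (auto simp: vert_def)
  moreover have "(\<lambda>t. (if i \<in> tiles d \<and> i + 1 \<in> tiles d then 0 else
        seg_coeff F (Complex ((of_int i + 1) / d) (- 1 / d)) (Complex ((of_int i + 1) / d) (1 / d)) x t) * (deriv ^^ t) kern (z - x)) sums vert d F (i + 1) z"
    using s[OF vert_edges_right[OF d, of i]] by (auto simp: vert_def)
  ultimately have "(\<lambda>t. tile_coeff d F i x t * (deriv ^^ t) kern (z - x)) sums tile_int d F i z"
    unfolding tile_coeff_def tile_int_def horiz_def ring_distribs
    by (intro sums_add sums_diff s horiz_edges d) auto
  then show ?thesis unfolding pole_series_def by (simp add: sums_iff)
qed

lemma pole_bound_add: "pole_bound a \<rho> A \<Longrightarrow> pole_bound b \<rho> B \<Longrightarrow> pole_bound (\<lambda>t. a t + b t) \<rho> (A + B)"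
  unfolding pole_bound_def
proof
  fix t assume "\<forall>t. cmod (a t) * fact t \<le> A * \<rho> ^ t" "\<forall>t. cmod (b t) * fact t \<le> B * \<rho> ^ t"
  then have "cmod (a t) * fact t + cmod (b t) * fact t \<le> A * \<rho> ^ t + B * \<rho> ^ t" by (intro add_mono) auto
  moreover have "cmod (a t + b t) * fact t \<le> (cmod (a t) + cmod (b t)) * fact t"
    by (intro mult_right_mono norm_triangle_ineq) auto
  ultimately show "cmod (a t + b t) * fact t \<le> (A + B) * \<rho> ^ t" by (simp add: algebra_simps)
qed

lemma pole_bound_diff: "pole_bound a \<rho> A \<Longrightarrow> pole_bound b \<rho> B \<Longrightarrow> pole_bound (\<lambda>t. a t - b t) \<rho> (A + B)"
  using pole_bound_add[of a \<rho> A "\<lambda>t. - b t" B] by (simp add: pole_bound_def)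

text \<open>The summands are the lengths of the four sides, an omitted vertical edge being counted
  with its full length.\<close>

lemma tile_coeff_bound:
  assumes F: "continuous_on (edges d i) F" and d: "d \<ge> 1"
    and \<rho>: "edges d i \<subseteq> cball x \<rho>" and M: "\<And>\<zeta>. \<zeta> \<in> edges d i \<Longrightarrow> cmod (F \<zeta>) \<le> M"
  shows "pole_bound (tile_coeff d F i x) \<rho> (M * (1 / d) + M * (2 / d) + M * (1 / d) + M * (2 / d))"
proof -
  have s: "pole_bound (seg_coeff F a b x) \<rho> (M * cmod (b - a))" if "closed_segment a b \<subseteq> edges d i" for a b
    by (rule seg_coeff_bound[OF continuous_on_subset[OF F that]]) (use that \<rho> M in auto)
  have e1: "cmod (Complex ((of_int i + 1) / d) y - Complex (of_int i / d) y) = 1 / d" for y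
  proof -
    have "Complex ((of_int i + 1) / d) y - Complex (of_int i / d) y = of_real (1 / d)"
      by (simp add: complex_eq_iff add_divide_distrib)
    then show ?thesis by (simp add: norm_divide)
  qed
  have e2: "cmod (Complex y (1 / d) - Complex y (- 1 / d)) = 2 / d" for y
  proof -
    have "Complex y (1 / d) - Complex y (- 1 / d) = of_real (2 / d) * \<i>"
      by (simp add: complex_eq_iff)
    then show ?thesis by (simp add: norm_divide norm_mult)
  qed
  have M0: "0 \<le> M" "edges d i \<noteq> {}"
  proof -
    have "Complex (of_int i / d) (1 / d) \<in> edges d i"
      using horiz_edges[OF d, of "1 / d" i] by auto
    then show "0 \<le> M" "edges d i \<noteq> {}" using M by (auto intro: order_trans[OF norm_ge_zero])
  qed
  have "Complex (of_int i / d) (1 / d) \<in> edges d i" using horiz_edges[OF d, of "1 / d" i] by auto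
  then have "Complex (of_int i / d) (1 / d) \<in> cball x \<rho>" using \<rho> by blast
  then have \<rho>0: "0 \<le> \<rho>" by (auto intro: order_trans[OF zero_le_dist])
  then have 0: "pole_bound (\<lambda>t. 0) \<rho> (M * (2 / d))" using M0 by (auto simp: pole_bound_def)
  have "pole_bound (\<lambda>t. if i \<in> tiles d \<and> i + 1 \<in> tiles d then 0 else
         seg_coeff F (Complex ((of_int i + 1) / d) (- 1 / d)) (Complex ((of_int i + 1) / d) (1 / d)) x t) \<rho> (M * (2 / d))"
    using 0 s[OF vert_edges_right[OF d, of i]]
    by (cases "i \<in> tiles d \<and> i + 1 \<in> tiles d") (auto simp only: e2 if_True if_False simp_thms)
  moreover have "pole_bound (\<lambda>t. if i - 1 \<in> tiles d \<and> i \<in> tiles d then 0 else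
         seg_coeff F (Complex (of_int i / d) (- 1 / d)) (Complex (of_int i / d) (1 / d)) x t) \<rho> (M * (2 / d))"
    using 0 s[OF vert_edges(1)[OF d, of i]]
    by (cases "i - 1 \<in> tiles d \<and> i \<in> tiles d") (auto simp only: e2 if_True if_False simp_thms)
  moreover have "pole_bound (seg_coeff F (Complex (of_int i / d) y) (Complex ((of_int i + 1) / d) y) x) \<rho> (M * (1 / d))"
    if "y = 1 / d \<or> y = - 1 / d" for y
    using s[OF horiz_edges[OF d that, of i]] by (simp only: e1)
  ultimately show ?thesis
    unfolding tile_coeff_def[abs_def] by (intro pole_bound_add pole_bound_diff) auto
qed

text \<open>Between two neighbouring tiles no vertical edge remains, and the two horizontal sides
  admit a bound by an integral over [i/d, (i+1)/d]. Such bounds can be summed over infinitely many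
  tiles.\<close>

lemma tile_coeff_bound_far:
  assumes F: "continuous_on (edges d i) F" and d: "d \<ge> 1"
    and \<rho>: "edges d i \<subseteq> cball x \<rho>" and far: "i - 1 \<in> tiles d" "i \<in> tiles d" "i + 1 \<in> tiles d"
    and u: "u integrable_on {of_int i / d..(of_int i + 1) / d}"
      "\<And>t y. of_int i / d \<le> t \<Longrightarrow> t \<le> (of_int i + 1) / d \<Longrightarrow> \<bar>y\<bar> = 1 / d \<Longrightarrow> cmod (F (Complex t y)) \<le> u t"
  shows "pole_bound (tile_coeff d F i x) \<rho> (2 * integral {of_int i / d..(of_int i + 1) / d} u)"
proof -
  have "pole_bound (seg_coeff F (Complex (of_int i / d) y) (Complex ((of_int i + 1) / d) y) x) \<rho>
      (integral {of_int i / d..(of_int i + 1) / d} u)" if "y = 1 / d \<or> y = - 1 / d" for y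
  proof (rule seg_coeff_bound_horizontal[OF step_le[OF d] _ _ u(1) u(2)])
    show "closed_segment (Complex (of_int i / d) y) (Complex ((of_int i + 1) / d) y) \<subseteq> cball x \<rho>"
      using horiz_edges[OF d that, of i] \<rho> by blast
    show "continuous_on {\<zeta>. Im \<zeta> = y \<and> of_int i / real d \<le> Re \<zeta> \<and> Re \<zeta> \<le> (of_int i + 1) / real d} F"
      using horiz_edges[OF d that, of i] by (intro continuous_on_subset[OF F]) (simp add: closed_segment_horizontal[OF step_le[OF d]])
  qed (use that in auto)
  from pole_bound_diff[OF this this, of "- 1 / d" "1 / d"] show ?thesis
    using far by (simp add: tile_coeff_def[abs_def])
qed

lemma tile_int_bound_far:
  assumes F: "continuous_on (edges d i) F" and d: "d \<ge> 1" and z: "z \<notin> edges d i"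
    and far: "i - 1 \<in> tiles d" "i \<in> tiles d" "i + 1 \<in> tiles d"
    and u: "u integrable_on {of_int i / d..(of_int i + 1) / d}"
      "\<And>t y. of_int i / d \<le> t \<Longrightarrow> t \<le> (of_int i + 1) / d \<Longrightarrow> \<bar>y\<bar> = 1 / d \<Longrightarrow>
         cmod (F (Complex t y) * kern (z - Complex t y)) \<le> u t"
  shows "cmod (tile_int d F i z) \<le> 2 * integral {of_int i / d..(of_int i + 1) / d} u"
proof -
  have "cmod (horiz d F i y z) \<le> integral {of_int i / d..(of_int i + 1) / d} u" if "y = 1 / d \<or> y = - 1 / d" for y
    unfolding horiz_def seg_def
  proof (rule contour_integral_horizontal_bound[OF step_le[OF d] _ u(1) u(2)])
    have "closed_segment (Complex (of_int i / d) y) (Complex ((of_int i + 1) / d) y) \<subseteq> edges d i"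
      using horiz_edges[OF d that] by blast
    then have "continuous_on (closed_segment (Complex (of_int i / d) y) (Complex ((of_int i + 1) / d) y)) (\<lambda>\<zeta>. F \<zeta> * kern (z - \<zeta>))"
      using z by (intro seg_continuous kern_holomorphic continuous_on_subset[OF F]) auto
    then show "continuous_on {\<zeta>. Im \<zeta> = y \<and> of_int i / real d \<le> Re \<zeta> \<and> Re \<zeta> \<le> (of_int i + 1) / real d} (\<lambda>\<zeta>. F \<zeta> * kern (z - \<zeta>))"
      by (simp add: closed_segment_horizontal[OF step_le[OF d]])
  qed (use that in auto)
  from this[of "1 / d"] this[of "- 1 / d"] show ?thesis
    using far norm_triangle_ineq4[of "horiz d F i (- 1 / d) z" "horiz d F i (1 / d) z"]
    by (simp add: tile_int_def vert_def)
qed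

end

lemma irr_pts_not_horizontal: "z \<in> irr_pts \<Longrightarrow> y \<in> \<rat> \<Longrightarrow> z \<notin> closed_segment (Complex a y) (Complex b y)"
  by (auto simp: irr_pts_def closed_segment_same_Im)

lemma irr_pts_not_vertical: "z \<in> irr_pts \<Longrightarrow> x \<in> \<rat> \<Longrightarrow> z \<notin> closed_segment (Complex x a) (Complex x b)"
  by (auto simp: irr_pts_def closed_segment_same_Re)

lemma sum_int_telescope:
  fixes f :: "int \<Rightarrow> 'a::ab_group_add"
  assumes "a \<le> b" shows "(\<Sum>i\<in>{a..<b}. f (i + 1) - f i) = f b - f a"
  using assms
proof (induction b rule: int_ge_induct)
  case (step b)
  then have "{a..<b + 1} = insert b {a..<b}" by auto
  then show ?case using step by simp
qed simp

context weighted_kernel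
begin

subsection \<open>The contour integral identity\<close>

definition psum :: "nat \<Rightarrow> (complex \<Rightarrow> complex) \<Rightarrow> nat \<Rightarrow> complex \<Rightarrow> complex" where
  "psum d F L z = (\<Sum>i\<in>tiles d \<inter> {- int (L * d)..<int (L * d)}. tile_int d F i z)"

definition line :: "(complex \<Rightarrow> complex) \<Rightarrow> nat \<Rightarrow> real \<Rightarrow> complex \<Rightarrow> complex" where
  "line F L y = seg kern F (Complex (- real L) y) (Complex (real L) y)"

text \<open>A vertical side of the box of height 2p. Its middle piece is taken from
  \<open>vert\<close> and so disappears where the side would separate two tiles.\<close>

definition side :: "nat \<Rightarrow> (complex \<Rightarrow> complex) \<Rightarrow> int \<Rightarrow> nat \<Rightarrow> complex \<Rightarrow> complex" where
  "side d F j p z = seg kern F (Complex (of_int j / d) (- real p)) (Complex (of_int j / d) (- 1 / d)) z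
     + vert d F j z + seg kern F (Complex (of_int j / d) (1 / d)) (Complex (of_int j / d) (real p)) z"

lemma cpart_Im: "z \<in> cpart K \<Longrightarrow> Im z = 0"
  by (auto simp: cpart_def)

text \<open>Both vertical edges are kept, so this is the integral over a whole boundary. The open
  strip one step wider than the tile on each side is free of K by the definition of
  \<open>tiles\<close>, and it is convex.\<close>

lemma tile_int_outside:
  assumes F: "F holomorphic_on - cpart K" and d: "d \<ge> 1" and i: "i \<notin> tiles d" and z: "z \<in> irr_pts"
  shows "tile_int d F i z = - (2 * pi * \<i>) *
    (if of_int i < real d * Re z \<and> real d * Re z < of_int i + 1 \<and> \<bar>Im z\<bar> < 1 / d then F z else 0)"
proof -
  define S where "S = {w. (of_int i - 1) / d < Re w} \<inter> {w. Re w < (of_int i + 2) / d}"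
  have S: "convex S" "open S"
    unfolding S_def by (auto intro!: convex_Int convex_halfspace_Re_lt convex_halfspace_Re_gt open_Int
        open_halfspace_Re_lt open_halfspace_Re_gt)
  have "S \<subseteq> - cpart K"
  proof
    fix w assume w: "w \<in> S"
    have "w \<noteq> complex_of_real x" if x: "ereal x \<in> K" for x
    proof
      assume "w = complex_of_real x"
      then have "(of_int i - 1) / d \<le> x" "x \<le> (of_int i + 2) / d" using w unfolding S_def by auto
      then show False using i x unfolding tiles_def by blast
    qed
    then show "w \<in> - cpart K" unfolding cpart_def by blast
  qed
  then have F': "F holomorphic_on S" using F holomorphic_on_subset by blast
  have ii: "(of_int i - 1) / real d < of_int i / d" "(of_int i + 1) / real d < (of_int i + 2) / d"
    using d by (auto simp: divide_strict_right_mono)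
  have sub: "cbox (Complex (of_int i / d) (- 1 / d)) (Complex ((of_int i + 1) / d) (1 / d)) \<subseteq> S"
    unfolding S_def in_cbox_complex_iff subset_iff using ii by auto
  have rat: "of_int i / real d \<in> \<rat>" "(of_int i + 1) / real d \<in> \<rat>" "1 / real d \<in> \<rat>" "- 1 / real d \<in> \<rat>"
    by auto
  have "Re z \<noteq> of_int i / real d" "Re z \<noteq> (of_int i + 1) / real d" "Im z \<noteq> 1 / real d" "Im z \<noteq> - 1 / real d"
    using z rat unfolding irr_pts_def by force+
  then have zz: "z \<notin> cbox (Complex (of_int i / d) (- 1 / d)) (Complex ((of_int i + 1) / d) (1 / d)) -
       box (Complex (of_int i / d) (- 1 / d)) (Complex ((of_int i + 1) / d) (1 / d))"
    unfolding Diff_iff in_cbox_complex_iff in_box_complex_iff by auto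
  have box: "z \<in> box (Complex (of_int i / d) (- 1 / d)) (Complex ((of_int i + 1) / d) (1 / d)) \<longleftrightarrow>
      of_int i < real d * Re z \<and> real d * Re z < of_int i + 1 \<and> \<bar>Im z\<bar> < 1 / d"
    unfolding in_box_complex_iff using d by (auto simp: field_simps abs_less_iff)
  have "tile_int d F i z = seg kern F (Complex (of_int i / d) (- 1 / d)) (Complex ((of_int i + 1) / d) (- 1 / d)) z
     + seg kern F (Complex ((of_int i + 1) / d) (- 1 / d)) (Complex ((of_int i + 1) / d) (1 / d)) z
     - seg kern F (Complex (of_int i / d) (1 / d)) (Complex ((of_int i + 1) / d) (1 / d)) z
     - seg kern F (Complex (of_int i / d) (- 1 / d)) (Complex (of_int i / d) (1 / d)) z"
    using i by (simp add: tile_int_def horiz_def vert_def)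
  also have "\<dots> = - (2 * pi * \<i>) * (if z \<in> box (Complex (of_int i / d) (- 1 / d)) (Complex ((of_int i + 1) / d) (1 / d)) then F z else 0)"
    by (rule seg_rectangle[OF g_entire g_0 kern_def S F' step_le[OF d] _ sub zz]) (use d in \<open>simp add: field_simps\<close>)
  finally show ?thesis unfolding box .
qed

lemma horiz_sum:
  assumes F: "continuous_on {w. Im w = y} F" and d: "d \<ge> 1" and y: "y \<in> \<rat>" and z: "z \<in> irr_pts" and ab: "a \<le> b"
  shows "(\<Sum>i\<in>{a..<b}. horiz d F i y z) = seg kern F (Complex (of_int a / d) y) (Complex (of_int b / d) y) z"
  using ab
proof (induction b rule: int_ge_induct)
  case base
  then show ?case by (simp add: seg_def)
next
  case (step b)
  then have eq: "{a..<b + 1} = insert b {a..<b}" by auto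
  have m: "of_int a / real d \<le> of_int b / d" "of_int b / real d \<le> (of_int b + 1) / real d"
    using step d by (auto simp: divide_right_mono)
  have "seg kern F (Complex (of_int a / d) y) (Complex ((of_int b + 1) / d) y) z =
     seg kern F (Complex (of_int a / d) y) (Complex (of_int b / d) y) z +
     seg kern F (Complex (of_int b / d) y) (Complex ((of_int b + 1) / d) y) z"
    using m by (intro seg_split kern_holomorphic continuous_on_subset[OF F] irr_pts_not_horizontal z y)
      (auto simp: closed_segment_horizontal)
  then show ?case unfolding eq using step by (simp add: horiz_def)
qed

text \<open>The box is cut into the row of tile rectangles and the two rectangles above and below
  it. Summed over all columns the vertical edges telescope. The Cauchy formula evaluates the columns
  outside \<open>tiles d\<close> and the upper and lower rectangle, exactly one of which contains z;
  what is left inside is \<open>psum\<close>. The right side depends on d only through the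
  \<open>vert\<close> pieces of the two sides.\<close>

lemma key_identity:
  assumes F: "F holomorphic_on - cpart K" and d: "d \<ge> 1" and p: "p \<ge> 2" and z: "z \<in> irr_pts"
    and zL: "\<bar>Re z\<bar> < real L" "\<bar>Im z\<bar> < real p" and zt: "\<And>i. i \<in> tiles d \<Longrightarrow> z \<notin> tile d i"
  shows "psum d F L z - 2 * pi * \<i> * F z =
    line F L (- real p) z - line F L (real p) z + side d F (int (L * d)) p z - side d F (- int (L * d)) p z"
proof -
  let ?I = "{- int (L * d)..<int (L * d)}"
  have L: "L \<ge> 1" using zL by linarith
  have Fc: "continuous_on X F" if "\<And>w. w \<in> X \<Longrightarrow> Im w \<noteq> 0" for X
    using F that cpart_Im by (intro continuous_on_subset[OF holomorphic_on_imp_continuous_on[OF F]]) blast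
  have Ld: "of_int (int (L * d)) / real d = real L" "of_int (- int (L * d)) / real d = - real L" using d by auto
  have dp: "1 / real d \<le> 1" "0 < 1 / real d" using d by auto
  have hs: "(\<Sum>i\<in>?I. horiz d F i y z) = line F L y z" if "y = 1 / real d \<or> y = - 1 / real d" for y
  proof -
    have "y \<in> \<rat>" "y \<noteq> 0" using that d by auto
    then have "(\<Sum>i\<in>?I. horiz d F i y z) =
      seg kern F (Complex (of_int (- int (L * d)) / d) y) (Complex (of_int (int (L * d)) / d) y) z"
      by (intro horiz_sum Fc d z) auto
    then show ?thesis unfolding line_def Ld .
  qed
  have all: "(\<Sum>i\<in>?I. tile_int d F i z) = line F L (- 1 / d) z - line F L (1 / d) z
      + vert d F (int (L * d)) z - vert d F (- int (L * d)) z"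
  proof -
    have "(\<Sum>i\<in>?I. tile_int d F i z) = (\<Sum>i\<in>?I. horiz d F i (- 1 / d) z) - (\<Sum>i\<in>?I. horiz d F i (1 / d) z)
      + (\<Sum>i\<in>?I. vert d F (i + 1) z - vert d F i z)"
      by (simp add: tile_int_def sum.distrib sum_subtractf)
    moreover have "(\<Sum>i\<in>?I. vert d F (i + 1) z - vert d F i z) = vert d F (int (L * d)) z - vert d F (- int (L * d)) z"
      by (rule sum_int_telescope[of _ _ "\<lambda>i. vert d F i z"]) simp
    ultimately show ?thesis using hs by simp
  qed
  have irr: "Re z \<notin> \<rat>" "Im z \<notin> \<rat>" using z by (auto simp: irr_pts_def)
  have out: "(\<Sum>i\<in>?I - tiles d. tile_int d F i z) = - (2 * pi * \<i>) * (if \<bar>Im z\<bar> < 1 / d then F z else 0)"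
  proof -
    have "real d * Re z \<notin> \<int>"
    proof
      assume "real d * Re z \<in> \<int>"
      then have "real d * Re z / real d \<in> \<rat>" by (intro Rats_divide) (auto simp: Ints_def)
      then show False using irr d by simp
    qed
    then have ni: "real d * Re z \<noteq> of_int i" for i by (metis Ints_of_int)
    \<comment> \<open>The irrational real part puts z strictly inside exactly one column.\<close>
    have fl: "of_int i < real d * Re z \<and> real d * Re z < of_int i + 1 \<longleftrightarrow> i = \<lfloor>real d * Re z\<rfloor>" for i
      using ni[of i] by (auto simp: eq_commute[of i] floor_eq_iff less_le)
    have eq: "tile_int d F i z = (if i = \<lfloor>real d * Re z\<rfloor> then - (2 * pi * \<i>) * (if \<bar>Im z\<bar> < 1 / d then F z else 0) else 0)"
      if "i \<in> ?I - tiles d" for i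
      using tile_int_outside[OF F d _ z, of i] that fl[of i] by auto
    have "(\<Sum>i\<in>?I - tiles d. tile_int d F i z) =
       (\<Sum>i\<in>?I - tiles d. if i = \<lfloor>real d * Re z\<rfloor> then - (2 * pi * \<i>) * (if \<bar>Im z\<bar> < 1 / d then F z else 0) else 0)"
      by (intro sum.cong refl eq)
    then have "(\<Sum>i\<in>?I - tiles d. tile_int d F i z) =
       (if \<lfloor>real d * Re z\<rfloor> \<in> ?I - tiles d then - (2 * pi * \<i>) * (if \<bar>Im z\<bar> < 1 / d then F z else 0) else 0)"
      by (subst (asm) sum.delta) auto
    moreover have "\<lfloor>real d * Re z\<rfloor> \<in> ?I - tiles d" if "\<bar>Im z\<bar> < 1 / d"
    proof
      have "\<bar>real d * Re z\<bar> < real d * real L" using zL d by (simp add: abs_mult)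
      then have "of_int (- int (L * d)) \<le> real d * Re z" "real d * Re z < of_int (int (L * d))"
        by (auto simp: abs_less_iff mult.commute)
      then show "\<lfloor>real d * Re z\<rfloor> \<in> ?I" by (auto simp only: atLeastLessThan_iff le_floor_iff floor_less_iff)
      have "of_int \<lfloor>real d * Re z\<rfloor> / d \<le> Re z" "Re z \<le> (of_int \<lfloor>real d * Re z\<rfloor> + 1) / d"
        using d floor_correct[of "real d * Re z"] by (auto simp: field_simps)
      then have "z \<in> tile d \<lfloor>real d * Re z\<rfloor>" using that by (auto simp: tile_def)
      then show "\<lfloor>real d * Re z\<rfloor> \<notin> tiles d" using zt by blast
    qed
    ultimately show ?thesis by (simp split: if_splits)
  qed
  have ps: "(\<Sum>i\<in>?I. tile_int d F i z) = psum d F L z + (\<Sum>i\<in>?I - tiles d. tile_int d F i z)"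
    unfolding psum_def
    by (subst sum.Int_Diff[of ?I _ "tiles d"]) (auto simp: Int_commute)
  have rect: "seg kern F (Complex (- real L) y1) (Complex (real L) y1) z + seg kern F (Complex (real L) y1) (Complex (real L) y2) z
      - seg kern F (Complex (- real L) y2) (Complex (real L) y2) z - seg kern F (Complex (- real L) y1) (Complex (- real L) y2) z
      = - (2 * pi * \<i>) * (if y1 < Im z \<and> Im z < y2 then F z else 0)"
    if y: "y1 \<le> y2" "y1 \<in> \<rat>" "y2 \<in> \<rat>" "convex S" "open S" "\<And>w. y1 \<le> Im w \<Longrightarrow> Im w \<le> y2 \<Longrightarrow> w \<in> S" "\<And>w. w \<in> S \<Longrightarrow> Im w \<noteq> 0"
    for y1 y2 and S :: "complex set"
  proof -
    have FS: "F holomorphic_on S" using y cpart_Im by (intro holomorphic_on_subset[OF F]) blast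
    have "Im z \<noteq> y1" "Im z \<noteq> y2" using irr y by auto
    then have "z \<notin> cbox (Complex (- real L) y1) (Complex (real L) y2) - box (Complex (- real L) y1) (Complex (real L) y2)"
      using zL(1) unfolding Diff_iff in_cbox_complex_iff in_box_complex_iff by auto
    moreover have "z \<in> box (Complex (- real L) y1) (Complex (real L) y2) \<longleftrightarrow> y1 < Im z \<and> Im z < y2"
      using zL unfolding in_box_complex_iff by auto
    moreover have "cbox (Complex (- real L) y1) (Complex (real L) y2) \<subseteq> S" using y(6) by (auto simp: in_cbox_complex_iff)
    ultimately show ?thesis
      using seg_rectangle[OF g_entire g_0 kern_def y(4,5) FS, of "- real L" "real L" y1 y2 z] y(1) by simp
  qed
  have sgn: "Im w < 0" if "Im w \<le> - 1 / real d" for w using that dp by linarith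
  have sgn': "Im w > 0" if "Im w \<ge> 1 / real d" for w using that dp by linarith
  have pd: "- real p \<le> - 1 / real d" "1 / real d \<le> real p" using dp p by linarith+
  have low: "line F L (- real p) z + seg kern F (Complex (real L) (- real p)) (Complex (real L) (- 1 / d)) z
      - line F L (- 1 / d) z - seg kern F (Complex (- real L) (- real p)) (Complex (- real L) (- 1 / d)) z
      = - (2 * pi * \<i>) * (if - real p < Im z \<and> Im z < - 1 / d then F z else 0)"
    unfolding line_def
    by (rule rect[where S = "{w. Im w < 0}"]) (use pd sgn in \<open>simp_all add: convex_halfspace_Im_lt open_halfspace_Im_lt\<close>)
  have up: "line F L (1 / d) z + seg kern F (Complex (real L) (1 / d)) (Complex (real L) (real p)) z
      - line F L (real p) z - seg kern F (Complex (- real L) (1 / d)) (Complex (- real L) (real p)) z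
      = - (2 * pi * \<i>) * (if 1 / d < Im z \<and> Im z < real p then F z else 0)"
    unfolding line_def
    by (rule rect[where S = "{w. Im w > 0}"]) (use pd sgn' in \<open>simp_all add: convex_halfspace_Im_gt open_halfspace_Im_gt\<close>)
  have ne: "Im z \<noteq> 1 / d" "Im z \<noteq> - 1 / d" using irr(2) by auto
  have one: "(if \<bar>Im z\<bar> < 1 / d then F z else 0) + (if - real p < Im z \<and> Im z < - 1 / d then F z else 0)
      + (if 1 / d < Im z \<and> Im z < real p then F z else 0) = F z"
  proof -
    have c: "if_1 + if_2 + if_3 = F z"
      if "if_1 = (if \<bar>Im z\<bar> < 1 / d then F z else 0)"
        "if_2 = (if - real p < Im z \<and> Im z < - 1 / d then F z else 0)"
        "if_3 = (if 1 / d < Im z \<and> Im z < real p then F z else 0)" for if_1 if_2 if_3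
    proof -
      consider "\<bar>Im z\<bar> < 1 / d" "\<not> Im z < - 1 / d" "\<not> 1 / d < Im z"
        | "\<not> \<bar>Im z\<bar> < 1 / d" "Im z < - 1 / d" "- real p < Im z" "\<not> 1 / d < Im z"
        | "\<not> \<bar>Im z\<bar> < 1 / d" "\<not> Im z < - 1 / d" "1 / d < Im z" "Im z < real p"
        using ne dp zL(2) by linarith
      then show ?thesis unfolding that by cases (simp_all only: if_True if_False simp_thms add_0 add_0_right)
    qed
    show ?thesis by (rule c) (rule refl)+
  qed
  have alg: "P + - c * A + - c * B + - c * D = P - c * (A + B + D)" for P c A B D :: complex
    by (simp add: algebra_simps)
  have tot: "(psum d F L z + - (2 * pi * \<i>) * (if \<bar>Im z\<bar> < 1 / d then F z else 0))
     + - (2 * pi * \<i>) * (if - real p < Im z \<and> Im z < - 1 / d then F z else 0)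
     + - (2 * pi * \<i>) * (if 1 / d < Im z \<and> Im z < real p then F z else 0)
     = psum d F L z - 2 * pi * \<i> * F z"
    unfolding alg one ..
  have e1: "psum d F L z + - (2 * pi * \<i>) * (if \<bar>Im z\<bar> < 1 / d then F z else 0) =
      line F L (- 1 / d) z - line F L (1 / d) z + vert d F (int (L * d)) z - vert d F (- int (L * d)) z"
    using ps all out by simp
  show ?thesis
    unfolding tot[symmetric] e1 low[symmetric] up[symmetric] side_def Ld by simp
qed

end

lemma sum_integral_steps:
  fixes w :: "real \<Rightarrow> real"
  assumes w: "continuous_on UNIV w" and d: "d \<ge> (1::nat)" and ab: "a \<le> b"
  shows "(\<Sum>i\<in>{a..<b}. integral {of_int i / d..(of_int i + 1) / d} w) = integral {of_int a / d..of_int b / d} w"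
  using ab
proof (induction b rule: int_ge_induct)
  case (step b)
  then have eq: "{a..<b + 1} = insert b {a..<b}" by auto
  have m: "of_int a / real d \<le> of_int b / d" "of_int b / real d \<le> (of_int b + 1) / real d"
    using step d by (auto simp: divide_right_mono)
  have "integral {of_int a / d..of_int b / d} w + integral {of_int b / d..(of_int b + 1) / d} w
      = integral {of_int a / d..(of_int b + 1) / d} w"
    using m by (intro Henstock_Kurzweil_Integration.integral_combine integrable_continuous_real continuous_on_subset[OF w]) auto
  then show ?case unfolding eq using step by simp
qed simp

context weighted_kernel
begin

subsection \<open>Convergence of the sums over tiles\<close>

text \<open>On a side without an infinite end the finite part of K is bounded, and so are the tiles.
  On a side with one, all indices from some point on are tiles, so that far out no vertical edge is
  left.\<close>

lemma far_tiles:
  assumes d: "d \<ge> 1"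
  obtains L0 :: nat where "L0 \<ge> 1" "\<And>i. i \<in> tiles d \<Longrightarrow> int (L0 * d) \<le> i \<Longrightarrow> \<infinity> \<in> K \<and> i - 1 \<in> tiles d \<and> i + 1 \<in> tiles d"
    "\<And>i. i \<in> tiles d \<Longrightarrow> i < - int (L0 * d) \<Longrightarrow> -\<infinity> \<in> K \<and> i - 1 \<in> tiles d \<and> i + 1 \<in> tiles d"
proof -
  obtain X where X: "\<And>x. \<infinity> \<notin> K \<Longrightarrow> ereal x \<in> K \<Longrightarrow> x \<le> X" using PInf_bound[OF closed_K] by metis
  obtain Y where Y: "\<And>x. -\<infinity> \<notin> K \<Longrightarrow> ereal x \<in> K \<Longrightarrow> Y \<le> x" using MInf_bound[OF closed_K] by metis
  obtain L0 :: nat where L0: "real L0 > \<bar>X\<bar> + \<bar>Y\<bar> + real d + 3" using reals_Archimedean2 by blast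
  have dd: "0 < 1 / real d" "1 / real d \<le> 1" using d by auto
  show thesis
  proof (rule that[of L0])
    show "L0 \<ge> 1" using L0 by linarith
    fix i assume i: "i \<in> tiles d"
    { assume "int (L0 * d) \<le> i"
      then have "real L0 * real d \<le> of_int i" by (metis of_int_le_iff of_int_of_nat_eq of_nat_mult)
      then have Li: "real L0 \<le> of_int i / d" using d by (simp add: field_simps)
      have e: "(of_int i - 1) / real d = of_int i / d - 1 / d" "(of_int i + 1) / real d = of_int i / d + 1 / d"
        by (auto simp: diff_divide_distrib add_divide_distrib)
      have "\<infinity> \<in> K"
      proof (rule ccontr)
        assume n: "\<infinity> \<notin> K"
        have "\<not> (of_int i + 1) / d \<le> - real d" using Li dd L0 unfolding e by linarith
        then obtain x where "ereal x \<in> K" "(of_int i - 1) / d \<le> x" using i n unfolding tiles_def by blast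
        moreover from this have "x \<le> X" using X[OF n] by blast
        ultimately show False using Li dd L0 unfolding e by linarith
      qed
      moreover have "real d \<le> of_int (i - 1) / d" "real d \<le> of_int (i + 1) / d"
        unfolding of_int_diff of_int_add of_int_1 e using Li dd L0 by linarith+
      ultimately show "\<infinity> \<in> K \<and> i - 1 \<in> tiles d \<and> i + 1 \<in> tiles d" unfolding tiles_def by blast }
    { assume "i < - int (L0 * d)"
      then have "of_int i < - (real L0 * real d)" by (metis of_int_less_iff of_int_minus of_int_of_nat_eq of_nat_mult)
      then have Li: "of_int i / d < - real L0" using d by (simp add: field_simps)
      have e: "(of_int i + 2) / real d = of_int i / d + 2 * (1 / d)" "(of_int i + 1) / real d = of_int i / d + 1 / d"
        by (auto simp: add_divide_distrib)
      have "-\<infinity> \<in> K"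
      proof (rule ccontr)
        assume n: "-\<infinity> \<notin> K"
        have "\<not> real d \<le> of_int i / d" using Li L0 by linarith
        then obtain x where "ereal x \<in> K" "x \<le> (of_int i + 2) / d" using i n unfolding tiles_def by blast
        moreover from this have "Y \<le> x" using Y[OF n] by blast
        ultimately show False using Li dd L0 unfolding e by linarith
      qed
      moreover have "(of_int (i - 1) + 1) / d \<le> - real d" "(of_int (i + 1) + 1) / d \<le> - real d"
      proof -
        have e2: "real_of_int (i - 1) + 1 = of_int i" "real_of_int (i + 1) + 1 = of_int i + 2" by auto
        show "(of_int (i - 1) + 1) / d \<le> - real d" "(of_int (i + 1) + 1) / d \<le> - real d"
          unfolding e2 e using Li dd L0 by linarith+
      qed
      ultimately show "-\<infinity> \<in> K \<and> i - 1 \<in> tiles d \<and> i + 1 \<in> tiles d" unfolding tiles_def by blast }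
  qed
qed

text \<open>For d >= 1 the horizontal sides have length at most 1 and the vertical ones at most 2,
  which adds up to 6.\<close>

lemma tile_int_bound:
  assumes F: "continuous_on (edges d i) F" and d: "d \<ge> 1" and z: "z \<notin> edges d i"
    and M: "\<And>\<zeta>. \<zeta> \<in> edges d i \<Longrightarrow> cmod (F \<zeta> * kern (z - \<zeta>)) \<le> M"
  shows "cmod (tile_int d F i z) \<le> 6 * M"
proof -
  have "Complex (of_int i / d) (1 / d) \<in> edges d i" using horiz_edges[OF d, of "1 / d" i] by auto
  then have M0: "0 \<le> M" using M by (auto intro: order_trans[OF norm_ge_zero])
  have s: "cmod (seg kern F a b z) \<le> M * 2" if "closed_segment a b \<subseteq> edges d i" "cmod (b - a) \<le> 2" for a b
    using seg_bound[OF kern_holomorphic continuous_on_subset[OF F that(1)], of z M] that z M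
      mult_left_mono[OF that(2) M0] by fastforce
  have s1: "cmod (seg kern F a b z) \<le> M * 1" if "closed_segment a b \<subseteq> edges d i" "cmod (b - a) \<le> 1" for a b
    using seg_bound[OF kern_holomorphic continuous_on_subset[OF F that(1)], of z M] that z M
      mult_left_mono[OF that(2) M0] by fastforce
  have dd: "1 / real d \<le> 1" using d by simp
  have e1: "cmod (Complex ((of_int i + 1) / d) y - Complex (of_int i / d) y) \<le> 1" for y
  proof -
    have "Complex ((of_int i + 1) / d) y - Complex (of_int i / d) y = of_real (1 / d)"
      by (simp add: complex_eq_iff add_divide_distrib)
    then show ?thesis using d by (simp add: norm_divide)
  qed
  have e2: "cmod (Complex y (1 / d) - Complex y (- 1 / d)) \<le> 2" for y
  proof -
    have "Complex y (1 / d) - Complex y (- 1 / d) = of_real (2 / d) * \<i>"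
      by (simp add: complex_eq_iff)
    then show ?thesis using d by (simp add: norm_divide norm_mult divide_le_eq)
  qed
  have h: "cmod (horiz d F i y z) \<le> M * 1" if "y = 1 / d \<or> y = - 1 / d" for y
    unfolding horiz_def by (rule s1[OF horiz_edges[OF d that] e1])
  have v1: "cmod (vert d F i z) \<le> M * 2"
    using s[OF vert_edges(1)[OF d, of i] e2] M0 by (cases "i - 1 \<in> tiles d \<and> i \<in> tiles d") (auto simp: vert_def)
  have v2: "cmod (vert d F (i + 1) z) \<le> M * 2"
    using s[OF vert_edges_right[OF d, of i] e2] M0 by (cases "i \<in> tiles d \<and> i + 1 \<in> tiles d") (auto simp: vert_def)
  have "cmod (a + b - c - e) \<le> cmod a + cmod b + cmod c + cmod e" for a b c e :: complex
    by norm
  from this[of "horiz d F i (- 1 / d) z" "vert d F (i + 1) z" "horiz d F i (1 / d) z" "vert d F i z"]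
  show ?thesis unfolding tile_int_def using v1 v2 h[of "1 / d"] h[of "- 1 / d"] by simp
qed

lemma psum_diff:
  assumes "L \<le> L'"
  shows "psum d F L' z - psum d F L z =
    (\<Sum>i\<in>tiles d \<inter> ({- int (L' * d)..<- int (L * d)} \<union> {int (L * d)..<int (L' * d)}). tile_int d F i z)"
proof -
  have le: "int (L * d) \<le> int (L' * d)" using assms by (simp only: of_nat_le_iff mult_le_mono1)
  have "T \<inter> {- b..<b} = (T \<inter> {- a..<a}) \<union> (T \<inter> ({- b..<- a} \<union> {a..<b}))" if "0 \<le> a" "a \<le> b" for T and a b :: int
    using that by auto
  from this[OF _ le, of "tiles d"]
  have eq: "tiles d \<inter> {- int (L' * d)..<int (L' * d)} = (tiles d \<inter> {- int (L * d)..<int (L * d)}) \<union>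
     (tiles d \<inter> ({- int (L' * d)..<- int (L * d)} \<union> {int (L * d)..<int (L' * d)}))" by simp
  show ?thesis unfolding psum_def eq by (subst sum.union_disjoint) auto
qed

lemma \<nu>_Re:
  assumes "qL1 \<nu> K" "n \<ge> 1" shows "\<nu> n z = \<nu> n (complex_of_real (Re z))"
proof -
  have "\<forall>z. \<nu> n z = \<nu> n (complex_of_real \<bar>Re z\<bar>)" using assms unfolding qL1_def by blast
  then have "\<nu> n z = \<nu> n (complex_of_real \<bar>Re z\<bar>)" "\<nu> n (complex_of_real (Re z)) = \<nu> n (complex_of_real \<bar>Re z\<bar>)"
    by (blast, metis Re_complex_of_real)
  then show ?thesis by simp
qed

definition ratio :: "nat \<Rightarrow> nat \<Rightarrow> real \<Rightarrow> real" where
  "ratio m q t = \<nu> m (complex_of_real t) / \<nu> q (complex_of_real t)"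

lemma ratio_continuous: "m \<ge> 1 \<Longrightarrow> q \<ge> 1 \<Longrightarrow> continuous_on A (ratio m q)"
  unfolding ratio_def[abs_def]
  by (intro continuous_intros continuous_on_compose2[OF weights_continuous[OF weights, of _ UNIV]])
    (use \<nu>_pos[of q] in \<open>auto simp: less_le\<close>)

lemma ratio_pos: "m \<ge> 1 \<Longrightarrow> q \<ge> 1 \<Longrightarrow> ratio m q t > 0"
  unfolding ratio_def using \<nu>_pos by simp

lemma ratio_integrable: "m \<ge> 1 \<Longrightarrow> q \<ge> 1 \<Longrightarrow> ratio m q integrable_on {a..b}"
  by (intro integrable_continuous_real ratio_continuous)

lemma ratio_integral_bounded:
  assumes qL: "qL1 \<nu> K" and inf: "K \<inter> {\<infinity>, -\<infinity>} \<noteq> {}" and m: "m \<ge> 1"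
  obtains q A where "q > m" "\<And>L. integral {- real L..real L} (ratio m q) \<le> A"
proof -
  obtain q where q: "q > m" and si: "set_integrable lebesgue {0..} (ratio m q)"
    using qL inf m unfolding qL1_def ratio_def[abs_def] by blast
  have io: "ratio m q integrable_on {0..}" using si by (rule set_lebesgue_integral_eq_integral(1))
  have q1: "q \<ge> 1" using q m by simp
  show thesis
  proof (rule that[OF q])
    fix L :: nat
    have half: "integral {0..real L} (ratio m q) \<le> integral {0..} (ratio m q)"
      using ratio_pos[OF m q1] by (intro integral_subset_le ratio_integrable[OF m q1] io) (auto simp: less_imp_le)
    have even: "ratio m q (- t) = ratio m q t" for t
    proof -
      have "\<forall>z. \<nu> n z = \<nu> n (complex_of_real \<bar>Re z\<bar>)" if "n \<ge> 1" for n
        using qL that unfolding qL1_def by blast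
      then have "\<nu> n (complex_of_real (- t)) = \<nu> n (complex_of_real t)" if "n \<ge> 1" for n
        using that by (metis Re_complex_of_real abs_minus_cancel)
      then show ?thesis unfolding ratio_def using m q1 by simp
    qed
    have "integral {- real L..0} (ratio m q) = integral {0..real L} (ratio m q)"
      using Henstock_Kurzweil_Integration.integral_reflect_real[of "real L" 0 "ratio m q"] even by simp
    moreover have "integral {- real L..0} (ratio m q) + integral {0..real L} (ratio m q) = integral {- real L..real L} (ratio m q)"
      by (intro Henstock_Kurzweil_Integration.integral_combine ratio_integrable[OF m q1]) auto
    ultimately show "integral {- real L..real L} (ratio m q) \<le> 2 * integral {0..} (ratio m q)" using half by simp
  qed
qed

lemma F_bound_edges:
  assumes "\<And>\<zeta>. \<zeta> \<in> S_set (real q) K \<Longrightarrow> cmod (F \<zeta>) * \<nu> q \<zeta> \<le> c" "q \<ge> d + 2" "d \<ge> 1" "\<zeta> \<in> edges d i"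
  shows "cmod (F \<zeta>) \<le> c / \<nu> q \<zeta>"
  using assms(1)[of \<zeta>] edges_subset_S[OF assms(3,2), of i] assms(4) \<nu>_pos[of q \<zeta>] assms(2) by (auto simp: field_simps)

text \<open>The increments of the partial sums are dominated by those of one bounded increasing
  sequence s that depends neither on F nor on z. This yields convergence, bounds uniform in L, and
  later a cut-off L depending on r alone. The second clause covers the start: 12 * L0 * d is 6 for
  each of at most 2 * L0 * d tiles.\<close>

definition tail_est :: "nat \<Rightarrow> nat \<Rightarrow> real \<Rightarrow> nat \<Rightarrow> nat \<Rightarrow> (nat \<Rightarrow> real) \<Rightarrow> real \<Rightarrow> bool" where
  "tail_est d n B q L0 s A \<longleftrightarrow> incseq s \<and> (\<forall>L. s L \<le> A) \<and> L0 \<ge> (1::nat) \<and> (\<forall>F q' c z. F \<in> OV \<nu> K \<longrightarrow> q' \<ge> q \<longrightarrow> q' \<ge> d + 2 \<longrightarrow>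
       0 \<le> c \<longrightarrow> (\<forall>\<zeta>\<in>S_set (real q') K. cmod (F \<zeta>) * \<nu> q' \<zeta> \<le> c) \<longrightarrow> z \<in> S_set (real n) K \<longrightarrow>
       (\<forall>L L'. L0 \<le> L \<longrightarrow> L \<le> L' \<longrightarrow> cmod (psum d F L' z - psum d F L z) * \<nu> n z \<le> c * B * (s L' - s L)) \<and>
       (\<forall>L\<le>L0. cmod (psum d F L z) * \<nu> n z \<le> c * B * real (12 * L0 * d)))"

text \<open>On the edges |F| <= c / \<nu> q and |kern| \<nu> n z <= B \<nu> m, so the integral of
  \<nu> m / \<nu> q over the real line controls the sum; it is finite by \<open>qL1\<close>. The
  index q is found before d, while the extra demand q' >= d + 2 in \<open>tail_est\<close> ensures
  that F can be estimated on the edges.\<close>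

lemma psum_tail:
  assumes qL: "qL1 \<nu> K" and n: "n \<ge> 2"
  obtains m B q where "m > n" "B > 0" "S_set (real n) K \<inter> U_nbhd (real m) K = {}" "q > m"
    "\<And>d. d \<ge> 4 * m \<Longrightarrow> \<exists>L0 s A. tail_est d n B q L0 s A"
proof -
  obtain m B where m: "m > n" "B > 0" "S_set (real n) K \<inter> U_nbhd (real m) K = {}" and kb:
    "\<And>z \<zeta>. z \<in> S_set (real n) K \<Longrightarrow> \<zeta> \<in> U_nbhd (real m) K \<Longrightarrow> cmod (kern (z - \<zeta>)) * \<nu> n z \<le> B * \<nu> m \<zeta>"
    using kern_bound[OF n] by blast
  have m1: "m \<ge> 1" using m by simp
  obtain q A where q: "q > m" and A: "K \<inter> {\<infinity>, -\<infinity>} \<noteq> {} \<Longrightarrow> integral {- real L..real L} (ratio m q) \<le> A" for L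
    using ratio_integral_bounded[OF qL _ m1] by (metis lessI)
  have q1: "q \<ge> 1" using q by simp
  \<comment> \<open>Without an infinite end there are no far tiles and the increments vanish;
    otherwise the factor 2 counts the two horizontal sides.\<close>
  define s where "s L = (if K \<inter> {\<infinity>, -\<infinity>} = {} then 0 else 2 * integral {- real L..real L} (ratio m q))" for L
  show thesis
  proof (rule that[OF m q])
    fix d assume d4: "d \<ge> 4 * m"
    then have d: "d \<ge> 1" using m by simp
    obtain L0 where L0: "L0 \<ge> 1" "\<And>i. i \<in> tiles d \<Longrightarrow> int (L0 * d) \<le> i \<Longrightarrow> \<infinity> \<in> K \<and> i - 1 \<in> tiles d \<and> i + 1 \<in> tiles d"
      "\<And>i. i \<in> tiles d \<Longrightarrow> i < - int (L0 * d) \<Longrightarrow> -\<infinity> \<in> K \<and> i - 1 \<in> tiles d \<and> i + 1 \<in> tiles d"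
      using far_tiles[OF d] by metis
    have inc: "incseq s"
      unfolding incseq_def s_def using ratio_pos[OF m1 q1] ratio_integrable[OF m1 q1]
      by (auto intro!: integral_subset_le simp: less_imp_le)
    have bd: "s L \<le> 2 * \<bar>A\<bar>" for L unfolding s_def using A[of L] by auto
    have main: "(\<forall>L L'. L0 \<le> L \<longrightarrow> L \<le> L' \<longrightarrow> cmod (psum d F L' z - psum d F L z) * \<nu> n z \<le> c * B * (s L' - s L)) \<and>
       (\<forall>L\<le>L0. cmod (psum d F L z) * \<nu> n z \<le> c * B * real (12 * L0 * d))"
      if F: "F \<in> OV \<nu> K" and q': "q' \<ge> q" "q' \<ge> d + 2" and c: "0 \<le> c" "\<forall>\<zeta>\<in>S_set (real q') K. cmod (F \<zeta>) * \<nu> q' \<zeta> \<le> c"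
      and z: "z \<in> S_set (real n) K" for F q' c z
    proof (intro conjI allI impI)
      have \<nu>z: "0 < \<nu> n z" using \<nu>_pos n by simp
      have cF: "continuous_on (edges d i) F" for i using OV_continuous_edges[OF F d] .
      have eU: "edges d i \<subseteq> U_nbhd (real m) K" if "i \<in> tiles d" for i
        using tile_subset_U[OF _ d4 that] m n unfolding edges_def by auto
      have ze: "z \<notin> edges d i" if "i \<in> tiles d" for i using eU[OF that] z m by blast
      have Fk: "cmod (F \<zeta> * kern (z - \<zeta>)) \<le> c * B / \<nu> n z * (\<nu> m \<zeta> / \<nu> q \<zeta>)" if "i \<in> tiles d" "\<zeta> \<in> edges d i" for i \<zeta>
      proof -
        have "cmod (F \<zeta>) \<le> c / \<nu> q' \<zeta>" using F_bound_edges[OF _ q'(2) d that(2)] c(2) by blast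
        also have "\<dots> \<le> c / \<nu> q \<zeta>" using c \<nu>_mono[OF q1 q'(1)] \<nu>_pos[OF q1] \<nu>_pos[of q'] q1 q' by (intro divide_left_mono) auto
        finally have 1: "cmod (F \<zeta>) \<le> c / \<nu> q \<zeta>" .
        have "cmod (kern (z - \<zeta>)) \<le> B * \<nu> m \<zeta> / \<nu> n z"
          using kb[OF z, of \<zeta>] eU[OF that(1)] that(2) \<nu>z by (auto simp: field_simps)
        then have "cmod (F \<zeta>) * cmod (kern (z - \<zeta>)) \<le> (c / \<nu> q \<zeta>) * (B * \<nu> m \<zeta> / \<nu> n z)"
          using 1 c \<nu>_pos[OF q1, of \<zeta>] by (intro mult_mono) auto
        then show ?thesis by (simp add: norm_mult mult_ac)
      qed
      show "cmod (psum d F L z) * \<nu> n z \<le> c * B * real (12 * L0 * d)" if "L \<le> L0" for L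
      proof -
        have one: "cmod (tile_int d F i z) \<le> 6 * (c * B / \<nu> n z)" if i: "i \<in> tiles d" for i
        proof (rule tile_int_bound[OF cF d ze[OF i]])
          fix \<zeta> assume \<zeta>: "\<zeta> \<in> edges d i"
          have "\<nu> m \<zeta> / \<nu> q \<zeta> \<le> 1" using \<nu>_mono[OF m1, of q \<zeta>] q \<nu>_pos[OF q1, of \<zeta>] by simp
          then show "cmod (F \<zeta> * kern (z - \<zeta>)) \<le> c * B / \<nu> n z"
            using Fk[OF i \<zeta>] c m(2) \<nu>z mult_left_mono[of "\<nu> m \<zeta> / \<nu> q \<zeta>" 1 "c * B / \<nu> n z"] by fastforce
        qed
        have nn: "0 \<le> 6 * (c * B / \<nu> n z)" using c m \<nu>z by simp
        have "card (tiles d \<inter> {- int (L * d)..<int (L * d)}) \<le> card {- int (L * d)..<int (L * d)}"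
          by (intro card_mono) auto
        also have "\<dots> = 2 * (L * d)" by (simp del: of_nat_mult)
        also have "\<dots> \<le> 2 * L0 * d" using that mult_le_mono1[OF that, of d] by simp
        finally have cd: "real (card (tiles d \<inter> {- int (L * d)..<int (L * d)})) \<le> real (2 * L0 * d)" by (simp only: of_nat_le_iff)
        have "cmod (psum d F L z) \<le> of_nat (card (tiles d \<inter> {- int (L * d)..<int (L * d)})) * (6 * (c * B / \<nu> n z))"
          unfolding psum_def by (rule sum_norm_bound) (use one in auto)
        also have "\<dots> \<le> real (2 * L0 * d) * (6 * (c * B / \<nu> n z))"
          by (rule mult_right_mono[OF cd nn])
        also have "\<dots> = c * B * real (12 * L0 * d) / \<nu> n z" by simp
        finally show ?thesis using \<nu>z by (simp add: field_simps)
      qed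
      show "cmod (psum d F L' z - psum d F L z) * \<nu> n z \<le> c * B * (s L' - s L)" if L: "L0 \<le> L" "L \<le> L'" for L L'
      proof -
        let ?J = "{- int (L' * d)..<- int (L * d)} \<union> {int (L * d)..<int (L' * d)}"
        have LL: "int (L0 * d) \<le> int (L * d)" "int (L * d) \<le> int (L' * d)" using L by (simp_all only: of_nat_le_iff mult_le_mono1)
        have far: "K \<inter> {\<infinity>, -\<infinity>} \<noteq> {} \<and> i - 1 \<in> tiles d \<and> i + 1 \<in> tiles d" if "i \<in> tiles d \<inter> ?J" for i
          using L0(2)[of i] L0(3)[of i] that LL by auto
        show ?thesis
        proof (cases "K \<inter> {\<infinity>, -\<infinity>} = {}")
          case True
          then have "tiles d \<inter> ?J = {}" using far by blast
          then show ?thesis unfolding psum_diff[OF L(2)] using True by (simp add: s_def)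
        next
          case False
          define u where "u t = c * B / \<nu> n z * ratio m q t" for t
          define I where "I i = integral {of_int i / d..(of_int i + 1) / d} (ratio m q)" for i
          have cB: "0 \<le> c * B / \<nu> n z" using c m \<nu>z by simp
          have I0: "0 \<le> I i" for i unfolding I_def using ratio_pos[OF m1 q1] by (intro integral_nonneg ratio_integrable[OF m1 q1]) (auto simp: less_imp_le)
          have one: "cmod (tile_int d F i z) \<le> 2 * (c * B / \<nu> n z * I i)" if i: "i \<in> tiles d \<inter> ?J" for i
          proof -
            have "cmod (tile_int d F i z) \<le> 2 * integral {of_int i / d..(of_int i + 1) / d} u"
            proof (rule tile_int_bound_far[OF cF d ze])
              show "u integrable_on {real_of_int i / real d..(real_of_int i + 1) / real d}"
                unfolding u_def[abs_def] by (intro integrable_on_mult_right ratio_integrable[OF m1 q1])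
              fix t y assume t: "real_of_int i / real d \<le> t" "t \<le> (real_of_int i + 1) / real d" "\<bar>y\<bar> = 1 / real d"
              then have "Complex t y \<in> edges d i" by (auto simp: edges_def tile_def)
              then have "cmod (F (Complex t y) * kern (z - Complex t y)) \<le> c * B / \<nu> n z * (\<nu> m (Complex t y) / \<nu> q (Complex t y))"
                using Fk i by blast
              then show "cmod (F (Complex t y) * kern (z - Complex t y)) \<le> u t"
                using \<nu>_Re[OF qL m1, of "Complex t y"] \<nu>_Re[OF qL q1, of "Complex t y"] by (simp add: u_def ratio_def)
            qed (use i far[OF i] in auto)
            also have "integral {of_int i / d..(of_int i + 1) / d} u = c * B / \<nu> n z * I i"
              unfolding u_def[abs_def] I_def by (rule Henstock_Kurzweil_Integration.integral_mult_right)
            finally show ?thesis .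
          qed
          have "cmod (psum d F L' z - psum d F L z) \<le> (\<Sum>i\<in>tiles d \<inter> ?J. 2 * (c * B / \<nu> n z * I i))"
            unfolding psum_diff[OF L(2)] by (rule sum_norm_le) (use one in auto)
          also have "\<dots> \<le> (\<Sum>i\<in>?J. 2 * (c * B / \<nu> n z * I i))"
            by (intro sum_mono2 mult_nonneg_nonneg cB I0) auto
          also have "\<dots> = 2 * (c * B / \<nu> n z) * ((\<Sum>i\<in>{- int (L' * d)..<- int (L * d)}. I i) + (\<Sum>i\<in>{int (L * d)..<int (L' * d)}. I i))"
            unfolding sum_distrib_left[symmetric] mult.assoc
          proof (subst sum.union_disjoint)
            have "- int (L * d) \<le> int (L * d)" by linarith
            then show "{- int (L' * d)..<- int (L * d)} \<inter> {int (L * d)..<int (L' * d)} = {}"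
              by (auto simp del: of_nat_mult)
          qed auto
          also have "(\<Sum>i\<in>{- int (L' * d)..<- int (L * d)}. I i) = integral {- real L'..- real L} (ratio m q)"
            unfolding I_def using sum_integral_steps[OF ratio_continuous[OF m1 q1] d, of "- int (L' * d)" "- int (L * d)"] LL d by simp
          also have "(\<Sum>i\<in>{int (L * d)..<int (L' * d)}. I i) = integral {real L..real L'} (ratio m q)"
            unfolding I_def using sum_integral_steps[OF ratio_continuous[OF m1 q1] d, of "int (L * d)" "int (L' * d)"] LL d by simp
          also have "2 * (c * B / \<nu> n z) * (integral {- real L'..- real L} (ratio m q) + integral {real L..real L'} (ratio m q))
             = c * B / \<nu> n z * (s L' - s L)"
          proof -
            have "integral {- real L'..- real L} (ratio m q) + integral {- real L..real L} (ratio m q) = integral {- real L'..real L} (ratio m q)"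
              using L by (intro Henstock_Kurzweil_Integration.integral_combine ratio_integrable[OF m1 q1]) auto
            moreover have "integral {- real L'..real L} (ratio m q) + integral {real L..real L'} (ratio m q) = integral {- real L'..real L'} (ratio m q)"
              using L by (intro Henstock_Kurzweil_Integration.integral_combine ratio_integrable[OF m1 q1]) auto
            moreover have alg: "2 * T' - 2 * T = 2 * (a + b)" if "a + T = X" "X + b = T'" for a b T T' X :: real
              using that by simp
            ultimately have "s L' - s L = 2 * (integral {- real L'..- real L} (ratio m q) + integral {real L..real L'} (ratio m q))"
              using alg unfolding s_def if_not_P[OF False] by blast
            then show ?thesis by simp
          qed
          finally show ?thesis using \<nu>z by (simp add: field_simps)
        qed
      qed
    qed
    show "\<exists>L0 s A. tail_est d n B q L0 s A"
      unfolding tail_est_def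
      by (intro exI[of _ L0] exI[of _ s] exI[of _ "2 * \<bar>A\<bar>"] conjI allI impI inc bd L0(1)) (use main in blast)+
  qed
qed

end

lemma limit_by_increments:
  fixes f :: "nat \<Rightarrow> complex" and s :: "nat \<Rightarrow> real"
  assumes s: "incseq s" "\<And>L. s L \<le> A" and C: "0 \<le> C"
    and f: "\<And>L L'. L0 \<le> L \<Longrightarrow> L \<le> L' \<Longrightarrow> cmod (f L' - f L) \<le> C * (s L' - s L)"
  obtains l where "f \<longlonglongrightarrow> l" "\<And>L. L0 \<le> L \<Longrightarrow> cmod (l - f L) \<le> C * (lim s - s L)"
proof -
  obtain l0 where "s \<longlonglongrightarrow> l0" using incseq_convergent[OF s(1), of A] s(2) by blast
  then have sl: "s \<longlonglongrightarrow> lim s" using limI by blast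
  have "Cauchy f"
    unfolding Cauchy_altdef dist_norm
  proof (intro allI impI)
    fix e :: real assume e: "e > 0"
    have "Cauchy s" using sl LIMSEQ_imp_Cauchy by blast
    moreover have "0 < e / (C + 1)" using e C by simp
    ultimately obtain M where M: "\<And>m n. m \<ge> M \<Longrightarrow> n \<ge> M \<Longrightarrow> norm (s m - s n) < e / (C + 1)"
      using CauchyD[of s "e / (C + 1)"] by metis
    show "\<exists>M. \<forall>m\<ge>M. \<forall>n>m. norm (f m - f n) < e"
    proof (intro exI[of _ "max M L0"] allI impI)
      fix m n assume mn: "max M L0 \<le> m" "m < n"
      have "norm (f m - f n) \<le> C * (s n - s m)" using f[of m n] mn by (simp add: norm_minus_commute)
      also have "\<dots> \<le> C * (e / (C + 1))" using M[of n m] mn C by (intro mult_left_mono) auto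
      also have "\<dots> < e" using C e by (simp add: field_simps)
      finally show "norm (f m - f n) < e" .
    qed
  qed
  then obtain l where l: "f \<longlonglongrightarrow> l" using Cauchy_convergent convergent_def by blast
  show thesis
  proof (rule that[OF l])
    fix L assume L: "L0 \<le> L"
    have "(\<lambda>L'. cmod (f L' - f L)) \<longlonglongrightarrow> cmod (l - f L)" "(\<lambda>L'. C * (s L' - s L)) \<longlonglongrightarrow> C * (lim s - s L)"
      by (intro tendsto_intros l sl)+
    then show "cmod (l - f L) \<le> C * (lim s - s L)"
      by (rule LIMSEQ_le) (use f[OF L] in blast)
  qed
qed

context weighted_kernel
begin

lemma psum_holomorphic:
  assumes F: "F \<in> OV \<nu> K" and d: "d \<ge> 4 * m" "m \<ge> 2" and S: "S \<inter> U_nbhd (real m) K = {}"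
  shows "psum d F L holomorphic_on S"
proof -
  have d1: "d \<ge> 1" using d by simp
  have "tile_int d F i holomorphic_on S" if "i \<in> tiles d" for i
    using tile_subset_U[OF d(2,1) that] S
    by (intro holomorphic_on_subset[OF tile_int_holomorphic[OF OV_continuous_edges[OF F d1] d1]]) (auto simp: edges_def)
  then show ?thesis unfolding psum_def[abs_def] by (intro holomorphic_intros) auto
qed

lemma psum_converges:
  assumes qL: "qL1 \<nu> K" and n: "n \<ge> 2"
  obtains m where "m > n" "S_set (real n) K \<inter> U_nbhd (real m) K = {}"
    "\<And>d. d \<ge> 4 * m \<Longrightarrow> \<exists>q\<ge>n. \<exists>B>0. \<forall>F\<in>OV \<nu> K. \<forall>c\<ge>0. (\<forall>\<zeta>\<in>S_set (real q) K. cmod (F \<zeta>) * \<nu> q \<zeta> \<le> c) \<longrightarrow>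
       (\<forall>z\<in>S_set (real n) K. (\<forall>L. cmod (psum d F L z) * \<nu> n z \<le> B * c) \<and> convergent (\<lambda>L. psum d F L z))"
proof -
  obtain m B q where m: "m > n" "B > 0" "S_set (real n) K \<inter> U_nbhd (real m) K = {}" "q > m" and tail:
    "\<And>d. d \<ge> 4 * m \<Longrightarrow> \<exists>L0 s A. tail_est d n B q L0 s A"
    using psum_tail[OF qL n] by blast
  show thesis
  proof (rule that[OF m(1,3)])
    fix d assume d: "d \<ge> 4 * m"
    obtain L0 s A where s: "incseq s" "\<And>L. s L \<le> A" "L0 \<ge> (1::nat)" and t: "\<And>F q' c z. F \<in> OV \<nu> K \<Longrightarrow> q' \<ge> q \<Longrightarrow> q' \<ge> d + 2 \<Longrightarrow>
       0 \<le> c \<Longrightarrow> (\<forall>\<zeta>\<in>S_set (real q') K. cmod (F \<zeta>) * \<nu> q' \<zeta> \<le> c) \<Longrightarrow> z \<in> S_set (real n) K \<Longrightarrow>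
       (\<forall>L L'. L0 \<le> L \<longrightarrow> L \<le> L' \<longrightarrow> cmod (psum d F L' z - psum d F L z) * \<nu> n z \<le> c * B * (s L' - s L)) \<and>
       (\<forall>L\<le>L0. cmod (psum d F L z) * \<nu> n z \<le> c * B * real (12 * L0 * d))"
      using tail[OF d] unfolding tail_est_def by metis
    define q' where "q' = max q (d + 2)"
    define B' where "B' = B * real (12 * L0 * d) + B * (A - s L0) + 1"
    have q': "q' \<ge> q" "q' \<ge> d + 2" by (auto simp: q'_def)
    have B': "B' > 0" unfolding B'_def using m(2) s(2)[of L0] by (intro add_nonneg_pos add_nonneg_nonneg) auto
    have "(\<forall>L. cmod (psum d F L z) * \<nu> n z \<le> B' * c) \<and> convergent (\<lambda>L. psum d F L z)"
      if F: "F \<in> OV \<nu> K" and c: "c \<ge> 0" "\<forall>\<zeta>\<in>S_set (real q') K. cmod (F \<zeta>) * \<nu> q' \<zeta> \<le> c" and z: "z \<in> S_set (real n) K" for F c z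
    proof
      have \<nu>z: "0 < \<nu> n z" using n \<nu>_pos by simp
      have tt: "cmod (psum d F L' z - psum d F L z) * \<nu> n z \<le> c * B * (s L' - s L)" if "L0 \<le> L" "L \<le> L'" for L L'
        using t[OF F q' c z] that by blast
      have t0: "cmod (psum d F L z) * \<nu> n z \<le> c * B * real (12 * L0 * d)" if "L \<le> L0" for L
        using t[OF F q' c z] that by blast
      have A0: "0 \<le> c * B * (A - s L0)" using c m(2) s(2)[of L0] by simp
      have B'c: "c * B * real (12 * L0 * d) + c * B * (A - s L0) \<le> B' * c"
        unfolding B'_def using c by (simp add: algebra_simps)
      show "\<forall>L. cmod (psum d F L z) * \<nu> n z \<le> B' * c"
      proof
        fix L
        show "cmod (psum d F L z) * \<nu> n z \<le> B' * c"
        proof (cases "L \<le> L0")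
          case True
          then show ?thesis using t0[OF True] A0 B'c by linarith
        next
          case False
          have "cmod (psum d F L z) * \<nu> n z \<le> (cmod (psum d F L z - psum d F L0 z) + cmod (psum d F L0 z)) * \<nu> n z"
            using \<nu>z norm_triangle_sub[of "psum d F L z" "psum d F L0 z"] by (intro mult_right_mono) auto
          also have "\<dots> \<le> c * B * (s L - s L0) + c * B * real (12 * L0 * d)"
            using tt[of L0 L] t0[of L0] False by (simp add: distrib_right)
          also have "c * B * (s L - s L0) \<le> c * B * (A - s L0)" using c m(2) s(2)[of L] by (intro mult_left_mono) auto
          finally show ?thesis using B'c by linarith
        qed
      qed
      obtain l where "(\<lambda>L. psum d F L z) \<longlonglongrightarrow> l"
      proof (rule limit_by_increments[OF s(1,2), of "c * B / \<nu> n z" L0 "\<lambda>L. psum d F L z"])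
        show "cmod (psum d F L' z - psum d F L z) \<le> c * B / \<nu> n z * (s L' - s L)" if "L0 \<le> L" "L \<le> L'" for L L'
          using tt[OF that] \<nu>z by (simp add: field_simps)
      qed (use c m(2) \<nu>z in auto)
      then show "convergent (\<lambda>L. psum d F L z)" by (rule convergentI)
    qed
    then show "\<exists>q\<ge>n. \<exists>B>0. \<forall>F\<in>OV \<nu> K. \<forall>c\<ge>0. (\<forall>\<zeta>\<in>S_set (real q) K. cmod (F \<zeta>) * \<nu> q \<zeta> \<le> c) \<longrightarrow>
       (\<forall>z\<in>S_set (real n) K. (\<forall>L. cmod (psum d F L z) * \<nu> n z \<le> B * c) \<and> convergent (\<lambda>L. psum d F L z))"
      using B' q' m by (intro exI[of _ q'] conjI exI[of _ B']) auto
  qed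
qed

subsection \<open>Splitting off an entire function\<close>

text \<open>The function \<open>R p L F\<close> is the part of the contour integral over the outer boundary of the
  box of half width \<open>L\<close> and half height \<open>p\<close> which persists in the limit.\<close>

definition inner_est :: "(nat \<Rightarrow> nat \<Rightarrow> (complex \<Rightarrow> complex) \<Rightarrow> complex \<Rightarrow> complex) \<Rightarrow>
    nat \<Rightarrow> nat \<Rightarrow> complex set \<Rightarrow> nat \<Rightarrow> real \<Rightarrow> nat \<Rightarrow> bool" where
  "inner_est R n p N q C L1 \<longleftrightarrow>
     p \<ge> 2 \<and> open N \<and> U_nbhd (real n) K \<subseteq> N \<and> closure (U_nbhd (real n) K) \<inter> irr_pts \<subseteq> N \<and> N \<subseteq> {z. \<bar>Im z\<bar> < real p} \<and> q \<ge> 1 \<and> C > 0 \<and>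
     (\<forall>F\<in>OV \<nu> K. \<forall>c\<ge>0. (\<forall>\<zeta>\<in>S_set (real q) K. cmod (F \<zeta>) * \<nu> q \<zeta> \<le> c) \<longrightarrow>
        (\<forall>L\<ge>L1. R p L F holomorphic_on N \<and> (\<forall>z\<in>N. cmod (R p L F z) * \<nu> n z \<le> C * c)))"

text \<open>Interface between two cases: with an infinite end only the horizontal lines of the box
  persist, otherwise its whole boundary does. In \<open>inner_est\<close> the closure of
  \<open>U_nbhd n K\<close> is covered at points of \<open>irr_pts\<close> only, because N may be
  the open strip |Im z| < 1/n, whose rational boundary lines this closure can touch.\<close>

definition inner_data :: "(nat \<Rightarrow> nat \<Rightarrow> (complex \<Rightarrow> complex) \<Rightarrow> complex \<Rightarrow> complex) \<Rightarrow> bool" where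
  "inner_data R \<longleftrightarrow>
    (\<forall>F\<in>OV \<nu> K. \<forall>p\<ge>2. \<forall>d\<ge>1. \<forall>z\<in>irr_pts. \<bar>Im z\<bar> < real p \<longrightarrow> (\<forall>i\<in>tiles d. z \<notin> tile d i) \<longrightarrow>
       (\<lambda>L. psum d F L z - 2 * pi * \<i> * F z - R p L F z) \<longlonglongrightarrow> 0) \<and>
    (\<forall>n\<ge>2. \<exists>p N q C L1. inner_est R n p N q C L1)"

text \<open>E is F minus the limit of \<open>psum\<close> divided by 2 pi i. Away from K it is
  estimated through \<open>psum\<close>; near K, where - 2 pi i E is the limit of R, through the
  bound of R, since R has no singularity on K. The two regions \<open>S_set n K\<close> and N
  together contain every point of \<open>irr_pts\<close> in the strip |Im z| < n.\<close>

lemma entire_part: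
  assumes qL: "qL1 \<nu> K" and R: "inner_data R"
  obtains q C where "\<And>n. n \<ge> 2 \<Longrightarrow> q n \<ge> n \<and> C n > (0::real)"
    "\<And>F. F \<in> OV \<nu> K \<Longrightarrow> \<exists>E\<in>OV \<nu> {}.
      (\<forall>n\<ge>2. \<forall>c\<ge>0. (\<forall>\<zeta>\<in>S_set (real (q n)) K. cmod (F \<zeta>) * \<nu> (q n) \<zeta> \<le> c) \<longrightarrow>
         (\<forall>z\<in>S_set (real n) {}. cmod (E z) * \<nu> n z \<le> C n * c)) \<and>
      (\<forall>d\<ge>1. \<forall>z\<in>irr_pts. (\<forall>i\<in>tiles d. z \<notin> tile d i) \<longrightarrow>
         (\<lambda>L. psum d F L z) \<longlonglongrightarrow> 2 * pi * \<i> * (F z - E z))"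
proof -
  have "\<forall>n. \<exists>m q B. n \<ge> 2 \<longrightarrow> m > n \<and> S_set (real n) K \<inter> U_nbhd (real m) K = {} \<and> q \<ge> n \<and> B > 0 \<and>
     (\<forall>F\<in>OV \<nu> K. \<forall>c\<ge>0. (\<forall>\<zeta>\<in>S_set (real q) K. cmod (F \<zeta>) * \<nu> q \<zeta> \<le> c) \<longrightarrow>
       (\<forall>z\<in>S_set (real n) K. (\<forall>L. cmod (psum (4 * m) F L z) * \<nu> n z \<le> B * c) \<and> convergent (\<lambda>L. psum (4 * m) F L z)))"
    using psum_converges[OF qL] by (metis order_refl)
  then obtain M q1 B1 where P: "\<And>n. n \<ge> 2 \<Longrightarrow> M n > n \<and> S_set (real n) K \<inter> U_nbhd (real (M n)) K = {} \<and> q1 n \<ge> n \<and> B1 n > 0 \<and>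
     (\<forall>F\<in>OV \<nu> K. \<forall>c\<ge>0. (\<forall>\<zeta>\<in>S_set (real (q1 n)) K. cmod (F \<zeta>) * \<nu> (q1 n) \<zeta> \<le> c) \<longrightarrow>
       (\<forall>z\<in>S_set (real n) K. (\<forall>L. cmod (psum (4 * M n) F L z) * \<nu> n z \<le> B1 n * c) \<and> convergent (\<lambda>L. psum (4 * M n) F L z)))"
    by metis
  obtain p N q2 C2 L1 where "\<And>n. n \<ge> 2 \<Longrightarrow> inner_est R n (p n) (N n) (q2 n) (C2 n) (L1 n)"
    using R unfolding inner_data_def by metis
  note Q = this[unfolded inner_est_def]
  define q where "q n = max (q1 n) (q2 n)" for n
  define C where "C n = 1 + B1 n + C2 n" for n
  have weaken: "\<forall>\<zeta>\<in>S_set (real a) K. cmod (F \<zeta>) * \<nu> a \<zeta> \<le> c"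
    if "\<forall>\<zeta>\<in>S_set (real b) K. cmod (F \<zeta>) * \<nu> b \<zeta> \<le> c" "1 \<le> a" "a \<le> b" for a b c F
  proof
    fix \<zeta> assume "\<zeta> \<in> S_set (real a) K"
    then have "cmod (F \<zeta>) * \<nu> b \<zeta> \<le> c" using that S_set_mono[of a b K] by auto
    moreover have "cmod (F \<zeta>) * \<nu> a \<zeta> \<le> cmod (F \<zeta>) * \<nu> b \<zeta>" using \<nu>_mono[of a b \<zeta>] that by (intro mult_left_mono) auto
    ultimately show "cmod (F \<zeta>) * \<nu> a \<zeta> \<le> c" by simp
  qed
  have pi1: "1 \<le> 2 * pi" using pi_gt3 by simp
  show thesis
  proof (rule that[of q C])
    show "q n \<ge> n \<and> C n > 0" if "n \<ge> 2" for n
      using P[OF that] Q[OF that] unfolding q_def C_def by (auto simp: add_pos_pos le_max_iff_disj)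
    fix F assume F: "F \<in> OV \<nu> K"
    \<comment> \<open>The limit does not depend on d: for two admissible values, \<open>psum\<close>
      differs from the same expression 2 pi i F(z) + R p' L F z by null sequences.\<close>
    have "\<exists>w. \<forall>d\<ge>1. (\<forall>i\<in>tiles d. z \<notin> tile d i) \<longrightarrow> (\<lambda>L. psum d F L z) \<longlonglongrightarrow> w" if z: "z \<in> irr_pts" for z
    proof -
      have "z \<notin> cpart K" using z cpart_Im by (force simp: irr_pts_def)
      then obtain n where n: "n \<ge> 2" "z \<in> S_set (real n) K" using S_set_exhaust[OF closed_K] by blast
      note Pn = P[OF n(1)]
      obtain c where c: "c > 0" "\<And>\<zeta>. \<zeta> \<in> S_set (real (q1 n)) K \<Longrightarrow> cmod (F \<zeta>) * \<nu> (q1 n) \<zeta> \<le> c"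
        using OV_bound[OF F, of "q1 n"] Pn n by (metis le_trans one_le_numeral)
      have "convergent (\<lambda>L. psum (4 * M n) F L z)"
        using Pn F c n(2) by (meson less_imp_le)
      then obtain w where w: "(\<lambda>L. psum (4 * M n) F L z) \<longlonglongrightarrow> w" by (auto simp: convergent_def)
      have zt: "\<forall>i\<in>tiles (4 * M n). z \<notin> tile (4 * M n) i"
        using tile_subset_U[of "M n" "4 * M n"] Pn n by fastforce
      obtain p' :: nat where p': "real p' > \<bar>Im z\<bar> + 2" using reals_Archimedean2 by blast
      have R0: "(\<lambda>L. psum d F L z - 2 * pi * \<i> * F z - R p' L F z) \<longlonglongrightarrow> 0"
        if "d \<ge> 1" "\<forall>i\<in>tiles d. z \<notin> tile d i" for d
      proof -
        have "p' \<ge> 2" "\<bar>Im z\<bar> < real p'" using p' abs_ge_zero[of "Im z"] by linarith+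
        then show ?thesis using R F z that unfolding inner_data_def by blast
      qed
      have "(\<lambda>L. psum d F L z) \<longlonglongrightarrow> w" if d: "d \<ge> 1" "\<forall>i\<in>tiles d. z \<notin> tile d i" for d
      proof -
        have "(\<lambda>L. (psum d F L z - 2 * pi * \<i> * F z - R p' L F z) - (psum (4 * M n) F L z - 2 * pi * \<i> * F z - R p' L F z)
            + psum (4 * M n) F L z) \<longlonglongrightarrow> 0 - 0 + w"
          using Pn by (intro tendsto_intros R0 d zt w) simp
        then show ?thesis by simp
      qed
      then show ?thesis by blast
    qed
    then obtain w where w: "\<And>z d. z \<in> irr_pts \<Longrightarrow> d \<ge> 1 \<Longrightarrow> \<forall>i\<in>tiles d. z \<notin> tile d i \<Longrightarrow> (\<lambda>L. psum d F L z) \<longlonglongrightarrow> w z"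
      by metis
    define e where "e z = F z - w z / (2 * pi * \<i>)" for z
    have outer: "\<exists>h. h holomorphic_on S_set (real n) K \<and> (\<forall>z\<in>S_set (real n) K \<inter> irr_pts. h z = w z) \<and>
        (\<forall>z\<in>S_set (real n) K. cmod (h z) \<le> B1 n * c / \<nu> n z)"
      if n: "n \<ge> 2" and c: "c \<ge> 0" "\<forall>\<zeta>\<in>S_set (real (q1 n)) K. cmod (F \<zeta>) * \<nu> (q1 n) \<zeta> \<le> c" for n c
    proof -
      note Pn = P[OF n]
      have \<nu>n: "0 < \<nu> n z" for z using \<nu>_pos n by simp
      obtain h where "h holomorphic_on S_set (real n) K" "\<And>z. z \<in> S_set (real n) K \<Longrightarrow> z \<in> irr_pts \<Longrightarrow> h z = w z"
        "\<And>z. z \<in> S_set (real n) K \<Longrightarrow> cmod (h z) \<le> B1 n * c / \<nu> n z"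
      proof (rule holomorphic_limit_on_dense[OF open_S_set, where f = "psum (4 * M n) F" and \<beta> = "\<lambda>z. B1 n * c / \<nu> n z" and e = w and t1 = "real n" and K1 = K])
        show "psum (4 * M n) F L holomorphic_on S_set (real n) K" for L
          by (rule psum_holomorphic[OF F, of "M n"]) (use Pn n in auto)
        show "continuous_on (S_set (real n) K) (\<lambda>z. B1 n * c / \<nu> n z)"
          using \<nu>n n by (intro continuous_intros weights_continuous[OF weights]) (auto simp: less_le)
        show "cmod (psum (4 * M n) F L z) \<le> B1 n * c / \<nu> n z" if "z \<in> S_set (real n) K" for L z
          using Pn F c that \<nu>n[of z] by (simp add: pos_le_divide_eq)
        show "(\<lambda>L. psum (4 * M n) F L z) \<longlonglongrightarrow> w z" if "z \<in> S_set (real n) K" "z \<in> irr_pts" for z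
          using tile_subset_U[of "M n" "4 * M n"] Pn n that by (intro w) fastforce+
      qed auto
      then show ?thesis by blast
    qed
    have inner: "\<exists>h. h holomorphic_on N n \<and> (\<forall>z\<in>N n \<inter> irr_pts. h z = - (2 * pi * \<i>) * e z) \<and>
        (\<forall>z\<in>N n. cmod (h z) \<le> C2 n * c / \<nu> n z)"
      if n: "n \<ge> 2" and c: "c \<ge> 0" "\<forall>\<zeta>\<in>S_set (real (q2 n)) K. cmod (F \<zeta>) * \<nu> (q2 n) \<zeta> \<le> c" for n c
    proof -
      note Qn = Q[OF n]
      have \<nu>n: "0 < \<nu> n z" for z using \<nu>_pos n by simp
      have RL: "R (p n) L F holomorphic_on N n \<and> (\<forall>z\<in>N n. cmod (R (p n) L F z) * \<nu> n z \<le> C2 n * c)" if "L \<ge> L1 n" for L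
        using Qn F c that by blast
      have "open (N n)" using Qn by blast
      then obtain h where "h holomorphic_on N n" "\<And>z. z \<in> N n \<Longrightarrow> z \<in> irr_pts \<Longrightarrow> h z = - (2 * pi * \<i>) * e z"
        "\<And>z. z \<in> N n \<Longrightarrow> cmod (h z) \<le> C2 n * c / \<nu> n z"
      proof (rule holomorphic_limit_on_dense[where f = "\<lambda>L. R (p n) (L + L1 n) F" and \<beta> = "\<lambda>z. C2 n * c / \<nu> n z" and e = "\<lambda>z. - (2 * pi * \<i>) * e z"])
        show "R (p n) (L + L1 n) F holomorphic_on N n" for L using RL by simp
        show "continuous_on (N n) (\<lambda>z. C2 n * c / \<nu> n z)"
          using \<nu>n n by (intro continuous_intros weights_continuous[OF weights]) (auto simp: less_le)
        show "cmod (R (p n) (L + L1 n) F z) \<le> C2 n * c / \<nu> n z" if "z \<in> N n" for L z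
          using RL[of "L + L1 n"] that \<nu>n[of z] by (simp add: pos_le_divide_eq)
        fix z assume z: "z \<in> N n" "z \<in> irr_pts"
        have "z \<notin> cpart K" using z cpart_Im by (force simp: irr_pts_def)
        then obtain n' where n': "n' \<ge> 2" "z \<in> S_set (real n') K" using S_set_exhaust[OF closed_K] by blast
        \<comment> \<open>Although z is close to K, it lies in some \<open>S_set n' K\<close>. This
          provides a finer tiling none of whose tiles contains z, and for it \<open>psum\<close>
          converges to w z.\<close>
        note P' = P[OF n'(1)]
        have zt: "\<forall>i\<in>tiles (4 * M n'). z \<notin> tile (4 * M n') i"
          using tile_subset_U[of "M n'" "4 * M n'"] P' n' by fastforce
        have "\<bar>Im z\<bar> < real (p n)" "p n \<ge> 2" using Qn z by auto
        then have "(\<lambda>L. psum (4 * M n') F L z - 2 * pi * \<i> * F z - R (p n) L F z) \<longlonglongrightarrow> 0"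
          using R F z zt P' unfolding inner_data_def by simp
        moreover have "(\<lambda>L. psum (4 * M n') F L z) \<longlonglongrightarrow> w z"
          by (rule w[OF z(2) _ zt]) (use P' in simp)
        ultimately have "(\<lambda>L. psum (4 * M n') F L z - 2 * pi * \<i> * F z - (psum (4 * M n') F L z - 2 * pi * \<i> * F z - R (p n) L F z))
            \<longlonglongrightarrow> w z - 2 * pi * \<i> * F z - 0"
          by (intro tendsto_intros)
        moreover have "w z - 2 * pi * \<i> * F z - 0 = - (2 * pi * \<i>) * e z"
          by (simp add: e_def right_diff_distrib)
        ultimately have "(\<lambda>L. R (p n) L F z) \<longlonglongrightarrow> - (2 * pi * \<i>) * e z" by simp
        then show "(\<lambda>L. R (p n) (L + L1 n) F z) \<longlonglongrightarrow> - (2 * pi * \<i>) * e z"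
          by (rule LIMSEQ_ignore_initial_segment)
      qed auto
      then show ?thesis by blast
    qed
    obtain E where E: "E holomorphic_on UNIV" "\<And>z. z \<in> irr_pts \<Longrightarrow> E z = e z"
    proof (rule holomorphic_patching[of e])
      fix z
      show "\<exists>S h. open S \<and> z \<in> S \<and> h holomorphic_on S \<and> (\<forall>w\<in>S \<inter> irr_pts. h w = e w)"
      proof (cases "z \<in> cpart K")
        case True
        then have "z \<in> U_nbhd (real 2) K" by (auto simp: cpart_def mem_U_nbhd intro!: exI)
        then have zN: "z \<in> N 2" using Q[of 2] closure_subset by auto
        obtain c where "c > 0" "\<And>\<zeta>. \<zeta> \<in> S_set (real (q2 2)) K \<Longrightarrow> cmod (F \<zeta>) * \<nu> (q2 2) \<zeta> \<le> c"
          using OV_bound[OF F, of "q2 2"] Q[of 2] by auto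
        then obtain h where h: "h holomorphic_on N 2" "\<forall>z\<in>N 2 \<inter> irr_pts. h z = - (2 * pi * \<i>) * e z"
          using inner[of 2 c] by auto
        show ?thesis
          using zN Q[of 2] h by (intro exI[of _ "N 2"] exI[of _ "\<lambda>z. h z / - (2 * pi * \<i>)"]) (auto intro!: holomorphic_intros)
      next
        case False
        then obtain n where n: "n \<ge> 2" "z \<in> S_set (real n) K" using S_set_exhaust[OF closed_K] by blast
        obtain c where "c > 0" "\<And>\<zeta>. \<zeta> \<in> S_set (real (q1 n)) K \<Longrightarrow> cmod (F \<zeta>) * \<nu> (q1 n) \<zeta> \<le> c"
          using OV_bound[OF F, of "q1 n"] P[OF n(1)] n(1) by (metis le_trans one_le_numeral)
        then obtain h where h: "h holomorphic_on S_set (real n) K" "\<forall>z\<in>S_set (real n) K \<inter> irr_pts. h z = w z"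
          using outer[OF n(1), of c] by auto
        have FS: "F holomorphic_on S_set (real n) K"
          using F S_set_disjoint_cpart[of n K] n unfolding OV_def by (auto intro: holomorphic_on_subset)
        show ?thesis
          using n(2) h FS open_S_set
          by (intro exI[of _ "S_set (real n) K"] exI[of _ "\<lambda>z. F z - h z / (2 * pi * \<i>)"]) (auto intro!: holomorphic_intros simp: e_def)
      qed
    qed blast
    have bound: "\<forall>z\<in>S_set (real n) {}. cmod (E z) * \<nu> n z \<le> C n * c"
      if n: "n \<ge> 2" and c: "c \<ge> 0" "\<forall>\<zeta>\<in>S_set (real (q n)) K. cmod (F \<zeta>) * \<nu> (q n) \<zeta> \<le> c" for n c
    proof
      fix z assume z: "z \<in> S_set (real n) {}"
      have \<nu>n: "0 < \<nu> n z" for z using \<nu>_pos n by simp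
      have qn: "1 \<le> n" "n \<le> q n" "1 \<le> q1 n" "1 \<le> q2 n" "q1 n \<le> q n" "q2 n \<le> q n" "0 < B1 n" "0 < C2 n"
        using P[OF n] Q[OF n] n unfolding q_def by auto
      obtain h1 where h1: "\<forall>z\<in>S_set (real n) K \<inter> irr_pts. h1 z = w z" "\<forall>z\<in>S_set (real n) K. cmod (h1 z) \<le> B1 n * c / \<nu> n z"
        using outer[OF n c(1) weaken[OF c(2)]] qn by auto
      obtain h2 where h2: "\<forall>z\<in>N n \<inter> irr_pts. h2 z = - (2 * pi * \<i>) * e z" "\<forall>z\<in>N n. cmod (h2 z) \<le> C2 n * c / \<nu> n z"
        using inner[OF n c(1) weaken[OF c(2)]] qn by auto
      have half: "a / (2 * pi) \<le> a" if "0 \<le> a" for a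
        using that pi1 by (simp add: divide_le_eq mult_le_cancel_left1)
      show "cmod (E z) * \<nu> n z \<le> C n * c"
      \<comment> \<open>The value e z is known to be E z only on \<open>irr_pts\<close>; continuity
        of E and of the weight extends the estimate.\<close>
      proof (rule irr_pts_le[OF open_S_set _ _ z])
        show "continuous_on (S_set (real n) {}) (\<lambda>z. cmod (E z) * \<nu> n z)"
          using n E(1) by (intro continuous_intros weights_continuous[OF weights] continuous_on_subset[OF holomorphic_on_imp_continuous_on[OF E(1)]]) auto
        fix z assume z: "z \<in> S_set (real n) {}" "z \<in> irr_pts"
        show "cmod (E z) * \<nu> n z \<le> C n * c"
        proof (cases "z \<in> S_set (real n) K")
          case True
          have 1: "cmod (F z) * \<nu> n z \<le> c" using weaken[OF c(2) qn(1,2)] True by blast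
          have "cmod (w z) \<le> B1 n * c / \<nu> n z" using h1 True z by auto
          then have 2: "cmod (w z) * \<nu> n z \<le> B1 n * c" using \<nu>n[of z] by (simp add: field_simps)
          have "cmod (e z) \<le> cmod (F z) + cmod (w z) / (2 * pi)"
            unfolding e_def using norm_triangle_ineq4[of "F z" "w z / (2 * pi * \<i>)"] by (simp add: norm_divide norm_mult)
          also have "\<dots> \<le> cmod (F z) + cmod (w z)" using half by simp
          finally have "cmod (e z) * \<nu> n z \<le> cmod (F z) * \<nu> n z + cmod (w z) * \<nu> n z"
            using \<nu>n[of z] by (simp add: distrib_right[symmetric])
          then show ?thesis using 1 2 mult_nonneg_nonneg[OF less_imp_le[OF qn(8)] c(1)]
            unfolding E(2)[OF z(2)] C_def distrib_right mult_1 by linarith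
        next
          case False
          then have "z \<in> N n" using z Q[OF n] unfolding S_set_empty[OF n] S_set_eq[OF n] by auto
          then have "cmod (- (2 * pi * \<i>) * e z) \<le> C2 n * c / \<nu> n z" using h2 z by (metis IntI)
          then have "2 * pi * cmod (e z) * \<nu> n z \<le> C2 n * c" using \<nu>n[of z] by (simp add: norm_mult field_simps)
          moreover have "cmod (e z) * \<nu> n z * 1 \<le> cmod (e z) * \<nu> n z * (2 * pi)"
            using \<nu>n[of z] pi1 by (intro mult_left_mono) auto
          moreover have "cmod (e z) * \<nu> n z * (2 * pi) = 2 * pi * cmod (e z) * \<nu> n z" by simp
          ultimately show ?thesis using mult_nonneg_nonneg[OF less_imp_le[OF qn(7)] c(1)] c(1)
            unfolding E(2)[OF z(2)] C_def distrib_right mult_1 by linarith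
        qed
      qed
    qed
    have "E \<in> OV \<nu> {}"
    proof (rule OV_I'[OF weights])
      show "E holomorphic_on - cpart {}" using E(1) holomorphic_on_subset by blast
      show "\<exists>c. \<forall>z\<in>S_set (real n) {}. cmod (E z) * \<nu> n z \<le> c" if n: "n \<ge> 2" for n
      proof -
        have "q n \<ge> 1" using P[OF n] Q[OF n] unfolding q_def by auto
        then obtain c where c: "c > 0" "\<And>\<zeta>. \<zeta> \<in> S_set (real (q n)) K \<Longrightarrow> cmod (F \<zeta>) * \<nu> (q n) \<zeta> \<le> c"
          using OV_bound[OF F, of "q n"] by auto
        then show ?thesis using bound[OF n, of c] by auto
      qed
    qed (simp add: cpart_def)
    moreover have "(\<lambda>L. psum d F L z) \<longlonglongrightarrow> 2 * pi * \<i> * (F z - E z)"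
      if "d \<ge> 1" "z \<in> irr_pts" "\<forall>i\<in>tiles d. z \<notin> tile d i" for d z
      using w[OF that(2,1,3)] E(2)[OF that(2)] by (simp add: e_def)
    ultimately show "\<exists>E\<in>OV \<nu> {}.
      (\<forall>n\<ge>2. \<forall>c\<ge>0. (\<forall>\<zeta>\<in>S_set (real (q n)) K. cmod (F \<zeta>) * \<nu> (q n) \<zeta> \<le> c) \<longrightarrow>
         (\<forall>z\<in>S_set (real n) {}. cmod (E z) * \<nu> n z \<le> C n * c)) \<and>
      (\<forall>d\<ge>1. \<forall>z\<in>irr_pts. (\<forall>i\<in>tiles d. z \<notin> tile d i) \<longrightarrow>
         (\<lambda>L. psum d F L z) \<longlonglongrightarrow> 2 * pi * \<i> * (F z - E z))"
      using bound by blast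
  qed
qed

end

section \<open>The outer boundary for K with an infinite end\<close>

lemma integral_le_nn_integral:
  fixes v :: "real \<Rightarrow> real"
  assumes v: "v integrable_on {a..b}" "\<And>t. 0 \<le> v t"
    and le: "(\<integral>\<^sup>+t. ennreal (v t) \<partial>lebesgue) \<le> ennreal C" and C: "0 \<le> C"
  shows "integral {a..b} v \<le> C"
proof -
  have "ennreal (integral {a..b} v) = (\<integral>\<^sup>+t. ennreal (indicator {a..b} t * v t) \<partial>lborel)"
    using nn_integral_has_integral_lebesgue[OF v(2) integrable_integral[OF v(1)]] by simp
  also have "\<dots> \<le> (\<integral>\<^sup>+t. ennreal (v t) \<partial>lborel)"
    using v(2) by (intro nn_integral_mono ennreal_leI) (auto simp: indicator_def)
  also have "\<dots> \<le> ennreal C" using le by (simp add: nn_integral_completion)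
  finally show ?thesis using C by (simp add: ennreal_le_iff)
qed

context weighted_kernel
begin

lemma F_continuous: "F \<in> OV \<nu> K \<Longrightarrow> X \<inter> cpart K = {} \<Longrightarrow> continuous_on X F"
  unfolding OV_def by (auto intro!: continuous_on_subset[OF holomorphic_on_imp_continuous_on])

lemma horizontal_avoids_cpart: "y \<noteq> 0 \<Longrightarrow> closed_segment (Complex a y) (Complex b y) \<inter> cpart K = {}"
  using cpart_Im by (fastforce simp: closed_segment_same_Im)

text \<open>For p >= 2 and |Im z| <= 1 the line keeps distance 1 from z, so |kern| <= |g|. Bounding
  F by c / \<nu> q then leaves exactly the integrand of (CT4), and the result is uniform in
  L.\<close>

lemma line_bound:
  assumes F: "F \<in> OV \<nu> K" and y: "\<bar>y\<bar> = real p" "p \<ge> 2" and z: "\<bar>Im z\<bar> \<le> 1"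
    and q: "q > p" and c: "0 \<le> c" "\<And>\<zeta>. \<zeta> \<in> S_set (real q) K \<Longrightarrow> cmod (F \<zeta>) * \<nu> q \<zeta> \<le> c"
    and C: "C \<ge> 0" "(\<integral>\<^sup>+t. ennreal (cmod (g (z - Complex t y)) / \<nu> q (Complex t y) * w) \<partial>lebesgue) \<le> ennreal C"
    and w: "w > 0"
  shows "cmod (line F L y z) * w \<le> C * c"
proof -
  define v where "v t = cmod (g (z - Complex t y)) / \<nu> q (Complex t y) * w" for t
  have q1: "q \<ge> 1" using q by simp
  have y0: "y \<noteq> 0" using y by auto
  have cg: "continuous_on UNIV g" using g_entire by (rule holomorphic_on_imp_continuous_on)
  have cC: "continuous_on A (\<lambda>t. Complex t y)" for A by (intro continuous_on_Complex continuous_intros)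
  have cv: "continuous_on A v" for A
    unfolding v_def[abs_def] using \<nu>_pos[OF q1]
    by (intro continuous_intros continuous_on_compose2[OF cg] continuous_on_compose2[OF weights_continuous[OF weights q1, of UNIV]] cC)
      (auto simp: less_le)
  have v0: "0 \<le> v t" for t unfolding v_def using \<nu>_pos[OF q1] w by (simp add: less_imp_le)
  have zL: "z \<notin> closed_segment (Complex (- real L) y) (Complex (real L) y)"
    using y z by (auto simp: closed_segment_same_Im)
  have ct: "continuous_on (closed_segment (Complex (- real L) y) (Complex (real L) y)) (\<lambda>\<zeta>. F \<zeta> * kern (z - \<zeta>))"
    using zL by (intro seg_continuous kern_holomorphic F_continuous[OF F] horizontal_avoids_cpart y0)
  have "cmod (line F L y z) \<le> integral {- real L..real L} (\<lambda>t. c / w * v t)"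
    unfolding line_def seg_def
  proof (rule contour_integral_horizontal_bound)
    show "continuous_on {\<zeta>. Im \<zeta> = y \<and> - real L \<le> Re \<zeta> \<and> Re \<zeta> \<le> real L} (\<lambda>\<zeta>. F \<zeta> * kern (z - \<zeta>))"
      using ct by (simp add: closed_segment_horizontal)
    show "(\<lambda>t. c / w * v t) integrable_on {- real L..real L}"
      by (intro integrable_continuous_real continuous_intros cv)
    fix t :: real
    have "Complex t y \<notin> closure (U_nbhd (real q) K)"
    proof (rule not_in_closure_U_Im)
      have "1 / real q \<le> 1" using q1 by simp
      then show "1 / real q < \<bar>Im (Complex t y)\<bar>" using y by simp
    qed
    then have "Complex t y \<in> S_set (real q) K" using q y S_set_eq[of q K] by auto
    then have 1: "cmod (F (Complex t y)) \<le> c / \<nu> q (Complex t y)" using c(2) \<nu>_pos[OF q1] by (simp add: pos_le_divide_eq)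
    have "1 \<le> \<bar>Im (z - Complex t y)\<bar>" using y z by auto
    then have "1 \<le> cmod (z - Complex t y)" using abs_Im_le_cmod order_trans by blast
    then have "cmod (kern (z - Complex t y)) \<le> cmod (g (z - Complex t y))"
      unfolding kern_def norm_divide by (simp add: divide_le_eq mult_le_cancel_left1)
    then have "cmod (F (Complex t y) * kern (z - Complex t y)) \<le> (c / \<nu> q (Complex t y)) * cmod (g (z - Complex t y))"
      unfolding norm_mult using 1 c(1) \<nu>_pos[OF q1] by (intro mult_mono) (auto simp: less_imp_le)
    then show "cmod (F (Complex t y) * kern (z - Complex t y)) \<le> c / w * v t" using w by (simp add: v_def)
  qed simp
  also have "\<dots> = c / w * integral {- real L..real L} v"
    by (rule Henstock_Kurzweil_Integration.integral_mult_right)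
  also have "\<dots> \<le> c / w * C"
    using integral_le_nn_integral[of v "- real L" "real L" C] cv v0 C c(1) w integrable_continuous_real[OF cv]
    unfolding v_def by (intro mult_left_mono) auto
  finally show ?thesis using w by (simp add: field_simps)
qed

lemma line_holomorphic:
  assumes F: "F \<in> OV \<nu> K" and y: "y \<noteq> 0" and N: "\<And>z. z \<in> N \<Longrightarrow> \<bar>Im z\<bar> < \<bar>y\<bar>"
  shows "line F L y holomorphic_on N"
  unfolding line_def
  by (rule holomorphic_on_subset[OF seg_holomorphic[OF kern_holomorphic F_continuous[OF F horizontal_avoids_cpart[OF y]]]])
    (use N in \<open>fastforce simp: closed_segment_same_Im\<close>)

text \<open>The real axis near an infinite end lies in \<open>U_nbhd m K\<close> and leaves every
  compact set Q, so (qV) forces the quotient to 0 there; the weights are even, which transfers this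
  to positive arguments.\<close>

lemma ratio_tendsto_0:
  assumes qV: "qV_inf \<nu> K" and qL: "qL1 \<nu> K" and inf: "K \<inter> {\<infinity>, -\<infinity>} \<noteq> {}" and n: "n \<ge> 1"
  obtains m where "m > n" "(\<lambda>L::nat. ratio n m (real L)) \<longlonglongrightarrow> 0"
proof -
  obtain m where m: "m > n" and Q: "\<And>\<epsilon>. \<epsilon> > 0 \<Longrightarrow> \<exists>Q. compact Q \<and> (\<forall>z\<in>closure (U_nbhd (real m) K) - Q. \<nu> n z \<le> \<epsilon> * \<nu> m z)"
    using qV n unfolding qV_inf_def by meson
  show thesis
  proof (rule that[OF m], rule LIMSEQ_I)
    fix e :: real assume e: "e > 0"
    obtain Q where Q: "compact Q" "\<And>z. z \<in> closure (U_nbhd (real m) K) - Q \<Longrightarrow> \<nu> n z \<le> e / 2 * \<nu> m z"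
      using Q[of "e / 2"] e by auto
    obtain r where r: "\<And>z. z \<in> Q \<Longrightarrow> cmod z \<le> r" using compact_imp_bounded[OF Q(1)] unfolding bounded_iff by blast
    obtain N :: nat where N: "real N > r + real m + 1" "real N > real m" using reals_Archimedean2[of "max (r + real m + 1) (real m)"] by auto
    show "\<exists>N. \<forall>L\<ge>N. norm (ratio n m (real L) - 0) < e"
    proof (intro exI[of _ N] allI impI)
      fix L assume L: "L \<ge> N"
      have LN: "real L \<ge> real N" using L by simp
      define x where "x = (if \<infinity> \<in> K then real L else - real L)"
      have "complex_of_real x \<in> U_nbhd (real m) K"
        using inf LN N m unfolding mem_U_nbhd x_def by auto
      moreover have "cmod (complex_of_real x) = real L" by (simp add: x_def)
      then have "complex_of_real x \<notin> Q" using r LN N by fastforce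
      ultimately have "\<nu> n (complex_of_real x) \<le> e / 2 * \<nu> m (complex_of_real x)"
        using Q(2) closure_subset by blast
      moreover have "\<nu> k (complex_of_real x) = \<nu> k (complex_of_real (real L))" if "k \<ge> 1" for k
      proof -
        have "\<forall>z. \<nu> k z = \<nu> k (complex_of_real \<bar>Re z\<bar>)" using qL that unfolding qL1_def by blast
        moreover have "\<bar>Re (complex_of_real x)\<bar> = \<bar>Re (complex_of_real (real L))\<bar>" by (simp add: x_def)
        ultimately show ?thesis by metis
      qed
      ultimately have "ratio n m (real L) \<le> e / 2"
        using n m \<nu>_pos[of m "complex_of_real (real L)"] by (simp add: ratio_def pos_divide_le_eq)
      then show "norm (ratio n m (real L) - 0) < e" using e ratio_pos[of n m "real L"] n m by simp
    qed
  qed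
qed

lemma seg_bound_2:
  assumes F: "F \<in> OV \<nu> K" and ab: "closed_segment a b \<inter> cpart K = {}" "cmod (b - a) \<le> l" and z: "z \<notin> closed_segment a b"
    and M: "0 \<le> M" "\<And>\<zeta>. \<zeta> \<in> closed_segment a b \<Longrightarrow> cmod (F \<zeta> * kern (z - \<zeta>)) \<le> M"
  shows "cmod (seg kern F a b z) \<le> M * l"
  using seg_bound[OF kern_holomorphic F_continuous[OF F ab(1)] z M(2)] mult_left_mono[OF ab(2) M(1)] by fastforce

text \<open>A point of a side has |Im| >= 1/d or lies on a kept vertical edge, and in both cases it
  stays off the closed neighbourhood of index p + d + 2. The summand p makes room for imaginary
  parts up to p.\<close>

lemma side_points:
  assumes d: "d \<ge> 1" and p: "p \<ge> 2"
  obtains L0 :: nat where "\<And>L \<zeta> j. L \<ge> L0 \<Longrightarrow> j = int (L * d) \<or> j = - int (L * d) \<Longrightarrow> Re \<zeta> = of_int j / d \<Longrightarrow>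
    \<bar>Im \<zeta>\<bar> \<le> real p \<Longrightarrow> 1 / d \<le> \<bar>Im \<zeta>\<bar> \<or> \<not> (j - 1 \<in> tiles d \<and> j \<in> tiles d) \<Longrightarrow> \<zeta> \<in> S_set (real (p + d + 2)) K"
proof
  fix L \<zeta> j assume *: "L \<ge> (0::nat)" "Re \<zeta> = of_int j / d" "\<bar>Im \<zeta>\<bar> \<le> real p"
    "1 / d \<le> \<bar>Im \<zeta>\<bar> \<or> \<not> (j - 1 \<in> tiles d \<and> j \<in> tiles d)"
  have dq: "1 / real (p + d + 2) < 1 / real d" using d by (simp add: frac_less2)
  have "\<zeta> \<notin> closure (U_nbhd (real (p + d + 2)) K)"
  proof (cases "1 / d \<le> \<bar>Im \<zeta>\<bar>")
    case True
    then show ?thesis using dq by (intro not_in_closure_U_Im) simp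
  next
    case False
    then have "\<zeta> \<in> edges d j" using * step_le[OF d, of j] by (auto simp: edges_def tile_def)
    then show ?thesis using d by (intro edges_not_closure_U[of d]) auto
  qed
  then show "\<zeta> \<in> S_set (real (p + d + 2)) K" using *(3) S_set_eq[of "p + d + 2" K] by auto
qed

text \<open>On the sides |g(z - \<zeta>)| <= M \<nu> m and |F| <= c / \<nu> q, so the integrand is
  at most a multiple of \<nu> m / \<nu> q at real part L, which tends to 0 while the length stays at
  most 2p. The growth assumption labelled \<open>CT5\<close> allows an index m larger than n, so
  that both alternatives of the theorem can provide it.\<close>

lemma side_tendsto_0:
  assumes qV: "qV_inf \<nu> K" and qL: "qL1 \<nu> K" and inf: "K \<inter> {\<infinity>, -\<infinity>} \<noteq> {}"
    and CT5: "\<And>z n. Im z \<noteq> 0 \<Longrightarrow> n \<ge> 2 \<Longrightarrow> \<exists>m\<ge>n. \<exists>M. \<forall>\<zeta>\<in>S_set (real n) K. cmod (g (z - \<zeta>)) \<le> M * \<nu> m \<zeta>"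
    and F: "F \<in> OV \<nu> K" and d: "d \<ge> 1" and p: "p \<ge> 2" and z: "z \<in> irr_pts"
    and sgn: "\<sigma> = 1 \<or> \<sigma> = (- 1 :: int)"
  shows "(\<lambda>L. side d F (\<sigma> * int (L * d)) p z) \<longlonglongrightarrow> 0"
proof -
  define n where "n = p + d + 2"
  obtain L0 :: nat where S: "\<And>L \<zeta> j. L \<ge> L0 \<Longrightarrow> j = int (L * d) \<or> j = - int (L * d) \<Longrightarrow> Re \<zeta> = of_int j / d \<Longrightarrow>
    \<bar>Im \<zeta>\<bar> \<le> real p \<Longrightarrow> 1 / d \<le> \<bar>Im \<zeta>\<bar> \<or> \<not> (j - 1 \<in> tiles d \<and> j \<in> tiles d) \<Longrightarrow> \<zeta> \<in> S_set (real n) K"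
    using side_points[OF d p] unfolding n_def by metis
  have n2: "n \<ge> 2" by (simp add: n_def)
  have "Im z \<noteq> 0" using z by (auto simp: irr_pts_def)
  then obtain m M where m: "m \<ge> n" and M: "\<And>\<zeta>. \<zeta> \<in> S_set (real n) K \<Longrightarrow> cmod (g (z - \<zeta>)) \<le> M * \<nu> m \<zeta>"
    using CT5[of z n] n2 by blast
  have m1: "m \<ge> 1" using m n2 by simp
  obtain q where q: "q > m" "(\<lambda>L::nat. ratio m q (real L)) \<longlonglongrightarrow> 0" using ratio_tendsto_0[OF qV qL inf m1] by blast
  have q1: "q \<ge> 1" using q m1 by simp
  obtain c where c: "c > 0" "\<And>\<zeta>. \<zeta> \<in> S_set (real q) K \<Longrightarrow> cmod (F \<zeta>) * \<nu> q \<zeta> \<le> c" using OV_bound[OF F q1] by blast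
  obtain L1 :: nat where L1: "real L1 > \<bar>Re z\<bar> + real L0 + 1" using reals_Archimedean2 by blast
  have even: "ratio m q (- t) = ratio m q t" for t
  proof -
    have "\<nu> k (complex_of_real (- t)) = \<nu> k (complex_of_real t)" if "k \<ge> 1" for k
    proof -
      have "\<forall>z. \<nu> k z = \<nu> k (complex_of_real \<bar>Re z\<bar>)" using qL that unfolding qL1_def by blast
      then show ?thesis by (metis Re_complex_of_real abs_minus_cancel)
    qed
    then show ?thesis unfolding ratio_def using m1 q1 by simp
  qed
  have bound: "cmod (side d F (\<sigma> * int (L * d)) p z) \<le> c * \<bar>M\<bar> * ratio m q (real L) * (4 * real p)" if L: "L \<ge> L1" for L
  proof -
    let ?j = "\<sigma> * int (L * d)"
    have LL: "real L > \<bar>Re z\<bar> + real L0 + 1" using L L1 by (meson less_le_trans of_nat_le_iff)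
    have LL0: "L \<ge> L0" using LL abs_ge_zero[of "Re z"] by linarith
    have j: "of_int ?j / real d = of_int \<sigma> * real L" using d by simp
    have rj: "ratio m q (of_int \<sigma> * real L) = ratio m q (real L)" using sgn even by auto
    have pt: "cmod (F \<zeta> * kern (z - \<zeta>)) \<le> c * \<bar>M\<bar> * ratio m q (real L)"
      if \<zeta>: "Re \<zeta> = of_int ?j / d" "\<bar>Im \<zeta>\<bar> \<le> real p" "1 / d \<le> \<bar>Im \<zeta>\<bar> \<or> \<not> (?j - 1 \<in> tiles d \<and> ?j \<in> tiles d)" for \<zeta>
    proof -
      have \<zeta>S: "\<zeta> \<in> S_set (real n) K" by (rule S[OF LL0 _ \<zeta>]) (use sgn in auto)
      then have "\<zeta> \<in> S_set (real q) K" using S_set_mono[of n q K] n2 m q by auto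
      then have 1: "cmod (F \<zeta>) \<le> c / \<nu> q \<zeta>" using c(2) \<nu>_pos[OF q1] by (simp add: pos_le_divide_eq)
      have "\<bar>Re \<zeta>\<bar> = real L" unfolding \<zeta>(1) j using sgn by auto
      then have "1 \<le> \<bar>Re (z - \<zeta>)\<bar>" using LL by auto
      then have "1 \<le> cmod (z - \<zeta>)" using abs_Re_le_cmod order_trans by blast
      then have "cmod (kern (z - \<zeta>)) \<le> cmod (g (z - \<zeta>))"
        unfolding kern_def norm_divide by (simp add: divide_le_eq mult_le_cancel_left1)
      also have "\<dots> \<le> \<bar>M\<bar> * \<nu> m \<zeta>"
        using M[OF \<zeta>S] \<nu>_pos[OF m1, of \<zeta>] mult_right_mono[OF abs_ge_self[of M], of "\<nu> m \<zeta>"] by linarith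
      finally have "cmod (F \<zeta> * kern (z - \<zeta>)) \<le> (c / \<nu> q \<zeta>) * (\<bar>M\<bar> * \<nu> m \<zeta>)"
        unfolding norm_mult using 1 c(1) \<nu>_pos[OF q1, of \<zeta>] by (intro mult_mono) auto
      also have "\<dots> = c * \<bar>M\<bar> * ratio m q (Re \<zeta>)"
        unfolding ratio_def \<nu>_Re[OF qL m1, of \<zeta>] \<nu>_Re[OF qL q1, of \<zeta>] by simp
      also have "ratio m q (Re \<zeta>) = ratio m q (real L)" unfolding \<zeta>(1) j by (rule rj)
      finally show ?thesis .
    qed
    have B0: "0 \<le> c * \<bar>M\<bar> * ratio m q (real L)" using c ratio_pos[OF m1 q1] by (simp add: less_imp_le)
    have dd: "0 < 1 / real d" "1 / real d \<le> 1" using d by auto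
    have rat: "of_int ?j / real d \<in> \<rat>" by simp
    have sg: "cmod (seg kern F (Complex (of_int ?j / d) y1) (Complex (of_int ?j / d) y2) z) \<le> c * \<bar>M\<bar> * ratio m q (real L) * (y2 - y1)"
      if y: "y1 \<le> y2" "\<And>y. y1 \<le> y \<Longrightarrow> y \<le> y2 \<Longrightarrow> \<bar>y\<bar> \<le> real p \<and> (1 / d \<le> \<bar>y\<bar> \<or> \<not> (?j - 1 \<in> tiles d \<and> ?j \<in> tiles d))" for y1 y2
    proof (rule seg_bound_2[OF F _ _ irr_pts_not_vertical[OF z rat] B0])
      have "closed_segment (Complex (of_int ?j / d) y1) (Complex (of_int ?j / d) y2) \<subseteq> S_set (real n) K"
      proof
        fix \<zeta> assume "\<zeta> \<in> closed_segment (Complex (of_int ?j / d) y1) (Complex (of_int ?j / d) y2)"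
        then have "Re \<zeta> = of_int ?j / d" "y1 \<le> Im \<zeta>" "Im \<zeta> \<le> y2" using y(1) by (auto simp: closed_segment_vertical)
        then show "\<zeta> \<in> S_set (real n) K" using sgn y(2)[of "Im \<zeta>"] by (intro S[OF LL0, of ?j \<zeta>]) auto
      qed
      then show "closed_segment (Complex (of_int ?j / d) y1) (Complex (of_int ?j / d) y2) \<inter> cpart K = {}"
        using S_set_disjoint_cpart[of n K] n2 by auto
      have "Complex (of_int ?j / d) y2 - Complex (of_int ?j / d) y1 = of_real (y2 - y1) * \<i>"
        by (simp add: complex_eq_iff)
      then show "cmod (Complex (of_int ?j / d) y2 - Complex (of_int ?j / d) y1) \<le> y2 - y1"
        using y(1) by (simp add: norm_mult del: of_real_diff)
      fix \<zeta> assume "\<zeta> \<in> closed_segment (Complex (of_int ?j / d) y1) (Complex (of_int ?j / d) y2)"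
      then have "Re \<zeta> = of_int ?j / d" "y1 \<le> Im \<zeta>" "Im \<zeta> \<le> y2" using y(1) by (auto simp: closed_segment_vertical)
      then show "cmod (F \<zeta> * kern (z - \<zeta>)) \<le> c * \<bar>M\<bar> * ratio m q (real L)"
        using y(2)[of "Im \<zeta>"] by (intro pt) auto
    qed
    have p2: "2 \<le> real p" using p by simp
    have s1: "cmod (seg kern F (Complex (of_int ?j / d) (- real p)) (Complex (of_int ?j / d) (- 1 / d)) z)
        \<le> c * \<bar>M\<bar> * ratio m q (real L) * (- 1 / d - (- real p))"
    proof (rule sg)
      show "- real p \<le> - 1 / real d" using dd p2 by linarith
      fix y assume "- real p \<le> y" "y \<le> - 1 / real d"
      then have "\<bar>y\<bar> \<le> real p" "1 / real d \<le> \<bar>y\<bar>" using dd by linarith+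
      then show "\<bar>y\<bar> \<le> real p \<and> (1 / real d \<le> \<bar>y\<bar> \<or> \<not> (?j - 1 \<in> tiles d \<and> ?j \<in> tiles d))" by blast
    qed
    have s2: "cmod (seg kern F (Complex (of_int ?j / d) (1 / d)) (Complex (of_int ?j / d) (real p)) z)
        \<le> c * \<bar>M\<bar> * ratio m q (real L) * (real p - 1 / d)"
    proof (rule sg)
      show "1 / real d \<le> real p" using dd p2 by linarith
      fix y assume "1 / real d \<le> y" "y \<le> real p"
      then have "\<bar>y\<bar> \<le> real p" "1 / real d \<le> \<bar>y\<bar>" using dd by linarith+
      then show "\<bar>y\<bar> \<le> real p \<and> (1 / real d \<le> \<bar>y\<bar> \<or> \<not> (?j - 1 \<in> tiles d \<and> ?j \<in> tiles d))" by blast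
    qed
    have s3: "cmod (vert d F ?j z) \<le> c * \<bar>M\<bar> * ratio m q (real L) * (1 / d - (- 1 / d))"
    proof (cases "?j - 1 \<in> tiles d \<and> ?j \<in> tiles d")
      case True
      then have "vert d F ?j z = 0" unfolding vert_def by simp
      then show ?thesis using B0 dd by simp
    next
      case False
      have "cmod (seg kern F (Complex (of_int ?j / d) (- 1 / d)) (Complex (of_int ?j / d) (1 / d)) z)
         \<le> c * \<bar>M\<bar> * ratio m q (real L) * (1 / d - (- 1 / d))"
      proof (rule sg)
        fix y assume y: "- 1 / real d \<le> y" "y \<le> 1 / real d"
        have "\<bar>y\<bar> \<le> 1 / real d" using y by linarith
        moreover have "1 / real d \<le> real p" using dd p by linarith
        ultimately show "\<bar>y\<bar> \<le> real p \<and> (1 / real d \<le> \<bar>y\<bar> \<or> \<not> (?j - 1 \<in> tiles d \<and> ?j \<in> tiles d))"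
          using False by linarith
      qed (use dd in linarith)
      moreover have "vert d F ?j z = seg kern F (Complex (of_int ?j / d) (- 1 / d)) (Complex (of_int ?j / d) (1 / d)) z"
        unfolding vert_def using False by (rule if_not_P)
      ultimately show ?thesis by simp
    qed
    have "cmod (side d F ?j p z) \<le> c * \<bar>M\<bar> * ratio m q (real L) * (- 1 / d - (- real p))
        + c * \<bar>M\<bar> * ratio m q (real L) * (1 / d - (- 1 / d)) + c * \<bar>M\<bar> * ratio m q (real L) * (real p - 1 / d)"
      unfolding side_def by (intro order_trans[OF norm_triangle_ineq] add_mono s1 s2 s3)
    also have "\<dots> = c * \<bar>M\<bar> * ratio m q (real L) * (2 * real p)"
      unfolding distrib_left[symmetric] by simp
    also have "\<dots> \<le> c * \<bar>M\<bar> * ratio m q (real L) * (4 * real p)" using B0 by (intro mult_left_mono) auto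
    finally show ?thesis .
  qed
  show ?thesis
  proof (rule Lim_null_comparison)
    show "\<forall>\<^sub>F L in sequentially. norm (side d F (\<sigma> * int (L * d)) p z) \<le> c * \<bar>M\<bar> * ratio m q (real L) * (4 * real p)"
      using bound by (auto simp: eventually_sequentially)
    have "(\<lambda>L::nat. c * \<bar>M\<bar> * ratio m q (real L) * (4 * real p)) \<longlonglongrightarrow> c * \<bar>M\<bar> * 0 * (4 * real p)"
      by (intro tendsto_intros q(2))
    then show "(\<lambda>L::nat. c * \<bar>M\<bar> * ratio m q (real L) * (4 * real p)) \<longlonglongrightarrow> 0" by simp
  qed
qed

text \<open>The vertical sides vanish in the limit, so the two horizontal lines alone persist. They
  stay away from the strip |Im z| < 1/n, and (CT4) bounds each of them by C c.\<close>

lemma inner_data_unbounded: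
  assumes qV: "qV_inf \<nu> K" and qL: "qL1 \<nu> K" and inf: "K \<inter> {\<infinity>, -\<infinity>} \<noteq> {}"
    and CT5: "\<And>z n. Im z \<noteq> 0 \<Longrightarrow> n \<ge> 2 \<Longrightarrow> \<exists>m\<ge>n. \<exists>M. \<forall>\<zeta>\<in>S_set (real n) K. cmod (g (z - \<zeta>)) \<le> M * \<nu> m \<zeta>"
    and CT4: "CT4 \<nu> g"
  shows "inner_data (\<lambda>p L F z. line F L (- real p) z - line F L (real p) z)"
  unfolding inner_data_def
proof (intro conjI ballI allI impI)
  fix F and p d :: nat and z
  assume F: "F \<in> OV \<nu> K" and p: "2 \<le> p" and d: "1 \<le> d" and z: "z \<in> irr_pts" "\<bar>Im z\<bar> < real p" "\<forall>i\<in>tiles d. z \<notin> tile d i"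
  have Fh: "F holomorphic_on - cpart K" using F by (simp add: OV_def)
  obtain L1 :: nat where L1: "real L1 > \<bar>Re z\<bar>" using reals_Archimedean2 by blast
  have eq: "psum d F L z - 2 * pi * \<i> * F z - (line F L (- real p) z - line F L (real p) z) =
      side d F (1 * int (L * d)) p z - side d F (- 1 * int (L * d)) p z" if "L \<ge> L1" for L
  proof -
    have "\<bar>Re z\<bar> < real L" using that L1 by (meson less_le_trans of_nat_le_iff)
    then show ?thesis using key_identity[OF Fh d p z(1) _ z(2)] z(3) by simp
  qed
  have "(\<lambda>L. side d F (1 * int (L * d)) p z - side d F (- 1 * int (L * d)) p z) \<longlonglongrightarrow> 0 - 0"
    by (intro tendsto_diff side_tendsto_0[OF qV qL inf CT5 F d p z(1)]) auto
  then show "(\<lambda>L. psum d F L z - 2 * pi * \<i> * F z - (line F L (- real p) z - line F L (real p) z)) \<longlonglongrightarrow> 0"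
    using eq by (subst tendsto_cong[where g = "\<lambda>L. side d F (1 * int (L * d)) p z - side d F (- 1 * int (L * d)) p z"])
      (auto simp: eventually_sequentially)
next
  fix n :: nat assume n: "2 \<le> n"
  obtain p m C where pm: "2 \<le> p" "p < m" "C > 0" and I: "\<And>s z. s \<in> {1, -1} \<Longrightarrow> \<bar>Im z\<bar> \<le> 1 / real n \<Longrightarrow>
     (\<integral>\<^sup>+t. ennreal (cmod (g (z - Complex t (s * real p))) / \<nu> m (Complex t (s * real p)) * \<nu> n z) \<partial>lebesgue) \<le> ennreal C"
    using CT4 n unfolding CT4_def by (meson one_le_numeral order_trans)
  have n1: "1 / real n \<le> 1" using n by simp
  show "\<exists>p N q C L1. inner_est (\<lambda>p L F z. line F L (- real p) z - line F L (real p) z) n p N q C L1"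
  proof (intro exI)
    show "inner_est (\<lambda>p L F z. line F L (- real p) z - line F L (real p) z) n p {z. \<bar>Im z\<bar> < 1 / n} m (2 * C) 0"
      unfolding inner_est_def
    proof (intro conjI ballI allI impI)
      show "open {z. \<bar>Im z\<bar> < 1 / real n}" by (intro open_Collect_less continuous_intros)
      show "U_nbhd (real n) K \<subseteq> {z. \<bar>Im z\<bar> < 1 / real n}" using U_nbhd_Im by blast
      show "closure (U_nbhd (real n) K) \<inter> irr_pts \<subseteq> {z. \<bar>Im z\<bar> < 1 / real n}"
      proof
        fix z assume z: "z \<in> closure (U_nbhd (real n) K) \<inter> irr_pts"
        then have "\<bar>Im z\<bar> \<le> 1 / real n" using not_in_closure_U_Im[of "real n" z K] by (auto simp: not_less[symmetric])
        moreover have "\<bar>Im z\<bar> \<noteq> 1 / real n"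
        proof
          assume "\<bar>Im z\<bar> = 1 / real n"
          then have "Im z = 1 / real n \<or> Im z = - (1 / real n)" by linarith
          then have "Im z \<in> \<rat>" by auto
          then show False using z by (auto simp: irr_pts_def)
        qed
        ultimately show "z \<in> {z. \<bar>Im z\<bar> < 1 / real n}" by simp
      qed
      show "{z. \<bar>Im z\<bar> < 1 / real n} \<subseteq> {z. \<bar>Im z\<bar> < real p}" using n1 pm by auto
      fix F c L assume F: "F \<in> OV \<nu> K" and c: "(0::real) \<le> c" "\<forall>\<zeta>\<in>S_set (real m) K. cmod (F \<zeta>) * \<nu> m \<zeta> \<le> c"
      show "(\<lambda>z. line F L (- real p) z - line F L (real p) z) holomorphic_on {z. \<bar>Im z\<bar> < 1 / real n}"
        using n1 pm by (intro holomorphic_intros line_holomorphic[OF F]) auto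
      fix z assume z: "z \<in> {z. \<bar>Im z\<bar> < 1 / real n}"
      have \<nu>z: "0 < \<nu> n z" using \<nu>_pos n by simp
      have l: "cmod (line F L y z) * \<nu> n z \<le> C * c" if "y = real p \<or> y = - real p" for y
      proof (rule line_bound[OF F, of y p z m c C "\<nu> n z" L])
        show "(\<integral>\<^sup>+ t. ennreal (cmod (g (z - Complex t y)) / \<nu> m (Complex t y) * \<nu> n z) \<partial>lebesgue) \<le> ennreal C"
          using I[of 1 z] I[of "- 1" z] that z by auto
      qed (use that pm c z n1 \<nu>z in auto)
      have "cmod (line F L (- real p) z - line F L (real p) z) * \<nu> n z \<le>
         (cmod (line F L (- real p) z) + cmod (line F L (real p) z)) * \<nu> n z"
        using \<nu>z norm_triangle_ineq4 by (intro mult_right_mono) auto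
      then show "cmod (line F L (- real p) z - line F L (real p) z) * \<nu> n z \<le> 2 * C * c"
        using l[of "real p"] l[of "- real p"] by (simp add: distrib_right)
    qed (use pm in auto)
  qed
qed

section \<open>The outer boundary for K without infinite ends\<close>

definition rect :: "(complex \<Rightarrow> complex) \<Rightarrow> nat \<Rightarrow> nat \<Rightarrow> complex \<Rightarrow> complex" where
  "rect F h p z = line F h (- real p) z - line F h (real p) z
     + seg kern F (Complex (real h) (- real p)) (Complex (real h) (real p)) z
     - seg kern F (Complex (- real h) (- real p)) (Complex (- real h) (real p)) z"

lemma bounded_tiles:
  assumes X: "\<And>x. ereal x \<in> K \<Longrightarrow> \<bar>x\<bar> < real X" and inf: "K \<inter> {\<infinity>, -\<infinity>} = {}"
    and d: "d \<ge> 1" and L: "L \<ge> X + 2" and i: "i \<ge> int (L * d) \<or> i < - int (L * d)"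
  shows "i \<notin> tiles d"
proof
  assume "i \<in> tiles d"
  then obtain x where x: "ereal x \<in> K" "(of_int i - 1) / d \<le> x" "x \<le> (of_int i + 2) / d"
    using inf unfolding tiles_def by blast
  have dd: "0 < 1 / real d" "1 / real d \<le> 1" "real L \<ge> real X + 2" using d L by auto
  have e: "(of_int i - 1) / real d = of_int i / d - 1 / d" "(of_int i + 2) / real d = (of_int i + 1) / d + 1 / d"
    by (auto simp: diff_divide_distrib add_divide_distrib)
  from i show False
  proof
    assume "i \<ge> int (L * d)"
    then have "real L * real d \<le> of_int i" by (metis of_int_le_iff of_int_of_nat_eq of_nat_mult)
    then have "real L \<le> of_int i / d" using d by (simp add: field_simps)
    then show False using X[OF x(1)] x(2) dd unfolding e by linarith
  next
    assume "i < - int (L * d)"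
    then have "i + 1 \<le> - int (L * d)" by simp
    then have "of_int (i + 1) \<le> - (real L * real d)" by (metis of_int_le_iff of_int_minus of_int_of_nat_eq of_nat_mult)
    then have "(of_int i + 1) / real d \<le> - real L" using d by (simp add: field_simps)
    then show False using X[OF x(1)] x(3) dd unfolding e by linarith
  qed
qed

text \<open>No tile reaches the sides of such a box, so the middle piece is present and the three
  pieces join to the full segment.\<close>

lemma side_bounded:
  assumes X: "\<And>x. ereal x \<in> K \<Longrightarrow> \<bar>x\<bar> < real X" and inf: "K \<inter> {\<infinity>, -\<infinity>} = {}"
    and d: "d \<ge> 1" and p: "p \<ge> 2" and L: "L \<ge> X + 2" and F: "F \<in> OV \<nu> K" and z: "z \<in> irr_pts"
    and j: "j = int (L * d) \<or> j = - int (L * d)"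
  shows "side d F j p z = seg kern F (Complex (of_int j / d) (- real p)) (Complex (of_int j / d) (real p)) z"
proof -
  have nt: "\<not> (j - 1 \<in> tiles d \<and> j \<in> tiles d)"
    using bounded_tiles[OF X inf d L, of j] bounded_tiles[OF X inf d L, of "j - 1"] j by auto
  have jr: "of_int j / real d = real L \<or> of_int j / real d = - real L" using j d by auto
  have dp: "0 < 1 / real d" "1 / real d \<le> real p" "- real p \<le> - 1 / real d"
  proof -
    have "1 / real d \<le> 1" "2 \<le> real p" using d p by auto
    then show "1 / real d \<le> real p" "- real p \<le> - 1 / real d" by linarith+
    show "0 < 1 / real d" using d by simp
  qed
  have av: "closed_segment (Complex (of_int j / d) a) (Complex (of_int j / d) b) \<inter> cpart K = {}" for a b
    using X jr L by (fastforce simp: closed_segment_same_Re cpart_def)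
  have sp: "seg kern F (Complex (of_int j / d) a) (Complex (of_int j / d) b) z =
     seg kern F (Complex (of_int j / d) a) (Complex (of_int j / d) c) z + seg kern F (Complex (of_int j / d) c) (Complex (of_int j / d) b) z"
    if "a \<le> c" "c \<le> b" for a b c
    using that by (intro seg_split kern_holomorphic F_continuous[OF F av] irr_pts_not_vertical[OF z]) (auto simp: closed_segment_vertical)
  have "vert d F j z = seg kern F (Complex (of_int j / d) (- 1 / d)) (Complex (of_int j / d) (1 / d)) z"
    unfolding vert_def using nt by (rule if_not_P)
  moreover have "- 1 / real d \<le> real p" using dp by linarith
  moreover have "- 1 / real d \<le> 1 / real d" using dp by simp
  ultimately show ?thesis unfolding side_def using sp[of "- real p" "- 1 / d" "real p"] sp[of "- 1 / d" "1 / d" "real p"] dp by simp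
qed

text \<open>The estimate comes from compactness: near K one fixed box of half width L1 is used. A
  point farther out needs a box that contains it, hence the case distinction in R. No tile lies
  beyond L1, so \<open>psum\<close> is constant in L from there on and both choices satisfy the
  contour identity.\<close>

lemma inner_data_bounded:
  assumes inf: "K \<inter> {\<infinity>, -\<infinity>} = {}"
  obtains R where "inner_data R"
proof -
  obtain a b where "\<And>x. ereal x \<in> K \<Longrightarrow> x \<le> a" "\<And>x. ereal x \<in> K \<Longrightarrow> b \<le> x"
    using PInf_bound[OF closed_K] MInf_bound[OF closed_K] inf by (metis Int_iff empty_iff insertCI)
  moreover obtain X :: nat where "real X > \<bar>a\<bar> + \<bar>b\<bar>" using reals_Archimedean2 by blast
  ultimately have X: "\<bar>x\<bar> < real X" if "ereal x \<in> K" for x using that by fastforce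
  \<comment> \<open>Room for two margins: the neighbourhood N of K used below is bounded by X + 2,
    the sides of the box lie at X + 4.\<close>
  define L1 where "L1 = X + 4"
  define R where "R p L F z = rect F (if \<bar>Re z\<bar> < real L1 - 1 then L1 else L) p z" for p L F z
  have ident: "psum d F L z - 2 * pi * \<i> * F z = rect F L p z"
    if F: "F \<in> OV \<nu> K" and p: "2 \<le> p" and d: "1 \<le> d" and z: "z \<in> irr_pts" "\<bar>Im z\<bar> < real p" "\<forall>i\<in>tiles d. z \<notin> tile d i"
      and L: "L \<ge> L1" "\<bar>Re z\<bar> < real L" for F p d z L
  proof -
    have Fh: "F holomorphic_on - cpart K" using F by (simp add: OV_def)
    have L2: "L \<ge> X + 2" using L by (simp add: L1_def)
    have j: "of_int (int (L * d)) / real d = real L" "of_int (- int (L * d)) / real d = - real L" using d by auto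
    have "side d F (int (L * d)) p z = seg kern F (Complex (real L) (- real p)) (Complex (real L) (real p)) z"
      using side_bounded[OF X inf d p L2 F z(1), of "int (L * d)"] unfolding j by simp
    moreover have "side d F (- int (L * d)) p z = seg kern F (Complex (- real L) (- real p)) (Complex (- real L) (real p)) z"
      using side_bounded[OF X inf d p L2 F z(1), of "- int (L * d)"] unfolding j by simp
    ultimately show ?thesis using key_identity[OF Fh d p z(1) L(2) z(2)] z(3) unfolding rect_def by simp
  qed
  have "inner_data R"
    unfolding inner_data_def
  proof (intro conjI ballI allI impI)
    fix F and p d :: nat and z
    assume F: "F \<in> OV \<nu> K" and p: "2 \<le> p" and d: "1 \<le> d" and z: "z \<in> irr_pts" "\<bar>Im z\<bar> < real p" "\<forall>i\<in>tiles d. z \<notin> tile d i"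
    obtain L2 :: nat where L2: "real L2 > \<bar>Re z\<bar> + real L1" using reals_Archimedean2 by blast
    have "psum d F L z - 2 * pi * \<i> * F z - R p L F z = 0" if "L \<ge> L2" for L
    proof -
      have L: "\<bar>Re z\<bar> + real L1 < real L" using that L2 by (meson less_le_trans of_nat_le_iff)
      have LL1: "L \<ge> L1" using L abs_ge_zero[of "Re z"] by linarith
      show ?thesis
      proof (cases "\<bar>Re z\<bar> < real L1 - 1")
        case True
        have "psum d F L z - psum d F L1 z = 0"
          unfolding psum_diff[OF LL1] by (rule sum.neutral) (use bounded_tiles[OF X inf d, of L1] in \<open>auto simp: L1_def\<close>)
        then show ?thesis using ident[OF F p d z, of L1] True by (simp add: R_def)
      next
        case False
        then show ?thesis using ident[OF F p d z LL1] L by (simp add: R_def)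
      qed
    qed
    then show "(\<lambda>L. psum d F L z - 2 * pi * \<i> * F z - R p L F z) \<longlonglongrightarrow> 0"
      by (intro tendsto_eventually) (auto simp: eventually_sequentially)
  next
    fix n :: nat assume n: "2 \<le> n"
    define N where "N = {z. \<bar>Re z\<bar> < real L1 - 2} \<inter> {z. \<bar>Im z\<bar> < 1}"
    \<comment> \<open>A radius that exceeds the modulus of all points of N and of the box boundary,
      and of all their differences.\<close>
    define r where "r = 2 * real L1 + 10"
    have "compact (g ` cball 0 r)"
      by (intro compact_continuous_image continuous_on_subset[OF holomorphic_on_imp_continuous_on[OF g_entire]]) auto
    then have "bounded (g ` cball 0 r)" by (rule compact_imp_bounded)
    then obtain G where "\<forall>w\<in>cball 0 r. cmod (g w) \<le> G" unfolding bounded_iff by auto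
    then have G: "\<And>w. cmod w \<le> r \<Longrightarrow> cmod (g w) \<le> G" by auto
    have G0: "0 \<le> G" using G[of 0] by (auto simp: r_def intro: order_trans[OF norm_ge_zero])
    have "compact ((\<lambda>z. 1 / \<nu> 3 z) ` cball 0 r)" "compact (\<nu> n ` cball 0 r)"
      using \<nu>_pos[of 3] n by (auto intro!: compact_continuous_image continuous_intros weights_continuous[OF weights] simp: less_le)
    then have "bounded ((\<lambda>z. 1 / \<nu> 3 z) ` cball 0 r)" "bounded (\<nu> n ` cball 0 r)" by (auto intro: compact_imp_bounded)
    then obtain A B where "\<forall>w\<in>cball 0 r. \<bar>1 / \<nu> 3 w\<bar> \<le> A" and "\<forall>w\<in>cball 0 r. \<bar>\<nu> n w\<bar> \<le> B"
      unfolding bounded_iff real_norm_def ball_simps by blast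
    then have "\<And>w. cmod w \<le> r \<Longrightarrow> \<bar>1 / \<nu> 3 w\<bar> \<le> A" "\<And>w. cmod w \<le> r \<Longrightarrow> \<bar>\<nu> n w\<bar> \<le> B" by auto
    then have A: "1 / \<nu> 3 w \<le> A" and B: "\<nu> n w \<le> B" if "cmod w \<le> r" for w
      using that abs_le_D1 by blast+
    have A0: "0 \<le> A"
    proof -
      have "0 < 1 / \<nu> 3 0" using \<nu>_pos[of 3 0] by simp
      also have "\<dots> \<le> A" by (rule A) (simp add: r_def)
      finally show ?thesis by simp
    qed
    have B0: "0 < B" using B[of 0] \<nu>_pos[of n 0] n by (auto simp: r_def)
    \<comment> \<open>4 * L1 + 8 is the perimeter of the box of half width L1 and half height 2; the
      summand 1 makes C positive.\<close>
    define C where "C = (A * G * (4 * real L1 + 8) + 1) * B"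
    have n1: "1 / real n \<le> 1 / 2" using n by simp
    have Lr: "real L1 \<ge> 4" "real L1 = real X + 4" by (auto simp: L1_def)
    have cl: "closure (U_nbhd (real n) K) \<subseteq> N"
    proof
      fix z assume z: "z \<in> closure (U_nbhd (real n) K)"
      have "\<bar>Im z\<bar> < 1" using z not_in_closure_U_Im[of "real n" z K] n1 by linarith
      moreover have "\<bar>Re z\<bar> < real L1 - 2"
      proof (rule ccontr)
        assume h: "\<not> \<bar>Re z\<bar> < real L1 - 2"
        have "z \<notin> closure (U_nbhd (real n) K)"
        proof (rule not_in_closure_U_I[of 1])
          fix x assume x: "ereal x \<in> K"
          have "2 \<le> \<bar>Re z - x\<bar>" using X[OF x] h Lr by auto
          then show "1 / real n + 1 \<le> dist z (complex_of_real x)" using abs_Re_le_dist[of z x] n1 by linarith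
        qed (use inf in auto)
        then show False using z by blast
      qed
      ultimately show "z \<in> N" by (simp add: N_def)
    qed
    have op: "open N" unfolding N_def by (intro open_Int open_Collect_less continuous_intros)
    show "\<exists>p N q C L1. inner_est R n p N q C L1"
    proof (intro exI)
      show "inner_est R n 2 N 3 C L1"
        unfolding inner_est_def
      proof (intro conjI ballI allI impI)
        show "U_nbhd (real n) K \<subseteq> N" "closure (U_nbhd (real n) K) \<inter> irr_pts \<subseteq> N" using cl closure_subset by auto
        show "N \<subseteq> {z. \<bar>Im z\<bar> < real 2}" by (auto simp: N_def)
        show "0 < C" unfolding C_def using A0 G0 B0 by (intro mult_pos_pos add_nonneg_pos mult_nonneg_nonneg) auto
        fix F c L assume F: "F \<in> OV \<nu> K" and c: "(0::real) \<le> c" "\<forall>\<zeta>\<in>S_set (real 3) K. cmod (F \<zeta>) * \<nu> 3 \<zeta> \<le> c"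
        have RN: "R 2 L F z = rect F L1 2 z" if "z \<in> N" for z using that by (simp add: R_def N_def)
        have SS: "\<zeta> \<in> S_set (real 3) K" if \<zeta>: "\<bar>Im \<zeta>\<bar> \<le> 2" "\<bar>Im \<zeta>\<bar> = 2 \<or> \<bar>Re \<zeta>\<bar> = real L1" for \<zeta>
        proof -
          have "\<zeta> \<notin> closure (U_nbhd (real 3) K)"
          proof (cases "\<bar>Im \<zeta>\<bar> = 2")
            case True
            then show ?thesis by (intro not_in_closure_U_Im) simp
          next
            case False
            then have h: "\<bar>Re \<zeta>\<bar> = real L1" using \<zeta> by simp
            show ?thesis
            proof (rule not_in_closure_U_I[of 1])
              fix x assume x: "ereal x \<in> K"
              have "2 \<le> \<bar>Re \<zeta> - x\<bar>" using X[OF x] h Lr by auto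
              then show "1 / real 3 + 1 \<le> dist \<zeta> (complex_of_real x)" using abs_Re_le_dist[of \<zeta> x] by simp
            qed (use inf in auto)
          qed
          then show ?thesis using \<zeta> S_set_eq[of 3 K] by auto
        qed
        have cases: "closed_segment a b \<inter> cpart K = {} \<and> closed_segment a b \<inter> N = {} \<and>
            (\<forall>z\<in>N. cmod (seg kern F a b z) \<le> c * A * G * l)"
          if ab: "cmod (b - a) \<le> l" "\<And>\<zeta>. \<zeta> \<in> closed_segment a b \<Longrightarrow> \<bar>Im \<zeta>\<bar> \<le> 2 \<and> \<bar>Re \<zeta>\<bar> \<le> real L1 \<and> (\<bar>Im \<zeta>\<bar> = 2 \<or> \<bar>Re \<zeta>\<bar> = real L1)" for a b l
        proof (intro conjI ballI)
          show av: "closed_segment a b \<inter> cpart K = {}" using SS ab(2) S_set_disjoint_cpart[of 3 K] by auto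
          show avN: "closed_segment a b \<inter> N = {}" using ab(2) unfolding N_def by fastforce
          fix z assume z: "z \<in> N"
          show "cmod (seg kern F a b z) \<le> c * A * G * l"
          proof (rule seg_bound_2[OF F av ab(1)])
            show "z \<notin> closed_segment a b" using z avN by blast
            show "0 \<le> c * A * G" using c A0 G0 by simp
            fix \<zeta> assume \<zeta>: "\<zeta> \<in> closed_segment a b"
            note h = ab(2)[OF \<zeta>]
            have "\<zeta> \<in> S_set (real 3) K" using SS h by blast
            then have "cmod (F \<zeta>) \<le> c * (1 / \<nu> 3 \<zeta>)" using c(2) \<nu>_pos[of 3 \<zeta>] by (simp add: pos_le_divide_eq)
            also have "\<dots> \<le> c * A"
            proof (intro mult_left_mono A c(1))
              show "cmod \<zeta> \<le> r" using cmod_le[of \<zeta>] h Lr unfolding r_def by linarith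
            qed
            finally have 1: "cmod (F \<zeta>) \<le> c * A" .
            have "1 \<le> \<bar>Im (z - \<zeta>)\<bar> \<or> 1 \<le> \<bar>Re (z - \<zeta>)\<bar>" using h z by (auto simp: N_def)
            then have d: "1 \<le> cmod (z - \<zeta>)" using abs_Im_le_cmod[of "z - \<zeta>"] abs_Re_le_cmod[of "z - \<zeta>"] by linarith
            have "cmod (kern (z - \<zeta>)) \<le> cmod (g (z - \<zeta>))"
              unfolding kern_def norm_divide using d by (simp add: divide_le_eq mult_le_cancel_left1)
            also have "\<dots> \<le> G"
            proof (rule G)
              have "\<bar>Re (z - \<zeta>)\<bar> \<le> 2 * real L1" "\<bar>Im (z - \<zeta>)\<bar> \<le> 3" using h z by (auto simp: N_def)
              then show "cmod (z - \<zeta>) \<le> r" using cmod_le[of "z - \<zeta>"] unfolding r_def by linarith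
            qed
            finally show "cmod (F \<zeta> * kern (z - \<zeta>)) \<le> c * A * G"
              unfolding norm_mult using 1 c A0 by (intro mult_mono) auto
          qed
        qed
        have lh: "cmod (Complex (real L1) y - Complex (- real L1) y) \<le> 2 * real L1" for y
        proof -
          have "Complex (real L1) y - Complex (- real L1) y = of_real (2 * real L1)" by (simp add: complex_eq_iff)
          then show ?thesis by (simp add: norm_mult)
        qed
        have lv: "cmod (Complex y (real 2) - Complex y (- real 2)) \<le> 4" for y
        proof -
          have "Complex y (real 2) - Complex y (- real 2) = 4 * \<i>" by (simp add: complex_eq_iff)
          then show ?thesis by (simp add: norm_mult)
        qed
        have ch: "closed_segment (Complex (- real L1) y) (Complex (real L1) y) \<inter> cpart K = {} \<and>
            closed_segment (Complex (- real L1) y) (Complex (real L1) y) \<inter> N = {} \<and>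
            (\<forall>z\<in>N. cmod (seg kern F (Complex (- real L1) y) (Complex (real L1) y) z) \<le> c * A * G * (2 * real L1))"
          if "\<bar>y\<bar> = real 2" for y
          by (rule cases[OF lh]) (use that in \<open>auto simp: closed_segment_horizontal abs_le_iff\<close>)
        have cv: "closed_segment (Complex x (- real 2)) (Complex x (real 2)) \<inter> cpart K = {} \<and>
            closed_segment (Complex x (- real 2)) (Complex x (real 2)) \<inter> N = {} \<and>
            (\<forall>z\<in>N. cmod (seg kern F (Complex x (- real 2)) (Complex x (real 2)) z) \<le> c * A * G * 4)"
          if "\<bar>x\<bar> = real L1" for x
          by (rule cases[OF lv]) (use that in \<open>auto simp: closed_segment_vertical abs_le_iff\<close>)
        have H: "\<bar>real 2\<bar> = real 2" "\<bar>- real 2\<bar> = real 2" "\<bar>real L1\<bar> = real L1" "\<bar>- real L1\<bar> = real L1" by auto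
        have H1: "closed_segment a b \<inter> cpart K = {} \<and> closed_segment a b \<inter> N = {} \<and>
            (\<forall>z\<in>N. cmod (seg kern F a b z) \<le> c * A * G * l)"
          if "(a, b, l) \<in> {(Complex (- real L1) (real 2), Complex (real L1) (real 2), 2 * real L1),
             (Complex (- real L1) (- real 2), Complex (real L1) (- real 2), 2 * real L1),
             (Complex (real L1) (- real 2), Complex (real L1) (real 2), 4),
             (Complex (- real L1) (- real 2), Complex (- real L1) (real 2), 4)}" for a b l
          using that ch[OF H(1)] ch[OF H(2)] cv[OF H(3)] cv[OF H(4)]
          by (elim insertE emptyE Pair_inject) (hypsubst, assumption)+
        have hol: "seg kern F a b holomorphic_on N" if "closed_segment a b \<inter> cpart K = {} \<and> closed_segment a b \<inter> N = {} \<and>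
            (\<forall>z\<in>N. cmod (seg kern F a b z) \<le> c * A * G * l)" for a b l
          by (rule holomorphic_on_subset[OF seg_holomorphic[OF kern_holomorphic F_continuous[OF F]]]) (use that in auto)
        have "rect F L1 2 holomorphic_on N"
          unfolding rect_def[abs_def] line_def by (intro holomorphic_intros hol[OF H1]) auto
        then show "R 2 L F holomorphic_on N" by (rule holomorphic_transform) (use RN in auto)
        fix z assume z: "z \<in> N"
        have q: "cmod (a - b + c - d) \<le> cmod a + cmod b + cmod c + cmod d" for a b c d :: complex by norm
        have sb: "cmod (seg kern F a b z) \<le> c * A * G * l"
          if "(a, b, l) \<in> {(Complex (- real L1) (real 2), Complex (real L1) (real 2), 2 * real L1),
             (Complex (- real L1) (- real 2), Complex (real L1) (- real 2), 2 * real L1),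
             (Complex (real L1) (- real 2), Complex (real L1) (real 2), 4),
             (Complex (- real L1) (- real 2), Complex (- real L1) (real 2), 4)}" for a b l
          using H1[OF that] z by blast
        have "cmod (rect F L1 2 z) \<le> c * A * G * (2 * real L1) + c * A * G * (2 * real L1) + c * A * G * 4 + c * A * G * 4"
          unfolding rect_def line_def by (intro order_trans[OF q] add_mono sb) auto
        also have "\<dots> = c * (A * G * (4 * real L1 + 8))" by (simp add: algebra_simps)
        also have "\<dots> \<le> c * (A * G * (4 * real L1 + 8) + 1)" using c by (intro mult_left_mono) auto
        finally have 1: "cmod (R 2 L F z) \<le> c * (A * G * (4 * real L1 + 8) + 1)" unfolding RN[OF z] .
        have "\<nu> n z \<le> B" using z cmod_le[of z] by (intro B) (auto simp: N_def r_def)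
        then have "cmod (R 2 L F z) * \<nu> n z \<le> c * (A * G * (4 * real L1 + 8) + 1) * B"
          using 1 \<nu>_pos[of n z] n c A0 G0 by (intro mult_mono) auto
        then show "cmod (R 2 L F z) * \<nu> n z \<le> C * c" by (simp add: C_def mult_ac)
      qed (use op in auto)
    qed
  qed
  then show thesis by (rule that)
qed

end

text \<open>N is the logarithm of r to base a, rounded up. The lower bound makes remainders of order
  1/r; the upper bound turns every exponential in N into a power of r.\<close>

lemma power_choice:
  fixes a r :: real
  assumes "1 < a" "1 \<le> r"
  obtains N where "r \<le> a ^ N" "a ^ N \<le> a * r"
proof -
  define N where "N = (LEAST N. r \<le> a ^ N)"
  have ex: "\<exists>N. r \<le> a ^ N" using real_arch_pow[OF assms(1), of r] less_imp_le by blast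
  then have 1: "r \<le> a ^ N" unfolding N_def by (rule LeastI_ex)
  have "a ^ N \<le> a * r"
  proof (cases N)
    case 0
    then show ?thesis using assms mult_mono[of 1 a 1 r] by simp
  next
    case (Suc N')
    then have "\<not> r \<le> a ^ N'" unfolding N_def by (metis not_less_Least lessI)
    then show ?thesis using Suc assms by simp
  qed
  then show thesis using that 1 by blast
qed

lemma pole_bound_mono:
  assumes "pole_bound b \<rho> A" "0 \<le> \<rho>" "\<rho> \<le> \<rho>'" "A \<le> A'"
  shows "pole_bound b \<rho>' A'"
  unfolding pole_bound_def
proof
  fix t
  have "A * \<rho> ^ t \<le> A' * \<rho>' ^ t"
    using assms pole_bound_nonneg[OF assms(1)] by (intro mult_mono power_mono) auto
  then show "cmod (b t) * fact t \<le> A' * \<rho>' ^ t" using assms(1) unfolding pole_bound_def by (meson order_trans)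
qed

lemma pole_bound_scale:
  assumes "pole_bound b \<rho> A" shows "pole_bound (\<lambda>t. of_real c * b t) \<rho> (\<bar>c\<bar> * A)"
  using assms unfolding pole_bound_def by (auto simp: norm_mult mult.assoc intro!: mult_left_mono)

lemma pole_series_scale:
  assumes "pole_bound b \<rho> A" "k holomorphic_on ball (z - x) R" "0 \<le> \<rho>" "\<rho> < R"
    "\<And>u. u \<in> ball (z - x) R \<Longrightarrow> cmod (k u) \<le> M"
  shows "pole_series k (\<lambda>t. c * b t) x z = c * pole_series k b x z"
  unfolding pole_series_def mult.assoc
  by (rule suminf_mult[OF summable_norm_cancel[OF pole_series_summable[OF assms]]])

text \<open>A finite sequence satisfies the bound for every positive radius, with an uncontrolled
  constant. This serves where only convergence matters and not its rate.\<close>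

lemma pole_bound_finite:
  assumes "0 < \<rho>" obtains A where "pole_bound (\<lambda>t. if t < N then b t else 0) \<rho> A"
proof
  show "pole_bound (\<lambda>t. if t < N then b t else 0) \<rho> (\<Sum>t<N. cmod (b t) * fact t / \<rho> ^ t)"
    unfolding pole_bound_def
  proof
    fix t
    show "cmod (if t < N then b t else 0) * fact t \<le> (\<Sum>t<N. cmod (b t) * fact t / \<rho> ^ t) * \<rho> ^ t"
    proof (cases "t < N")
      case True
      have "cmod (b t) * fact t / \<rho> ^ t \<le> (\<Sum>t<N. cmod (b t) * fact t / \<rho> ^ t)"
        using True assms by (intro member_le_sum) auto
      then show ?thesis using True assms by (simp add: pos_divide_le_eq)
    qed (use assms in \<open>auto intro!: mult_nonneg_nonneg sum_nonneg\<close>)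
  qed
qed

context weighted_kernel
begin

subsection \<open>Decomposition of poles\<close>

text \<open>This is \<open>(\<Omega>)\<close> for a family of functions indexed by \<open>D\<close>, which need not be defined on all
  of the complement of \<open>K\<close> but only near \<open>S_set j K\<close>.\<close>

definition omega_est :: "nat \<Rightarrow> nat \<Rightarrow> 'a set \<Rightarrow> ('a \<Rightarrow> complex \<Rightarrow> complex) \<Rightarrow> bool" where
  "omega_est j k D \<Phi> \<longleftrightarrow> (\<exists>(n::nat) C. C > 0 \<and> (\<forall>r\<ge>1. \<forall>a\<in>D. \<exists>f\<in>OV \<nu> K.
     (\<forall>z\<in>S_set (real k) K. cmod (f z) * \<nu> k z \<le> C * r ^ n) \<and>
     (\<forall>z\<in>S_set (real j) K. cmod (\<Phi> a z - f z) * \<nu> j z \<le> C / r)))"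

lemma omega_est_zero:
  assumes "\<And>a z. a \<in> D \<Longrightarrow> z \<in> S_set (real j) K \<Longrightarrow> \<Phi> a z = 0" shows "omega_est j k D \<Phi>"
  unfolding omega_est_def
  by (rule exI[of _ 0], rule exI[of _ 1]) (use assms OV_zero in \<open>auto intro!: bexI[of _ "\<lambda>z. 0"]\<close>)

lemma omega_est_add:
  assumes jk: "j \<ge> 1" "k \<ge> 1" and "omega_est j k D \<Phi>" "omega_est j k D \<Psi>"
  shows "omega_est j k D (\<lambda>a z. \<Phi> a z + \<Psi> a z)"
proof -
  obtain n C where 1: "C > 0" "\<And>r a. r \<ge> 1 \<Longrightarrow> a \<in> D \<Longrightarrow> \<exists>f\<in>OV \<nu> K.
     (\<forall>z\<in>S_set (real k) K. cmod (f z) * \<nu> k z \<le> C * r ^ n) \<and> (\<forall>z\<in>S_set (real j) K. cmod (\<Phi> a z - f z) * \<nu> j z \<le> C / r)"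
    using assms(3) unfolding omega_est_def by blast
  obtain n' C' where 2: "C' > 0" "\<And>r a. r \<ge> 1 \<Longrightarrow> a \<in> D \<Longrightarrow> \<exists>f\<in>OV \<nu> K.
     (\<forall>z\<in>S_set (real k) K. cmod (f z) * \<nu> k z \<le> C' * r ^ n') \<and> (\<forall>z\<in>S_set (real j) K. cmod (\<Psi> a z - f z) * \<nu> j z \<le> C' / r)"
    using assms(4) unfolding omega_est_def by blast
  show ?thesis
    unfolding omega_est_def
  proof (rule exI[of _ "max n n'"], rule exI[of _ "C + C'"], intro conjI allI impI ballI)
    fix r :: real and a assume r: "r \<ge> 1" and a: "a \<in> D"
    obtain f where f: "f \<in> OV \<nu> K" "\<And>z. z \<in> S_set (real k) K \<Longrightarrow> cmod (f z) * \<nu> k z \<le> C * r ^ n"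
      "\<And>z. z \<in> S_set (real j) K \<Longrightarrow> cmod (\<Phi> a z - f z) * \<nu> j z \<le> C / r" using 1(2)[OF r a] by blast
    obtain h where h: "h \<in> OV \<nu> K" "\<And>z. z \<in> S_set (real k) K \<Longrightarrow> cmod (h z) * \<nu> k z \<le> C' * r ^ n'"
      "\<And>z. z \<in> S_set (real j) K \<Longrightarrow> cmod (\<Psi> a z - h z) * \<nu> j z \<le> C' / r" using 2(2)[OF r a] by blast
    show "\<exists>f\<in>OV \<nu> K. (\<forall>z\<in>S_set (real k) K. cmod (f z) * \<nu> k z \<le> (C + C') * r ^ max n n') \<and>
        (\<forall>z\<in>S_set (real j) K. cmod (\<Phi> a z + \<Psi> a z - f z) * \<nu> j z \<le> (C + C') / r)"
    proof (intro bexI[of _ "\<lambda>z. f z + h z"] conjI ballI)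
      fix z assume z: "z \<in> S_set (real k) K"
      have "cmod (f z + h z) * \<nu> k z \<le> (cmod (f z) + cmod (h z)) * \<nu> k z"
        using \<nu>_pos[OF jk(2), of z] by (intro mult_right_mono norm_triangle_ineq) auto
      also have "\<dots> \<le> C * r ^ n + C' * r ^ n'" using f(2)[OF z] h(2)[OF z] by (simp add: distrib_right)
      also have "\<dots> \<le> C * r ^ max n n' + C' * r ^ max n n'"
        using 1(1) 2(1) r by (intro add_mono mult_left_mono power_increasing) auto
      finally show "cmod (f z + h z) * \<nu> k z \<le> (C + C') * r ^ max n n'" by (simp add: distrib_right)
    next
      fix z assume z: "z \<in> S_set (real j) K"
      have "cmod (\<Phi> a z + \<Psi> a z - (f z + h z)) * \<nu> j z \<le> (cmod (\<Phi> a z - f z) + cmod (\<Psi> a z - h z)) * \<nu> j z"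
        using \<nu>_pos[OF jk(1), of z] norm_triangle_ineq[of "\<Phi> a z - f z" "\<Psi> a z - h z"] by (intro mult_right_mono) (auto simp: algebra_simps)
      then show "cmod (\<Phi> a z + \<Psi> a z - (f z + h z)) * \<nu> j z \<le> (C + C') / r"
        using f(3)[OF z] h(3)[OF z] by (simp add: distrib_right add_divide_distrib)
    qed (rule OV_add[OF weights f(1) h(1)])
  qed (use 1 2 in auto)
qed

lemma omega_est_sum:
  assumes "j \<ge> 1" "k \<ge> 1" "finite I" "\<And>i. i \<in> I \<Longrightarrow> omega_est j k D (\<Phi> i)"
  shows "omega_est j k D (\<lambda>a z. \<Sum>i\<in>I. \<Phi> i a z)"
  using assms(3,4)
proof (induction I rule: finite_induct)
  case empty
  then show ?case by (auto intro: omega_est_zero)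
next
  case (insert i I)
  then show ?case using omega_est_add[OF assms(1,2), of D "\<Phi> i" "\<lambda>a z. \<Sum>i\<in>I. \<Phi> i a z"] by simp
qed

text \<open>Reduces a family to a normalized one: the factor W depends neither on r nor on the
  member of the family, so it changes only the constant.\<close>

lemma omega_est_scale:
  assumes jk: "j \<ge> 1" "k \<ge> 1" and W: "W > 0" and \<Phi>: "omega_est j k D \<Phi>"
    and h: "\<And>a. a \<in> D' \<Longrightarrow> h a \<in> D" "\<And>a z. a \<in> D' \<Longrightarrow> z \<in> S_set (real j) K \<Longrightarrow> \<Psi> a z = of_real W * \<Phi> (h a) z"
  shows "omega_est j k D' \<Psi>"
proof -
  obtain n C where 1: "C > 0" "\<And>r a. r \<ge> 1 \<Longrightarrow> a \<in> D \<Longrightarrow> \<exists>f\<in>OV \<nu> K.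
     (\<forall>z\<in>S_set (real k) K. cmod (f z) * \<nu> k z \<le> C * r ^ n) \<and> (\<forall>z\<in>S_set (real j) K. cmod (\<Phi> a z - f z) * \<nu> j z \<le> C / r)"
    using \<Phi> unfolding omega_est_def by blast
  show ?thesis
    unfolding omega_est_def
  proof (rule exI[of _ n], rule exI[of _ "W * C"], intro conjI allI impI ballI)
    fix r :: real and a assume r: "r \<ge> 1" and a: "a \<in> D'"
    obtain f where f: "f \<in> OV \<nu> K" "\<And>z. z \<in> S_set (real k) K \<Longrightarrow> cmod (f z) * \<nu> k z \<le> C * r ^ n"
      "\<And>z. z \<in> S_set (real j) K \<Longrightarrow> cmod (\<Phi> (h a) z - f z) * \<nu> j z \<le> C / r" using 1(2)[OF r h(1)[OF a]] by blast
    show "\<exists>f\<in>OV \<nu> K. (\<forall>z\<in>S_set (real k) K. cmod (f z) * \<nu> k z \<le> W * C * r ^ n) \<and>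
        (\<forall>z\<in>S_set (real j) K. cmod (\<Psi> a z - f z) * \<nu> j z \<le> W * C / r)"
    proof (intro bexI[of _ "\<lambda>z. of_real W * f z"] conjI ballI)
      fix z assume z: "z \<in> S_set (real k) K"
      show "cmod (of_real W * f z) * \<nu> k z \<le> W * C * r ^ n"
        using mult_left_mono[OF f(2)[OF z], of W] W by (simp add: norm_mult mult.assoc)
    next
      fix z assume z: "z \<in> S_set (real j) K"
      have "\<Psi> a z - of_real W * f z = of_real W * (\<Phi> (h a) z - f z)" using h(2)[OF a z] by (simp add: algebra_simps)
      then show "cmod (\<Psi> a z - of_real W * f z) * \<nu> j z \<le> W * C / r"
        using mult_left_mono[OF f(3)[OF z], of W] W by (simp add: norm_mult mult.assoc)
    qed (rule OV_scale[OF weights f(1)])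
  qed (use 1 W in auto)
qed

text \<open>The outcome of \<open>kern_bound\<close> as a predicate, so that the data belonging to j
  and those belonging to k can be carried through the estimates side by side.\<close>

definition kdata :: "nat \<Rightarrow> nat \<Rightarrow> real \<Rightarrow> bool" where
  "kdata n m B \<longleftrightarrow> n \<ge> 2 \<and> m > n \<and> B > 0 \<and> S_set (real n) K \<inter> U_nbhd (real m) K = {} \<and>
    (\<forall>z\<in>S_set (real n) K. \<forall>\<zeta>\<in>U_nbhd (real m) K. cmod (kern (z - \<zeta>)) * \<nu> n z \<le> B * \<nu> m \<zeta>)"

lemma kdata_exists: "n \<ge> 2 \<Longrightarrow> \<exists>m B. kdata n m B"
  using kern_bound[of n] unfolding kdata_def by metis

text \<open>If u is near z - x, then z - u is near x, so a disc in \<open>U_nbhd m K\<close> around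
  x becomes a disc around z - x that avoids the pole 0. In the bound z enters through its weight
  alone, which cancels against the weight in the seminorm.\<close>

lemma kdata_ball:
  assumes kd: "kdata n m B" and x: "ball x R \<subseteq> U_nbhd (real m) K" and V: "\<And>\<zeta>. \<zeta> \<in> ball x R \<Longrightarrow> \<nu> m \<zeta> \<le> V"
    and z: "z \<in> S_set (real n) K"
  shows "kern holomorphic_on ball (z - x) R" "\<And>u. u \<in> ball (z - x) R \<Longrightarrow> cmod (kern u) \<le> B * V / \<nu> n z"
proof -
  have mem: "z - u \<in> ball x R" if "u \<in> ball (z - x) R" for u
    using that by (simp add: dist_norm algebra_simps norm_minus_commute)
  have "0 \<notin> ball (z - x) R" using mem[of 0] x z kd unfolding kdata_def by auto
  then show "kern holomorphic_on ball (z - x) R" by (intro holomorphic_on_subset[OF kern_holomorphic]) auto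
  fix u assume u: "u \<in> ball (z - x) R"
  have "cmod (kern (z - (z - u))) * \<nu> n z \<le> B * \<nu> m (z - u)"
    using kd z mem[OF u] x unfolding kdata_def by blast
  also have "\<dots> \<le> B * V" using V[OF mem[OF u]] kd unfolding kdata_def by (intro mult_left_mono) auto
  finally show "cmod (kern u) \<le> B * V / \<nu> n z"
    using \<nu>_pos[of n z] kd unfolding kdata_def by (simp add: pos_le_divide_eq)
qed

lemma weight_bounded_ball:
  assumes "m \<ge> 1" obtains V where "V > 0" "\<And>\<zeta>. \<zeta> \<in> cball x R \<Longrightarrow> \<nu> m \<zeta> \<le> V"
proof -
  have "bounded (\<nu> m ` cball x R)"
    by (intro compact_imp_bounded compact_continuous_image weights_continuous[OF weights assms]) auto
  then obtain V where "\<forall>\<zeta>\<in>cball x R. \<bar>\<nu> m \<zeta>\<bar> \<le> V" unfolding bounded_iff by auto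
  then show thesis using that[of "\<bar>V\<bar> + 1"] by fastforce
qed

lemma center_pole_S:
  assumes "kdata n m B" "ball x R \<subseteq> U_nbhd (real m) K" "0 < R" shows "x \<notin> S_set (real n) K"
  using assms unfolding kdata_def by (meson centre_in_ball disjoint_iff subsetD)

lemma pole_sum_weighted_bounded:
  assumes kd: "kdata n m B" and x: "ball x R \<subseteq> U_nbhd (real m) K" "0 < R"
  obtains c where "\<And>z. z \<in> S_set (real n) K \<Longrightarrow> cmod (pole_sum kern b N x z) * \<nu> n z \<le> c"
proof -
  have n: "n \<ge> 1" "m \<ge> 1" using kd unfolding kdata_def by auto
  obtain V where V: "V > 0" "\<And>\<zeta>. \<zeta> \<in> cball x R \<Longrightarrow> \<nu> m \<zeta> \<le> V" using weight_bounded_ball[OF n(2)] by blast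
  obtain A where A: "pole_bound (\<lambda>t. if t < N then b t else 0) 1 A" using pole_bound_finite[of 1 N b] by auto
  show thesis
  proof (rule that)
    fix z assume z: "z \<in> S_set (real n) K"
    note kb = kdata_ball[OF kd x(1) V(2) z]
    have "cmod (pole_sum kern (\<lambda>t. if t < N then b t else 0) N x z) \<le> A * (B * V / \<nu> n z) * (\<Sum>t<N. (1 / R) ^ t)"
      by (rule pole_sum_bound[OF A kb(1) x(2)]) (use kb(2) in auto)
    then show "cmod (pole_sum kern b N x z) * \<nu> n z \<le> A * B * V * (\<Sum>t<N. (1 / R) ^ t)"
      using \<nu>_pos[OF n(1), of z] unfolding pole_sum_truncate by (simp add: field_simps)
  qed
qed

text \<open>Purely qualitative: nothing is said about how f depends on b, N and \<epsilon>.
  Quantitative bounds are obtained for the pole sum itself, and f differs from it by an arbitrarily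
  small amount.\<close>

definition approximable :: "nat \<Rightarrow> complex \<Rightarrow> bool" where
  "approximable k y \<longleftrightarrow> (\<forall>b N \<epsilon>. \<epsilon> > 0 \<longrightarrow> (\<exists>f\<in>OV \<nu> K. \<forall>z\<in>S_set (real k) K. cmod (pole_sum kern b N y z - f z) * \<nu> k z \<le> \<epsilon>))"

text \<open>The series is cut at a degree N of order log r to base 4/3. The disc of radius 4\<delta>
  available for j makes the remainder at most a multiple of (3/4)^N <= 1/r. For k only a disc of
  some radius R is available, on which the partial sum may grow like (3\<delta>/R)^N; being
  exponential in N, this is still a power of r.\<close>

lemma omega_est_base:
  assumes jk: "j \<le> k" and kj: "kdata j mj Bj" and kk: "kdata k mk Bk" and \<delta>: "\<delta> > 0"
    and y: "ball y (4 * \<delta>) \<subseteq> U_nbhd (real mj) K" "ball y R \<subseteq> U_nbhd (real mk) K" "R > 0"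
    and ap: "approximable k y"
  shows "omega_est j k {b. pole_bound b (3 * \<delta>) 1} (\<lambda>b. pole_series kern b y)"
proof -
  have n: "j \<ge> 1" "mj \<ge> 1" "k \<ge> 1" "mk \<ge> 1" and B: "Bj > 0" "Bk > 0" using kj kk unfolding kdata_def by auto
  obtain V where V: "V > 0" "\<And>\<zeta>. \<zeta> \<in> cball y (4 * \<delta>) \<Longrightarrow> \<nu> mj \<zeta> \<le> V" using weight_bounded_ball[OF n(2)] by blast
  obtain V' where V': "V' > 0" "\<And>\<zeta>. \<zeta> \<in> cball y R \<Longrightarrow> \<nu> mk \<zeta> \<le> V'" using weight_bounded_ball[OF n(4)] by blast
  \<comment> \<open>A base of at least 2 bounds the geometric sum by a^N. The exponent s expressing
    a through powers of 4/3 becomes the exponent of r.\<close>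
  define a where "a = max (3 * \<delta> / R) 2"
  have a: "a \<ge> 2" "3 * \<delta> / R \<le> a" by (auto simp: a_def)
  obtain s where s: "a \<le> (4 / 3) ^ s" using real_arch_pow[of "4/3" a] by (auto intro: less_imp_le)
  show ?thesis
    unfolding omega_est_def
  proof (rule exI[of _ s], rule exI[of _ "Bk * V' * (4 / 3) ^ s + 4 * Bj * V + 1"], intro conjI allI impI ballI)
    show "0 < Bk * V' * (4 / 3) ^ s + 4 * Bj * V + 1" using B V V' by (intro add_pos_pos mult_pos_pos) auto
    fix r :: real and b assume r: "r \<ge> 1" and b: "b \<in> {b. pole_bound b (3 * \<delta>) 1}"
    obtain N where N: "r \<le> (4 / 3) ^ N" "(4 / 3) ^ N \<le> 4 / 3 * r" using power_choice[of "4/3" r] r by auto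
    obtain f where f: "f \<in> OV \<nu> K" "\<And>z. z \<in> S_set (real k) K \<Longrightarrow> cmod (pole_sum kern b N y z - f z) * \<nu> k z \<le> 1 / r"
      using ap r unfolding approximable_def by (meson divide_pos_pos less_le_trans zero_less_one)
    have main: "cmod (pole_sum kern b N y z) * \<nu> k z \<le> Bk * V' * (4 / 3) ^ s * r ^ s" if z: "z \<in> S_set (real k) K" for z
    proof -
      note kb = kdata_ball[OF kk y(2) V'(2) z]
      have "(\<Sum>t<N. (3 * \<delta> / R) ^ t) \<le> (\<Sum>t<N. a ^ t)" using a \<delta> y(3) by (intro sum_mono power_mono) auto
      also have "\<dots> \<le> a ^ N"
      proof (induction N)
        case (Suc N)
        have "a ^ N + a ^ N \<le> a * a ^ N" using a mult_right_mono[of 2 a "a ^ N"] by simp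
        then show ?case using Suc by simp
      qed simp
      also have "\<dots> \<le> ((4 / 3) ^ s) ^ N" using s a by (intro power_mono) auto
      also have "\<dots> = ((4 / 3) ^ N) ^ s" by (simp add: power_mult[symmetric] mult.commute)
      also have "\<dots> \<le> (4 / 3 * r) ^ s" using N by (intro power_mono) auto
      finally have S: "(\<Sum>t<N. (3 * \<delta> / R) ^ t) \<le> (4 / 3 * r) ^ s" .
      have "cmod (pole_sum kern b N y z) \<le> 1 * (Bk * V' / \<nu> k z) * (\<Sum>t<N. (3 * \<delta> / R) ^ t)"
        by (rule pole_sum_bound[OF _ kb(1) y(3)]) (use kb(2) b in auto)
      also have "\<dots> \<le> 1 * (Bk * V' / \<nu> k z) * (4 / 3 * r) ^ s"
        using S B V' \<nu>_pos[OF n(3), of z] by (intro mult_left_mono) auto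
      finally show ?thesis using \<nu>_pos[OF n(3), of z] by (simp add: field_simps power_mult_distrib)
    qed
    show "\<exists>f\<in>OV \<nu> K. (\<forall>z\<in>S_set (real k) K. cmod (f z) * \<nu> k z \<le> (Bk * V' * (4 / 3) ^ s + 4 * Bj * V + 1) * r ^ s) \<and>
        (\<forall>z\<in>S_set (real j) K. cmod (pole_series kern b y z - f z) * \<nu> j z \<le> (Bk * V' * (4 / 3) ^ s + 4 * Bj * V + 1) / r)"
    proof (intro bexI[OF _ f(1)] conjI ballI)
      fix z assume z: "z \<in> S_set (real k) K"
      have "cmod (f z) * \<nu> k z \<le> (cmod (pole_sum kern b N y z) + cmod (pole_sum kern b N y z - f z)) * \<nu> k z"
        using \<nu>_pos[OF n(3), of z] norm_triangle_sub[of "f z" "pole_sum kern b N y z"]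
        by (intro mult_right_mono) (auto simp: norm_minus_commute)
      also have "\<dots> \<le> Bk * V' * (4 / 3) ^ s * r ^ s + 1 / r" using main[OF z] f(2)[OF z] by (simp add: distrib_right)
      also have "\<dots> \<le> Bk * V' * (4 / 3) ^ s * r ^ s + (4 * Bj * V * r ^ s + r ^ s)"
      proof -
        have "1 / r \<le> 1" "1 \<le> r ^ s" "0 \<le> 4 * Bj * V * r ^ s" using r B V by auto
        then show ?thesis by linarith
      qed
      finally show "cmod (f z) * \<nu> k z \<le> (Bk * V' * (4 / 3) ^ s + 4 * Bj * V + 1) * r ^ s" by (simp add: algebra_simps)
    next
      fix z assume z: "z \<in> S_set (real j) K"
      note kb = kdata_ball[OF kj y(1) V(2) z]
      have \<nu>z: "0 < \<nu> j z" "\<nu> j z \<le> \<nu> k z" using \<nu>_pos[OF n(1)] \<nu>_mono[OF n(1) jk] by auto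
      have zk: "z \<in> S_set (real k) K" using z S_set_mono[OF n(1) jk] by blast
      have "cmod (pole_series kern b y z - pole_sum kern b N y z) \<le> 1 * (Bj * V / \<nu> j z) * (3 * \<delta> / (4 * \<delta>)) ^ N / (1 - 3 * \<delta> / (4 * \<delta>))"
        by (rule pole_series_minus_sum[OF _ kb(1)]) (use kb(2) b \<delta> in auto)
      also have "3 * \<delta> / (4 * \<delta>) = 3 / 4" using \<delta> by simp
      also have "1 * (Bj * V / \<nu> j z) * (3 / 4) ^ N / (1 - 3 / 4) = 4 * (Bj * V / \<nu> j z) * (3 / 4) ^ N" by simp
      also have "\<dots> \<le> 4 * (Bj * V / \<nu> j z) * (1 / r)"
      proof (rule mult_left_mono)
        have "(3 / 4 :: real) ^ N = 1 / (4 / 3) ^ N" by (simp add: power_divide)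
        also have "\<dots> \<le> 1 / r" using N(1) r by (intro divide_left_mono mult_pos_pos) auto
        finally show "(3 / 4 :: real) ^ N \<le> 1 / r" .
      qed (use B V \<nu>z in auto)
      finally have "cmod (pole_series kern b y z - pole_sum kern b N y z) \<le> 4 * (Bj * V / \<nu> j z) * (1 / r)" .
      then have "cmod (pole_series kern b y z - pole_sum kern b N y z) * \<nu> j z \<le> 4 * (Bj * V / \<nu> j z) * (1 / r) * \<nu> j z"
        using \<nu>z by (intro mult_right_mono) auto
      also have "\<dots> = 4 * Bj * V / r" using \<nu>z by simp
      finally have 1: "cmod (pole_series kern b y z - pole_sum kern b N y z) * \<nu> j z \<le> 4 * Bj * V / r" .
      have "cmod (pole_sum kern b N y z - f z) * \<nu> j z \<le> cmod (pole_sum kern b N y z - f z) * \<nu> k z"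
        using \<nu>z by (intro mult_left_mono) auto
      then have 2: "cmod (pole_sum kern b N y z - f z) * \<nu> j z \<le> 1 / r" using f(2)[OF zk] by simp
      have "cmod (pole_series kern b y z - f z) * \<nu> j z \<le>
         (cmod (pole_series kern b y z - pole_sum kern b N y z) + cmod (pole_sum kern b N y z - f z)) * \<nu> j z"
        using \<nu>z norm_triangle_ineq[of "pole_series kern b y z - pole_sum kern b N y z" "pole_sum kern b N y z - f z"]
        by (intro mult_right_mono) auto
      also have "\<dots> \<le> 4 * Bj * V / r + 1 / r" using 1 2 by (simp add: distrib_right)
      also have "\<dots> \<le> (Bk * V' * (4 / 3) ^ s + 4 * Bj * V + 1) / r"
        unfolding add_divide_distrib[symmetric] using r B V' by (intro divide_right_mono) auto
      finally show "cmod (pole_series kern b y z - f z) * \<nu> j z \<le> (Bk * V' * (4 / 3) ^ s + 4 * Bj * V + 1) / r" .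
    qed
  qed
qed

text \<open>Truncation at N allows the radius to shrink from 3\<delta> to \<delta> at the cost 3^N,
  and the shift by at most 2\<delta> brings it back to 3\<delta>. So the new coefficients belong to
  the same class up to a factor A, a power of r. Using the estimate at y with A r in place of r
  compensates this factor.\<close>

lemma omega_est_step:
  assumes k: "k \<ge> 1" and kj: "kdata j mj Bj" and \<delta>: "\<delta> > 0"
    and x: "ball x (4 * \<delta>) \<subseteq> U_nbhd (real mj) K" and y: "ball y (4 * \<delta>) \<subseteq> U_nbhd (real mj) K"
    and xy: "cmod (y - x) \<le> 2 * \<delta>"
    and est: "omega_est j k {b. pole_bound b (3 * \<delta>) 1} (\<lambda>b. pole_series kern b y)"
  shows "omega_est j k {b. pole_bound b (3 * \<delta>) 1} (\<lambda>b. pole_series kern b x)"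
proof -
  have n: "j \<ge> 1" "mj \<ge> 1" and B: "Bj > 0" using kj unfolding kdata_def by auto
  obtain V where V: "V > 0" "\<And>\<zeta>. \<zeta> \<in> cball x (4 * \<delta>) \<Longrightarrow> \<nu> mj \<zeta> \<le> V" using weight_bounded_ball[OF n(2)] by blast
  obtain V' where V': "V' > 0" "\<And>\<zeta>. \<zeta> \<in> cball y (4 * \<delta>) \<Longrightarrow> \<nu> mj \<zeta> \<le> V'" using weight_bounded_ball[OF n(2)] by blast
  obtain n' C where C: "C > 0" "\<And>r a. r \<ge> 1 \<Longrightarrow> pole_bound a (3 * \<delta>) 1 \<Longrightarrow> \<exists>f\<in>OV \<nu> K.
     (\<forall>z\<in>S_set (real k) K. cmod (f z) * \<nu> k z \<le> C * r ^ n') \<and> (\<forall>z\<in>S_set (real j) K. cmod (pole_series kern a y z - f z) * \<nu> j z \<le> C / r)"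
    using est unfolding omega_est_def by blast
  define D where "D = (4 / 3 :: real) ^ (4 * (n' + 1))"
  have D1: "1 \<le> D" unfolding D_def by (rule one_le_power) simp
  show ?thesis
    unfolding omega_est_def
  proof (rule exI[of _ "4 * (n' + 1) + n'"], rule exI[of _ "C * D + 4 * Bj * V"], intro conjI allI impI ballI)
    show "0 < C * D + 4 * Bj * V" using B V C D1 by (intro add_pos_pos mult_pos_pos) auto
    fix r :: real and b assume r: "r \<ge> 1" and b: "b \<in> {b. pole_bound b (3 * \<delta>) 1}"
    obtain N where N: "r \<le> (4 / 3) ^ N" "(4 / 3) ^ N \<le> 4 / 3 * r" using power_choice[of "4/3" r] r by auto
    \<comment> \<open>As (4/3)^4 > 3, the truncation cost 3^N is at most the fourth power of
      (4/3)^N.\<close>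
    define A where "A = (4 / 3 * r) ^ 4"
    have A1: "1 \<le> A" unfolding A_def using r by (intro one_le_power) simp
    have "(3::real) ^ N \<le> ((4 / 3) ^ 4) ^ N" by (intro power_mono) (auto simp: power4_eq_xxxx)
    also have "\<dots> = ((4 / 3) ^ N) ^ 4" by (simp add: power_mult[symmetric] mult.commute)
    also have "\<dots> \<le> A" unfolding A_def using N by (intro power_mono) auto
    finally have 3: "3 ^ N \<le> A" .
    define b1 where "b1 t = (if t < N then b t else 0)" for t
    define b2 where "b2 = pole_shift b1 N (y - x)"
    define b3 where "b3 t = of_real (1 / A) * b2 t" for t
    have "pole_bound b1 \<delta> (1 * (3 * \<delta> / \<delta>) ^ N)" unfolding b1_def[abs_def] using b \<delta> by (intro pole_bound_truncate) auto
    then have "pole_bound b2 (\<delta> + cmod (y - x)) (1 * (3 * \<delta> / \<delta>) ^ N)" unfolding b2_def using \<delta> by (intro pole_bound_shift) auto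
    then have b2: "pole_bound b2 (3 * \<delta>) A" using 3 \<delta> xy by (elim pole_bound_mono) auto
    then have b3: "pole_bound b3 (3 * \<delta>) 1"
      using pole_bound_scale[OF b2, of "1 / A"] A1 unfolding b3_def[abs_def] by simp
    have Ar: "1 \<le> A * r" using A1 r mult_mono[of 1 A 1 r] by simp
    obtain f where f: "f \<in> OV \<nu> K" "\<And>z. z \<in> S_set (real k) K \<Longrightarrow> cmod (f z) * \<nu> k z \<le> C * (A * r) ^ n'"
      "\<And>z. z \<in> S_set (real j) K \<Longrightarrow> cmod (pole_series kern b3 y z - f z) * \<nu> j z \<le> C / (A * r)" using C(2)[OF Ar b3] by blast
    show "\<exists>f\<in>OV \<nu> K. (\<forall>z\<in>S_set (real k) K. cmod (f z) * \<nu> k z \<le> (C * D + 4 * Bj * V) * r ^ (4 * (n' + 1) + n')) \<and>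
        (\<forall>z\<in>S_set (real j) K. cmod (pole_series kern b x z - f z) * \<nu> j z \<le> (C * D + 4 * Bj * V) / r)"
    proof (intro bexI[of _ "\<lambda>z. of_real A * f z"] conjI ballI)
      show "(\<lambda>z. of_real A * f z) \<in> OV \<nu> K" by (rule OV_scale[OF weights f(1)])
      fix z assume z: "z \<in> S_set (real k) K"
      have "cmod (of_real A * f z) * \<nu> k z \<le> A * (C * (A * r) ^ n')"
        using mult_left_mono[OF f(2)[OF z], of A] A1 by (simp add: norm_mult mult.assoc)
      also have "\<dots> = C * (A ^ (n' + 1) * r ^ n')" by (simp add: power_mult_distrib)
      also have "A ^ (n' + 1) = D * r ^ (4 * (n' + 1))"
        unfolding A_def D_def power_mult[symmetric] by (rule power_mult_distrib)
      also have "C * (D * r ^ (4 * (n' + 1)) * r ^ n') = C * D * r ^ (4 * (n' + 1) + n')" by (simp only: power_add mult.assoc)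
      also have "\<dots> \<le> (C * D + 4 * Bj * V) * r ^ (4 * (n' + 1) + n')" using r B V by (intro mult_right_mono) auto
      finally show "cmod (of_real A * f z) * \<nu> k z \<le> (C * D + 4 * Bj * V) * r ^ (4 * (n' + 1) + n')" .
    next
      fix z assume z: "z \<in> S_set (real j) K"
      note kb = kdata_ball[OF kj x V(2) z] and kb' = kdata_ball[OF kj y V'(2) z]
      have \<nu>z: "0 < \<nu> j z" using \<nu>_pos[OF n(1)] by auto
      have "cmod (pole_series kern b x z - pole_sum kern b N x z) \<le> 1 * (Bj * V / \<nu> j z) * (3 * \<delta> / (4 * \<delta>)) ^ N / (1 - 3 * \<delta> / (4 * \<delta>))"
        by (rule pole_series_minus_sum[OF _ kb(1)]) (use kb(2) b \<delta> in auto)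
      also have "3 * \<delta> / (4 * \<delta>) = 3 / 4" using \<delta> by simp
      also have "1 * (Bj * V / \<nu> j z) * (3 / 4) ^ N / (1 - 3 / 4) = 4 * (Bj * V / \<nu> j z) * (3 / 4) ^ N" by simp
      also have "\<dots> \<le> 4 * (Bj * V / \<nu> j z) * (1 / r)"
      proof (rule mult_left_mono)
        have "(3 / 4 :: real) ^ N = 1 / (4 / 3) ^ N" by (simp add: power_divide)
        also have "\<dots> \<le> 1 / r" using N(1) r by (intro divide_left_mono mult_pos_pos) auto
        finally show "(3 / 4 :: real) ^ N \<le> 1 / r" .
      qed (use B V \<nu>z in auto)
      finally have "cmod (pole_series kern b x z - pole_sum kern b N x z) \<le> 4 * (Bj * V / \<nu> j z) * (1 / r)" .
      then have "cmod (pole_series kern b x z - pole_sum kern b N x z) * \<nu> j z \<le> 4 * (Bj * V / \<nu> j z) * (1 / r) * \<nu> j z"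
        using \<nu>z by (intro mult_right_mono) auto
      also have "\<dots> = 4 * Bj * V / r" using \<nu>z by simp
      finally have 1: "cmod (pole_series kern b x z - pole_sum kern b N x z) * \<nu> j z \<le> 4 * Bj * V / r" .
      have "pole_sum kern b N x z = pole_series kern b2 y z"
        unfolding b2_def using pole_sum_shift[OF kb'(1), of x b1 N] xy \<delta> pole_sum_truncate[of kern N b x z]
        unfolding b1_def[abs_def] by simp
      also have "\<dots> = of_real A * pole_series kern b3 y z"
      proof -
        have "pole_series kern (\<lambda>t. of_real A * b3 t) y z = of_real A * pole_series kern b3 y z"
          by (rule pole_series_scale[OF b3 kb'(1)]) (use kb'(2) \<delta> in auto)
        then show ?thesis using A1 by (simp add: b3_def)
      qed
      finally have "pole_sum kern b N x z - of_real A * f z = of_real A * (pole_series kern b3 y z - f z)"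
        by (simp add: algebra_simps)
      then have 2: "cmod (pole_sum kern b N x z - of_real A * f z) * \<nu> j z \<le> C / r"
        using mult_left_mono[OF f(3)[OF z], of A] A1 r by (simp add: norm_mult mult.assoc)
      have "cmod (pole_series kern b x z - of_real A * f z) * \<nu> j z \<le>
         (cmod (pole_series kern b x z - pole_sum kern b N x z) + cmod (pole_sum kern b N x z - of_real A * f z)) * \<nu> j z"
        using \<nu>z norm_triangle_ineq[of "pole_series kern b x z - pole_sum kern b N x z" "pole_sum kern b N x z - of_real A * f z"]
        by (intro mult_right_mono) auto
      also have "\<dots> \<le> 4 * Bj * V / r + C / r" using 1 2 by (simp add: distrib_right)
      also have "\<dots> = (C * 1 + 4 * Bj * V) / r" by (simp add: add_divide_distrib)
      also have "\<dots> \<le> (C * D + 4 * Bj * V) / r" using r C D1 by (intro divide_right_mono add_right_mono mult_left_mono) auto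
      finally show "cmod (pole_series kern b x z - of_real A * f z) * \<nu> j z \<le> (C * D + 4 * Bj * V) / r" .
    qed
  qed
qed

subsection \<open>Pushing poles into \<open>K\<close>\<close>

text \<open>Only smallness of the error matters here, not its relation to the size of the sum. So
  any radius \<rho> > 0 with \<rho> + |y - x| < R will do, and a single shift may be almost as long
  as R.\<close>

lemma pole_move:
  assumes kd: "kdata n m B" and y: "ball y R \<subseteq> U_nbhd (real m) K" "cmod (y - x) < R" and \<epsilon>: "\<epsilon> > 0"
  obtains b' N' where "\<And>z. z \<in> S_set (real n) K \<Longrightarrow> cmod (pole_sum kern b N x z - pole_sum kern b' N' y z) * \<nu> n z \<le> \<epsilon>"
proof -
  have n: "n \<ge> 1" "m \<ge> 1" and B: "B > 0" using kd unfolding kdata_def by auto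
  obtain V where V: "V > 0" "\<And>\<zeta>. \<zeta> \<in> cball y R \<Longrightarrow> \<nu> m \<zeta> \<le> V" using weight_bounded_ball[OF n(2)] by blast
  define \<rho> where "\<rho> = (R - cmod (y - x)) / 2"
  have \<rho>: "\<rho> > 0" "\<rho> + cmod (y - x) < R" using y by (auto simp: \<rho>_def field_simps)
  define b1 where "b1 t = (if t < N then b t else 0)" for t
  obtain A where A: "pole_bound b1 \<rho> A" using pole_bound_finite[OF \<rho>(1), of N b] unfolding b1_def[abs_def] by blast
  define b' where "b' = pole_shift b1 N (y - x)"
  define \<sigma> where "\<sigma> = \<rho> + cmod (y - x)"
  have \<sigma>: "0 \<le> \<sigma>" "\<sigma> < R" "0 < \<sigma>" using \<rho> by (auto simp: \<sigma>_def intro: add_pos_nonneg)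
  have b': "pole_bound b' \<sigma> A" unfolding b'_def \<sigma>_def using A \<rho> by (intro pole_bound_shift) auto
  have "(\<lambda>N'. A * (B * V) * (\<sigma> / R) ^ N' / (1 - \<sigma> / R)) \<longlonglongrightarrow> A * (B * V) * 0 / (1 - \<sigma> / R)"
    using \<sigma> by (intro tendsto_intros LIMSEQ_power_zero) auto
  then have "eventually (\<lambda>N'. A * (B * V) * (\<sigma> / R) ^ N' / (1 - \<sigma> / R) < \<epsilon>) sequentially"
    using \<epsilon> by (intro order_tendstoD) auto
  then obtain N' where N': "A * (B * V) * (\<sigma> / R) ^ N' / (1 - \<sigma> / R) < \<epsilon>" by (auto simp: eventually_sequentially)
  show thesis
  proof (rule that[of b' N'])
    fix z assume z: "z \<in> S_set (real n) K"
    note kb = kdata_ball[OF kd y(1) V(2) z]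
    have "pole_sum kern b N x z = pole_series kern b' y z"
      unfolding b'_def using pole_sum_shift[OF kb(1) y(2), of b1 N] pole_sum_truncate[of kern N b x z]
      unfolding b1_def[abs_def] by simp
    moreover have "cmod (pole_series kern b' y z - pole_sum kern b' N' y z) \<le> A * (B * V / \<nu> n z) * (\<sigma> / R) ^ N' / (1 - \<sigma> / R)"
      by (rule pole_series_minus_sum[OF b' kb(1) \<sigma>(1,2)]) (use kb(2) in auto)
    moreover have "A * (B * V / \<nu> n z) * (\<sigma> / R) ^ N' / (1 - \<sigma> / R) * \<nu> n z = A * (B * V) * (\<sigma> / R) ^ N' / (1 - \<sigma> / R)"
      using \<nu>_pos[OF n(1), of z] by simp
    ultimately show "cmod (pole_sum kern b N x z - pole_sum kern b' N' y z) * \<nu> n z \<le> \<epsilon>"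
      using N' mult_right_mono[of "cmod (pole_series kern b' y z - pole_sum kern b' N' y z)" _ "\<nu> n z"] \<nu>_pos[OF n(1), of z]
      by fastforce
  qed
qed

lemma pole_move_steps:
  assumes kd: "kdata n m B" and R: "h < R" "0 \<le> h" and \<sigma>: "cmod \<sigma> = 1"
    and y: "\<And>i. ball (x + of_nat i * of_real h * \<sigma>) R \<subseteq> U_nbhd (real m) K"
  shows "\<epsilon> > 0 \<Longrightarrow> \<exists>b' N'. \<forall>z\<in>S_set (real n) K. cmod (pole_sum kern b N x z - pole_sum kern b' N' (x + of_nat i * of_real h * \<sigma>) z) * \<nu> n z \<le> \<epsilon>"
proof (induction i arbitrary: \<epsilon>)
  case 0
  then show ?case by (intro exI[of _ b] exI[of _ N]) simp
next
  case (Suc i)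
  let ?p = "\<lambda>i. x + of_nat i * of_real h * \<sigma>"
  have n: "n \<ge> 1" using kd unfolding kdata_def by auto
  obtain b1 N1 where 1: "\<And>z. z \<in> S_set (real n) K \<Longrightarrow> cmod (pole_sum kern b N x z - pole_sum kern b1 N1 (?p i) z) * \<nu> n z \<le> \<epsilon> / 2"
    using Suc.IH[of "\<epsilon> / 2"] Suc.prems by auto
  have "?p (Suc i) - ?p i = of_real h * \<sigma>" by (simp add: algebra_simps)
  then have "cmod (?p (Suc i) - ?p i) < R" using R \<sigma> by (simp add: norm_mult)
  then obtain b2 N2 where 2: "\<And>z. z \<in> S_set (real n) K \<Longrightarrow> cmod (pole_sum kern b1 N1 (?p i) z - pole_sum kern b2 N2 (?p (Suc i)) z) * \<nu> n z \<le> \<epsilon> / 2"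
    using pole_move[OF kd y, of "Suc i" "?p i" "\<epsilon> / 2" b1 N1] Suc.prems by auto
  show ?case
  proof (intro exI[of _ b2] exI[of _ N2] ballI)
    fix z assume z: "z \<in> S_set (real n) K"
    have "cmod (pole_sum kern b N x z - pole_sum kern b2 N2 (?p (Suc i)) z) * \<nu> n z \<le>
      (cmod (pole_sum kern b N x z - pole_sum kern b1 N1 (?p i) z) + cmod (pole_sum kern b1 N1 (?p i) z - pole_sum kern b2 N2 (?p (Suc i)) z)) * \<nu> n z"
      using \<nu>_pos[OF n, of z] norm_triangle_ineq[of "pole_sum kern b N x z - pole_sum kern b1 N1 (?p i) z" "pole_sum kern b1 N1 (?p i) z - pole_sum kern b2 N2 (?p (Suc i)) z"]
      by (intro mult_right_mono) auto
    then show "cmod (pole_sum kern b N x z - pole_sum kern b2 N2 (?p (Suc i)) z) * \<nu> n z \<le> \<epsilon>"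
      using 1[OF z] 2[OF z] unfolding distrib_right by linarith
  qed
qed

text \<open>A pole in K needs no approximation: the pole sum itself, set to 0 on the finite part of
  K, lies in \<open>OV\<close>.\<close>

lemma approximable_K:
  assumes y: "ereal y \<in> K" and k: "k \<ge> 1"
  shows "approximable k (complex_of_real y)"
  unfolding approximable_def
proof (intro allI impI)
  fix b N and \<epsilon> :: real assume \<epsilon>: "\<epsilon> > 0"
  let ?f = "\<lambda>z. if z \<in> cpart K then 0 else pole_sum kern b N (complex_of_real y) z"
  have yc: "complex_of_real y \<in> cpart K" using y by (auto simp: cpart_def)
  have "?f \<in> OV \<nu> K"
  proof (rule OV_I'[OF weights])
    have "pole_sum kern b N (complex_of_real y) holomorphic_on - cpart K"
      by (rule holomorphic_on_subset[OF pole_sum_holomorphic[OF kern_holomorphic]]) (use yc in auto)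
    then show "?f holomorphic_on - cpart K" by (rule holomorphic_transform) auto
    fix n :: nat assume n: "n \<ge> 2"
    obtain m B where kd: "kdata n m B" using kdata_exists[OF n] by blast
    have m: "m > 0" "n \<ge> 1" using kd by (auto simp: kdata_def)
    have "ball (complex_of_real y) (1 / real m) \<subseteq> U_nbhd (real m) K"
      using y by (auto simp: mem_U_nbhd dist_commute)
    then obtain c where "\<And>z. z \<in> S_set (real n) K \<Longrightarrow> cmod (pole_sum kern b N (complex_of_real y) z) * \<nu> n z \<le> c"
      using pole_sum_weighted_bounded[OF kd, of _ "1 / real m" b N] m by auto
    then show "\<exists>c. \<forall>z\<in>S_set (real n) K. cmod (?f z) * \<nu> n z \<le> c"
      using S_set_disjoint_cpart[OF m(2), of K] by (intro exI[of _ c]) auto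
  qed auto
  then show "\<exists>f\<in>OV \<nu> K. \<forall>z\<in>S_set (real k) K. cmod (pole_sum kern b N (complex_of_real y) z - f z) * \<nu> k z \<le> \<epsilon>"
    using \<epsilon> S_set_disjoint_cpart[OF k, of K] by (intro bexI[of _ ?f]) auto
qed

text \<open>The sign lets both infinite ends be treated at once, through points \<sigma> * u with
  large u.\<close>

definition end_sign :: "real \<Rightarrow> bool" where
  "end_sign \<sigma> \<longleftrightarrow> (\<sigma> = 1 \<and> \<infinity> \<in> K) \<or> (\<sigma> = -1 \<and> -\<infinity> \<in> K)"

lemma end_ball:
  assumes \<sigma>: "end_sign \<sigma>" and u: "u \<ge> real m + R" "0 < R" "R \<le> 1 / real m"
  shows "ball (complex_of_real (\<sigma> * u)) R \<subseteq> U_nbhd (real m) K"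
proof
  fix w assume "w \<in> ball (complex_of_real (\<sigma> * u)) R"
  then have w: "dist w (complex_of_real (\<sigma> * u)) < R" by (simp add: dist_commute)
  then have "\<bar>Re w - \<sigma> * u\<bar> < R" "\<bar>Im w\<bar> < 1 / real m"
    using abs_Re_le_dist[of w "\<sigma> * u"] abs_Im_le_dist[of w "\<sigma> * u"] u by linarith+
  then show "w \<in> U_nbhd (real m) K" using \<sigma> u unfolding mem_U_nbhd end_sign_def by auto
qed

lemma pole_move_end:
  assumes kd: "kdata n m B" and \<sigma>: "end_sign \<sigma>" and xy: "x \<ge> real m + 1" "y \<ge> x" and \<epsilon>: "\<epsilon> > 0"
  shows "\<exists>b' N'. \<forall>z\<in>S_set (real n) K. cmod (pole_sum kern b N (complex_of_real (\<sigma> * x)) z -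
    pole_sum kern b' N' (complex_of_real (\<sigma> * y)) z) * \<nu> n z \<le> \<epsilon>"
proof -
  have m: "real m \<ge> 1" using kd unfolding kdata_def by auto
  \<comment> \<open>Enough steps to make each of them shorter than 1/m, the half width of
    \<open>U_nbhd m K\<close> along the end.\<close>
  obtain i :: nat where i: "real i > (y - x) * real m + 1" using reals_Archimedean2 by blast
  have "0 \<le> (y - x) * real m" using xy m by simp
  then have i0: "real i > 0" using i by linarith
  define h where "h = (y - x) / real i"
  have h0: "0 \<le> h" using xy by (simp add: h_def)
  have "(y - x) * real m < real i" using i by simp
  then have hR: "h < 1 / real m" using i0 m by (simp add: h_def field_simps)
  have \<sigma>1: "cmod (complex_of_real \<sigma>) = 1" using \<sigma> by (auto simp: end_sign_def)
  have pt: "complex_of_real (\<sigma> * x) + of_nat i' * of_real h * of_real \<sigma> = complex_of_real (\<sigma> * (x + real i' * h))" for i'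
    by (simp add: algebra_simps)
  have bl: "ball (complex_of_real (\<sigma> * x) + of_nat i' * of_real h * of_real \<sigma>) (1 / real m) \<subseteq> U_nbhd (real m) K" for i'
    unfolding pt
  proof (rule end_ball[OF \<sigma>])
    have "0 \<le> real i' * h" "1 / real m \<le> 1" using h0 m by auto
    then show "real m + 1 / real m \<le> x + real i' * h" using xy by linarith
  qed (use m in auto)
  have "x + real i * h = y" using i0 by (simp add: h_def)
  then have "complex_of_real (\<sigma> * x) + of_nat i * of_real h * of_real \<sigma> = complex_of_real (\<sigma> * y)" unfolding pt by simp
  then show ?thesis using pole_move_steps[OF kd hR h0 \<sigma>1 bl \<epsilon>, of b N i] by simp
qed

text \<open>The pole is moved to infinity in countably many steps, as in the proof of the
  Mittag-Leffler theorem.\<close>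

lemma approximable_end:
  assumes kd: "kdata k mk Bk" and \<sigma>: "end_sign \<sigma>" and y: "y \<ge> real mk + 1"
  shows "approximable k (complex_of_real (\<sigma> * y))"
  unfolding approximable_def
proof (intro allI impI)
  fix b :: "nat \<Rightarrow> complex" and N and \<epsilon> :: real assume \<epsilon>: "\<epsilon> > 0"
  have k2: "k \<ge> 2" using kd by (simp add: kdata_def)
  have "\<forall>s. \<exists>m B. kdata (k + s) m B \<and> (s = 0 \<longrightarrow> m = mk)"
  proof
    fix s show "\<exists>m B. kdata (k + s) m B \<and> (s = 0 \<longrightarrow> m = mk)"
      using kd kdata_exists[of "k + s"] k2 by (cases "s = 0") auto
  qed
  then obtain M Bs where M: "\<And>s. kdata (k + s) (M s) (Bs s)" "M 0 = mk" by metis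
  \<comment> \<open>The s-th pole lies beyond M s + 1, hence inside the neighbourhood of index M s
    and outside \<open>S_set (k + s) K\<close>; s = 0 gives y itself.\<close>
  define x where "x s = y + (\<Sum>i<s. real (M (Suc i)))" for s
  have x_ge: "x s \<ge> real (M s) + 1" for s
  proof (cases s)
    case 0
    then show ?thesis using M(2) y by (simp add: x_def)
  next
    case (Suc s')
    have "real (M (Suc s')) \<le> (\<Sum>i<Suc s'. real (M (Suc i)))" by (rule member_le_sum) auto
    then show ?thesis using y Suc by (simp add: x_def)
  qed
  have x_mono: "s \<le> t \<Longrightarrow> x s \<le> x t" for s t
    unfolding x_def by (intro add_left_mono sum_mono2) auto
  let ?p = "\<lambda>s. complex_of_real (\<sigma> * x s)"
  have "\<forall>s c. \<exists>c'. \<forall>z\<in>S_set (real (k + s)) K. cmod (pole_sum kern (fst c) (snd c) (?p s) z -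
      pole_sum kern (fst c') (snd c') (?p (Suc s)) z) * \<nu> (k + s) z \<le> \<epsilon> / 2 ^ Suc s"
  proof (intro allI)
    fix s and c :: "(nat \<Rightarrow> complex) \<times> nat"
    have "x s \<le> x (Suc s)" by (rule x_mono) simp
    then show "\<exists>c'. \<forall>z\<in>S_set (real (k + s)) K. cmod (pole_sum kern (fst c) (snd c) (?p s) z -
      pole_sum kern (fst c') (snd c') (?p (Suc s)) z) * \<nu> (k + s) z \<le> \<epsilon> / 2 ^ Suc s"
      using pole_move_end[OF M(1) \<sigma> x_ge, of s "x (Suc s)" "\<epsilon> / 2 ^ Suc s" "fst c" "snd c"] \<epsilon> by auto
  qed
  then obtain G where G: "\<And>s c z. z \<in> S_set (real (k + s)) K \<Longrightarrow> cmod (pole_sum kern (fst c) (snd c) (?p s) z -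
      pole_sum kern (fst (G s c)) (snd (G s c)) (?p (Suc s)) z) * \<nu> (k + s) z \<le> \<epsilon> / 2 ^ Suc s" by metis
  \<comment> \<open>Coefficients and degree of the s-th approximant, obtained by moving the previous
    one to the next pole with error \<epsilon> / 2^(s+1) on \<open>S_set (k + s) K\<close>.\<close>
  define q where "q = rec_nat (b, N) G"
  define P where "P s z = pole_sum kern (fst (q s)) (snd (q s)) (?p s) z" for s z
  have Sm: "S_set (real (k + s)) K \<subseteq> S_set (real (k + t)) K" if "s \<le> t" for s t
    using S_set_mono[of "k + s" "k + t" K] that k2 by auto
  have \<nu>p: "0 < \<nu> (k + s) z" for s z using \<nu>_pos k2 by simp
  have step: "cmod (P (Suc t) z - P t z) * \<nu> (k + s) z \<le> \<epsilon> / 2 ^ Suc t" if "s \<le> t" "z \<in> S_set (real (k + s)) K" for s t z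
  proof -
    have "cmod (P (Suc t) z - P t z) * \<nu> (k + s) z \<le> cmod (P (Suc t) z - P t z) * \<nu> (k + t) z"
      using \<nu>_mono[of "k + s" "k + t" z] that k2 by (intro mult_left_mono) auto
    also have "\<dots> \<le> \<epsilon> / 2 ^ Suc t"
      using G[of z t "q t"] Sm[OF that(1)] that(2) by (simp add: P_def q_def norm_minus_commute subset_iff)
    finally show ?thesis .
  qed
  have incr: "cmod (P t' z - P t z) * \<nu> (k + s) z \<le> \<epsilon> / 2 ^ t - \<epsilon> / 2 ^ t'" if "s \<le> t" "t \<le> t'" "z \<in> S_set (real (k + s)) K" for s t t' z
    using that(2)
  proof (induction t' rule: dec_induct)
    case (step t')
    have "cmod (P (Suc t') z - P t z) * \<nu> (k + s) z \<le> (cmod (P (Suc t') z - P t' z) + cmod (P t' z - P t z)) * \<nu> (k + s) z"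
      using \<nu>p[of s z] norm_triangle_ineq[of "P (Suc t') z - P t' z" "P t' z - P t z"] by (intro mult_right_mono) auto
    also have "\<dots> \<le> \<epsilon> / 2 ^ Suc t' + (\<epsilon> / 2 ^ t - \<epsilon> / 2 ^ t')"
      using step.IH \<open>\<And>s t z. s \<le> t \<Longrightarrow> z \<in> S_set (real (k + s)) K \<Longrightarrow> cmod (P (Suc t) z - P t z) * \<nu> (k + s) z \<le> \<epsilon> / 2 ^ Suc t\<close>[of s t' z] step.hyps that
      unfolding distrib_right by (intro add_mono) auto
    also have "\<dots> = \<epsilon> / 2 ^ t - \<epsilon> / 2 ^ Suc t'" by simp
    finally show ?case .
  qed simp
  \<comment> \<open>The negative sign makes the errors an increasing sequence bounded above, as
    \<open>limit_by_increments\<close> requires; its increments are the telescoped errors.\<close>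
  define sq where "sq t = - (\<epsilon> / 2 ^ t)" for t :: nat
  have sq: "incseq sq" "\<And>t. sq t \<le> 0" "sq \<longlonglongrightarrow> 0"
  proof -
    show "incseq sq" unfolding incseq_Suc_iff sq_def using \<epsilon> by (auto simp: field_simps)
    show "\<And>t. sq t \<le> 0" using \<epsilon> by (simp add: sq_def)
    have "(\<lambda>t. - (\<epsilon> * (1 / 2) ^ t)) \<longlonglongrightarrow> - (\<epsilon> * 0)" by (intro tendsto_intros LIMSEQ_power_zero) auto
    then show "sq \<longlonglongrightarrow> 0" by (simp add: sq_def[abs_def] power_divide)
  qed
  have "\<exists>l. \<forall>s t. z \<in> S_set (real (k + s)) K \<longrightarrow> s \<le> t \<longrightarrow> cmod (l - P t z) * \<nu> (k + s) z \<le> \<epsilon> / 2 ^ t" if z: "z \<notin> cpart K" for z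
  proof -
    have lim: "\<exists>l. (\<lambda>t. P t z) \<longlonglongrightarrow> l \<and> (\<forall>t\<ge>s. cmod (l - P t z) * \<nu> (k + s) z \<le> \<epsilon> / 2 ^ t)" if zs: "z \<in> S_set (real (k + s)) K" for s
    proof -
      obtain l where "(\<lambda>t. P t z) \<longlonglongrightarrow> l" "\<And>t. s \<le> t \<Longrightarrow> cmod (l - P t z) \<le> 1 / \<nu> (k + s) z * (lim sq - sq t)"
      proof (rule limit_by_increments[OF sq(1,2), of "1 / \<nu> (k + s) z" s "\<lambda>t. P t z"])
        show "0 \<le> 1 / \<nu> (k + s) z" using \<nu>p[of s z] by simp
        show "cmod (P L' z - P L z) \<le> 1 / \<nu> (k + s) z * (sq L' - sq L)" if "s \<le> L" "L \<le> L'" for L L'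
          using incr[OF that zs] \<nu>p[of s z] by (simp add: sq_def field_simps)
      qed auto
      then show ?thesis using limI[OF sq(3)] \<nu>p[of s z] by (intro exI[of _ l]) (auto simp: sq_def field_simps)
    qed
    obtain n where n: "n \<ge> 2" "z \<in> S_set (real n) K" using S_set_exhaust[OF closed_K z] by blast
    have "z \<in> S_set (real (k + n)) K" using n S_set_mono[of n "k + n" K] by auto
    then obtain l where l: "(\<lambda>t. P t z) \<longlonglongrightarrow> l" using lim by blast
    then show ?thesis using lim LIMSEQ_unique by (intro exI[of _ l]) blast
  qed
  then obtain f0 where f0: "\<And>z s t. z \<notin> cpart K \<Longrightarrow> z \<in> S_set (real (k + s)) K \<Longrightarrow> s \<le> t \<Longrightarrow> cmod (f0 z - P t z) * \<nu> (k + s) z \<le> \<epsilon> / 2 ^ t"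
    by metis
  define f where "f z = (if z \<in> cpart K then 0 else f0 z)" for z
  have f: "cmod (f z - P t z) * \<nu> (k + s) z \<le> \<epsilon> / 2 ^ t" if "z \<in> S_set (real (k + s)) K" "s \<le> t" for z s t
    using f0[OF _ that] S_set_disjoint_cpart[of "k + s" K] that k2 by (auto simp: f_def)
  have ballp: "ball (?p t) (1 / real (M t)) \<subseteq> U_nbhd (real (M t)) K" for t
  proof (rule end_ball[OF \<sigma>])
    have "real (M t) \<ge> 1" using M(1)[of t] by (simp add: kdata_def)
    then show "0 < 1 / real (M t)" "real (M t) + 1 / real (M t) \<le> x t" using x_ge[of t] by (auto intro: order_trans[rotated])
  qed simp
  have Mpos: "0 < 1 / real (M t)" for t using M(1)[of t] by (simp add: kdata_def)
  have pS: "?p t \<notin> S_set (real (k + s)) K" if "s \<le> t" for s t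
    using center_pole_S[OF M(1) ballp Mpos, of t] Sm[OF that] by blast
  \<comment> \<open>From index s on all poles have left \<open>S_set (k + s) K\<close>, and the
    approximants converge locally uniformly there.\<close>
  have hol_s: "f holomorphic_on S_set (real (k + s)) K" for s
  proof (rule holomorphic_uniform_sequence[OF open_S_set, of "\<lambda>i. P (s + i)"])
    show "P (s + i) holomorphic_on S_set (real (k + s)) K" for i
      unfolding P_def[abs_def]
      by (rule holomorphic_on_subset[OF pole_sum_holomorphic[OF kern_holomorphic]]) (use pS[of s "s + i"] in auto)
    fix z assume z: "z \<in> S_set (real (k + s)) K"
    obtain d where d: "d > 0" "cball z d \<subseteq> S_set (real (k + s)) K" using open_S_set open_contains_cball z by blast
    have "compact ((\<lambda>w. 1 / \<nu> (k + s) w) ` cball z d)"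
      using \<nu>p k2 by (intro compact_continuous_image continuous_intros weights_continuous[OF weights]) (auto simp: less_le)
    then have "bounded ((\<lambda>w. 1 / \<nu> (k + s) w) ` cball z d)" by (rule compact_imp_bounded)
    then obtain A where "\<forall>w\<in>cball z d. \<bar>1 / \<nu> (k + s) w\<bar> \<le> A" unfolding bounded_iff by auto
    then have A: "1 / \<nu> (k + s) w \<le> A" if "w \<in> cball z d" for w using that abs_le_D1 by blast
    have ub: "cmod (P (s + i) w - f w) \<le> - A * sq (s + i)" if w: "w \<in> cball z d" for w i
    proof -
      have "cmod (P (s + i) w - f w) \<le> \<epsilon> / 2 ^ (s + i) * (1 / \<nu> (k + s) w)"
        using f[of w s "s + i"] w d \<nu>p[of s w] by (auto simp: norm_minus_commute field_simps)
      also have "\<dots> \<le> \<epsilon> / 2 ^ (s + i) * A" using A[OF w] \<epsilon> by (intro mult_left_mono) auto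
      finally show ?thesis by (simp add: sq_def mult.commute)
    qed
    have "uniform_limit (cball z d) (\<lambda>i. P (s + i)) f sequentially"
    proof (rule uniform_limitI)
      fix e :: real assume e: "e > 0"
      have "(\<lambda>i. - A * sq (i + s)) \<longlonglongrightarrow> - A * 0" by (intro tendsto_intros LIMSEQ_ignore_initial_segment sq(3))
      then have "eventually (\<lambda>i. - A * sq (i + s) < e) sequentially" using e by (intro order_tendstoD) auto
      then show "\<forall>\<^sub>F i in sequentially. \<forall>w\<in>cball z d. dist (P (s + i) w) (f w) < e"
      proof (rule eventually_mono, intro ballI)
        fix i w assume "- A * sq (i + s) < e" "w \<in> cball z d"
        then show "dist (P (s + i) w) (f w) < e" using ub[of w i] by (simp add: dist_norm add.commute)
      qed
    qed
    then show "\<exists>d>0. cball z d \<subseteq> S_set (real (k + s)) K \<and> uniform_limit (cball z d) (\<lambda>i. P (s + i)) f sequentially"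
      using d by blast
  qed
  have "f \<in> OV \<nu> K"
  proof (rule OV_I'[OF weights])
    have "f field_differentiable at z" if "z \<in> - cpart K" for z
    proof -
      obtain n where n: "n \<ge> 2" "z \<in> S_set (real n) K" using S_set_exhaust[OF closed_K, of z] \<open>z \<in> - cpart K\<close> by blast
      then have "z \<in> S_set (real (k + n)) K" using S_set_mono[of n "k + n" K] by auto
      then show ?thesis using hol_s[of n] open_S_set holomorphic_on_imp_differentiable_at by blast
    qed
    then show "f holomorphic_on - cpart K" by (simp add: holomorphic_on_def field_differentiable_at_within)
    show "f z = 0" if "z \<in> cpart K" for z using that by (simp add: f_def)
    fix n :: nat assume n: "n \<ge> 2"
    \<comment> \<open>Truncated subtraction is intended: for n <= k it gives 0, and n <= k + s holds
      in every case.\<close>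
    define s where "s = n - k"
    have ns: "n \<le> k + s" by (simp add: s_def)
    obtain c where c: "\<And>z. z \<in> S_set (real (k + s)) K \<Longrightarrow> cmod (P s z) * \<nu> (k + s) z \<le> c"
      using pole_sum_weighted_bounded[OF M(1) ballp Mpos, of s "fst (q s)" "snd (q s)"] unfolding P_def by blast
    have "cmod (f z) * \<nu> n z \<le> c + \<epsilon> / 2 ^ s" if z: "z \<in> S_set (real n) K" for z
    proof -
      have zs: "z \<in> S_set (real (k + s)) K" using z S_set_mono[of n "k + s" K] n ns by auto
      have "cmod (f z) * \<nu> n z \<le> cmod (f z) * \<nu> (k + s) z"
        using \<nu>_mono[of n "k + s" z] n ns by (intro mult_left_mono) auto
      also have "\<dots> \<le> (cmod (P s z) + cmod (f z - P s z)) * \<nu> (k + s) z"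
        using \<nu>p[of s z] norm_triangle_sub[of "f z" "P s z"] by (intro mult_right_mono) auto
      also have "\<dots> \<le> c + \<epsilon> / 2 ^ s" using c[OF zs] f[OF zs order_refl] unfolding distrib_right by (rule add_mono)
      finally show ?thesis .
    qed
    then show "\<exists>c. \<forall>z\<in>S_set (real n) K. cmod (f z) * \<nu> n z \<le> c" by blast
  qed
  moreover have "cmod (pole_sum kern b N (complex_of_real (\<sigma> * y)) z - f z) * \<nu> k z \<le> \<epsilon>" if "z \<in> S_set (real k) K" for z
    using f[of z 0 0] that by (simp add: P_def q_def x_def norm_minus_commute)
  ultimately show "\<exists>f\<in>OV \<nu> K. \<forall>z\<in>S_set (real k) K. cmod (pole_sum kern b N (complex_of_real (\<sigma> * y)) z - f z) * \<nu> k z \<le> \<epsilon>"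
    by blast
qed

text \<open>A center in K is handled directly. Any other center lies beyond d on an infinite end,
  and steps of length 2\<delta> lead outwards past mk + 1, from where poles can be moved off to
  infinity. The number of steps grows with k and worsens only exponent and constant; the step length
  is 2/d, whatever k is.\<close>

lemma omega_est_near:
  assumes jk: "j \<le> k" and kj: "kdata j mj Bj" and k: "k \<ge> 2" and d: "d \<ge> 4 * mj"
    and x: "ereal x \<in> K \<or> (\<infinity> \<in> K \<and> real d \<le> x) \<or> (-\<infinity> \<in> K \<and> x \<le> - real d)"
  shows "omega_est j k {b. pole_bound b (3 * (1 / d)) 1} (\<lambda>b. pole_series kern b (complex_of_real x))"
proof -
  obtain mk Bk where kk: "kdata k mk Bk" using kdata_exists[OF k] by blast
  have mj: "mj \<ge> 2" and mk: "real mk \<ge> 1" and d1: "d \<ge> 1" using kj kk d by (auto simp: kdata_def)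
  define \<delta> where "\<delta> = 1 / real d"
  have \<delta>: "\<delta> > 0" using d1 by (simp add: \<delta>_def)
  have bl: "ball (complex_of_real x) (4 * \<delta>) \<subseteq> U_nbhd (real mj) K"
    if "ereal x \<in> K \<or> (\<infinity> \<in> K \<and> real d \<le> x) \<or> (-\<infinity> \<in> K \<and> x \<le> - real d)" for x
    using center_ball_subset_U[OF mj d that] by (simp add: \<delta>_def)
  show ?thesis
    unfolding \<delta>_def[symmetric]
  proof (cases "ereal x \<in> K")
    case True
    have "ball (complex_of_real x) (1 / real mk) \<subseteq> U_nbhd (real mk) K"
      using True by (auto simp: mem_U_nbhd dist_commute)
    then show "omega_est j k {b. pole_bound b (3 * \<delta>) 1} (\<lambda>b. pole_series kern b (complex_of_real x))"
      using approximable_K[OF True, of k] k mk by (intro omega_est_base[OF jk kj kk \<delta> bl[OF x], of "1 / real mk"]) auto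
  next
    case False
    define \<sigma> :: real where "\<sigma> = (if \<infinity> \<in> K \<and> real d \<le> x then 1 else - 1)"
    have \<sigma>: "end_sign \<sigma>" "\<sigma> * \<sigma> = 1" "real d \<le> \<sigma> * x" using x False by (auto simp: end_sign_def \<sigma>_def)
    have ends: "ereal (\<sigma> * u) \<in> K \<or> (\<infinity> \<in> K \<and> real d \<le> \<sigma> * u) \<or> (-\<infinity> \<in> K \<and> \<sigma> * u \<le> - real d)" if "u \<ge> real d" for u
      using \<sigma>(1) that by (auto simp: end_sign_def)
    obtain s :: nat where "real s > (real mk + 1) / (2 * \<delta>)" using reals_Archimedean2 by blast
    then have s: "real s * (2 * \<delta>) \<ge> real mk + 1" using \<delta> by (simp add: field_simps)
    \<comment> \<open>The induction runs from the far end of the chain inwards: the last point is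
      the base case, and each step carries the estimate to the preceding point.\<close>
    have chain: "omega_est j k {b. pole_bound b (3 * \<delta>) 1} (\<lambda>b. pole_series kern b (complex_of_real (\<sigma> * u)))"
      if "u \<ge> real d" "u + real i * (2 * \<delta>) \<ge> real mk + 1" for u i
      using that
    proof (induction i arbitrary: u)
      case 0
      have "ball (complex_of_real (\<sigma> * u)) (1 / real mk) \<subseteq> U_nbhd (real mk) K"
      proof (rule end_ball[OF \<sigma>(1)])
        have "1 / real mk \<le> 1" using mk by simp
        then show "real mk + 1 / real mk \<le> u" using 0 by simp
      qed (use mk in auto)
      then show ?case
        using approximable_end[OF kk \<sigma>(1), of u] 0 mk
        by (intro omega_est_base[OF jk kj kk \<delta> bl[OF ends], of u "1 / real mk"]) auto
    next
      case (Suc i)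
      have u': "u + 2 * \<delta> \<ge> real d" using Suc.prems(1) \<delta> by simp
      have "omega_est j k {b. pole_bound b (3 * \<delta>) 1} (\<lambda>b. pole_series kern b (complex_of_real (\<sigma> * (u + 2 * \<delta>))))"
        using Suc.prems u' by (intro Suc.IH) (auto simp: algebra_simps)
      moreover have "complex_of_real (\<sigma> * (u + 2 * \<delta>)) - complex_of_real (\<sigma> * u) = complex_of_real (\<sigma> * (2 * \<delta>))"
        by (simp add: algebra_simps)
      then have "cmod (complex_of_real (\<sigma> * (u + 2 * \<delta>)) - complex_of_real (\<sigma> * u)) \<le> 2 * \<delta>"
        using \<sigma>(1) \<delta> by (auto simp: end_sign_def norm_mult simp del: of_real_mult)
      ultimately show ?case
        using k Suc.prems(1) u' by (intro omega_est_step[OF _ kj \<delta> bl[OF ends] bl[OF ends], of _ u "u + 2 * \<delta>"]) auto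
    qed
    have "real mk + 1 \<le> \<sigma> * x + real s * (2 * \<delta>)" using s \<sigma>(3) by linarith
    then have "omega_est j k {b. pole_bound b (3 * \<delta>) 1} (\<lambda>b. pole_series kern b (complex_of_real (\<sigma> * (\<sigma> * x))))"
      by (rule chain[OF \<sigma>(3)])
    moreover have "\<sigma> * (\<sigma> * x) = x" using \<sigma>(2) by (simp add: mult.assoc[symmetric])
    ultimately show "omega_est j k {b. pole_bound b (3 * \<delta>) 1} (\<lambda>b. pole_series kern b (complex_of_real x))" by simp
  qed
qed

subsection \<open>Tiles near infinity\<close>

definition sup_ball :: "(nat \<Rightarrow> real) \<Rightarrow> nat \<Rightarrow> real \<Rightarrow> real" where
  "sup_ball c n x = (SUP z\<in>cball (complex_of_real x) (c n). \<nu> n z)"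

definition inf_ball :: "(nat \<Rightarrow> real) \<Rightarrow> nat \<Rightarrow> real \<Rightarrow> real" where
  "inf_ball c n x = (INF z\<in>cball (complex_of_real x) (c n). \<nu> n z)"

lemma sup_ball_ge:
  assumes "n \<ge> 1" "z \<in> cball (complex_of_real x) (c n)" shows "\<nu> n z \<le> sup_ball c n x"
  unfolding sup_ball_def
  by (intro cSUP_upper assms compact_imp_bounded[THEN bounded_imp_bdd_above] compact_continuous_image
      weights_continuous[OF weights]) auto

lemma inf_ball_le:
  assumes "n \<ge> 1" "z \<in> cball (complex_of_real x) (c n)" shows "inf_ball c n x \<le> \<nu> n z"
  unfolding inf_ball_def
  by (intro cINF_lower assms compact_imp_bounded[THEN bounded_imp_bdd_below] compact_continuous_image
      weights_continuous[OF weights]) auto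

lemma sup_ball_pos: "n \<ge> 1 \<Longrightarrow> c n > 0 \<Longrightarrow> sup_ball c n x > 0"
  using sup_ball_ge[of n "complex_of_real x" x c] \<nu>_pos[of n "complex_of_real x"] by simp

lemma inf_ball_pos:
  assumes "n \<ge> 1" "c n > 0" shows "inf_ball c n x > 0"
proof -
  obtain z where z: "\<forall>w\<in>cball (complex_of_real x) (c n). \<nu> n z \<le> \<nu> n w"
    using continuous_attains_inf[of "cball (complex_of_real x) (c n)" "\<nu> n"] weights_continuous[OF weights assms(1)] assms(2)
    by auto
  have "\<nu> n z \<le> inf_ball c n x"
    unfolding inf_ball_def using z assms(2) by (intro cINF_greatest) auto
  then show ?thesis using \<nu>_pos[OF assms(1), of z] by simp
qed

text \<open>With \<beta> = ln a / ln A the interpolation exponent is 1 / (1 + \<beta>), so the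
  hypothesis is raised to the power 1 + \<beta>. The resulting form matches a truncation in which
  the decay A^(-N) is traded for the growth a^N = (A^N)^\<beta>.\<close>

lemma three_circles_powr:
  fixes SR SP I A a Cc :: real
  assumes "1 < A" "1 < a" "0 < SR" "0 < SP" "0 < I" "0 < Cc"
    and H: "SR powr (ln A / ln (A * a)) * SP powr (1 - ln A / ln (A * a)) \<le> Cc * I"
  shows "SR / I * (SP / I) powr (ln a / ln A) \<le> Cc powr (1 + ln a / ln A)"
proof -
  define \<beta> where "\<beta> = ln a / ln A"
  have lA: "ln A > 0" "ln a > 0" using assms by auto
  have \<beta>: "\<beta> > 0" unfolding \<beta>_def using lA by simp
  have \<theta>: "ln A / ln (A * a) = 1 / (1 + \<beta>)"
  proof -
    have "ln (A * a) = ln A + ln a" using assms by (simp add: ln_mult)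
    also have "\<dots> = ln A * (1 + \<beta>)" unfolding \<beta>_def using lA by (simp add: field_simps)
    finally show ?thesis using lA by simp
  qed
  have e1: "1 / (1 + \<beta>) * (1 + \<beta>) = 1" "(1 - 1 / (1 + \<beta>)) * (1 + \<beta>) = \<beta>" using \<beta> by (auto simp: field_simps)
  have "(SR powr (1 / (1 + \<beta>)) * SP powr (1 - 1 / (1 + \<beta>))) powr (1 + \<beta>) \<le> (Cc * I) powr (1 + \<beta>)"
    using H assms \<beta> unfolding \<theta> by (intro powr_mono2) auto
  then have "SR * SP powr \<beta> \<le> (Cc * I) powr (1 + \<beta>)"
    using assms \<beta> by (simp add: powr_mult powr_powr e1)
  also have "\<dots> = Cc powr (1 + \<beta>) * (I * I powr \<beta>)" using assms by (simp add: powr_mult powr_add)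
  finally have "SR * SP powr \<beta> / (I * I powr \<beta>) \<le> Cc powr (1 + \<beta>)"
    using assms by (simp add: pos_divide_le_eq)
  moreover have "SR / I * (SP / I) powr \<beta> = SR * SP powr \<beta> / (I * I powr \<beta>)"
    using assms by (simp add: powr_divide)
  ultimately show ?thesis unfolding \<beta>_def by simp
qed

text \<open>The Taylor series at the center of a far tile is truncated at a degree depending on the
  center; the condition \<open>H3CT\<close> is what makes both resulting bounds uniform in the center.\<close>

lemma omega_est_far:
  assumes jk: "j \<le> k" and kj: "kdata j mj Bj" and kk: "kdata k mk Bk"
    and cp: "c p \<le> 1 / real mj" "mj \<le> p" "c p \<le> 1" and cl: "c l \<le> 1 / real mk" "mk \<le> l" "0 < c l"
    and dec: "c q < c p" "c l < c q" and q: "q \<ge> 1" and Cc: "Cc > 0"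
    and H: "\<And>\<zeta>. \<bar>\<zeta>\<bar> \<ge> 1 + inverse (c l) \<Longrightarrow> sup_ball c l \<zeta> powr (ln (c p / c q) / ln (c p / c l)) *
        sup_ball c p \<zeta> powr (1 - ln (c p / c q) / ln (c p / c l)) \<le> Cc * inf_ball c q \<zeta>"
  shows "omega_est j k {(x, b). \<exists>\<sigma> u. end_sign \<sigma> \<and> x = \<sigma> * u \<and> u \<ge> 1 + inverse (c l) \<and> pole_bound b (c q) (1 / inf_ball c q x)}
     (\<lambda>(x, b). pole_series kern b (complex_of_real x))"
proof -
  have n: "j \<ge> 1" "k \<ge> 1" "mj \<ge> 1" "mk \<ge> 1" "p \<ge> 1" "l \<ge> 1" and B: "Bj > 0" "Bk > 0"
    using kj kk cp cl unfolding kdata_def by auto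
  have c0: "0 < c l" "0 < c q" "0 < c p" using cl dec by auto
  \<comment> \<open>A governs the decay of the remainder on the disc of radius c p used for j, and a
    the growth of the partial sum on the disc of radius c l used for k.\<close>
  define A where "A = c p / c q"
  define a where "a = c q / c l"
  define \<beta> where "\<beta> = ln a / ln A"
  have A: "1 < A" and a: "1 < a" using dec c0 by (auto simp: A_def a_def)
  have Aa: "c p / c l = A * a" using c0 by (simp add: A_def a_def)
  have \<beta>: "\<beta> > 0" using A a by (simp add: \<beta>_def)
  define n' where "n' = nat \<lceil>\<beta>\<rceil>"
  have n': "\<beta> \<le> real n'" unfolding n'_def using \<beta> by linarith
  define C1 where "C1 = Bk / (a - 1) * (A powr \<beta> * Cc powr (1 + \<beta>))"
  define C2 where "C2 = Bj / (1 - 1 / A)"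
  have C: "0 \<le> C1" "0 < C2" unfolding C1_def C2_def using A a B by auto
  show ?thesis
    unfolding omega_est_def
  proof (rule exI[of _ n'], rule exI[of _ "C1 + C2 + 1"], intro conjI allI impI ballI)
    show "0 < C1 + C2 + 1" using C by simp
    fix r :: real and xb assume r: "r \<ge> 1"
      and xb: "xb \<in> {(x, b). \<exists>\<sigma> u. end_sign \<sigma> \<and> x = \<sigma> * u \<and> u \<ge> 1 + inverse (c l) \<and> pole_bound b (c q) (1 / inf_ball c q x)}"
    obtain x b where xb_eq: "xb = (x, b)" by fastforce
    obtain \<sigma> u where \<sigma>: "end_sign \<sigma>" and x: "x = \<sigma> * u" and u: "u \<ge> 1 + inverse (c l)" and b: "pole_bound b (c q) (1 / inf_ball c q x)"
      using xb unfolding xb_eq by auto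
    define I where "I = inf_ball c q x"
    define SP where "SP = sup_ball c p x"
    define SR where "SR = sup_ball c l x"
    have pos: "0 < I" "0 < SP" "0 < SR"
      unfolding I_def SP_def SR_def using inf_ball_pos[OF q, of c x] sup_ball_pos[OF n(5), of c x] sup_ball_pos[OF n(6), of c x] c0 by auto
    have u0: "0 < u" using u c0 by (smt (verit) positive_imp_inverse_positive)
    have ax: "\<bar>x\<bar> = u" using \<sigma> u0 by (auto simp: x end_sign_def abs_mult)
    have H': "SR / I * (SP / I) powr \<beta> \<le> Cc powr (1 + \<beta>)"
      unfolding \<beta>_def
      by (rule three_circles_powr) (use H[of x] ax u A a pos Cc in \<open>auto simp: Aa A_def[symmetric] I_def[symmetric] SP_def[symmetric] SR_def[symmetric]\<close>)
    have icl: "inverse (c l) \<ge> real mk" "inverse (c l) \<ge> real mj"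
    proof -
      show "inverse (c l) \<ge> real mk" using cl n by (simp add: field_simps)
      have "c l \<le> 1 / real mj" using cp dec by simp
      then show "inverse (c l) \<ge> real mj" using cl n by (simp add: field_simps)
    qed
    have ballj: "ball (complex_of_real x) (c p) \<subseteq> U_nbhd (real mj) K"
      unfolding x by (rule end_ball[OF \<sigma>]) (use u icl cp c0 in linarith)+
    have ballk: "ball (complex_of_real x) (c l) \<subseteq> U_nbhd (real mk) K"
      unfolding x by (rule end_ball[OF \<sigma>]) (use u icl cp cl dec c0 in linarith)+
    have SPb: "\<nu> mj \<zeta> \<le> SP" if "\<zeta> \<in> ball (complex_of_real x) (c p)" for \<zeta>
      using sup_ball_ge[of p \<zeta> x c] \<nu>_mono[of mj p \<zeta>] n cp that unfolding SP_def by auto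
    have SRb: "\<nu> mk \<zeta> \<le> SR" if "\<zeta> \<in> ball (complex_of_real x) (c l)" for \<zeta>
      using sup_ball_ge[of l \<zeta> x c] \<nu>_mono[of mk l \<zeta>] n cl that unfolding SR_def by auto
    \<comment> \<open>The degree is adapted to the center: the remainder is of order 1/r at j as
      soon as A^N reaches T. For T <= 1 the empty partial sum suffices, hence the alternative N =
      0.\<close>
    define T where "T = r * SP / I"
    obtain N where N: "T \<le> A ^ N" "N = 0 \<or> A ^ N \<le> A * T"
    proof (cases "T \<le> 1")
      case True
      then show ?thesis using that[of 0] by simp
    next
      case False
      then obtain N where "T \<le> A ^ N" "A ^ N \<le> A * T" using power_choice[OF A, of T] by auto
      then show ?thesis using that by blast
    qed
    have ap: "approximable k (complex_of_real x)"
      unfolding x by (rule approximable_end[OF kk \<sigma>]) (use u icl in linarith)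
    obtain f where f: "f \<in> OV \<nu> K" "\<And>z. z \<in> S_set (real k) K \<Longrightarrow> cmod (pole_sum kern b N (complex_of_real x) z - f z) * \<nu> k z \<le> 1 / r"
      using ap r unfolding approximable_def by (meson divide_pos_pos less_le_trans zero_less_one)
    have main: "cmod (pole_sum kern b N (complex_of_real x) z) * \<nu> k z \<le> C1 * r ^ n'" if z: "z \<in> S_set (real k) K" for z
    proof (cases "N = 0")
      case True
      then show ?thesis using C r by (simp add: pole_sum_def)
    next
      case False
      note kb = kdata_ball[OF kk ballk SRb z]
      have \<nu>z: "0 < \<nu> k z" using \<nu>_pos[OF n(2)] .
      have "cmod (pole_sum kern b N (complex_of_real x) z) \<le> 1 / I * (Bk * SR / \<nu> k z) * (\<Sum>t<N. (c q / c l) ^ t)"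
        unfolding I_def by (rule pole_sum_bound[OF b kb(1) c0(1)]) (use kb(2) in auto)
      also have "(\<Sum>t<N. (c q / c l) ^ t) = (a ^ N - 1) / (a - 1)"
        unfolding a_def[symmetric] using a by (subst geometric_sum) auto
      finally have 1: "cmod (pole_sum kern b N (complex_of_real x) z) \<le> 1 / I * (Bk * SR / \<nu> k z) * ((a ^ N - 1) / (a - 1))" .
      \<comment> \<open>The growth a^N is a power of A^N and so of r * SP / I. The factor (SP /
        I)^\<beta>, which varies with the center, is then absorbed together with SR / I by the
        interpolated bound.\<close>
      have "a = A powr \<beta>" unfolding \<beta>_def using A a by (simp add: powr_def)
      then have "a ^ N = (A ^ N) powr \<beta>" using A by (simp add: powr_realpow[symmetric] powr_powr mult.commute)
      also have "\<dots> \<le> (A * T) powr \<beta>" using N False A \<beta> by (intro powr_mono2) auto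
      also have "\<dots> = A powr \<beta> * (r powr \<beta> * (SP / I) powr \<beta>)"
        unfolding T_def using A r pos by (simp add: powr_mult powr_divide)
      finally have aN: "a ^ N - 1 \<le> A powr \<beta> * (r powr \<beta> * (SP / I) powr \<beta>)" by simp
      have "cmod (pole_sum kern b N (complex_of_real x) z) \<le> 1 / I * (Bk * SR / \<nu> k z) * (A powr \<beta> * (r powr \<beta> * (SP / I) powr \<beta>) / (a - 1))"
        by (rule order_trans[OF 1]) (use aN pos B a \<nu>z in \<open>intro mult_left_mono divide_right_mono; auto\<close>)
      also have "\<dots> = Bk / (a - 1) * A powr \<beta> * r powr \<beta> * (SR / I * (SP / I) powr \<beta>) / \<nu> k z" by (simp add: mult_ac)
      also have "\<dots> \<le> Bk / (a - 1) * A powr \<beta> * r powr \<beta> * Cc powr (1 + \<beta>) / \<nu> k z"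
        using H' B a A \<nu>z by (intro divide_right_mono mult_left_mono) auto
      finally have "cmod (pole_sum kern b N (complex_of_real x) z) * \<nu> k z \<le> Bk / (a - 1) * A powr \<beta> * r powr \<beta> * Cc powr (1 + \<beta>)"
        unfolding pos_le_divide_eq[OF \<nu>z] .
      also have "\<dots> = C1 * r powr \<beta>" unfolding C1_def by simp
      also have "\<dots> \<le> C1 * r powr (real n')" using r n' C by (intro mult_left_mono powr_mono) auto
      also have "r powr (real n') = r ^ n'" using r by (simp add: powr_realpow)
      finally show ?thesis .
    qed
    have rem: "cmod (pole_series kern b (complex_of_real x) z - pole_sum kern b N (complex_of_real x) z) * \<nu> j z \<le> C2 / r"
      if z: "z \<in> S_set (real j) K" for z
    proof -
      note kb = kdata_ball[OF kj ballj SPb z]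
      have \<nu>z: "0 < \<nu> j z" using \<nu>_pos[OF n(1)] .
      have qp: "c q / c p = 1 / A" by (simp add: A_def)
      have "cmod (pole_series kern b (complex_of_real x) z - pole_sum kern b N (complex_of_real x) z) \<le>
          1 / I * (Bj * SP / \<nu> j z) * (c q / c p) ^ N / (1 - c q / c p)"
        unfolding I_def by (rule pole_series_minus_sum[OF b kb(1)]) (use kb(2) c0 dec in auto)
      also have "\<dots> = C2 / \<nu> j z * (SP / I * (1 / A ^ N))" unfolding qp C2_def by (simp add: power_divide)
      also have "\<dots> \<le> C2 / \<nu> j z * (1 / r)"
      proof (rule mult_left_mono)
        have "r * SP / I \<le> A ^ N" using N by (simp add: T_def)
        then show "SP / I * (1 / A ^ N) \<le> 1 / r" using r pos A by (simp add: field_simps)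
      qed (use C \<nu>z in auto)
      also have "\<dots> = C2 / r / \<nu> j z" by simp
      finally show ?thesis unfolding pos_le_divide_eq[OF \<nu>z] .
    qed
    show "\<exists>f\<in>OV \<nu> K. (\<forall>z\<in>S_set (real k) K. cmod (f z) * \<nu> k z \<le> (C1 + C2 + 1) * r ^ n') \<and>
        (\<forall>z\<in>S_set (real j) K. cmod ((case xb of (x, b) \<Rightarrow> pole_series kern b (complex_of_real x)) z - f z) * \<nu> j z \<le> (C1 + C2 + 1) / r)"
    proof (intro bexI[OF _ f(1)] conjI ballI)
      fix z assume z: "z \<in> S_set (real k) K"
      have "cmod (f z) * \<nu> k z \<le> (cmod (pole_sum kern b N (complex_of_real x) z) + cmod (pole_sum kern b N (complex_of_real x) z - f z)) * \<nu> k z"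
        using \<nu>_pos[OF n(2), of z] norm_triangle_sub[of "f z" "pole_sum kern b N (complex_of_real x) z"]
        by (intro mult_right_mono) (auto simp: norm_minus_commute)
      also have "\<dots> \<le> C1 * r ^ n' + 1 / r" unfolding distrib_right by (intro add_mono main[OF z] f(2)[OF z])
      also have "\<dots> \<le> C1 * r ^ n' + (C2 * r ^ n' + 1 * r ^ n')"
      proof -
        have "1 / r \<le> 1" "1 \<le> r ^ n'" "0 \<le> C2 * r ^ n'" using r C by auto
        then show ?thesis by linarith
      qed
      also have "\<dots> = (C1 + C2 + 1) * r ^ n'" by (simp add: distrib_right)
      finally show "cmod (f z) * \<nu> k z \<le> (C1 + C2 + 1) * r ^ n'" .
    next
      fix z assume z: "z \<in> S_set (real j) K"
      have \<nu>z: "0 < \<nu> j z" "\<nu> j z \<le> \<nu> k z" using \<nu>_pos[OF n(1)] \<nu>_mono[OF n(1) jk] by auto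
      have zk: "z \<in> S_set (real k) K" using z S_set_mono[OF n(1) jk] by blast
      have 2: "cmod (pole_sum kern b N (complex_of_real x) z - f z) * \<nu> j z \<le> 1 / r"
        using f(2)[OF zk] mult_left_mono[OF \<nu>z(2), of "cmod (pole_sum kern b N (complex_of_real x) z - f z)"] by simp
      have "cmod (pole_series kern b (complex_of_real x) z - f z) * \<nu> j z \<le>
         (cmod (pole_series kern b (complex_of_real x) z - pole_sum kern b N (complex_of_real x) z) + cmod (pole_sum kern b N (complex_of_real x) z - f z)) * \<nu> j z"
        using \<nu>z norm_triangle_ineq[of "pole_series kern b (complex_of_real x) z - pole_sum kern b N (complex_of_real x) z" "pole_sum kern b N (complex_of_real x) z - f z"]
        by (intro mult_right_mono) auto
      also have "\<dots> \<le> C2 / r + 1 / r" unfolding distrib_right by (intro add_mono rem[OF z] 2)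
      also have "\<dots> \<le> (C1 + C2 + 1) / r"
        unfolding add_divide_distrib[symmetric] using r C by (intro divide_right_mono) auto
      finally show "cmod ((case xb of (x, b) \<Rightarrow> pole_series kern b (complex_of_real x)) z - f z) * \<nu> j z \<le> (C1 + C2 + 1) / r"
        unfolding xb_eq by simp
    qed
  qed
qed

section \<open>Decomposition of the sum over all tiles\<close>

lemma OV_sum:
  assumes "finite I" "\<And>i. i \<in> I \<Longrightarrow> f i \<in> OV \<nu> K" shows "(\<lambda>z. \<Sum>i\<in>I. f i z) \<in> OV \<nu> K"
  using assms by (induction I rule: finite_induct) (auto intro: OV_zero OV_add[OF weights])

definition unit_OV :: "nat \<Rightarrow> (complex \<Rightarrow> complex) set" where
  "unit_OV q = {F \<in> OV \<nu> K. \<forall>\<zeta>\<in>S_set (real q) K. cmod (F \<zeta>) * \<nu> q \<zeta> \<le> 1}"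

lemma unit_OV_edges:
  assumes "F \<in> unit_OV q" "q \<ge> d + 2" "d \<ge> 1" "\<zeta> \<in> edges d i"
  shows "cmod (F \<zeta>) \<le> 1 / \<nu> q \<zeta>"
  using F_bound_edges[of q F 1 d \<zeta> i] assms by (auto simp: unit_OV_def)

lemma inverse_weight_bounded_ball:
  assumes "m \<ge> 1" obtains M where "M > 0" "\<And>\<zeta>. \<zeta> \<in> cball x R \<Longrightarrow> 1 / \<nu> m \<zeta> \<le> M"
proof -
  have "\<nu> m z \<noteq> 0" for z using \<nu>_pos[OF assms, of z] by simp
  then have "compact ((\<lambda>z. 1 / \<nu> m z) ` cball x R)"
    by (intro compact_continuous_image continuous_intros weights_continuous[OF weights assms]) auto
  then have "bounded ((\<lambda>z. 1 / \<nu> m z) ` cball x R)" by (rule compact_imp_bounded)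
  then obtain M where "\<forall>\<zeta>\<in>cball x R. \<bar>1 / \<nu> m \<zeta>\<bar> \<le> M" unfolding bounded_iff by auto
  then have le: "1 / \<nu> m \<zeta> \<le> M" if "\<zeta> \<in> cball x R" for \<zeta> using that abs_le_D1 by blast
  show thesis
  proof (rule that[of "\<bar>M\<bar> + 1"])
    show "1 / \<nu> m \<zeta> \<le> \<bar>M\<bar> + 1" if "\<zeta> \<in> cball x R" for \<zeta> using le[OF that] by linarith
  qed simp
qed

text \<open>On the edges of a single tile the weight is bounded below, so division by W, which does
  not depend on the function, normalizes all coefficient sequences at once.\<close>

lemma omega_est_tile:
  assumes jk: "j \<le> k" and kj: "kdata j mj Bj" and k: "k \<ge> 2" and d: "d \<ge> 4 * mj" and q: "q \<ge> d + 2" and i: "i \<in> tiles d"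
    and D: "\<And>a. a \<in> D \<Longrightarrow> \<phi> a \<in> unit_OV q"
  shows "omega_est j k D (\<lambda>a. tile_int d (\<phi> a) i)"
proof -
  have mj: "mj \<ge> 2" "j \<ge> 1" "q \<ge> 1" and d1: "d \<ge> 1" using kj d q by (auto simp: kdata_def)
  obtain x where x: "tile d i \<subseteq> cball (complex_of_real x) (3 / d)"
    "ereal x \<in> K \<or> (\<infinity> \<in> K \<and> real d \<le> x) \<or> (-\<infinity> \<in> K \<and> x \<le> - real d)"
    using tile_center[OF d1 i] by blast
  have ed: "edges d i \<subseteq> cball (complex_of_real x) (3 * (1 / d))" using x(1) by (auto simp: edges_def)
  obtain M where M: "M > 0" "\<And>z. z \<in> cball (complex_of_real x) (3 * (1 / d)) \<Longrightarrow> 1 / \<nu> q z \<le> M"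
    using inverse_weight_bounded_ball[OF mj(3)] by blast
  define W where "W = M * (1 / d) + M * (2 / d) + M * (1 / d) + M * (2 / d)"
  have W: "W > 0" unfolding W_def using M d1 by (intro add_pos_pos mult_pos_pos) auto
  have FO: "\<phi> a \<in> OV \<nu> K" if "a \<in> D" for a using D[OF that] by (simp add: unit_OV_def)
  have cF: "continuous_on (edges d i) (\<phi> a)" if "a \<in> D" for a using OV_continuous_edges[OF FO[OF that] d1] .
  have tb: "pole_bound (tile_coeff d (\<phi> a) i (complex_of_real x)) (3 * (1 / d)) W" if a: "a \<in> D" for a
    unfolding W_def
  proof (rule tile_coeff_bound[OF cF[OF a] d1 ed])
    fix \<zeta> assume \<zeta>: "\<zeta> \<in> edges d i"
    show "cmod (\<phi> a \<zeta>) \<le> M" using unit_OV_edges[OF D[OF a] q d1 \<zeta>] M(2)[OF subsetD[OF ed \<zeta>]] by (rule order_trans)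
  qed
  show ?thesis
  proof (rule omega_est_scale[OF mj(2) _ W omega_est_near[OF jk kj k d x(2)]])
    show "1 \<le> k" using k by simp
    fix a assume a: "a \<in> D"
    define b where "b t = of_real (1 / W) * tile_coeff d (\<phi> a) i (complex_of_real x) t" for t
    have b: "pole_bound b (3 * (1 / d)) 1"
      using pole_bound_scale[OF tb[OF a], of "1 / W"] W unfolding b_def[abs_def] by simp
    then show "(\<lambda>t. of_real (1 / W) * tile_coeff d (\<phi> a) i (complex_of_real x) t) \<in> {b. pole_bound b (3 * (1 / d)) 1}"
      unfolding b_def[abs_def] by simp
    fix z assume z: "z \<in> S_set (real j) K"
    have bl: "ball (complex_of_real x) (4 * (1 / d)) \<subseteq> U_nbhd (real mj) K"
      using center_ball_subset_U[OF mj(1) d x(2)] by simp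
    obtain V where V: "\<And>\<zeta>. \<zeta> \<in> cball (complex_of_real x) (4 * (1 / d)) \<Longrightarrow> \<nu> mj \<zeta> \<le> V"
      using weight_bounded_ball[of mj] mj by (metis le_trans one_le_numeral)
    note kb = kdata_ball[OF kj bl V z]
    have sm: "3 * (1 / real d) < 4 * (1 / real d)" using d1 by (intro mult_strict_right_mono) auto
    have "tile_int d (\<phi> a) i z = pole_series kern (tile_coeff d (\<phi> a) i (complex_of_real x)) (complex_of_real x) z"
      by (rule tile_expansion[OF cF[OF a] d1 kb(1) kb(2) ed sm]) auto
    also have "tile_coeff d (\<phi> a) i (complex_of_real x) = (\<lambda>t. of_real W * b t)" using W by (auto simp: b_def)
    also have "pole_series kern (\<lambda>t. of_real W * b t) (complex_of_real x) z = of_real W * pole_series kern b (complex_of_real x) z"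
      by (rule pole_series_scale[OF b kb(1)]) (use kb(2) d1 sm in auto)
    finally show "tile_int d (\<phi> a) i z = of_real W * pole_series kern (\<lambda>t. of_real (1 / W) * tile_coeff d (\<phi> a) i (complex_of_real x) t) (complex_of_real x) z"
      unfolding b_def[abs_def] .
  qed
qed

text \<open>All far tiles share one exponent and one constant, so only the sizes w of their
  coefficients have to be summed. The integrability of \<nu> Q / \<nu> q1 bounds this sum
  independently of the cut-off L. The thresholds for d and q are fixed before k, while X may depend
  on k.\<close>

lemma omega_est_far_sum:
  assumes qL: "qL1 \<nu> K" and inf: "K \<inter> {\<infinity>, -\<infinity>} \<noteq> {}" and H3: "H3CT \<nu>" and kj: "kdata j mj Bj"
  obtains d0 q1 where "\<And>d q k. d \<ge> d0 \<Longrightarrow> d \<ge> 4 * mj \<Longrightarrow> q \<ge> q1 \<Longrightarrow> q \<ge> d + 2 \<Longrightarrow> k \<ge> j \<Longrightarrow>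
     \<exists>X. omega_est j k {(F, L). F \<in> unit_OV q \<and> X \<le> L} (\<lambda>(F, L) z. psum d F L z - psum d F X z)"
proof -
  have "\<exists>c :: nat \<Rightarrow> real. (\<forall>m\<ge>1. \<forall>n>m. c n < c m) \<and> (\<forall>n\<ge>1. c n \<le> 1) \<and> c \<longlonglongrightarrow> 0 \<and>
    (\<forall>p q l. 1 \<le> p \<longrightarrow> p < q \<longrightarrow> q < l \<longrightarrow> (\<exists>C>0. \<forall>\<zeta>::real. \<bar>\<zeta>\<bar> \<ge> 1 + inverse (c l) \<longrightarrow>
       sup_ball c l \<zeta> powr (ln (c p / c q) / ln (c p / c l)) * sup_ball c p \<zeta> powr (1 - ln (c p / c q) / ln (c p / c l)) \<le> C * inf_ball c q \<zeta>))"
    using H3 unfolding H3CT_def Let_def sup_ball_def inf_ball_def .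
  then obtain c :: "nat \<Rightarrow> real" where c: "(\<forall>m\<ge>1. \<forall>n>m. c n < c m) \<and> (\<forall>n\<ge>1. c n \<le> 1) \<and> c \<longlonglongrightarrow> 0 \<and>
    (\<forall>p q l. 1 \<le> p \<longrightarrow> p < q \<longrightarrow> q < l \<longrightarrow> (\<exists>C>0. \<forall>\<zeta>::real. \<bar>\<zeta>\<bar> \<ge> 1 + inverse (c l) \<longrightarrow>
       sup_ball c l \<zeta> powr (ln (c p / c q) / ln (c p / c l)) * sup_ball c p \<zeta> powr (1 - ln (c p / c q) / ln (c p / c l)) \<le> C * inf_ball c q \<zeta>))" ..
  have cdec: "\<And>m n. m \<ge> 1 \<Longrightarrow> n > m \<Longrightarrow> c n < c m" and c1: "\<And>n. n \<ge> 1 \<Longrightarrow> c n \<le> 1"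
    and clim: "c \<longlonglongrightarrow> 0" using c by auto
  note cH = c[THEN conjunct2, THEN conjunct2, THEN conjunct2, rule_format]
  have c0: "0 < c n" if n: "n \<ge> 1" for n
  proof -
    have "0 \<le> c (Suc n)"
    proof (rule LIMSEQ_le_const2[OF clim], intro exI allI impI)
      fix m assume "Suc n \<le> m"
      then show "c m \<le> c (Suc n)" using cdec[of "Suc n" m] by (cases "m = Suc n") auto
    qed
    then show ?thesis using cdec[OF n, of "Suc n"] by simp
  qed
  have small: "\<exists>l\<ge>N. c l \<le> e" if e: "e > 0" for e N
  proof -
    have "eventually (\<lambda>l. c l < e) sequentially" using clim e by (rule order_tendstoD)
    then have "eventually (\<lambda>l. c l < e \<and> N \<le> l) sequentially" using eventually_ge_at_top by (rule eventually_conj)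
    then show ?thesis using eventually_happens[of _ sequentially] less_imp_le by (metis (mono_tags, lifting) trivial_limit_sequentially)
  qed
  have j: "j \<ge> 2" "mj \<ge> 1" using kj by (auto simp: kdata_def)
  obtain p where p: "p \<ge> mj" "c p \<le> 1 / real mj" using small[of "1 / real mj" mj] j by auto
  \<comment> \<open>Three indices enter the interpolation: p for the estimate at j, Q for the size
    of F on a tile, and later l for the estimate at k. Only l depends on k.\<close>
  define Q where "Q = p + 1"
  have pQ: "p \<ge> 1" "Q \<ge> 1" "p < Q" using p j by (auto simp: Q_def)
  obtain q1 A where q1: "q1 > Q" and A: "\<And>L. integral {- real L..real L} (ratio Q q1) \<le> A"
    using ratio_integral_bounded[OF qL inf pQ(2)] by blast
  have q11: "q1 \<ge> 1" using q1 by simp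
  \<comment> \<open>Makes every tile fit into the disc of radius c Q around its center i/d.\<close>
  obtain d0 :: nat where d0: "real d0 > 2 / c Q" using reals_Archimedean2 by blast
  show thesis
  proof (rule that[of d0 q1])
    fix d q k assume d: "d \<ge> d0" "d \<ge> 4 * mj" and q: "q \<ge> q1" "q \<ge> d + 2" and k: "k \<ge> j"
    have k2: "k \<ge> 2" "k \<ge> 1" "j \<ge> 1" and d1: "d \<ge> 1" using k j d by auto
    obtain mk Bk where kk: "kdata k mk Bk" using kdata_exists[OF k2(1)] by blast
    have mk: "mk \<ge> 1" using kk by (auto simp: kdata_def)
    obtain l where l: "l \<ge> max mk (Suc Q)" "c l \<le> 1 / real mk" using small[of "1 / real mk" "max mk (Suc Q)"] mk by auto
    obtain Cc where Cc: "Cc > 0" "\<And>\<zeta>. \<bar>\<zeta>\<bar> \<ge> 1 + inverse (c l) \<Longrightarrow>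
       sup_ball c l \<zeta> powr (ln (c p / c Q) / ln (c p / c l)) * sup_ball c p \<zeta> powr (1 - ln (c p / c Q) / ln (c p / c l)) \<le> Cc * inf_ball c Q \<zeta>"
      using cH[OF pQ(1,3), of l] l by (metis Suc_le_lessD max.bounded_iff)
    have est: "omega_est j k {(x, b). \<exists>\<sigma> u. end_sign \<sigma> \<and> x = \<sigma> * u \<and> u \<ge> 1 + inverse (c l) \<and> pole_bound b (c Q) (1 / inf_ball c Q x)}
       (\<lambda>(x, b). pole_series kern b (complex_of_real x))"
      using l cdec[OF pQ(1,3)] cdec[OF pQ(2), of l] c0[of l] c1[OF pQ(1)] pQ
      by (intro omega_est_far[OF k kj kk p(2,1) _ l(2) _ _ _ _ _ Cc]) auto
    then obtain n C where C: "C > 0" and raw: "\<And>r a. r \<ge> 1 \<Longrightarrow> a \<in> {(x, b). \<exists>\<sigma> u. end_sign \<sigma> \<and> x = \<sigma> * u \<and> u \<ge> 1 + inverse (c l) \<and> pole_bound b (c Q) (1 / inf_ball c Q x)} \<Longrightarrow>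
       \<exists>f\<in>OV \<nu> K. (\<forall>z\<in>S_set (real k) K. cmod (f z) * \<nu> k z \<le> C * r ^ n) \<and>
       (\<forall>z\<in>S_set (real j) K. cmod ((case a of (x, b) \<Rightarrow> pole_series kern b (complex_of_real x)) z - f z) * \<nu> j z \<le> C / r)"
      unfolding omega_est_def by blast
    have est': "\<exists>f\<in>OV \<nu> K. (\<forall>z\<in>S_set (real k) K. cmod (f z) * \<nu> k z \<le> C * r ^ n) \<and>
       (\<forall>z\<in>S_set (real j) K. cmod (pole_series kern b (complex_of_real x) z - f z) * \<nu> j z \<le> C / r)"
      if "r \<ge> 1" "\<exists>\<sigma> u. end_sign \<sigma> \<and> x = \<sigma> * u \<and> u \<ge> 1 + inverse (c l)" "pole_bound b (c Q) (1 / inf_ball c Q x)" for r x b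
    proof -
      have "(x, b) \<in> {(x, b). \<exists>\<sigma> u. end_sign \<sigma> \<and> x = \<sigma> * u \<and> u \<ge> 1 + inverse (c l) \<and> pole_bound b (c Q) (1 / inf_ball c Q x)}"
        using that(2,3) by blast
      from raw[OF that(1) this] show ?thesis by simp
    qed
    obtain L0 where L0: "L0 \<ge> 1" "\<And>i. i \<in> tiles d \<Longrightarrow> int (L0 * d) \<le> i \<Longrightarrow> \<infinity> \<in> K \<and> i - 1 \<in> tiles d \<and> i + 1 \<in> tiles d"
      "\<And>i. i \<in> tiles d \<Longrightarrow> i < - int (L0 * d) \<Longrightarrow> -\<infinity> \<in> K \<and> i - 1 \<in> tiles d \<and> i + 1 \<in> tiles d"
      using far_tiles[OF d1] by metis
    obtain X0 :: nat where X0: "real X0 > 1 + inverse (c l)" using reals_Archimedean2 by blast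
    define X where "X = max L0 X0"
    have X: "X \<ge> L0" "X \<ge> 1" "real X \<ge> 1 + inverse (c l)" using L0(1) X0 by (auto simp: X_def)
    \<comment> \<open>The second summand keeps w positive, so that coefficients can be divided by
      it; over the 2 * L * d indices between -L and L it adds up to 1.\<close>
    define w where "w L i = 2 * integral {of_int i / d..(of_int i + 1) / d} (ratio Q q1) + 1 / real (2 * L * d)" for L :: nat and i :: int
    have I0: "0 \<le> integral {of_int i / d..(of_int i + 1) / d} (ratio Q q1)" for i
      using ratio_pos[OF pQ(2) q11] by (intro integral_nonneg ratio_integrable[OF pQ(2) q11]) (auto simp: less_imp_le)
    have tileest: "\<exists>f\<in>OV \<nu> K. (\<forall>z\<in>S_set (real k) K. cmod (f z) * \<nu> k z \<le> w L i * C * r ^ n) \<and>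
        (\<forall>z\<in>S_set (real j) K. cmod (tile_int d F i z - f z) * \<nu> j z \<le> w L i * C / r)"
      if F: "F \<in> unit_OV q" and L: "X \<le> L" and i: "i \<in> tiles d" "i < - int (X * d) \<or> int (X * d) \<le> i" and r: "r \<ge> 1" for F L i r
    proof -
      have LX: "int (L0 * d) \<le> int (X * d)" using X(1) by (simp only: of_nat_le_iff mult_le_mono1)
      have FO: "F \<in> OV \<nu> K" using F by (simp add: unit_OV_def)
      have cF: "continuous_on (edges d i) F" using OV_continuous_edges[OF FO d1] .
      have wpos: "0 < w L i" unfolding w_def using I0[of i] X L d1 by (intro add_nonneg_pos) auto
      define x where "x = real_of_int i / d"
      define \<sigma> :: real where "\<sigma> = (if int (X * d) \<le> i then 1 else - 1)"
      have nb: "i - 1 \<in> tiles d" "i \<in> tiles d" "i + 1 \<in> tiles d" and \<sigma>: "end_sign \<sigma>"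
      proof -
        have "(int (X * d) \<le> i \<and> \<infinity> \<in> K \<or> \<not> int (X * d) \<le> i \<and> -\<infinity> \<in> K) \<and> i - 1 \<in> tiles d \<and> i + 1 \<in> tiles d"
        proof (cases "int (X * d) \<le> i")
          case True
          then show ?thesis using L0(2)[OF i(1) order_trans[OF LX True]] by simp
        next
          case False
          then have "i < - int (L0 * d)" using i(2) LX by linarith
          then show ?thesis using L0(3)[OF i(1)] False by blast
        qed
        then show "i - 1 \<in> tiles d" "i \<in> tiles d" "i + 1 \<in> tiles d" "end_sign \<sigma>"
          using i(1) unfolding end_sign_def \<sigma>_def by auto
      qed
      have u: "\<sigma> * x \<ge> real X"
      proof (cases "int (X * d) \<le> i")
        case True
        then have "real X * real d \<le> of_int i" by (metis of_int_le_iff of_int_of_nat_eq of_nat_mult)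
        then show ?thesis using True d1 by (simp add: \<sigma>_def x_def field_simps)
      next
        case False
        then have "i < - int (X * d)" using i by auto
        then have "of_int i < - (real X * real d)" by (metis of_int_less_iff of_int_minus of_int_of_nat_eq of_nat_mult)
        then show ?thesis using False d1 by (simp add: \<sigma>_def x_def field_simps)
      qed
      have \<sigma>\<sigma>: "\<sigma> * \<sigma> = 1" by (simp add: \<sigma>_def)
      have xu: "x = \<sigma> * (\<sigma> * x)" using \<sigma>\<sigma> by (simp add: mult.assoc[symmetric])
      have ex: "\<exists>\<sigma> u. end_sign \<sigma> \<and> x = \<sigma> * u \<and> u \<ge> 1 + inverse (c l)"
        using \<sigma> xu order_trans[OF X(3) u] by (intro exI[of _ \<sigma>] exI[of _ "\<sigma> * x"] conjI)
      have dQ: "2 / real d \<le> c Q"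
      proof -
        have "real d \<ge> real d0" using d by simp
        then have "2 / c Q < real d" using d0 by linarith
        then show ?thesis using c0[OF pQ(2)] d1 by (simp add: field_simps)
      qed
      have ed: "edges d i \<subseteq> cball (complex_of_real x) (c Q)"
        using tile_dist'[OF d1, of _ i] dQ unfolding edges_def x_def by fastforce
      define I where "I = inf_ball c Q x"
      have I: "I > 0" unfolding I_def using inf_ball_pos[OF pQ(2), of c x] c0[OF pQ(2)] by simp
      have "pole_bound (tile_coeff d F i (complex_of_real x)) (c Q) (2 * integral {of_int i / d..(of_int i + 1) / d} (\<lambda>t. 1 / I * ratio Q q1 t))"
      proof (rule tile_coeff_bound_far[OF cF d1 ed nb])
        show "(\<lambda>t. 1 / I * ratio Q q1 t) integrable_on {real_of_int i / real d..(real_of_int i + 1) / real d}"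
          by (intro integrable_on_mult_right ratio_integrable[OF pQ(2) q11])
        fix t y assume t: "real_of_int i / real d \<le> t" "t \<le> (real_of_int i + 1) / real d" "\<bar>y\<bar> = 1 / real d"
        let ?\<zeta> = "Complex t y"
        have \<zeta>: "?\<zeta> \<in> edges d i" using t by (auto simp: edges_def tile_def)
        have "cmod (F ?\<zeta>) \<le> 1 / \<nu> q ?\<zeta>" using unit_OV_edges[OF F q(2) d1 \<zeta>] .
        also have "\<dots> \<le> 1 / \<nu> q1 ?\<zeta>" using \<nu>_mono[OF q11 q(1)] \<nu>_pos[OF q11] \<nu>_pos[of q] q11 q(1) by (intro divide_left_mono) auto
        \<comment> \<open>One factor is bounded by the infimum of the weight over the disc, the
          normalization used for far centers; the other carries the integrability in t.\<close>
        also have "\<dots> = 1 / \<nu> Q ?\<zeta> * ratio Q q1 t"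
          using \<nu>_Re[OF qL pQ(2), of ?\<zeta>] \<nu>_Re[OF qL q11, of ?\<zeta>] \<nu>_pos[OF pQ(2), of "complex_of_real t"] by (simp add: ratio_def)
        also have "\<dots> \<le> 1 / I * ratio Q q1 t"
        proof (rule mult_right_mono)
          have "I \<le> \<nu> Q ?\<zeta>" unfolding I_def using inf_ball_le[OF pQ(2)] ed \<zeta> by blast
          then show "1 / \<nu> Q ?\<zeta> \<le> 1 / I" using I by (intro divide_left_mono) auto
        qed (use ratio_pos[OF pQ(2) q11, of t] in simp)
        finally show "cmod (F ?\<zeta>) \<le> 1 / I * ratio Q q1 t" .
      qed
      also have "integral {of_int i / d..(of_int i + 1) / d} (\<lambda>t. 1 / I * ratio Q q1 t) = 1 / I * integral {of_int i / d..(of_int i + 1) / d} (ratio Q q1)"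
        by (rule Henstock_Kurzweil_Integration.integral_mult_right)
      finally have tb: "pole_bound (tile_coeff d F i (complex_of_real x)) (c Q) (w L i / I)"
        by (rule pole_bound_mono) (use c0[OF pQ(2)] I in \<open>auto simp: w_def field_simps\<close>)
      define b where "b t = of_real (1 / w L i) * tile_coeff d F i (complex_of_real x) t" for t
      have b: "pole_bound b (c Q) (1 / I)"
        using pole_bound_scale[OF tb, of "1 / w L i"] wpos unfolding b_def[abs_def] by simp
      obtain f where f: "f \<in> OV \<nu> K" "\<And>z. z \<in> S_set (real k) K \<Longrightarrow> cmod (f z) * \<nu> k z \<le> C * r ^ n"
        "\<And>z. z \<in> S_set (real j) K \<Longrightarrow> cmod (pole_series kern b (complex_of_real x) z - f z) * \<nu> j z \<le> C / r"
        using est'[OF r ex b[unfolded I_def]] by blast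
      show ?thesis
      proof (intro bexI[of _ "\<lambda>z. of_real (w L i) * f z"] conjI ballI)
        show "(\<lambda>z. of_real (w L i) * f z) \<in> OV \<nu> K" by (rule OV_scale[OF weights f(1)])
        fix z assume z: "z \<in> S_set (real k) K"
        show "cmod (of_real (w L i) * f z) * \<nu> k z \<le> w L i * C * r ^ n"
          using mult_left_mono[OF f(2)[OF z], of "w L i"] wpos by (simp add: norm_mult mult.assoc)
      next
        fix z assume z: "z \<in> S_set (real j) K"
        have icl: "real mj \<le> inverse (c l)"
        proof -
          have "c l \<le> 1 / real mj" using p(2) cdec[OF pQ(1), of l] pQ(3) l(1) by simp
          then show ?thesis using c0[of l] l(1) j(2) by (simp add: field_simps)
        qed
        have bl: "ball (complex_of_real x) (c p) \<subseteq> U_nbhd (real mj) K"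
          by (subst xu, rule end_ball[OF \<sigma>]) (use u X(3) icl p(2) c0[OF pQ(1)] c1[OF pQ(1)] in linarith)+
        obtain V where V: "\<And>\<zeta>. \<zeta> \<in> cball (complex_of_real x) (c p) \<Longrightarrow> \<nu> mj \<zeta> \<le> V"
          using weight_bounded_ball[OF j(2)] by metis
        have Vb: "\<And>\<zeta>. \<zeta> \<in> ball (complex_of_real x) (c p) \<Longrightarrow> \<nu> mj \<zeta> \<le> V" using V by auto
        note kb = kdata_ball[OF kj bl Vb z]
        have sm: "c Q < c p" using cdec[OF pQ(1,3)] .
        have "tile_int d F i z = pole_series kern (tile_coeff d F i (complex_of_real x)) (complex_of_real x) z"
          by (rule tile_expansion[OF cF d1 kb(1) kb(2) ed sm]) auto
        also have "tile_coeff d F i (complex_of_real x) = (\<lambda>t. of_real (w L i) * b t)" using wpos by (auto simp: b_def)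
        also have "pole_series kern (\<lambda>t. of_real (w L i) * b t) (complex_of_real x) z = of_real (w L i) * pole_series kern b (complex_of_real x) z"
          by (rule pole_series_scale[OF b kb(1)]) (use kb(2) sm c0[OF pQ(2)] in auto)
        finally have "tile_int d F i z - of_real (w L i) * f z = of_real (w L i) * (pole_series kern b (complex_of_real x) z - f z)"
          by (simp add: algebra_simps)
        then show "cmod (tile_int d F i z - of_real (w L i) * f z) * \<nu> j z \<le> w L i * C / r"
          using mult_left_mono[OF f(3)[OF z], of "w L i"] wpos by (simp add: norm_mult mult.assoc)
      qed
    qed
    have "omega_est j k {(F, L). F \<in> unit_OV q \<and> X \<le> L} (\<lambda>(F, L) z. psum d F L z - psum d F X z)"
      unfolding omega_est_def
    proof (rule exI[of _ n], rule exI[of _ "(2 * \<bar>A\<bar> + 1) * C"], intro conjI allI impI ballI)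
      show "0 < (2 * \<bar>A\<bar> + 1) * C" using C by (intro mult_pos_pos) auto
      fix r :: real and a assume r: "r \<ge> 1" and a: "a \<in> {(F, L). F \<in> unit_OV q \<and> X \<le> L}"
      obtain F L where aFL: "a = (F, L)" and F: "F \<in> unit_OV q" and L: "X \<le> L" using a by auto
      define J where "J = tiles d \<inter> ({- int (L * d)..<- int (X * d)} \<union> {int (X * d)..<int (L * d)})"
      have "\<forall>i\<in>J. \<exists>f. f \<in> OV \<nu> K \<and> (\<forall>z\<in>S_set (real k) K. cmod (f z) * \<nu> k z \<le> w L i * C * r ^ n) \<and>
        (\<forall>z\<in>S_set (real j) K. cmod (tile_int d F i z - f z) * \<nu> j z \<le> w L i * C / r)"
      proof
        fix i assume "i \<in> J"
        then have "i \<in> tiles d" "i < - int (X * d) \<or> int (X * d) \<le> i" unfolding J_def by (auto simp del: of_nat_mult)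
        then show "\<exists>f. f \<in> OV \<nu> K \<and> (\<forall>z\<in>S_set (real k) K. cmod (f z) * \<nu> k z \<le> w L i * C * r ^ n) \<and>
          (\<forall>z\<in>S_set (real j) K. cmod (tile_int d F i z - f z) * \<nu> j z \<le> w L i * C / r)"
          using tileest[OF F L _ _ r] by blast
      qed
      then obtain f where f: "\<And>i. i \<in> J \<Longrightarrow> f i \<in> OV \<nu> K" "\<And>i z. i \<in> J \<Longrightarrow> z \<in> S_set (real k) K \<Longrightarrow> cmod (f i z) * \<nu> k z \<le> w L i * C * r ^ n"
        "\<And>i z. i \<in> J \<Longrightarrow> z \<in> S_set (real j) K \<Longrightarrow> cmod (tile_int d F i z - f i z) * \<nu> j z \<le> w L i * C / r"
        by metis
      have fin: "finite J" by (simp add: J_def)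
      have LX: "int (X * d) \<le> int (L * d)" using L by (simp only: of_nat_le_iff mult_le_mono1)
      have Jsub: "J \<subseteq> {- int (L * d)..<int (L * d)}"
      proof -
        have "0 \<le> int (X * d)" by simp
        then show ?thesis unfolding J_def using LX by (auto simp del: of_nat_mult of_nat_0_le_iff)
      qed
      have Lp: "0 < real (2 * L * d)" using L X d1 by simp
      have wsum: "(\<Sum>i\<in>J. w L i) \<le> 2 * \<bar>A\<bar> + 1"
      proof -
        have "(\<Sum>i\<in>J. w L i) \<le> (\<Sum>i\<in>{- int (L * d)..<int (L * d)}. w L i)"
          using I0 Lp by (intro sum_mono2 Jsub) (auto simp: w_def intro!: add_nonneg_nonneg)
        also have "\<dots> = 2 * (\<Sum>i\<in>{- int (L * d)..<int (L * d)}. integral {of_int i / d..(of_int i + 1) / d} (ratio Q q1))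
           + real (2 * L * d) * (1 / real (2 * L * d))"
          unfolding w_def sum.distrib sum_distrib_left[symmetric] by (simp add: mult.assoc)
        also have "(\<Sum>i\<in>{- int (L * d)..<int (L * d)}. integral {of_int i / d..(of_int i + 1) / d} (ratio Q q1)) = integral {- real L..real L} (ratio Q q1)"
          using sum_integral_steps[OF ratio_continuous[OF pQ(2) q11] d1, of "- int (L * d)" "int (L * d)"] d1 by simp
        also have "real (2 * L * d) * (1 / real (2 * L * d)) = 1" using L X(2) d1 by simp
        finally show ?thesis using A[of L] by linarith
      qed
      have triangle: "cmod (\<Sum>i\<in>J. h i) * v \<le> (\<Sum>i\<in>J. cmod (h i) * v)" if "v \<ge> 0" for h :: "int \<Rightarrow> complex" and v
        using that unfolding sum_distrib_right[symmetric] by (intro mult_right_mono norm_sum) auto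
      show "\<exists>f\<in>OV \<nu> K. (\<forall>z\<in>S_set (real k) K. cmod (f z) * \<nu> k z \<le> (2 * \<bar>A\<bar> + 1) * C * r ^ n) \<and>
          (\<forall>z\<in>S_set (real j) K. cmod ((case a of (F, L) \<Rightarrow> \<lambda>z. psum d F L z - psum d F X z) z - f z) * \<nu> j z \<le> (2 * \<bar>A\<bar> + 1) * C / r)"
      proof (intro bexI[of _ "\<lambda>z. \<Sum>i\<in>J. f i z"] conjI ballI)
        show "(\<lambda>z. \<Sum>i\<in>J. f i z) \<in> OV \<nu> K" by (rule OV_sum[OF fin f(1)])
        fix z assume z: "z \<in> S_set (real k) K"
        have "cmod (\<Sum>i\<in>J. f i z) * \<nu> k z \<le> (\<Sum>i\<in>J. cmod (f i z) * \<nu> k z)" using \<nu>_pos[OF k2(2), of z] by (intro triangle) simp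
        also have "\<dots> \<le> (\<Sum>i\<in>J. w L i * C * r ^ n)" by (intro sum_mono f(2) z)
        also have "\<dots> = (\<Sum>i\<in>J. w L i) * (C * r ^ n)" by (simp add: sum_distrib_right mult.assoc)
        also have "\<dots> \<le> (2 * \<bar>A\<bar> + 1) * (C * r ^ n)" using wsum C r by (intro mult_right_mono) auto
        finally show "cmod (\<Sum>i\<in>J. f i z) * \<nu> k z \<le> (2 * \<bar>A\<bar> + 1) * C * r ^ n" by (simp add: mult.assoc)
      next
        fix z assume z: "z \<in> S_set (real j) K"
        have "psum d F L z - psum d F X z - (\<Sum>i\<in>J. f i z) = (\<Sum>i\<in>J. tile_int d F i z - f i z)"
          unfolding psum_diff[OF L] J_def[symmetric] by (simp add: sum_subtractf)
        then have "cmod (psum d F L z - psum d F X z - (\<Sum>i\<in>J. f i z)) * \<nu> j z \<le> (\<Sum>i\<in>J. cmod (tile_int d F i z - f i z) * \<nu> j z)"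
          using \<nu>_pos[OF k2(3), of z] triangle[of "\<nu> j z"] by simp
        also have "\<dots> \<le> (\<Sum>i\<in>J. w L i * C / r)" by (intro sum_mono f(3) z)
        also have "\<dots> = (\<Sum>i\<in>J. w L i) * (C / r)" unfolding sum_distrib_right by simp
        also have "\<dots> \<le> (2 * \<bar>A\<bar> + 1) * (C / r)" using wsum C r by (intro mult_right_mono) auto
        finally show "cmod ((case a of (F, L) \<Rightarrow> \<lambda>z. psum d F L z - psum d F X z) z - (\<Sum>i\<in>J. f i z)) * \<nu> j z \<le> (2 * \<bar>A\<bar> + 1) * C / r"
          unfolding aFL by (simp add: mult.assoc)
      qed
    qed
    then show "\<exists>X. omega_est j k {(F, L). F \<in> unit_OV q \<and> X \<le> L} (\<lambda>(F, L) z. psum d F L z - psum d F X z)" by (rule exI)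
  qed
qed

text \<open>The far part is treated as a whole. What remains are finitely many tiles below X, each
  of which may have constants of its own.\<close>

lemma omega_est_psum:
  assumes qL: "qL1 \<nu> K" and H3: "K \<inter> {\<infinity>, -\<infinity>} \<noteq> {} \<Longrightarrow> H3CT \<nu>" and j: "j \<ge> 2"
  obtains d q B L0 s A where "d \<ge> 1" "\<And>z i. z \<in> S_set (real j) K \<Longrightarrow> i \<in> tiles d \<Longrightarrow> z \<notin> tile d i" "q \<ge> 1" "B > 0"
    "incseq s" "\<And>L. s L \<le> A"
    "\<And>F z L L'. F \<in> unit_OV q \<Longrightarrow> z \<in> S_set (real j) K \<Longrightarrow> L0 \<le> L \<Longrightarrow> L \<le> L' \<Longrightarrow>
       cmod (psum d F L' z - psum d F L z) * \<nu> j z \<le> B * (s L' - s L)"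
    "\<And>k. k \<ge> j \<Longrightarrow> \<exists>X. omega_est j k {(F, L). F \<in> unit_OV q \<and> X \<le> L} (\<lambda>(F, L) z. psum d F L z)"
proof -
  obtain mj Bj where kj: "kdata j mj Bj" using kdata_exists[OF j] by blast
  obtain m B q0 where m: "m > j" "B > 0" "S_set (real j) K \<inter> U_nbhd (real m) K = {}" "q0 > m" and tail:
    "\<And>d. d \<ge> 4 * m \<Longrightarrow> \<exists>L0 s A. tail_est d j B q0 L0 s A"
    using psum_tail[OF qL j] by blast
  obtain d0 q1 where far: "\<And>d q k. d \<ge> d0 \<Longrightarrow> d \<ge> 4 * mj \<Longrightarrow> q \<ge> q1 \<Longrightarrow> q \<ge> d + 2 \<Longrightarrow> k \<ge> j \<Longrightarrow>
     \<exists>X. omega_est j k {(F, L). F \<in> unit_OV q \<and> X \<le> L} (\<lambda>(F, L) z. psum d F L z - psum d F X z)"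
  proof (cases "K \<inter> {\<infinity>, -\<infinity>} = {}")
    case False
    show ?thesis by (rule omega_est_far_sum[OF qL False H3[OF False] kj]) (rule that)
  next
    case True
    have "\<exists>X. omega_est j k {(F, L). F \<in> unit_OV q \<and> X \<le> L} (\<lambda>(F, L) z. psum d F L z - psum d F X z)" if d: "d \<ge> 4 * mj" for d q k
    proof -
      have "d \<ge> 1" using d kj by (auto simp: kdata_def)
      then obtain L0 where L0: "\<And>i. i \<in> tiles d \<Longrightarrow> int (L0 * d) \<le> i \<Longrightarrow> \<infinity> \<in> K"
        "\<And>i. i \<in> tiles d \<Longrightarrow> i < - int (L0 * d) \<Longrightarrow> -\<infinity> \<in> K"
        using far_tiles by metis
      have eq0: "psum d F L z - psum d F L0 z = 0" if L: "L0 \<le> L" for F L z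
        unfolding psum_diff[OF L]
      proof (rule sum.neutral, intro ballI)
        fix i assume "i \<in> tiles d \<inter> ({- int (L * d)..<- int (L0 * d)} \<union> {int (L0 * d)..<int (L * d)})"
        then have "i \<in> tiles d" "i < - int (L0 * d) \<or> int (L0 * d) \<le> i" by (auto simp del: of_nat_mult)
        then show "tile_int d F i z = 0" using L0 True by blast
      qed
      have "omega_est j k {(F, L). F \<in> unit_OV q \<and> L0 \<le> L} (\<lambda>(F, L) z. psum d F L z - psum d F L0 z)"
      proof (rule omega_est_zero)
        fix a z assume "a \<in> {(F, L). F \<in> unit_OV q \<and> L0 \<le> L}"
        then obtain F L where a: "a = (F, L)" "L0 \<le> L" by auto
        show "(case a of (F, L) \<Rightarrow> \<lambda>z. psum d F L z - psum d F L0 z) z = 0"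
          unfolding a(1) prod.case by (rule eq0[OF a(2)])
      qed
      then show ?thesis by (rule exI)
    qed
    then show ?thesis by (rule that)
  qed
  \<comment> \<open>One tile width for the far tiles, the Taylor expansions at j and the tail
    estimate; all three requirements come from j and not from k.\<close>
  define d where "d = d0 + 4 * mj + 4 * m"
  define q where "q = max (max q0 q1) (d + 2)"
  have d: "d \<ge> d0" "d \<ge> 4 * mj" "d \<ge> 4 * m" "d \<ge> 1" and q: "q \<ge> q0" "q \<ge> q1" "q \<ge> d + 2" "q \<ge> 1"
    using m by (auto simp: d_def q_def)
  obtain L0 s A where te: "tail_est d j B q0 L0 s A" using tail[OF d(3)] by blast
  show thesis
  proof (rule that[of d q B s A L0])
    show "z \<notin> tile d i" if "z \<in> S_set (real j) K" "i \<in> tiles d" for z i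
      using tile_subset_U[OF _ d(3) that(2)] m j that(1) by auto
    show "cmod (psum d F L' z - psum d F L z) * \<nu> j z \<le> B * (s L' - s L)"
      if F: "F \<in> unit_OV q" and z: "z \<in> S_set (real j) K" and L: "L0 \<le> L" "L \<le> L'" for F z L L'
    proof -
      have "F \<in> OV \<nu> K" "\<forall>\<zeta>\<in>S_set (real q) K. cmod (F \<zeta>) * \<nu> q \<zeta> \<le> 1" using F by (auto simp: unit_OV_def)
      then have "cmod (psum d F L' z - psum d F L z) * \<nu> j z \<le> 1 * B * (s L' - s L)"
        using te q(1,3) z L unfolding tail_est_def by (metis zero_le_one)
      then show ?thesis by simp
    qed
    fix k assume k: "k \<ge> j"
    obtain X where X: "omega_est j k {(F, L). F \<in> unit_OV q \<and> X \<le> L} (\<lambda>(F, L) z. psum d F L z - psum d F X z)"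
      using far[OF d(1,2) q(2,3) k] by blast
    have "omega_est j k {(F, L). F \<in> unit_OV q \<and> X \<le> L} (\<lambda>a z. \<Sum>i\<in>tiles d \<inter> {- int (X * d)..<int (X * d)}. tile_int d (fst a) i z)"
      using k j by (intro omega_est_sum omega_est_tile[OF k kj _ d(2) q(3)]) auto
    then have "omega_est j k {(F, L). F \<in> unit_OV q \<and> X \<le> L} (\<lambda>a z. (case a of (F, L) \<Rightarrow> \<lambda>z. psum d F L z - psum d F X z) z +
       (\<Sum>i\<in>tiles d \<inter> {- int (X * d)..<int (X * d)}. tile_int d (fst a) i z))"
      using k j by (intro omega_est_add X) auto
    moreover have "(\<lambda>a z. (case a of (F, L) \<Rightarrow> \<lambda>z. psum d F L z - psum d F X z) z +
       (\<Sum>i\<in>tiles d \<inter> {- int (X * d)..<int (X * d)}. tile_int d (fst a) i z)) = (\<lambda>(F, L) z. psum d F L z)"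
      by (auto simp: fun_eq_iff psum_def)
    ultimately show "\<exists>X. omega_est j k {(F, L). F \<in> unit_OV q \<and> X \<le> L} (\<lambda>(F, L) z. psum d F L z)" by auto
  qed (use d q m te in \<open>auto simp: tail_est_def\<close>)
qed

subsection \<open>The property \<open>\<Omega>\<close>\<close>

lemma unit_OV_mono:
  assumes "1 \<le> p" "p \<le> q" shows "unit_OV q \<subseteq> unit_OV p"
proof
  fix F assume F: "F \<in> unit_OV q"
  have "cmod (F \<zeta>) * \<nu> p \<zeta> \<le> 1" if "\<zeta> \<in> S_set (real p) K" for \<zeta>
  proof -
    have "cmod (F \<zeta>) * \<nu> q \<zeta> \<le> 1" using F S_set_mono[OF assms, of K] that unfolding unit_OV_def by auto
    moreover have "cmod (F \<zeta>) * \<nu> p \<zeta> \<le> cmod (F \<zeta>) * \<nu> q \<zeta>" using \<nu>_mono[OF assms, of \<zeta>] by (intro mult_left_mono) auto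
    ultimately show ?thesis by simp
  qed
  then show "F \<in> unit_OV p" using F unfolding unit_OV_def by auto
qed

lemma unit_ball_OV: "unit_ball (OV \<nu> K) (OV_norm \<nu> K) q = unit_OV q"
  unfolding unit_ball_def unit_OV_def OV_norm_le_1_iff ..

text \<open>The seminorms increase with the index, so j >= 2 and k >= j may be assumed. For r <= 1
  the decomposition is trivial: the first summand is 0 and r F still lies in the ball of index
  j.\<close>

lemma OmegaI:
  assumes "\<And>j. j \<ge> 2 \<Longrightarrow> \<exists>q\<ge>j. \<forall>k\<ge>j. \<exists>(n::nat) C. C > 0 \<and> (\<forall>r\<ge>1. \<forall>F\<in>unit_OV q. \<exists>f\<in>OV \<nu> K.
     (\<forall>z\<in>S_set (real k) K. cmod (f z) * \<nu> k z \<le> C * r ^ n) \<and> (\<forall>z\<in>S_set (real j) K. cmod (F z - f z) * \<nu> j z \<le> C / r))"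
  shows "Omega (OV \<nu> K) (OV_norm \<nu> K)"
  unfolding Omega_def unit_ball_OV
proof (intro allI impI)
  fix j0 :: nat assume j0: "j0 \<ge> 1"
  define j where "j = max j0 2"
  have j: "j \<ge> 2" "j0 \<le> j" "j \<ge> 1" by (auto simp: j_def)
  obtain q where q: "q \<ge> j" and Q: "\<And>k. k \<ge> j \<Longrightarrow> \<exists>(n::nat) C. C > 0 \<and> (\<forall>r\<ge>1. \<forall>F\<in>unit_OV q. \<exists>f\<in>OV \<nu> K.
     (\<forall>z\<in>S_set (real k) K. cmod (f z) * \<nu> k z \<le> C * r ^ n) \<and> (\<forall>z\<in>S_set (real j) K. cmod (F z - f z) * \<nu> j z \<le> C / r))"
    using assms[OF j(1)] by blast
  show "\<exists>q\<ge>1. \<forall>k\<ge>1. \<exists>n\<ge>1. \<exists>C>0. \<forall>r>0. unit_OV q \<subseteq>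
      {\<lambda>z. complex_of_real (C * r ^ n) * f z + complex_of_real (1 / r) * g z |f g. f \<in> unit_OV k \<and> g \<in> unit_OV j0}"
  proof (rule exI[of _ q], intro conjI allI impI)
    show "1 \<le> q" using q j by simp
    fix k0 :: nat assume k0: "k0 \<ge> 1"
    define k where "k = max k0 j"
    have k: "k \<ge> j" "k0 \<le> k" by (auto simp: k_def)
    obtain n and C0 :: real where C0: "C0 > 0" and E0: "\<And>r F. r \<ge> 1 \<Longrightarrow> F \<in> unit_OV q \<Longrightarrow> \<exists>f\<in>OV \<nu> K.
     (\<forall>z\<in>S_set (real k) K. cmod (f z) * \<nu> k z \<le> C0 * r ^ n) \<and> (\<forall>z\<in>S_set (real j) K. cmod (F z - f z) * \<nu> j z \<le> C0 / r)"
      using Q[OF k(1)] by blast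
    define C where "C = C0 + 1"
    have C: "C \<ge> 1" using C0 by (simp add: C_def)
    show "\<exists>n\<ge>1. \<exists>C>0. \<forall>r>0. unit_OV q \<subseteq>
      {\<lambda>z. complex_of_real (C * r ^ n) * f z + complex_of_real (1 / r) * g z |f g. f \<in> unit_OV k0 \<and> g \<in> unit_OV j0}"
    proof (rule exI[of _ "n + 1"], intro conjI exI[of _ "C ^ (n + 1)"] allI impI subsetI)
      show "C ^ (n + 1) > 0" using C by simp
      fix r :: real and F assume r: "r > 0" and F: "F \<in> unit_OV q"
      have FO: "F \<in> OV \<nu> K" using F by (simp add: unit_OV_def)
      have z0: "(\<lambda>z. 0) \<in> unit_OV k0" using OV_zero by (simp add: unit_OV_def)
      show "F \<in> {\<lambda>z. complex_of_real (C ^ (n + 1) * r ^ (n + 1)) * f z + complex_of_real (1 / r) * g z |f g. f \<in> unit_OV k0 \<and> g \<in> unit_OV j0}"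
      proof (cases "r \<le> 1")
        case True
        define h where "h z = complex_of_real r * F z" for z
        have Fj: "F \<in> unit_OV j0" using F unit_OV_mono[OF j0, of q] q j by auto
        have "h \<in> unit_OV j0"
        proof -
          have "cmod (h z) * \<nu> j0 z \<le> 1" if "z \<in> S_set (real j0) K" for z
          proof -
            have "cmod (F z) * \<nu> j0 z \<le> 1" using Fj that by (auto simp: unit_OV_def)
            then have "r * (cmod (F z) * \<nu> j0 z) \<le> 1 * 1" using True r \<nu>_pos[OF j0, of z] by (intro mult_mono) auto
            then show ?thesis using r by (simp add: h_def norm_mult mult.assoc)
          qed
          then show ?thesis using OV_scale[OF weights FO] by (auto simp: unit_OV_def h_def[abs_def])
        qed
        moreover have "F = (\<lambda>z. complex_of_real (C ^ (n + 1) * r ^ (n + 1)) * 0 + complex_of_real (1 / r) * h z)"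
          using r by (simp add: h_def fun_eq_iff)
        ultimately show ?thesis unfolding mem_Collect_eq using z0 by (intro exI[of _ "\<lambda>z. 0"] exI[of _ h] conjI)
      next
        case False
        then have r1: "r \<ge> 1" by simp
        \<comment> \<open>Using the estimate with C * r instead of r turns the error C0 / (C * r)
          into at most 1/r. The larger exponent n + 1 absorbs the extra factor and is at least 1, as
          demanded.\<close>
        have Cr: "C * r \<ge> 1" using C r1 mult_mono[of 1 C 1 r] by simp
        obtain f where f: "f \<in> OV \<nu> K" "\<And>z. z \<in> S_set (real k) K \<Longrightarrow> cmod (f z) * \<nu> k z \<le> C0 * (C * r) ^ n"
          "\<And>z. z \<in> S_set (real j) K \<Longrightarrow> cmod (F z - f z) * \<nu> j z \<le> C0 / (C * r)" using E0[OF Cr F] by blast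
        define D where "D = C ^ (n + 1) * r ^ (n + 1)"
        have D: "D > 0" unfolding D_def using C r by simp
        have le: "C0 * (C * r) ^ n \<le> D"
        proof -
          have "C0 * (C * r) ^ n \<le> C * (C * r) ^ n" using C r by (intro mult_right_mono) (auto simp: C_def)
          also have "\<dots> \<le> C * r * (C * r) ^ n" using C r r1 by (intro mult_right_mono) auto
          also have "\<dots> = D" unfolding D_def by (simp add: power_mult_distrib)
          finally show ?thesis .
        qed
        define f' where "f' z = complex_of_real (1 / D) * f z" for z
        define h where "h z = complex_of_real r * (F z - f z)" for z
        have "f' \<in> unit_OV k"
        proof -
          have "cmod (f' z) * \<nu> k z \<le> 1" if "z \<in> S_set (real k) K" for z
          proof -
            have "cmod (f z) * \<nu> k z \<le> D" using f(2)[OF that] le by simp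
            then have "1 / D * (cmod (f z) * \<nu> k z) \<le> 1" using D by simp
            then show ?thesis using D by (simp add: f'_def norm_mult norm_divide)
          qed
          moreover have "f' \<in> OV \<nu> K" unfolding f'_def[abs_def] by (rule OV_scale[OF weights f(1)])
          ultimately show ?thesis by (auto simp: unit_OV_def)
        qed
        then have f': "f' \<in> unit_OV k0" using unit_OV_mono[OF k0 k(2)] by auto
        have "h \<in> unit_OV j"
        proof -
          have "cmod (h z) * \<nu> j z \<le> 1" if "z \<in> S_set (real j) K" for z
          proof -
            have "r * (cmod (F z - f z) * \<nu> j z) \<le> r * (C0 / (C * r))" using f(3)[OF that] r by (intro mult_left_mono) auto
            also have "\<dots> = C0 / C" using r C by simp
            also have "\<dots> \<le> 1" using C by (simp add: C_def)
            finally show ?thesis using r by (simp add: h_def norm_mult mult.assoc)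
          qed
          moreover have "h \<in> OV \<nu> K"
            using OV_lincomb[OF weights FO f(1), of "complex_of_real r" "- complex_of_real r"] by (simp add: h_def[abs_def] algebra_simps)
          ultimately show ?thesis by (auto simp: unit_OV_def)
        qed
        then have h: "h \<in> unit_OV j0" using unit_OV_mono[OF j0 j(2)] by auto
        have "F = (\<lambda>z. complex_of_real (C ^ (n + 1) * r ^ (n + 1)) * f' z + complex_of_real (1 / r) * h z)"
          unfolding D_def[symmetric] using r D by (simp add: h_def f'_def fun_eq_iff)
        then show ?thesis unfolding mem_Collect_eq using f' h by (intro exI[of _ f'] exI[of _ h] conjI)
      qed
    qed simp
  qed
qed

text \<open>F is the sum of E and w / (2 pi i), where w is the limit of \<open>psum\<close>. The
  assumption on entire functions decomposes E. The limit is replaced by a partial sum whose length L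
  depends on r; this is allowed because the estimates for \<open>psum\<close> hold for all large L
  with the same constants.\<close>

lemma Omega_OV:
  assumes Om: "Omega (OV \<nu> {}) (OV_norm \<nu> {})" and qL: "qL1 \<nu> K" and R: "inner_data R"
    and H3: "K \<inter> {\<infinity>, -\<infinity>} \<noteq> {} \<Longrightarrow> H3CT \<nu>"
  shows "Omega (OV \<nu> K) (OV_norm \<nu> K)"
proof (rule OmegaI)
  fix j :: nat assume j: "j \<ge> 2"
  have j1: "j \<ge> 1" using j by simp
  obtain d q0 B L0 s A where d: "d \<ge> 1" "\<And>z i. z \<in> S_set (real j) K \<Longrightarrow> i \<in> tiles d \<Longrightarrow> z \<notin> tile d i"
    and q0: "q0 \<ge> 1" and B: "B > 0" and s: "incseq s" "\<And>L. s L \<le> A"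
    and tail: "\<And>F z L L'. F \<in> unit_OV q0 \<Longrightarrow> z \<in> S_set (real j) K \<Longrightarrow> L0 \<le> L \<Longrightarrow> L \<le> L' \<Longrightarrow>
       cmod (psum d F L' z - psum d F L z) * \<nu> j z \<le> B * (s L' - s L)"
    and est: "\<And>k. k \<ge> j \<Longrightarrow> \<exists>X. omega_est j k {(F, L). F \<in> unit_OV q0 \<and> X \<le> L} (\<lambda>(F, L) z. psum d F L z)"
  proof (rule omega_est_psum[OF qL H3 j])
    fix d q B L0 s A
    assume "d \<ge> 1" "\<And>z i. z \<in> S_set (real j) K \<Longrightarrow> i \<in> tiles d \<Longrightarrow> z \<notin> tile d i" "q \<ge> 1" "B > 0"
      "incseq s" "\<And>L. s L \<le> A"
      "\<And>F z L L'. F \<in> unit_OV q \<Longrightarrow> z \<in> S_set (real j) K \<Longrightarrow> L0 \<le> L \<Longrightarrow> L \<le> L' \<Longrightarrow>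
         cmod (psum d F L' z - psum d F L z) * \<nu> j z \<le> B * (s L' - s L)"
      "\<And>k. k \<ge> j \<Longrightarrow> \<exists>X. omega_est j k {(F, L). F \<in> unit_OV q \<and> X \<le> L} (\<lambda>(F, L) z. psum d F L z)"
    then show ?thesis by (rule that)
  qed
  obtain qf Cf where qf: "\<And>n. n \<ge> 2 \<Longrightarrow> qf n \<ge> n \<and> Cf n > (0::real)" and ent:
    "\<And>F. F \<in> OV \<nu> K \<Longrightarrow> \<exists>E\<in>OV \<nu> {}.
      (\<forall>n\<ge>2. \<forall>c\<ge>0. (\<forall>\<zeta>\<in>S_set (real (qf n)) K. cmod (F \<zeta>) * \<nu> (qf n) \<zeta> \<le> c) \<longrightarrow>
         (\<forall>z\<in>S_set (real n) {}. cmod (E z) * \<nu> n z \<le> Cf n * c)) \<and>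
      (\<forall>d\<ge>1. \<forall>z\<in>irr_pts. (\<forall>i\<in>tiles d. z \<notin> tile d i) \<longrightarrow>
         (\<lambda>L. psum d F L z) \<longlonglongrightarrow> 2 * pi * \<i> * (F z - E z))"
    using entire_part[OF qL R] by blast
  obtain qE where qE: "qE \<ge> 1" and OmE: "\<And>k. k \<ge> 1 \<Longrightarrow> \<exists>n\<ge>1. \<exists>C>0. \<forall>r>0. unit_ball (OV \<nu> {}) (OV_norm \<nu> {}) qE \<subseteq>
      {\<lambda>z. complex_of_real (C * r ^ n) * f z + complex_of_real (1 / r) * g z |f g.
         f \<in> unit_ball (OV \<nu> {}) (OV_norm \<nu> {}) k \<and> g \<in> unit_ball (OV \<nu> {}) (OV_norm \<nu> {}) j}"
    using Om[unfolded Omega_def, THEN spec, THEN mp, OF j1] by blast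
  \<comment> \<open>E has to be normalized in the seminorm of index qE, while its estimates are
    available from index 2 on.\<close>
  define n0 where "n0 = max qE 2"
  have n0: "n0 \<ge> 2" "qE \<le> n0" by (auto simp: n0_def)
  define q where "q = max (max q0 (qf n0)) j"
  have q: "q \<ge> q0" "q \<ge> qf n0" "q \<ge> j" by (auto simp: q_def)
  have C0: "Cf n0 > 0" "qf n0 \<ge> 1" using qf[OF n0(1)] n0 by auto
  obtain ls where "s \<longlonglongrightarrow> ls" using incseq_convergent[OF s(1), of A] s(2) by blast
  note sl = this
  have pi1: "1 \<le> 2 * pi" using pi_gt3 by simp
  show "\<exists>q\<ge>j. \<forall>k\<ge>j. \<exists>(n::nat) C. C > 0 \<and> (\<forall>r\<ge>1. \<forall>F\<in>unit_OV q. \<exists>f\<in>OV \<nu> K.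
     (\<forall>z\<in>S_set (real k) K. cmod (f z) * \<nu> k z \<le> C * r ^ n) \<and> (\<forall>z\<in>S_set (real j) K. cmod (F z - f z) * \<nu> j z \<le> C / r))"
  proof (rule exI[of _ q], intro conjI q(3) allI impI)
    fix k assume k: "k \<ge> j"
    have k1: "k \<ge> 1" using k j by simp
    obtain n1 C1 where C1: "C1 > 0" and dec: "\<And>r. r > 0 \<Longrightarrow> unit_ball (OV \<nu> {}) (OV_norm \<nu> {}) qE \<subseteq>
      {\<lambda>z. complex_of_real (C1 * r ^ n1) * f z + complex_of_real (1 / r) * g z |f g.
         f \<in> unit_ball (OV \<nu> {}) (OV_norm \<nu> {}) k \<and> g \<in> unit_ball (OV \<nu> {}) (OV_norm \<nu> {}) j}"
      using OmE[OF k1] by blast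
    obtain X where "omega_est j k {(F, L). F \<in> unit_OV q0 \<and> X \<le> L} (\<lambda>(F, L) z. psum d F L z)" using est[OF k] by blast
    then obtain n2 C2 where C2: "C2 > 0" and raw: "\<And>r a. r \<ge> 1 \<Longrightarrow> a \<in> {(F, L). F \<in> unit_OV q0 \<and> X \<le> L} \<Longrightarrow> \<exists>f\<in>OV \<nu> K.
       (\<forall>z\<in>S_set (real k) K. cmod (f z) * \<nu> k z \<le> C2 * r ^ n2) \<and>
       (\<forall>z\<in>S_set (real j) K. cmod ((case a of (F, L) \<Rightarrow> \<lambda>z. psum d F L z) z - f z) * \<nu> j z \<le> C2 / r)"
      unfolding omega_est_def by blast
    define n where "n = max n1 n2"
    define C where "C = Cf n0 * C1 + Cf n0 + C2 + 1"
    show "\<exists>n C. 0 < C \<and> (\<forall>r\<ge>1. \<forall>F\<in>unit_OV q. \<exists>f\<in>OV \<nu> K.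
     (\<forall>z\<in>S_set (real k) K. cmod (f z) * \<nu> k z \<le> C * r ^ n) \<and> (\<forall>z\<in>S_set (real j) K. cmod (F z - f z) * \<nu> j z \<le> C / r))"
    proof (rule exI[of _ n], rule exI[of _ C], intro conjI allI impI ballI)
      show "0 < C" unfolding C_def using C0 C1 C2 by (intro add_pos_pos mult_pos_pos) auto
      fix r :: real and F assume r: "r \<ge> 1" and F: "F \<in> unit_OV q"
      have FO: "F \<in> OV \<nu> K" and F0: "F \<in> unit_OV q0" and Ff: "F \<in> unit_OV (qf n0)"
        using F unit_OV_mono[OF q0 q(1)] unit_OV_mono[OF C0(2) q(2)] by (auto simp: unit_OV_def)
      obtain E where E: "E \<in> OV \<nu> {}" and Eb: "\<And>n c. n \<ge> 2 \<Longrightarrow> c \<ge> 0 \<Longrightarrow> \<forall>\<zeta>\<in>S_set (real (qf n)) K. cmod (F \<zeta>) * \<nu> (qf n) \<zeta> \<le> c \<Longrightarrow>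
         \<forall>z\<in>S_set (real n) {}. cmod (E z) * \<nu> n z \<le> Cf n * c"
        and Elim: "\<And>d z. d \<ge> 1 \<Longrightarrow> z \<in> irr_pts \<Longrightarrow> \<forall>i\<in>tiles d. z \<notin> tile d i \<Longrightarrow> (\<lambda>L. psum d F L z) \<longlonglongrightarrow> 2 * pi * \<i> * (F z - E z)"
        using ent[OF FO] by blast
      define E' where "E' z = complex_of_real (1 / Cf n0) * E z" for z
      have E'b: "cmod (E' z) * \<nu> qE z \<le> 1" if z: "z \<in> S_set (real qE) {}" for z
      proof -
        have zn: "z \<in> S_set (real n0) {}" using S_set_mono[OF qE n0(2)] z by blast
        have "cmod (E z) * \<nu> n0 z \<le> Cf n0 * 1"
          using Eb[OF n0(1), of 1] Ff zn by (auto simp: unit_OV_def)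
        moreover have "cmod (E z) * \<nu> qE z \<le> cmod (E z) * \<nu> n0 z" using \<nu>_mono[OF qE n0(2), of z] by (intro mult_left_mono) auto
        ultimately have "cmod (E z) * \<nu> qE z \<le> Cf n0" by simp
        then show ?thesis using C0 by (simp add: E'_def norm_mult norm_divide)
      qed
      have E'OV: "E' \<in> OV \<nu> {}" unfolding E'_def[abs_def] by (rule OV_scale[OF weights E])
      have "E' \<in> unit_ball (OV \<nu> {}) (OV_norm \<nu> {}) qE"
        unfolding unit_ball_def OV_norm_le_1_iff using E'b E'OV by auto
      then obtain f h where f: "f \<in> unit_ball (OV \<nu> {}) (OV_norm \<nu> {}) k" and h: "h \<in> unit_ball (OV \<nu> {}) (OV_norm \<nu> {}) j"
        and eq: "E' = (\<lambda>z. complex_of_real (C1 * r ^ n1) * f z + complex_of_real (1 / r) * h z)"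
        using dec[of r] r by force
      have fb: "f \<in> OV \<nu> {}" "\<And>z. z \<in> S_set (real k) {} \<Longrightarrow> cmod (f z) * \<nu> k z \<le> 1"
        using f unfolding unit_ball_def OV_norm_le_1_iff by auto
      have hb: "\<And>z. z \<in> S_set (real j) {} \<Longrightarrow> cmod (h z) * \<nu> j z \<le> 1"
        using h unfolding unit_ball_def OV_norm_le_1_iff by auto
      have Eeq: "E z = complex_of_real (Cf n0 * C1 * r ^ n1) * f z + complex_of_real (Cf n0 / r) * h z" for z
      proof -
        have "E z = complex_of_real (Cf n0) * E' z" using C0 by (simp add: E'_def)
        then show ?thesis unfolding eq by (simp add: algebra_simps)
      qed
      obtain L where L: "L \<ge> L0" "L \<ge> X" "B * (ls - s L) \<le> 1 / r"
      proof -
        have "(\<lambda>L. B * (ls - s L)) \<longlonglongrightarrow> B * (ls - ls)" by (intro tendsto_intros sl)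
        then have "eventually (\<lambda>L. B * (ls - s L) < 1 / r) sequentially" using r by (intro order_tendstoD) auto
        then obtain N where N: "\<And>L. L \<ge> N \<Longrightarrow> B * (ls - s L) < 1 / r" by (auto simp: eventually_sequentially)
        show ?thesis using that[of "max N (max L0 X)"] N[of "max N (max L0 X)"] by simp
      qed
      have "(F, L) \<in> {(F, L). F \<in> unit_OV q0 \<and> X \<le> L}" using F0 L by simp
      from raw[OF r this] obtain f1 where f1: "f1 \<in> OV \<nu> K" "\<And>z. z \<in> S_set (real k) K \<Longrightarrow> cmod (f1 z) * \<nu> k z \<le> C2 * r ^ n2"
        "\<And>z. z \<in> S_set (real j) K \<Longrightarrow> cmod (psum d F L z - f1 z) * \<nu> j z \<le> C2 / r" by auto
      \<comment> \<open>Elements of \<open>OV\<close> are represented with value 0 on the finite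
        part of K, so the entire function f is reset there.\<close>
      define fr where "fr z = (if z \<in> cpart K then 0 else f z)" for z
      have fr: "fr \<in> OV \<nu> K" using OV_restrict[OF fb(1)] by (simp add: fr_def[abs_def])
      define ft where "ft z = complex_of_real (Cf n0 * C1 * r ^ n1) * fr z + 1 / (2 * pi * \<i>) * f1 z" for z
      have ft: "ft \<in> OV \<nu> K" unfolding ft_def[abs_def] by (rule OV_lincomb[OF weights fr f1(1)])
      have half: "cmod (1 / (2 * pi * \<i>)) \<le> 1" using pi1 by (simp add: norm_divide norm_mult)
      show "\<exists>f\<in>OV \<nu> K. (\<forall>z\<in>S_set (real k) K. cmod (f z) * \<nu> k z \<le> C * r ^ n) \<and> (\<forall>z\<in>S_set (real j) K. cmod (F z - f z) * \<nu> j z \<le> C / r)"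
      proof (intro bexI[OF _ ft] conjI ballI)
        fix z assume z: "z \<in> S_set (real k) K"
        have fz: "cmod (fr z) * \<nu> k z \<le> 1"
          using fb(2)[of z] z S_set_subset_empty[OF k1, of K] by (auto simp: fr_def)
        have "cmod (ft z) * \<nu> k z \<le> cmod (complex_of_real (Cf n0 * C1 * r ^ n1)) * 1 + cmod (1 / (2 * pi * \<i>)) * (C2 * r ^ n2)"
          unfolding ft_def by (rule weighted_triangle[of fr _ _ _ f1, OF fz f1(2)[OF z]]) (use \<nu>_pos[OF k1, of z] in simp)
        also have "\<dots> \<le> Cf n0 * C1 * r ^ n1 + 1 * (C2 * r ^ n2)"
          using half C0 C1 C2 r by (intro add_mono mult_right_mono) (auto simp: norm_mult norm_power)
        also have "\<dots> \<le> Cf n0 * C1 * r ^ n + 1 * (C2 * r ^ n)"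
          using C0 C1 C2 r unfolding n_def by (intro add_mono mult_left_mono power_increasing) auto
        also have "\<dots> = (Cf n0 * C1 + C2) * r ^ n" by (simp add: distrib_right)
        also have "\<dots> \<le> C * r ^ n" unfolding C_def using C0 r by (intro mult_right_mono) auto
        finally show "cmod (ft z) * \<nu> k z \<le> C * r ^ n" .
      next
        fix z assume z: "z \<in> S_set (real j) K"
        have cont: "continuous_on (S_set (real j) K) G" if "G \<in> OV \<nu> K" for G
          using F_continuous[OF that] S_set_disjoint_cpart[OF j1, of K] by auto
        show "cmod (F z - ft z) * \<nu> j z \<le> C / r"
        \<comment> \<open>The limit of \<open>psum\<close> is known at points of
          \<open>irr_pts\<close> only; the final estimate extends by continuity.\<close>
        proof (rule irr_pts_le[OF open_S_set _ _ z])
          show "continuous_on (S_set (real j) K) (\<lambda>z. cmod (F z - ft z) * \<nu> j z)"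
            by (intro continuous_intros cont FO ft weights_continuous[OF weights j1])
          fix z assume z: "z \<in> S_set (real j) K" "z \<in> irr_pts"
          have \<nu>z: "0 < \<nu> j z" using \<nu>_pos[OF j1] .
          have zc: "z \<notin> cpart K" using S_set_disjoint_cpart[OF j1, of K] z by blast
          define w where "w = 2 * pi * \<i> * (F z - E z)"
          have lim: "(\<lambda>L. psum d F L z) \<longlonglongrightarrow> w" unfolding w_def by (rule Elim[OF d(1) z(2)]) (use d(2)[OF z(1)] in blast)
          have 1: "cmod (w - psum d F L z) * \<nu> j z \<le> 1 / r"
          proof -
            have "(\<lambda>L'. cmod (psum d F L' z - psum d F L z) * \<nu> j z) \<longlonglongrightarrow> cmod (w - psum d F L z) * \<nu> j z"
              "(\<lambda>L'. B * (s L' - s L)) \<longlonglongrightarrow> B * (ls - s L)" by (intro tendsto_intros lim sl)+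
            then have "cmod (w - psum d F L z) * \<nu> j z \<le> B * (ls - s L)"
              by (rule LIMSEQ_le) (use tail[OF F0 z(1) L(1)] in blast)
            then show ?thesis using L(3) by simp
          qed
          have 2: "cmod (psum d F L z - f1 z) * \<nu> j z \<le> C2 / r" by (rule f1(3)[OF z(1)])
          have 3: "cmod (h z) * \<nu> j z \<le> 1" using hb[of z] z S_set_subset_empty[OF j1, of K] by auto
          have 4: "cmod (1 * (w - psum d F L z) + 1 * (psum d F L z - f1 z)) * \<nu> j z \<le> cmod 1 * (1 / r) + cmod 1 * (C2 / r)"
            by (rule weighted_triangle[of "\<lambda>_. w - psum d F L z" _ _ _ "\<lambda>_. psum d F L z - f1 z", OF 1 2]) (use \<nu>z in simp)
          then have 5: "cmod (w - f1 z) * \<nu> j z \<le> 1 / r + C2 / r" by simp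
          have "F z - ft z = 1 / (2 * pi * \<i>) * (w - f1 z) + complex_of_real (Cf n0 / r) * h z"
          proof -
            have "1 / (2 * pi * \<i>) * w = F z - E z" by (simp add: w_def)
            then have "1 / (2 * pi * \<i>) * (w - f1 z) = F z - E z - 1 / (2 * pi * \<i>) * f1 z" by (simp only: right_diff_distrib)
            then show ?thesis unfolding ft_def Eeq using zc by (simp add: fr_def)
          qed
          then have "cmod (F z - ft z) * \<nu> j z \<le> cmod (1 / (2 * pi * \<i>)) * (1 / r + C2 / r) + cmod (complex_of_real (Cf n0 / r)) * 1"
            using weighted_triangle[of "\<lambda>_. w - f1 z" _ _ _ h, OF 5 3, of "1 / (2 * pi * \<i>)" "complex_of_real (Cf n0 / r)"] \<nu>z by simp
          also have "\<dots> \<le> 1 * (1 / r + C2 / r) + Cf n0 / r * 1"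
            using half C0 C2 r by (intro add_mono mult_right_mono) (auto simp: norm_divide)
          also have "\<dots> = (1 + C2 + Cf n0) / r" by (simp add: add_divide_distrib)
          also have "\<dots> \<le> C / r" unfolding C_def using C0 C1 r by (intro divide_right_mono) auto
          finally show "cmod (F z - ft z) * \<nu> j z \<le> C / r" .
        qed
      qed
    qed
  qed
qed

end

section \<open>The two alternatives of the theorem\<close>

lemma CT5_bound:
  assumes \<nu>: "directed_weights \<nu>" and CT5: "CT5 \<nu> K g" and z: "z \<notin> cpart K" and n: "n \<ge> 1"
  obtains M where "\<And>\<zeta>. \<zeta> \<in> S_set (real n) K \<Longrightarrow> cmod (g (z - \<zeta>)) \<le> M * \<nu> n \<zeta>"
proof -
  have "(SUP \<zeta>\<in>S_set (real n) K. ennreal (cmod (g (z - \<zeta>)) * inverse (\<nu> n \<zeta>))) < \<infinity>" (is "?s < _")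
    using CT5 z n unfolding CT5_def by simp
  then obtain M where M: "M \<ge> 0" "?s = ennreal M" by (cases ?s) auto
  show thesis
  proof (rule that)
    fix \<zeta> assume \<zeta>: "\<zeta> \<in> S_set (real n) K"
    have "ennreal (cmod (g (z - \<zeta>)) * inverse (\<nu> n \<zeta>)) \<le> ennreal M"
      unfolding M(2)[symmetric] using \<zeta> by (intro SUP_upper)
    then have "cmod (g (z - \<zeta>)) * inverse (\<nu> n \<zeta>) \<le> M" using M by (simp add: ennreal_le_iff)
    then show "cmod (g (z - \<zeta>)) \<le> M * \<nu> n \<zeta>" using weights_pos[OF \<nu> n, of \<zeta>] by (simp add: field_simps)
  qed
qed

theorem theorem4p3:
  fixes K :: "ereal set" and \<nu> :: "nat \<Rightarrow> complex \<Rightarrow> real" and g :: "complex \<Rightarrow> complex"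
  assumes "compact K" and "K \<noteq> {}"
    and "directed_weights \<nu>"
    and "Omega (OV \<nu> {}) (OV_norm \<nu> {})"
    and "qV_inf \<nu> K" and "qL1 \<nu> K"
    and "g holomorphic_on UNIV" and "g 0 = 1"
    and "CT1 \<nu> K g" and "CT2 \<nu> K g"
    and "K \<inter> {\<infinity>, -\<infinity>} \<noteq> {} \<longrightarrow> H3CT \<nu>"
    and "(K \<subseteq> range ereal \<or>
            ((\<forall>x\<in>K \<inter> {\<infinity>, -\<infinity>}. \<not> x isolated_in K) \<and> CT3 \<nu> K g \<and> CT4 \<nu> g \<and> CT5 \<nu> K g))
        \<or> (qV_inf \<nu> UNIV \<and> qL1 \<nu> UNIV \<and>
            CT1 \<nu> UNIV g \<and> CT2 \<nu> UNIV g \<and> CT3 \<nu> UNIV g \<and> CT4 \<nu> g \<and> CT5 \<nu> UNIV g \<and>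
            OV_ind_dense \<nu> K)"
  shows "Omega (OV \<nu> K) (OV_norm \<nu> K)"
proof -
  interpret weighted_kernel K \<nu> g
    using assms(1,3,7,8,10) compact_imp_closed by unfold_locales auto
  \<comment> \<open>The alternatives serve to control the outer boundary of the box when K has an
    infinite end.\<close>
  have "\<exists>R. inner_data R"
  proof (cases "K \<inter> {\<infinity>, -\<infinity>} = {}")
    case True
    then show ?thesis using inner_data_bounded by blast
  next
    case False
    then have nr: "\<not> K \<subseteq> range ereal" by auto
    have CT4: "CT4 \<nu> g" using assms(12) nr by blast
    \<comment> \<open>This is the growth bound for the vertical sides. If (CT5) holds for K it is
      immediate. Otherwise the conditions for the full line are used: (CT2), with z fixed in some
      \<open>S_set n0 UNIV\<close>, covers \<zeta> near the real axis, and (CT5) covers the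
      rest.\<close>
    have growth: "\<exists>m\<ge>n. \<exists>M. \<forall>\<zeta>\<in>S_set (real n) K. cmod (g (z - \<zeta>)) \<le> M * \<nu> m \<zeta>" if z: "Im z \<noteq> 0" and n: "n \<ge> 2" for z n
    proof (cases "CT5 \<nu> K g")
      case True
      have "z \<notin> cpart K" using z cpart_Im by blast
      then obtain M where "\<And>\<zeta>. \<zeta> \<in> S_set (real n) K \<Longrightarrow> cmod (g (z - \<zeta>)) \<le> M * \<nu> n \<zeta>"
        using CT5_bound[OF assms(3) True, of z n] n by auto
      then show ?thesis by blast
    next
      case no: False
      have U: "CT2 \<nu> UNIV g" "CT5 \<nu> UNIV g" using assms(12) nr no by blast+
      interpret line: weighted_kernel UNIV \<nu> g
        using assms(3,7,8) U(1) by unfold_locales auto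
      have zU: "z \<notin> cpart UNIV" using z line.cpart_Im by blast
      obtain n0 where n0: "n0 \<ge> 2" "z \<in> S_set (real n0) UNIV" using S_set_exhaust[OF _ zU] by auto
      obtain m0 B where m0: "m0 > n0" "B > 0" and near: "\<And>\<zeta>. \<zeta> \<in> closure (U_nbhd (real m0) UNIV) \<Longrightarrow>
          cmod (g (z - \<zeta>)) * \<nu> n0 z \<le> B * \<nu> m0 \<zeta>"
        using line.g_bound[of n0] n0 by (metis le_trans one_le_numeral)
      define m where "m = max n m0"
      have m: "m \<ge> n" "m \<ge> m0" "m \<ge> 2" using n by (auto simp: m_def)
      obtain M where far: "\<And>\<zeta>. \<zeta> \<in> S_set (real m) UNIV \<Longrightarrow> cmod (g (z - \<zeta>)) \<le> M * \<nu> m \<zeta>"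
        using CT5_bound[OF assms(3) U(2) zU, of m] m by auto
      have \<nu>0: "0 < \<nu> n0 z" using \<nu>_pos n0 by simp
      have "cmod (g (z - \<zeta>)) \<le> max M (B / \<nu> n0 z) * \<nu> m \<zeta>" if \<zeta>: "\<zeta> \<in> S_set (real n) K" for \<zeta>
      proof (cases "\<zeta> \<in> closure (U_nbhd (real m0) UNIV)")
        case True
        have "cmod (g (z - \<zeta>)) \<le> B / \<nu> n0 z * \<nu> m0 \<zeta>" using near[OF True] \<nu>0 by (simp add: field_simps)
        also have "\<dots> \<le> max M (B / \<nu> n0 z) * \<nu> m \<zeta>"
          using \<nu>_mono[of m0 m \<zeta>] \<nu>_pos[of m0 \<zeta>] m m0 \<nu>0 by (intro mult_mono) (auto simp: le_max_iff_disj)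
        finally show ?thesis .
      next
        case False
        have "closure (U_nbhd (real m) UNIV) \<subseteq> closure (U_nbhd (real m0) UNIV)"
          using m m0 by (intro closure_mono U_mono) auto
        moreover have "\<bar>Im \<zeta>\<bar> < real m" using \<zeta> S_set_eq[OF n, of K] m(1) by auto
        ultimately have "\<zeta> \<in> S_set (real m) UNIV" using False S_set_eq[OF m(3), of UNIV] by auto
        then have "cmod (g (z - \<zeta>)) \<le> M * \<nu> m \<zeta>" by (rule far)
        also have "\<dots> \<le> max M (B / \<nu> n0 z) * \<nu> m \<zeta>" using \<nu>_pos[of m \<zeta>] m by (intro mult_right_mono) auto
        finally show ?thesis .
      qed
      then show ?thesis using m by blast
    qed
    show ?thesis using inner_data_unbounded[OF assms(5,6) False growth CT4] by blast
  qed
  then show ?thesis using Omega_OV[OF assms(4,6)] assms(11) by blast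
qed

end
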